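(* Let $B=B_q(\mathfrak g)$ be the $q$-boson Kashiwara algebra of a symmetrizable Kac--Moody algebra $\mathfrak g$, let $B^-$ (resp. $B^+$) be the subalgebra of $B$ generated by the $f_i$ (resp. the $e''_i$), $i\in I$, let $\widehat B$ be the completion of $B$ described in the context, and let $\Gamma\in\widehat B$ be the extremal projector $$\Gamma=\sum_{\beta\in Q_+}\sum_r k_\beta^{-1}S^{-1}(y_r^{-\beta})\,\varphi(x_r^{\beta}).$$ Then: (i) $e''_i\Gamma=0$ and $\Gamma f_i=0$ for all $i\in I$. (ii) $\Gamma^2=\Gamma$. (iii) There exist a (possibly infinite) family of elements $a_k\in B^-$, $b_k\in B^+$ such that the sum $\sum_k a_k\Gamma b_k$ converges in $\widehat B$ and $$\sum_k a_k\Gamma b_k=1 .$$ (iv) $\Gamma$ is a well-defined element of $\widehat{B^\vee}$, the corresponding completion of the subalgebra $B^\vee\subset B$ generated by all $e''_i,f_i$ ($i\in I$).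
   Context: Cartan data. $\mathfrak g$ is a symmetrizable Kac--Moody algebra over $\mathbf Q$ with Cartan subalgebra $\mathfrak t$, finite index set $I$, simple roots $\alpha_i\in\mathfrak t^*$, coroots $h_i\in\mathfrak t$, and an inner product on $\mathfrak t^*$ with $(\alpha_i,\alpha_i)\in 2\mathbf Z_{>0}$ and $\langle h_i,\lambda\rangle=2(\alpha_i,\lambda)/(\alpha_i,\alpha_i)$ for $\lambda\in\mathfrak t^*$. $Q_+=\oplus_i\mathbf Z_{\ge0}\alpha_i$; for $\beta=\sum_i m_i\alpha_i\in Q_+$, $|\beta|=\sum_i m_i$. $P\subset\mathfrak t^*$ is a lattice (free $\mathbf Z$-submodule with $\mathbf Q\otimes_{\mathbf Z}P\cong\mathfrak t^*$) containing all $\alpha_i$, and $P^*=\{h\in\mathfrak t:\langle h,P\rangle\subset\mathbf Z\}$ contains all $h_i$. $q$ is transcendental over $\mathbf Q$; $q_i=q^{(\alpha_i,\alpha_i)/2}$, $t_i=q_i^{h_i}=q^{(\alpha_i,\alpha_i)h_i/2}$, $[n]_i=(q_i^n-q_i^{-n})/(q_i-q_i^{-1})$, $[n]_i!=\prod_{k=1}^n[k]_i$, $X_i^{(n)}=X_i^n/[n]_i!$; $k_\beta=\prod_i t_i^{m_i}$ for $\beta=\sum_i m_i\alpha_i$. The algebra $B=B_q(\mathfrak g)$. It is the associative $\mathbf Q(q)$-algebra generated by $e''_i,f_i$ ($i\in I$), $q^h$ ($h\in P^*$) with relations: $q^0=1$, $q^hq^{h'}=q^{h+h'}$; $q^he''_iq^{-h}=q^{\langle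 h,\alpha_i\rangle}e''_i$; $q^hf_iq^{-h}=q^{-\langle h,\alpha_i\rangle}f_i$; $e''_if_j=q_i^{\langle h_i,\alpha_j\rangle}f_je''_i+\delta_{i,j}$; and the $q$-Serre relations $\sum_{k=0}^{1-\langle h_i,\alpha_j\rangle}(-1)^kX_i^{(k)}X_jX_i^{(1-\langle h_i,\alpha_j\rangle-k)}=0$ ($i\ne j$) for $X_i=e''_i$ and for $X_i=f_i$. $B^+_\beta=\{u\in B^+: q^huq^{-h}=q^{\langle h,\beta\rangle}u\ \forall h\in P^*\}$. Completions. $\widehat B=\varprojlim_l B/(B\cdot B^{+,l})$ with $B^{+,l}=\oplus_{|\beta|\ge l}B^+_\beta$; the multiplication of $B$ extends to $\widehat B$. Likewise $\widehat{B^\vee}=\varprojlim_l B^\vee/(B^\vee\cdot B^{+,l})$. The quantum algebra $U=U_q(\mathfrak g)$. It is generated over $\mathbf Q(q)$ by $e_i,f_i$ ($i\in I$), $q^h$ ($h\in P^*$) with relations $q^0=1$, $q^hq^{h'}=q^{h+h'}$, $q^he_iq^{-h}=q^{\langle h,\alpha_i\rangle}e_i$, $q^hf_iq^{-h}=q^{-\langle h,\alpha_i\rangle}f_i$, $[e_i,f_j]=\delta_{i,j}(t_i-t_i^{-1})/(q_i-q_i^{-1})$ and the $q$-Serre relations $\sum_{k=0}^{1-\langle h_i,\alpha_j\rangle}(-1)^kX_i^{(k)}X_jX_i^{(1-\langle h_i,\alpha_j\rangle-k)}=0$ ($i\ne j$) for $X_i=e_i$ and for $X_i=f_i$. Coproduct: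 $\Delta(q^h)=q^h\otimes q^h$, $\Delta(e_i)=e_i\otimes1+t_i\otimes e_i$, $\Delta(f_i)=f_i\otimes t_i^{-1}+1\otimes f_i$. Antipode (anti-automorphism): $S(e_i)=-t_i^{-1}e_i$, $S(f_i)=-f_it_i$, $S(q^h)=q^{-h}$. $U^+$, $U^-$ are the subalgebras generated by the $e_i$, resp. the $f_i$, and $U^{\ge}$, $U^{\le}$ those generated by $U^+$, resp. $U^-$, together with $T=\langle q^h: h\in P^*\rangle$; $U^{\pm}_{\pm\beta}$ denote weight spaces under conjugation by the $q^h$. The subalgebra of $U$ generated by the $f_i,q^h$ is identified with the subalgebra of $B$ generated by the $f_i,q^h$; in particular $U^-=B^-$. The map $\varphi$. $\varphi:U^{\ge}\to B$ is the algebra anti-homomorphism (onto the subalgebra generated by the $e''_i$ and $q^h$) with $\varphi(e_i)=-\frac1{q_i-q_i^{-1}}e''_i$, $\varphi(q^h)=q^{-h}$. Drinfeld--Killing form. It is the unique bilinear form $\langle\,,\rangle$ on $U^{\ge}\times U^{\le}$ with $\langle x,y_1y_2\rangle=\langle\Delta(x),y_1\otimes y_2\rangle$, $\langle x_1x_2,y\rangle=\langle x_2\otimes x_1,\Delta(y)\rangle$, $\langle q^h,q^{h'}\rangle=q^{-(h|h')}$, $\langle T,f_i\rangle=\langle e_i,T\rangle=0$, $\langle e_i,f_j\rangle=\delta_{ij}/(q_i^{-1}-q_i)$, where $(\,|\,)$ is the invariant bilinear form on $\mathfrak t$ corresponding to the inner product on $\mathfrak t^*$ (under which $\alpha_i$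 corresponds to $\frac{(\alpha_i,\alpha_i)}2h_i$). Its restriction to $U^+_\beta\times U^-_{-\beta}$ is $\mathbf Q(q)$-valued and non-degenerate. For each $\beta\in Q_+$, $\{x_r^\beta\}_r$ is a basis of $U^+_\beta$ and $\{y_r^{-\beta}\}_r$ the dual basis of $U^-_{-\beta}$, i.e. $\langle x_r^\beta,y_s^{-\beta}\rangle=\delta_{rs}$. *)

theory Defs
  imports
    "HOL-Algebra.Embedded_Algebras"
    "HOL-Algebra.QuotRing"
    "HOL-Algebra.Generated_Rings"
    "HOL-Algebra.Algebraic_Closure_Type"
    "HOL-Library.Poly_Mapping"
begin

section \<open>Algebras over \<open>\<rat>(q)\<close>\<close>

text \<open>The ground field is \<open>\<rat>(q)\<close> with \<open>q\<close> an indeterminate.\<close>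

type_synonym qfield = "rat poly fract"

definition qv :: qfield
  where "qv = Fract [:0, 1:] 1"

text \<open>\<open>qpow r\<close> is \<open>q\<^sup>r\<close>; it is only ever used for integral \<open>r\<close>.\<close>

definition qpow :: "rat \<Rightarrow> qfield"
  where "qpow r = qv powi \<lfloor>r\<rfloor>"

text \<open>
  A unital associative algebra over \<open>\<rat>(q)\<close> is a ring together with its structure map
  \<open>scal\<close> from \<open>\<rat>(q)\<close>, so the scalar multiple \<open>c x\<close> is \<open>scal A c \<otimes>\<^bsub>A\<^esub> x\<close>.
\<close>

record 'a kalgebra = "'a ring" +
  scal :: "qfield \<Rightarrow> 'a"

definition alg_quot :: "'a kalgebra \<Rightarrow> 'a set \<Rightarrow> 'a set kalgebra"
  where "alg_quot A J = ring.extend (A Quot J) (kalgebra.fields (\<lambda>c. J +>\<^bsub>A\<^esub> scal A c))"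

definition subalg :: "'a kalgebra \<Rightarrow> 'a set \<Rightarrow> 'a set"
  where "subalg A S = generate_ring A (S \<union> range (scal A))"

definition alg_hom :: "'a kalgebra \<Rightarrow> 'a set \<Rightarrow> 'b kalgebra \<Rightarrow> ('a \<Rightarrow> 'b) \<Rightarrow> bool"
  where "alg_hom A V C f \<longleftrightarrow>
    f \<in> ring_hom (A\<lparr>carrier := V\<rparr>) C \<and> (\<forall>c. f (scal A c) = scal C c)"

definition alg_antihom :: "'a kalgebra \<Rightarrow> 'a set \<Rightarrow> 'b kalgebra \<Rightarrow> ('a \<Rightarrow> 'b) \<Rightarrow> bool"
  where "alg_antihom A V C f \<longleftrightarrow>
    alg_hom A V (C\<lparr>monoid.mult := (\<lambda>x y. y \<otimes>\<^bsub>C\<^esub> x)\<rparr>) f"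

subsection \<open>Free algebras and presentations\<close>

text \<open>
  Words form a monoid, written additively so that \<open>'g word \<Rightarrow>\<^sub>0 qfield\<close>, with the convolution
  product of \<^theory>\<open>HOL-Library.Poly_Mapping\<close>, is the algebra of noncommutative polynomials.
\<close>

datatype 'g word = Word (letters: "'g list")

instantiation word :: (type) monoid_add
begin

definition zero_word_def: "0 = Word []"

definition plus_word_def: "u + v = Word (letters u @ letters v)"

instance
  by standard (simp_all add: zero_word_def plus_word_def)

end

definition kconst :: "qfield \<Rightarrow> 'g word \<Rightarrow>\<^sub>0 qfield"
  where "kconst c = Poly_Mapping.single 0 c"

definition letter :: "'g \<Rightarrow> 'g word \<Rightarrow>\<^sub>0 qfield"
  where "letter g = Poly_Mapping.single (Word [g]) 1"

definition free_alg :: "'g set \<Rightarrow> ('g word \<Rightarrow>\<^sub>0 qfield) kalgebra"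
  where "free_alg G =
    ring.extend
      (ring_of_type_algebra\<lparr>carrier := {p. \<forall>w\<in>Poly_Mapping.keys p. set (letters w) \<subseteq> G}\<rparr>)
      (kalgebra.fields kconst)"

definition presented :: "'g set \<Rightarrow> ('g word \<Rightarrow>\<^sub>0 qfield) set \<Rightarrow> ('g word \<Rightarrow>\<^sub>0 qfield) set kalgebra"
  where "presented G R = alg_quot (free_alg G) (genideal (free_alg G) R)"

definition pclass ::
  "'g set \<Rightarrow> ('g word \<Rightarrow>\<^sub>0 qfield) set \<Rightarrow> ('g word \<Rightarrow>\<^sub>0 qfield) \<Rightarrow> ('g word \<Rightarrow>\<^sub>0 qfield) set"
  where "pclass G R p = genideal (free_alg G) R +>\<^bsub>free_alg G\<^esub> p"

subsection \<open>Tensor products\<close>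

text \<open>
  \<open>A \<otimes> C\<close> is the vector space on the set \<open>A \<times> C\<close>, with the componentwise product of basis
  elements, modulo the bilinearity relations. Multiplying a bilinearity relation by a basis
  element gives again such a relation, so the ideal below is the linear span of the relations.
\<close>

definition pair_alg :: "'a kalgebra \<Rightarrow> 'b kalgebra \<Rightarrow> (('a \<times> 'b) \<Rightarrow>\<^sub>0 qfield) kalgebra"
  where "pair_alg A C =
    \<lparr>carrier = {p. Poly_Mapping.keys p \<subseteq> carrier A \<times> carrier C},
     monoid.mult = (\<lambda>p r. \<Sum>s\<in>Poly_Mapping.keys p. \<Sum>t\<in>Poly_Mapping.keys r.
        Poly_Mapping.single (fst s \<otimes>\<^bsub>A\<^esub> fst t, snd s \<otimes>\<^bsub>C\<^esub> snd t)
          (Poly_Mapping.lookup p s * Poly_Mapping.lookup r t)),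
     one = Poly_Mapping.single (\<one>\<^bsub>A\<^esub>, \<one>\<^bsub>C\<^esub>) 1,
     ring.zero = 0,
     add = (+),
     scal = Poly_Mapping.single (\<one>\<^bsub>A\<^esub>, \<one>\<^bsub>C\<^esub>)\<rparr>"

definition bilin_rels :: "'a kalgebra \<Rightarrow> 'b kalgebra \<Rightarrow> (('a \<times> 'b) \<Rightarrow>\<^sub>0 qfield) set"
  where "bilin_rels A C =
    {Poly_Mapping.single (a \<oplus>\<^bsub>A\<^esub> a', b) 1
        - Poly_Mapping.single (a, b) 1 - Poly_Mapping.single (a', b) 1 | a a' b.
      a \<in> carrier A \<and> a' \<in> carrier A \<and> b \<in> carrier C} \<union>
    {Poly_Mapping.single (a, b \<oplus>\<^bsub>C\<^esub> b') 1
        - Poly_Mapping.single (a, b) 1 - Poly_Mapping.single (a, b') 1 | a b b'.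
      a \<in> carrier A \<and> b \<in> carrier C \<and> b' \<in> carrier C} \<union>
    {Poly_Mapping.single (scal A c \<otimes>\<^bsub>A\<^esub> a, b) 1 - Poly_Mapping.single (a, b) c | c a b.
      a \<in> carrier A \<and> b \<in> carrier C} \<union>
    {Poly_Mapping.single (a, scal C c \<otimes>\<^bsub>C\<^esub> b) 1 - Poly_Mapping.single (a, b) c | c a b.
      a \<in> carrier A \<and> b \<in> carrier C}"

definition tensor_alg :: "'a kalgebra \<Rightarrow> 'b kalgebra \<Rightarrow> (('a \<times> 'b) \<Rightarrow>\<^sub>0 qfield) set kalgebra"
  where "tensor_alg A C = alg_quot (pair_alg A C) (genideal (pair_alg A C) (bilin_rels A C))"

definition tens :: "'a kalgebra \<Rightarrow> 'b kalgebra \<Rightarrow> 'a \<Rightarrow> 'b \<Rightarrow> (('a \<times> 'b) \<Rightarrow>\<^sub>0 qfield) set"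
  where "tens A C a b =
    genideal (pair_alg A C) (bilin_rels A C) +>\<^bsub>pair_alg A C\<^esub> Poly_Mapping.single (a, b) 1"

definition tens_sum :: "'a kalgebra \<Rightarrow> 'b kalgebra \<Rightarrow> ('a \<times> 'b) list \<Rightarrow> (('a \<times> 'b) \<Rightarrow>\<^sub>0 qfield) set"
  where "tens_sum A C ts =
    foldr (\<lambda>(a, b) z. tens A C a b \<oplus>\<^bsub>tensor_alg A C\<^esub> z) ts \<zero>\<^bsub>tensor_alg A C\<^esub>"

subsection \<open>Completions along a descending sequence of left ideals\<close>

text \<open>
  For \<open>J 0 \<supseteq> J 1 \<supseteq> \<dots>\<close> a point of the inverse limit of the \<open>R / J l\<close> is a sequence of cosets,
  the transition maps sending a coset of \<open>J (Suc l)\<close> to the coset of \<open>J l\<close> containing it.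
  As the \<open>J l\<close> are only left ideals, the product is not computed level by level: it is the
  continuous extension of the product of \<open>R\<close>, i.e. the limit of the products of
  representatives, which become constant modulo each \<open>J l\<close>.
\<close>

definition completion :: "('a, 'm) ring_scheme \<Rightarrow> (nat \<Rightarrow> 'a set) \<Rightarrow> (nat \<Rightarrow> 'a set) ring"
  where "completion R J =
    \<lparr>carrier = {x. \<forall>l. x l \<in> a_rcosets\<^bsub>R\<^esub> (J l) \<and> x (Suc l) \<subseteq> x l},
     monoid.mult = (\<lambda>x y l. {z \<in> carrier R.
        \<exists>N. \<forall>m\<ge>N. \<forall>a\<in>x m. \<forall>b\<in>y m. z \<ominus>\<^bsub>R\<^esub> a \<otimes>\<^bsub>R\<^esub> b \<in> J l}),
     one = (\<lambda>l. J l +>\<^bsub>R\<^esub> \<one>\<^bsub>R\<^esub>),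
     ring.zero = (\<lambda>l. J l),
     add = (\<lambda>x y l. x l <+>\<^bsub>R\<^esub> y l)\<rparr>"

definition to_completion :: "('a, 'm) ring_scheme \<Rightarrow> (nat \<Rightarrow> 'a set) \<Rightarrow> 'a \<Rightarrow> nat \<Rightarrow> 'a set"
  where "to_completion R J b = (\<lambda>l. J l +>\<^bsub>R\<^esub> b)"

text \<open>
  Unconditional convergence of a family in the inverse limit topology, the quotients \<open>R / J l\<close>
  being discrete.
\<close>

definition has_csum ::
  "(nat \<Rightarrow> 'a set) ring \<Rightarrow> ('k \<Rightarrow> nat \<Rightarrow> 'a set) \<Rightarrow> 'k set \<Rightarrow> (nat \<Rightarrow> 'a set) \<Rightarrow> bool"
  where "has_csum C f A s \<longleftrightarrow>
    s \<in> carrier C \<and> f ` A \<subseteq> carrier C \<and>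
    (\<forall>l. \<exists>S0. finite S0 \<and> S0 \<subseteq> A \<and>
      (\<forall>S. finite S \<and> S0 \<subseteq> S \<and> S \<subseteq> A \<longrightarrow> finsum C f S l = s l))"

definition csum ::
  "(nat \<Rightarrow> 'a set) ring \<Rightarrow> ('k \<Rightarrow> nat \<Rightarrow> 'a set) \<Rightarrow> 'k set \<Rightarrow> nat \<Rightarrow> 'a set"
  where "csum C f A = (THE s. has_csum C f A s)"

section \<open>Cartan data\<close>

text \<open>
  The type \<open>'t\<close> is the Cartan subalgebra \<open>\<tt>\<close>, with scalar multiplication \<open>tscale\<close>; elements of
  \<open>\<tt>\<^sup>*\<close> are functions \<open>'t \<Rightarrow> rat\<close>, so the pairing \<open>\<langle>h, \<xi>\<rangle>\<close> is \<open>\<xi> h\<close>.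
\<close>

record ('i, 't) cartan_data =
  tscale :: "rat \<Rightarrow> 't \<Rightarrow> 't"
  inds :: "'i set"
  sroot :: "'i \<Rightarrow> 't \<Rightarrow> rat"
  coroot :: "'i \<Rightarrow> 't"
  iprod :: "('t \<Rightarrow> rat) \<Rightarrow> ('t \<Rightarrow> rat) \<Rightarrow> rat"
  wlat :: "('t \<Rightarrow> rat) set"

definition dual_space :: "('i, 't::ab_group_add) cartan_data \<Rightarrow> ('t \<Rightarrow> rat) set"
  where "dual_space D = {\<xi>. Vector_Spaces.linear (tscale D) (*) \<xi>}"

definition colat :: "('i, 't) cartan_data \<Rightarrow> 't set"
  where "colat D = {h. \<forall>\<xi>\<in>wlat D. \<xi> h \<in> \<int>}"

definition inner_product_on_dual :: "('i, 't::ab_group_add) cartan_data \<Rightarrow> bool"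
  where "inner_product_on_dual D \<longleftrightarrow>
    (\<forall>\<xi>\<in>dual_space D. \<forall>\<mu>\<in>dual_space D. iprod D \<xi> \<mu> = iprod D \<mu> \<xi>) \<and>
    (\<forall>\<xi>\<in>dual_space D. \<forall>\<mu>\<in>dual_space D. \<forall>\<kappa>\<in>dual_space D. \<forall>a b.
       iprod D (\<lambda>h. a * \<xi> h + b * \<mu> h) \<kappa> = a * iprod D \<xi> \<kappa> + b * iprod D \<mu> \<kappa>) \<and>
    (\<forall>\<xi>\<in>dual_space D. (\<forall>\<mu>\<in>dual_space D. iprod D \<xi> \<mu> = 0) \<longrightarrow> \<xi> = (\<lambda>h. 0))"

text \<open>\<open>P\<close> has a \<open>\<int>\<close>-basis which is at the same time a \<open>\<rat>\<close>-basis of \<open>\<tt>\<^sup>*\<close>.\<close>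

definition lattice_in_dual :: "('i, 't::ab_group_add) cartan_data \<Rightarrow> bool"
  where "lattice_in_dual D \<longleftrightarrow> (\<exists>(n::nat) b.
    (\<forall>k<n. b k \<in> dual_space D) \<and>
    (\<forall>c. (\<forall>h. (\<Sum>k<n. c k * b k h) = 0) \<longrightarrow> (\<forall>k<n. c k = 0)) \<and>
    (\<forall>\<xi>\<in>dual_space D. \<exists>c. \<xi> = (\<lambda>h. \<Sum>k<n. c k * b k h)) \<and>
    wlat D = {(\<lambda>h. \<Sum>k<n. of_int (z k) * b k h) | z. True})"

definition cartan_datum :: "('i, 't::ab_group_add) cartan_data \<Rightarrow> bool"
  where "cartan_datum D \<longleftrightarrow>
    vector_space (tscale D) \<and>
    (\<exists>S. finite S \<and> module.span (tscale D) S = UNIV) \<and>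
    finite (inds D) \<and>
    sroot D ` inds D \<subseteq> dual_space D \<and>
    (\<forall>c. (\<forall>h. (\<Sum>i\<in>inds D. c i * sroot D i h) = 0) \<longrightarrow> (\<forall>i\<in>inds D. c i = 0)) \<and>
    (\<forall>c. (\<Sum>i\<in>inds D. tscale D (c i) (coroot D i)) = 0 \<longrightarrow> (\<forall>i\<in>inds D. c i = 0)) \<and>
    inner_product_on_dual D \<and>
    (\<forall>i\<in>inds D. \<exists>d::nat. d > 0 \<and> iprod D (sroot D i) (sroot D i) = 2 * of_nat d) \<and>
    (\<forall>i\<in>inds D. \<forall>\<xi>\<in>dual_space D.
       \<xi> (coroot D i) = 2 * iprod D (sroot D i) \<xi> / iprod D (sroot D i) (sroot D i)) \<and>
    (\<forall>i\<in>inds D. \<forall>j\<in>inds D. i \<noteq> j \<longrightarrow> sroot D j (coroot D i) \<le> 0) \<and>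
    lattice_in_dual D \<and>
    sroot D ` inds D \<subseteq> wlat D \<and>
    coroot D ` inds D \<subseteq> colat D"

definition half_norm :: "('i, 't) cartan_data \<Rightarrow> 'i \<Rightarrow> rat"
  where "half_norm D i = iprod D (sroot D i) (sroot D i) / 2"

text \<open>
  The form on \<open>\<tt>\<close> is transported from \<open>\<tt>\<^sup>*\<close> along the isomorphism under which \<open>h\<close> corresponds to
  the \<open>\<xi>\<close> with \<open>(\<xi>, \<kappa>) = \<langle>h, \<kappa>\<rangle>\<close> for all \<open>\<kappa>\<close>.
\<close>

definition flat :: "('i, 't::ab_group_add) cartan_data \<Rightarrow> 't \<Rightarrow> 't \<Rightarrow> rat"
  where "flat D h = (THE \<xi>. \<xi> \<in> dual_space D \<and> (\<forall>\<kappa>\<in>dual_space D. iprod D \<xi> \<kappa> = \<kappa> h))"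

definition tform :: "('i, 't::ab_group_add) cartan_data \<Rightarrow> 't \<Rightarrow> 't \<Rightarrow> rat"
  where "tform D h h' = iprod D (flat D h) (flat D h')"

text \<open>
  \<open>\<Sum>\<^sub>i m\<^sub>i \<alpha>\<^sub>i \<in> Q\<^sub>+\<close> is represented by its coefficient function \<open>m\<close>
  (the simple roots are linearly independent).
\<close>

definition Qplus :: "('i, 't) cartan_data \<Rightarrow> ('i \<Rightarrow> nat) set"
  where "Qplus D = {m. \<forall>i. i \<notin> inds D \<longrightarrow> m i = 0}"

definition Qweight :: "('i, 't) cartan_data \<Rightarrow> ('i \<Rightarrow> nat) \<Rightarrow> 't \<Rightarrow> rat"
  where "Qweight D m = (\<lambda>h. \<Sum>i\<in>inds D. of_nat (m i) * sroot D i h)"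

definition Qheight :: "('i, 't) cartan_data \<Rightarrow> ('i \<Rightarrow> nat) \<Rightarrow> nat"
  where "Qheight D m = (\<Sum>i\<in>inds D. m i)"

section \<open>The algebras \<open>B\<^sub>q(\<gg>)\<close> and \<open>U\<^sub>q(\<gg>)\<close>\<close>

definition qi :: "('i, 't) cartan_data \<Rightarrow> 'i \<Rightarrow> qfield"
  where "qi D i = qpow (half_norm D i)"

definition qint :: "('i, 't) cartan_data \<Rightarrow> 'i \<Rightarrow> nat \<Rightarrow> qfield"
  where "qint D i n = (qi D i ^ n - inverse (qi D i) ^ n) / (qi D i - inverse (qi D i))"

definition qfact :: "('i, 't) cartan_data \<Rightarrow> 'i \<Rightarrow> nat \<Rightarrow> qfield"
  where "qfact D i n = (\<Prod>k=1..n. qint D i k)"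

text \<open>The letter \<open>Egen i\<close> stands for \<open>e''\<^sub>i\<close> in \<open>B\<close> and for \<open>e\<^sub>i\<close> in \<open>U\<close>; \<open>Qgen h\<close> is \<open>q\<^sup>h\<close>.\<close>

datatype ('i, 't) gen = Egen 'i | Fgen 'i | Qgen 't

type_synonym ('i, 't) ncpoly = "('i, 't) gen word \<Rightarrow>\<^sub>0 qfield"

definition gens :: "('i, 't) cartan_data \<Rightarrow> ('i, 't) gen set"
  where "gens D = Egen ` inds D \<union> Fgen ` inds D \<union> Qgen ` colat D"

definition tcoroot :: "('i, 't) cartan_data \<Rightarrow> 'i \<Rightarrow> 't"
  where "tcoroot D i = tscale D (half_norm D i) (coroot D i)"

definition torus_rels :: "('i, 't::ab_group_add) cartan_data \<Rightarrow> ('i, 't) ncpoly set"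
  where "torus_rels D =
    {letter (Qgen 0) - 1} \<union>
    {letter (Qgen (h + h')) - letter (Qgen h) * letter (Qgen h') | h h'.
      h \<in> colat D \<and> h' \<in> colat D} \<union>
    {letter (Qgen h) * letter (Egen i) * letter (Qgen (- h))
        - kconst (qpow (sroot D i h)) * letter (Egen i) | h i.
      h \<in> colat D \<and> i \<in> inds D} \<union>
    {letter (Qgen h) * letter (Fgen i) * letter (Qgen (- h))
        - kconst (qpow (- sroot D i h)) * letter (Fgen i) | h i.
      h \<in> colat D \<and> i \<in> inds D}"

definition divpow ::
  "('i, 't) cartan_data \<Rightarrow> ('i \<Rightarrow> ('i, 't) gen) \<Rightarrow> 'i \<Rightarrow> nat \<Rightarrow> ('i, 't) ncpoly"
  where "divpow D gen i n = kconst (inverse (qfact D i n)) * letter (gen i) ^ n"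

definition serre_rels ::
  "('i, 't) cartan_data \<Rightarrow> ('i \<Rightarrow> ('i, 't) gen) \<Rightarrow> ('i, 't) ncpoly set"
  where "serre_rels D gen =
    {let N = nat (1 - \<lfloor>sroot D j (coroot D i)\<rfloor>)
      in \<Sum>k=0..N. (- 1) ^ k * divpow D gen i k * letter (gen j) * divpow D gen i (N - k) | i j.
      i \<in> inds D \<and> j \<in> inds D \<and> i \<noteq> j}"

definition boson_rels :: "('i, 't::ab_group_add) cartan_data \<Rightarrow> ('i, 't) ncpoly set"
  where "boson_rels D =
    torus_rels D \<union>
    {letter (Egen i) * letter (Fgen j)
        - kconst (qi D i powi \<lfloor>sroot D j (coroot D i)\<rfloor>) * letter (Fgen j) * letter (Egen i)
        - (if i = j then 1 else 0) | i j. i \<in> inds D \<and> j \<in> inds D} \<union>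
    serre_rels D Egen \<union> serre_rels D Fgen"

definition qgroup_rels :: "('i, 't::ab_group_add) cartan_data \<Rightarrow> ('i, 't) ncpoly set"
  where "qgroup_rels D =
    torus_rels D \<union>
    {letter (Egen i) * letter (Fgen j) - letter (Fgen j) * letter (Egen i)
        - (if i = j
           then kconst (inverse (qi D i - inverse (qi D i))) *
                  (letter (Qgen (tcoroot D i)) - letter (Qgen (- tcoroot D i)))
           else 0) | i j. i \<in> inds D \<and> j \<in> inds D} \<union>
    serre_rels D Egen \<union> serre_rels D Fgen"

definition Bq :: "('i, 't::ab_group_add) cartan_data \<Rightarrow> ('i, 't) ncpoly set kalgebra"
  where "Bq D = presented (gens D) (boson_rels D)"

definition Uq :: "('i, 't::ab_group_add) cartan_data \<Rightarrow> ('i, 't) ncpoly set kalgebra"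
  where "Uq D = presented (gens D) (qgroup_rels D)"

definition Bgen :: "('i, 't::ab_group_add) cartan_data \<Rightarrow> ('i, 't) gen \<Rightarrow> ('i, 't) ncpoly set"
  where "Bgen D g = pclass (gens D) (boson_rels D) (letter g)"

definition Ugen :: "('i, 't::ab_group_add) cartan_data \<Rightarrow> ('i, 't) gen \<Rightarrow> ('i, 't) ncpoly set"
  where "Ugen D g = pclass (gens D) (qgroup_rels D) (letter g)"

subsection \<open>Subalgebras and weight spaces of \<open>B\<close>; the completions\<close>

definition Bplus :: "('i, 't::ab_group_add) cartan_data \<Rightarrow> ('i, 't) ncpoly set set"
  where "Bplus D = subalg (Bq D) (Bgen D ` Egen ` inds D)"

definition Bminus :: "('i, 't::ab_group_add) cartan_data \<Rightarrow> ('i, 't) ncpoly set set"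
  where "Bminus D = subalg (Bq D) (Bgen D ` Fgen ` inds D)"

definition Bvee :: "('i, 't::ab_group_add) cartan_data \<Rightarrow> ('i, 't) ncpoly set set"
  where "Bvee D = subalg (Bq D) (Bgen D ` (Egen ` inds D \<union> Fgen ` inds D))"

definition Ble :: "('i, 't::ab_group_add) cartan_data \<Rightarrow> ('i, 't) ncpoly set set"
  where "Ble D = subalg (Bq D) (Bgen D ` (Fgen ` inds D \<union> Qgen ` colat D))"

definition Bplus_wt ::
  "('i, 't::ab_group_add) cartan_data \<Rightarrow> ('i \<Rightarrow> nat) \<Rightarrow> ('i, 't) ncpoly set set"
  where "Bplus_wt D m =
    {u \<in> Bplus D. \<forall>h\<in>colat D.
       Bgen D (Qgen h) \<otimes>\<^bsub>Bq D\<^esub> u \<otimes>\<^bsub>Bq D\<^esub> Bgen D (Qgen (- h))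
         = scal (Bq D) (qpow (Qweight D m h)) \<otimes>\<^bsub>Bq D\<^esub> u}"

definition Bplus_ge :: "('i, 't::ab_group_add) cartan_data \<Rightarrow> nat \<Rightarrow> ('i, 't) ncpoly set set"
  where "Bplus_ge D l =
    generate (add_monoid (Bq D)) (\<Union>m\<in>{m \<in> Qplus D. l \<le> Qheight D m}. Bplus_wt D m)"

definition left_span :: "('a, 'm) ring_scheme \<Rightarrow> 'a set \<Rightarrow> 'a set"
  where "left_span R V = generate (add_monoid R) {b \<otimes>\<^bsub>R\<^esub> u | b u. b \<in> carrier R \<and> u \<in> V}"

definition Bfilt :: "('i, 't::ab_group_add) cartan_data \<Rightarrow> nat \<Rightarrow> ('i, 't) ncpoly set set"
  where "Bfilt D l = left_span (Bq D) (Bplus_ge D l)"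

definition Bhat :: "('i, 't::ab_group_add) cartan_data \<Rightarrow> (nat \<Rightarrow> ('i, 't) ncpoly set set) ring"
  where "Bhat D = completion (Bq D) (Bfilt D)"

definition to_Bhat ::
  "('i, 't::ab_group_add) cartan_data \<Rightarrow> ('i, 't) ncpoly set \<Rightarrow> nat \<Rightarrow> ('i, 't) ncpoly set set"
  where "to_Bhat D = to_completion (Bq D) (Bfilt D)"

definition Bvee_alg :: "('i, 't::ab_group_add) cartan_data \<Rightarrow> ('i, 't) ncpoly set kalgebra"
  where "Bvee_alg D = (Bq D)\<lparr>carrier := Bvee D\<rparr>"

definition Bvee_filt :: "('i, 't::ab_group_add) cartan_data \<Rightarrow> nat \<Rightarrow> ('i, 't) ncpoly set set"
  where "Bvee_filt D l = left_span (Bvee_alg D) (Bplus_ge D l)"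

definition Bvee_hat ::
  "('i, 't::ab_group_add) cartan_data \<Rightarrow> (nat \<Rightarrow> ('i, 't) ncpoly set set) ring"
  where "Bvee_hat D = completion (Bvee_alg D) (Bvee_filt D)"

definition to_Bvee_hat ::
  "('i, 't::ab_group_add) cartan_data \<Rightarrow> ('i, 't) ncpoly set \<Rightarrow> nat \<Rightarrow> ('i, 't) ncpoly set set"
  where "to_Bvee_hat D = to_completion (Bvee_alg D) (Bvee_filt D)"

text \<open>The map of completions induced by \<open>B\<^sup>\<or> \<subseteq> B\<close>.\<close>

definition Bvee_hat_to_Bhat ::
  "('i, 't::ab_group_add) cartan_data \<Rightarrow>
    (nat \<Rightarrow> ('i, 't) ncpoly set set) \<Rightarrow> nat \<Rightarrow> ('i, 't) ncpoly set set"
  where "Bvee_hat_to_Bhat D x = (\<lambda>l. Bfilt D l <+>\<^bsub>Bq D\<^esub> x l)"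

subsection \<open>Subalgebras and weight spaces of \<open>U\<close>\<close>

definition Uplus :: "('i, 't::ab_group_add) cartan_data \<Rightarrow> ('i, 't) ncpoly set set"
  where "Uplus D = subalg (Uq D) (Ugen D ` Egen ` inds D)"

definition Uminus :: "('i, 't::ab_group_add) cartan_data \<Rightarrow> ('i, 't) ncpoly set set"
  where "Uminus D = subalg (Uq D) (Ugen D ` Fgen ` inds D)"

definition Utorus :: "('i, 't::ab_group_add) cartan_data \<Rightarrow> ('i, 't) ncpoly set set"
  where "Utorus D = subalg (Uq D) (Ugen D ` Qgen ` colat D)"

definition Uge :: "('i, 't::ab_group_add) cartan_data \<Rightarrow> ('i, 't) ncpoly set set"
  where "Uge D = subalg (Uq D) (Uplus D \<union> Utorus D)"

definition Ule :: "('i, 't::ab_group_add) cartan_data \<Rightarrow> ('i, 't) ncpoly set set"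
  where "Ule D = subalg (Uq D) (Uminus D \<union> Utorus D)"

definition Uplus_wt ::
  "('i, 't::ab_group_add) cartan_data \<Rightarrow> ('i \<Rightarrow> nat) \<Rightarrow> ('i, 't) ncpoly set set"
  where "Uplus_wt D m =
    {u \<in> Uplus D. \<forall>h\<in>colat D.
       Ugen D (Qgen h) \<otimes>\<^bsub>Uq D\<^esub> u \<otimes>\<^bsub>Uq D\<^esub> Ugen D (Qgen (- h))
         = scal (Uq D) (qpow (Qweight D m h)) \<otimes>\<^bsub>Uq D\<^esub> u}"

definition Uminus_wt ::
  "('i, 't::ab_group_add) cartan_data \<Rightarrow> ('i \<Rightarrow> nat) \<Rightarrow> ('i, 't) ncpoly set set"
  where "Uminus_wt D m =
    {u \<in> Uminus D. \<forall>h\<in>colat D.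
       Ugen D (Qgen h) \<otimes>\<^bsub>Uq D\<^esub> u \<otimes>\<^bsub>Uq D\<^esub> Ugen D (Qgen (- h))
         = scal (Uq D) (qpow (- Qweight D m h)) \<otimes>\<^bsub>Uq D\<^esub> u}"

text \<open>\<open>k\<^sub>\<beta> = \<Prod>\<^sub>i t\<^sub>i\<^bsup>m\<^sub>i\<^esup>\<close>, written as one torus element by means of \<open>q\<^sup>h q\<^sup>h\<^sup>' = q\<^bsup>h + h'\<^esup>\<close>.\<close>

definition kbeta :: "('i, 't::ab_group_add) cartan_data \<Rightarrow> ('i \<Rightarrow> nat) \<Rightarrow> ('i, 't) ncpoly set"
  where "kbeta D m =
    Ugen D (Qgen (\<Sum>i\<in>inds D. tscale D (of_nat (m i)) (tcoroot D i)))"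

subsection \<open>Coproduct, antipode, and the maps to \<open>B\<close>\<close>

text \<open>
  Each of the following predicates determines the map on the stated subalgebra, since it is
  prescribed on algebra generators.
\<close>

definition is_coproduct ::
  "('i, 't::ab_group_add) cartan_data \<Rightarrow>
    (('i, 't) ncpoly set \<Rightarrow> (('i, 't) ncpoly set \<times> ('i, 't) ncpoly set \<Rightarrow>\<^sub>0 qfield) set) \<Rightarrow> bool"
  where "is_coproduct D \<Delta> \<longleftrightarrow>
    alg_hom (Uq D) (carrier (Uq D)) (tensor_alg (Uq D) (Uq D)) \<Delta> \<and>
    (\<forall>h\<in>colat D. \<Delta> (Ugen D (Qgen h)) =
       tens (Uq D) (Uq D) (Ugen D (Qgen h)) (Ugen D (Qgen h))) \<and>
    (\<forall>i\<in>inds D. \<Delta> (Ugen D (Egen i)) =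
       tens (Uq D) (Uq D) (Ugen D (Egen i)) \<one>\<^bsub>Uq D\<^esub>
         \<oplus>\<^bsub>tensor_alg (Uq D) (Uq D)\<^esub>
       tens (Uq D) (Uq D) (Ugen D (Qgen (tcoroot D i))) (Ugen D (Egen i))) \<and>
    (\<forall>i\<in>inds D. \<Delta> (Ugen D (Fgen i)) =
       tens (Uq D) (Uq D) (Ugen D (Fgen i)) (Ugen D (Qgen (- tcoroot D i)))
         \<oplus>\<^bsub>tensor_alg (Uq D) (Uq D)\<^esub>
       tens (Uq D) (Uq D) \<one>\<^bsub>Uq D\<^esub> (Ugen D (Fgen i)))"

definition is_antipode ::
  "('i, 't::ab_group_add) cartan_data \<Rightarrow> (('i, 't) ncpoly set \<Rightarrow> ('i, 't) ncpoly set) \<Rightarrow> bool"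
  where "is_antipode D S \<longleftrightarrow>
    alg_antihom (Uq D) (carrier (Uq D)) (Uq D) S \<and>
    bij_betw S (carrier (Uq D)) (carrier (Uq D)) \<and>
    (\<forall>i\<in>inds D. S (Ugen D (Egen i)) =
       \<ominus>\<^bsub>Uq D\<^esub> (Ugen D (Qgen (- tcoroot D i)) \<otimes>\<^bsub>Uq D\<^esub> Ugen D (Egen i))) \<and>
    (\<forall>i\<in>inds D. S (Ugen D (Fgen i)) =
       \<ominus>\<^bsub>Uq D\<^esub> (Ugen D (Fgen i) \<otimes>\<^bsub>Uq D\<^esub> Ugen D (Qgen (tcoroot D i)))) \<and>
    (\<forall>h\<in>colat D. S (Ugen D (Qgen h)) = Ugen D (Qgen (- h)))"

definition is_phi ::
  "('i, 't::ab_group_add) cartan_data \<Rightarrow> (('i, 't) ncpoly set \<Rightarrow> ('i, 't) ncpoly set) \<Rightarrow> bool"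
  where "is_phi D \<phi> \<longleftrightarrow>
    alg_antihom (Uq D) (Uge D) (Bq D) \<phi> \<and>
    (\<forall>i\<in>inds D. \<phi> (Ugen D (Egen i)) =
       scal (Bq D) (- (1 / (qi D i - inverse (qi D i)))) \<otimes>\<^bsub>Bq D\<^esub> Bgen D (Egen i)) \<and>
    (\<forall>h\<in>colat D. \<phi> (Ugen D (Qgen h)) = Bgen D (Qgen (- h)))"

text \<open>The identification of \<open>U\<^bsup>\<le>\<^esup>\<close> with the subalgebra of \<open>B\<close> generated by the \<open>f\<^sub>i\<close> and \<open>q\<^sup>h\<close>.\<close>

definition is_identification ::
  "('i, 't::ab_group_add) cartan_data \<Rightarrow> (('i, 't) ncpoly set \<Rightarrow> ('i, 't) ncpoly set) \<Rightarrow> bool"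
  where "is_identification D \<iota> \<longleftrightarrow>
    alg_hom (Uq D) (Ule D) (Bq D) \<iota> \<and>
    bij_betw \<iota> (Ule D) (Ble D) \<and>
    (\<forall>i\<in>inds D. \<iota> (Ugen D (Fgen i)) = Bgen D (Fgen i)) \<and>
    (\<forall>h\<in>colat D. \<iota> (Ugen D (Qgen h)) = Bgen D (Qgen h))"

subsection \<open>The Drinfeld--Killing form and dual bases\<close>

text \<open>
  The exponents \<open>(h | h')\<close> are rational numbers that need not be integers, so the form takes
  values in an extension of \<open>\<rat>(q)\<close> containing a compatible system of rational powers of \<open>q\<close>;
  we take an algebraic closure and call the powers \<open>\<rho>\<close>.
\<close>

definition rational_powers :: "(rat \<Rightarrow> qfield alg_closure) \<Rightarrow> bool"
  where "rational_powers \<rho> \<longleftrightarrow> (\<forall>r s. \<rho> (r + s) = \<rho> r * \<rho> s) \<and> \<rho> 1 = to_ac qv"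

definition DK_form ::
  "('i, 't::ab_group_add) cartan_data \<Rightarrow>
    (('i, 't) ncpoly set \<Rightarrow> (('i, 't) ncpoly set \<times> ('i, 't) ncpoly set \<Rightarrow>\<^sub>0 qfield) set) \<Rightarrow>
    (rat \<Rightarrow> qfield alg_closure) \<Rightarrow>
    (('i, 't) ncpoly set \<Rightarrow> ('i, 't) ncpoly set \<Rightarrow> qfield alg_closure) \<Rightarrow> bool"
  where "DK_form D \<Delta> \<rho> \<omega> \<longleftrightarrow>
    (\<forall>x\<in>Uge D. \<forall>x'\<in>Uge D. \<forall>y\<in>Ule D. \<omega> (x \<oplus>\<^bsub>Uq D\<^esub> x') y = \<omega> x y + \<omega> x' y) \<and>
    (\<forall>x\<in>Uge D. \<forall>y\<in>Ule D. \<forall>y'\<in>Ule D. \<omega> x (y \<oplus>\<^bsub>Uq D\<^esub> y') = \<omega> x y + \<omega> x y') \<and>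
    (\<forall>c. \<forall>x\<in>Uge D. \<forall>y\<in>Ule D. \<omega> (scal (Uq D) c \<otimes>\<^bsub>Uq D\<^esub> x) y = to_ac c * \<omega> x y) \<and>
    (\<forall>c. \<forall>x\<in>Uge D. \<forall>y\<in>Ule D. \<omega> x (scal (Uq D) c \<otimes>\<^bsub>Uq D\<^esub> y) = to_ac c * \<omega> x y) \<and>
    (\<forall>x\<in>Uge D. \<forall>y1\<in>Ule D. \<forall>y2\<in>Ule D. \<forall>ts.
       set ts \<subseteq> Uge D \<times> Uge D \<and> \<Delta> x = tens_sum (Uq D) (Uq D) ts \<longrightarrow>
       \<omega> x (y1 \<otimes>\<^bsub>Uq D\<^esub> y2) = (\<Sum>(a, b)\<leftarrow>ts. \<omega> a y1 * \<omega> b y2)) \<and>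
    (\<forall>x1\<in>Uge D. \<forall>x2\<in>Uge D. \<forall>y\<in>Ule D. \<forall>ts.
       set ts \<subseteq> Ule D \<times> Ule D \<and> \<Delta> y = tens_sum (Uq D) (Uq D) ts \<longrightarrow>
       \<omega> (x1 \<otimes>\<^bsub>Uq D\<^esub> x2) y = (\<Sum>(a, b)\<leftarrow>ts. \<omega> x2 a * \<omega> x1 b)) \<and>
    (\<forall>h\<in>colat D. \<forall>h'\<in>colat D.
       \<omega> (Ugen D (Qgen h)) (Ugen D (Qgen h')) = \<rho> (- tform D h h')) \<and>
    (\<forall>x\<in>Utorus D. \<forall>i\<in>inds D. \<omega> x (Ugen D (Fgen i)) = 0 \<and> \<omega> (Ugen D (Egen i)) x = 0) \<and>
    (\<forall>i\<in>inds D. \<forall>j\<in>inds D. \<omega> (Ugen D (Egen i)) (Ugen D (Fgen j)) =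
       (if i = j then to_ac (1 / (inverse (qi D i) - qi D i)) else 0))"

definition basis_list :: "'a kalgebra \<Rightarrow> 'a set \<Rightarrow> 'a list \<Rightarrow> bool"
  where "basis_list A V us \<longleftrightarrow>
    ring.independent A (range (scal A)) us \<and> ring.Span A (range (scal A)) us = V"

text \<open>\<open>xs \<beta>\<close> and \<open>ys \<beta>\<close> list the bases \<open>(x\<^sub>r\<^sup>\<beta>)\<^sub>r\<close> and \<open>(y\<^sub>r\<^bsup>- \<beta>\<^esup>)\<^sub>r\<close>.\<close>

definition dual_bases ::
  "('i, 't::ab_group_add) cartan_data \<Rightarrow>
    (('i, 't) ncpoly set \<Rightarrow> ('i, 't) ncpoly set \<Rightarrow> qfield alg_closure) \<Rightarrow>
    (('i \<Rightarrow> nat) \<Rightarrow> ('i, 't) ncpoly set list) \<Rightarrow>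
    (('i \<Rightarrow> nat) \<Rightarrow> ('i, 't) ncpoly set list) \<Rightarrow> bool"
  where "dual_bases D \<omega> xs ys \<longleftrightarrow>
    (\<forall>\<beta>\<in>Qplus D.
       basis_list (Uq D) (Uplus_wt D \<beta>) (xs \<beta>) \<and>
       basis_list (Uq D) (Uminus_wt D \<beta>) (ys \<beta>) \<and>
       length (ys \<beta>) = length (xs \<beta>) \<and>
       (\<forall>r<length (xs \<beta>). \<forall>s<length (ys \<beta>).
          \<omega> (xs \<beta> ! r) (ys \<beta> ! s) = (if r = s then 1 else 0)))"

section \<open>The extremal projector\<close>

definition proj_index ::
  "('i, 't) cartan_data \<Rightarrow> (('i \<Rightarrow> nat) \<Rightarrow> 'u list) \<Rightarrow> (('i \<Rightarrow> nat) \<times> nat) set"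
  where "proj_index D xs = {(\<beta>, r). \<beta> \<in> Qplus D \<and> r < length (xs \<beta>)}"

definition proj_term ::
  "('i, 't::ab_group_add) cartan_data \<Rightarrow>
    (('i, 't) ncpoly set \<Rightarrow> ('i, 't) ncpoly set) \<Rightarrow>
    (('i, 't) ncpoly set \<Rightarrow> ('i, 't) ncpoly set) \<Rightarrow>
    (('i, 't) ncpoly set \<Rightarrow> ('i, 't) ncpoly set) \<Rightarrow>
    (('i \<Rightarrow> nat) \<Rightarrow> ('i, 't) ncpoly set list) \<Rightarrow>
    (('i \<Rightarrow> nat) \<Rightarrow> ('i, 't) ncpoly set list) \<Rightarrow>
    ('i \<Rightarrow> nat) \<times> nat \<Rightarrow> ('i, 't) ncpoly set"
  where "proj_term D S \<phi> \<iota> xs ys = (\<lambda>(\<beta>, r).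
    \<iota> (inv\<^bsub>Uq D\<^esub> (kbeta D \<beta>) \<otimes>\<^bsub>Uq D\<^esub> inv_into (carrier (Uq D)) S (ys \<beta> ! r))
      \<otimes>\<^bsub>Bq D\<^esub> \<phi> (xs \<beta> ! r))"

definition extremal_projector ::
  "('i, 't::ab_group_add) cartan_data \<Rightarrow>
    (('i, 't) ncpoly set \<Rightarrow> ('i, 't) ncpoly set) \<Rightarrow>
    (('i, 't) ncpoly set \<Rightarrow> ('i, 't) ncpoly set) \<Rightarrow>
    (('i, 't) ncpoly set \<Rightarrow> ('i, 't) ncpoly set) \<Rightarrow>
    (('i \<Rightarrow> nat) \<Rightarrow> ('i, 't) ncpoly set list) \<Rightarrow>
    (('i \<Rightarrow> nat) \<Rightarrow> ('i, 't) ncpoly set list) \<Rightarrow>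
    nat \<Rightarrow> ('i, 't) ncpoly set set"
  where "extremal_projector D S \<phi> \<iota> xs ys =
    csum (Bhat D) (\<lambda>k. to_Bhat D (proj_term D S \<phi> \<iota> xs ys k)) (proj_index D xs)"

end

theory Submission
  imports Defs "HOL-Library.Countable_Set"
begin

text \<open>
  Write \<open>\<Gamma> = \<Sum>\<^sub>\<beta> C\<^sub>\<beta>\<close> by weight. On \<open>U\<^sup>-\<close> of weight \<open>- \<beta>\<close> the map
  \<open>y \<mapsto> k\<^sub>\<beta>\<^bsup>-1\<^esup> S\<^bsup>-1\<^esup>(y)\<close> is a scalar multiple of the anti-automorphism fixing the \<open>f\<^sub>i\<close>, so that
  \<open>C\<^sub>\<beta> \<in> B\<^sup>- B\<^sup>+\<close>. Moving \<open>e''\<^sub>i\<close> past \<open>f\<^bsub>i\<^sub>1\<^esub> \<dots> f\<^bsub>i\<^sub>n\<^esub>\<close> produces the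
  twisted derivation that is adjoint, for the Drinfeld--Killing form, to right multiplication by
  \<open>e\<^sub>i\<close>. Expanding in dual bases, the derivation part of \<open>e''\<^sub>i C\<^bsub>\<beta> + \<alpha>\<^sub>i\<^esub>\<close> therefore cancels
  the part of \<open>e''\<^sub>i C\<^sub>\<beta>\<close> in which \<open>e''\<^sub>i\<close> has been moved across \<open>B\<^sup>-\<close>: the partial sums of
  \<open>e''\<^sub>i \<Gamma>\<close> telescope, and so, symmetrically, do those of \<open>\<Gamma> f\<^sub>i\<close>. Idempotency follows since
  \<open>C\<^sub>0 = 1\<close> and \<open>e''\<^sub>i \<Gamma> = 0\<close>, and the resolution of \<open>1\<close> is obtained by iterating
  \<open>1 = \<Gamma> - \<Sum>\<^bsub>\<beta> \<noteq> 0\<^esub> C\<^sub>\<beta>\<close>.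
\<close>

section \<open>Linear algebra over central scalars: monomials, generated subalgebras, extraction of
  a weight\<close>

section \<open>Algebras over a central field\<close>

text \<open>No basis of U or B by monomials is used, and the twisted derivations are not constructed
  as maps on U^- or U^+. They live on words, where two independent computations return the same list
  of coefficients: commuting e''_i past a reversed word of f's, and pairing a word with x e_i
  (likewise for f_i on the other side). A homogeneous element then receives some derivative that has
  both properties at once, and the dual bases do the rest. The constant 1/(q_i^{-1} - q_i) is at
  once <e_i, f_i> and the scalar in \<phi>(e_i). This equality makes left multiplication by e''_i on
  \<phi>(U^+) the exact transpose of the derivation, with no constant left over. The completion is
  by left ideals only. Its products can nevertheless be computed by limits, because right
  multiplication by a fixed element of B lowers the filtration by a bounded amount. The iterated
  expansion of 1 converges because every substitution adds a weight of height at least 1 on the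
  right.\<close>

definition smul :: "'a kalgebra \<Rightarrow> qfield \<Rightarrow> 'a \<Rightarrow> 'a"
  where "smul A c x = scal A c \<otimes>\<^bsub>A\<^esub> x"

primrec mon :: "'a kalgebra \<Rightarrow> ('i \<Rightarrow> 'a) \<Rightarrow> 'i list \<Rightarrow> 'a"
  where
    "mon A g [] = \<one>\<^bsub>A\<^esub>"
  | "mon A g (i # w) = g i \<otimes>\<^bsub>A\<^esub> mon A g w"

text \<open>A single constructor c m + u, so that a linear statement about a span is proved by one
  induction; closure under sums and scalars is derived afterwards.\<close>

inductive_set lspan :: "'a kalgebra \<Rightarrow> 'a set \<Rightarrow> 'a set" for A M
  where
    zero: "\<zero>\<^bsub>A\<^esub> \<in> lspan A M"
  | step: "m \<in> M \<Longrightarrow> u \<in> lspan A M \<Longrightarrow> smul A c m \<oplus>\<^bsub>A\<^esub> u \<in> lspan A M"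

text \<open>Lists of coefficients and words are used because a derivation can reach the same word by
  deleting different positions; such repetitions are not merged.\<close>

definition lincomb :: "'a kalgebra \<Rightarrow> ('w \<Rightarrow> 'a) \<Rightarrow> (qfield \<times> 'w) list \<Rightarrow> 'a"
  where "lincomb A m L = foldr (\<lambda>(c, v) u. smul A c (m v) \<oplus>\<^bsub>A\<^esub> u) L \<zero>\<^bsub>A\<^esub>"

lemma lincomb_Nil [simp]: "lincomb A m [] = \<zero>\<^bsub>A\<^esub>"
  and lincomb_Cons [simp]: "lincomb A m ((c, v) # L) = smul A c (m v) \<oplus>\<^bsub>A\<^esub> lincomb A m L"
  by (simp_all add: lincomb_def)

locale kalg = ring A for A :: "'a kalgebra" (structure) +
  assumes scal_closed [simp]: "scal A c \<in> carrier A"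
    and scal_add: "scal A (c + d) = scal A c \<oplus> scal A d"
    and scal_mult: "scal A (c * d) = scal A c \<otimes> scal A d"
    and scal_one: "scal A 1 = \<one>"
    and scal_comm: "x \<in> carrier A \<Longrightarrow> scal A c \<otimes> x = x \<otimes> scal A c"
begin

lemma smul_closed [simp]: "x \<in> carrier A \<Longrightarrow> smul A c x \<in> carrier A"
  by (simp add: smul_def)

lemma smul_one [simp]: "x \<in> carrier A \<Longrightarrow> smul A 1 x = x"
  by (simp add: smul_def scal_one)

lemma scal_zero: "scal A 0 = \<zero>"
  by (metis add.r_cancel_one' add_cancel_right_left scal_add scal_closed)

lemma smul_zero_left [simp]: "x \<in> carrier A \<Longrightarrow> smul A 0 x = \<zero>"
  by (simp add: smul_def scal_zero)

lemma smul_zero [simp]: "smul A c \<zero> = \<zero>"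
  by (simp add: smul_def)

lemma smul_smul [simp]: "x \<in> carrier A \<Longrightarrow> smul A c (smul A d x) = smul A (c * d) x"
  by (simp add: smul_def scal_mult m_assoc)

lemma smul_add: "x \<in> carrier A \<Longrightarrow> y \<in> carrier A \<Longrightarrow> smul A c (x \<oplus> y) = smul A c x \<oplus> smul A c y"
  by (simp add: smul_def r_distr)

lemma smul_add_left: "x \<in> carrier A \<Longrightarrow> smul A (c + d) x = smul A c x \<oplus> smul A d x"
  by (simp add: smul_def scal_add l_distr)

lemma smul_mult_left: "x \<in> carrier A \<Longrightarrow> y \<in> carrier A \<Longrightarrow> smul A c x \<otimes> y = smul A c (x \<otimes> y)"
  by (simp add: smul_def m_assoc)

lemma smul_mult_right: "x \<in> carrier A \<Longrightarrow> y \<in> carrier A \<Longrightarrow> x \<otimes> smul A c y = smul A c (x \<otimes> y)"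
  unfolding smul_def by (metis m_assoc scal_closed scal_comm)

lemma smul_minus: "x \<in> carrier A \<Longrightarrow> smul A (- c) x = \<ominus> smul A c x"
  by (metis add.inv_equality add.left_inverse smul_add_left smul_closed smul_zero_left)

lemma smul_minus_one: "x \<in> carrier A \<Longrightarrow> smul A (- 1) x = \<ominus> x"
  by (simp add: smul_minus)

lemma smul_finsum:
  "f \<in> F \<rightarrow> carrier A \<Longrightarrow> smul A c (\<Oplus>x\<in>F. f x) = (\<Oplus>x\<in>F. smul A c (f x))"
  by (cases "finite F") (simp_all add: smul_def finsum_rdistr)

lemma mon_closed [simp]:
  "(\<And>i. i \<in> set w \<Longrightarrow> g i \<in> carrier A) \<Longrightarrow> mon A g w \<in> carrier A"
  by (induction w) auto

lemma mon_append:
  "(\<And>i. i \<in> set u \<union> set w \<Longrightarrow> g i \<in> carrier A) \<Longrightarrow> mon A g (u @ w) = mon A g u \<otimes> mon A g w"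
  by (induction u) (auto simp: m_assoc)

lemma lspan_closed: "M \<subseteq> carrier A \<Longrightarrow> u \<in> lspan A M \<Longrightarrow> u \<in> carrier A"
  by (rotate_tac, induction rule: lspan.induct) auto

lemma lspan_incl: "M \<subseteq> carrier A \<Longrightarrow> m \<in> M \<Longrightarrow> m \<in> lspan A M"
  using lspan.step[OF _ lspan.zero, of m M A 1] by (auto simp: subset_iff)

lemma lspan_add:
  assumes M: "M \<subseteq> carrier A" and u: "u \<in> lspan A M" and v: "v \<in> lspan A M"
  shows "u \<oplus> v \<in> lspan A M"
  using u
proof induction
  case zero
  then show ?case using v lspan_closed[OF M] by simp
next
  case (step m u c)
  then show ?case
    using lspan.step[of m M "u \<oplus> v" A c] M v lspan_closed[OF M]
    by (auto simp: a_assoc subset_iff)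
qed

lemma lspan_smul:
  assumes M: "M \<subseteq> carrier A" and u: "u \<in> lspan A M"
  shows "smul A c u \<in> lspan A M"
  using u
proof induction
  case zero
  then show ?case by (simp add: lspan.zero)
next
  case (step m u d)
  then show ?case
    using lspan.step[of m M "smul A c u" A "c * d"] M lspan_closed[OF M]
    by (auto simp: smul_add subset_iff)
qed

lemma lspan_minus: "M \<subseteq> carrier A \<Longrightarrow> u \<in> lspan A M \<Longrightarrow> \<ominus> u \<in> lspan A M"
  using lspan_smul[of M u "- 1"] lspan_closed[of M u] by (simp add: smul_minus_one)

lemma lspan_mono: "M \<subseteq> M' \<Longrightarrow> lspan A M \<subseteq> lspan A M'"
proof
  fix u assume "M \<subseteq> M'" "u \<in> lspan A M"
  from this(2,1) show "u \<in> lspan A M'"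
    by induction (auto intro: lspan.intros)
qed

lemma lincomb_closed [simp]:
  "(\<forall>v\<in>snd ` set L. m v \<in> carrier A) \<Longrightarrow> lincomb A m L \<in> carrier A"
  by (induction L) auto

lemma lincomb_in_lspan:
  "(\<forall>v\<in>snd ` set L. m v \<in> M) \<Longrightarrow> lincomb A m L \<in> lspan A M"
  by (induction L) (auto intro: lspan.intros)

lemma lincomb_map:
  "lincomb A m (map (\<lambda>(c, v). (c, f v)) L) = lincomb A (\<lambda>v. m (f v)) L"
  by (induction L) auto

lemma lincomb_cong:
  "(\<forall>v\<in>snd ` set L. m v = m' v) \<Longrightarrow> lincomb A m L = lincomb A m' L"
  by (induction L) auto

lemma lincomb_mult_right:
  "(\<forall>v\<in>snd ` set L. m v \<in> carrier A) \<Longrightarrow> x \<in> carrier A \<Longrightarrow>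
    lincomb A m L \<otimes> x = lincomb A (\<lambda>v. m v \<otimes> x) L"
  by (induction L) (auto simp: l_distr smul_mult_left)

text \<open>Provides the finite set of weights on which the elimination of one weight after another
  runs.\<close>

lemma lspan_finite_support:
  assumes "u \<in> lspan A (m ` W)"
  obtains F where "finite F" "F \<subseteq> W" "u \<in> lspan A (m ` F)"
proof -
  have "\<exists>F. finite F \<and> F \<subseteq> W \<and> u \<in> lspan A (m ` F)"
    using assms
  proof induction
    case zero
    then show ?case by (auto intro: lspan.zero exI[of _ "{}"])
  next
    case (step m' u c)
    then obtain F w where F: "finite F" "F \<subseteq> W" "u \<in> lspan A (m ` F)" and w: "w \<in> W" "m' = m w"
      by auto
    have "u \<in> lspan A (m ` insert w F)"
      using lspan_mono[of "m ` F" "m ` insert w F"] F(3) by auto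
    then have "smul A c m' \<oplus> u \<in> lspan A (m ` insert w F)"
      using w by (auto intro!: lspan.step)
    then show ?case using F w by (intro exI[of _ "insert w F"]) auto
  qed
  then show ?thesis using that by blast
qed

lemma lspan_mon_mult:
  assumes g: "g ` I \<subseteq> carrier A"
    and u: "u \<in> lspan A (mon A g ` lists I)" and v: "v \<in> lspan A (mon A g ` lists I)"
  shows "u \<otimes> v \<in> lspan A (mon A g ` lists I)"
proof -
  let ?M = "mon A g ` lists I"
  have M: "?M \<subseteq> carrier A"
    using g by (auto intro!: mon_closed)
  have 1: "mon A g a \<otimes> v \<in> lspan A ?M" if a: "a \<in> lists I" for a
    using v
  proof induction
    case zero
    have "mon A g a \<in> carrier A" using M a by auto
    then show ?case by (simp add: lspan.zero)
  next
    case (step m u c)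
    then obtain b where b: "b \<in> lists I" "m = mon A g b" by auto
    have ab: "mon A g a \<otimes> mon A g b = mon A g (a @ b)"
      using a b g by (subst mon_append) auto
    have "mon A g a \<otimes> (smul A c m \<oplus> u) = smul A c (mon A g (a @ b)) \<oplus> mon A g a \<otimes> u"
    proof -
      have "mon A g a \<in> carrier A" "m \<in> carrier A" "u \<in> carrier A"
        using a M step lspan_closed[OF M] by (auto simp: image_subset_iff)
      then show ?thesis using b ab by (simp add: r_distr smul_mult_right)
    qed
    moreover have "mon A g (a @ b) \<in> ?M" using a b by auto
    ultimately show ?case using step by (auto intro: lspan.step)
  qed
  show ?thesis
    using u
  proof induction
    case zero
    then show ?case using lspan_closed[OF M] v by (simp add: lspan.zero)
  next
    case (step m u c)
    then have "(smul A c m \<oplus> u) \<otimes> v = smul A c (m \<otimes> v) \<oplus> u \<otimes> v"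
      using M v lspan_closed[OF M] by (subst l_distr) (auto simp: smul_mult_left)
    then show ?case
      using step 1 by (auto intro!: lspan_add[OF M] lspan_smul[OF M])
  qed
qed

lemma subalg_subset: "S \<subseteq> carrier A \<Longrightarrow> subalg A S \<subseteq> carrier A"
  unfolding subalg_def using generate_ring_in_carrier[of "S \<union> range (scal A)"]
  by (auto simp: image_subset_iff)

lemma subalg_incl: "s \<in> S \<Longrightarrow> s \<in> subalg A S"
  unfolding subalg_def by (auto intro: generate_ring.incl)

lemma subalg_one: "\<one> \<in> subalg A S"
  unfolding subalg_def by (rule generate_ring.one)

lemma subalg_scal: "scal A c \<in> subalg A S"
  unfolding subalg_def by (auto intro: generate_ring.incl)

lemma subalg_add: "x \<in> subalg A S \<Longrightarrow> y \<in> subalg A S \<Longrightarrow> x \<oplus> y \<in> subalg A S"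
  unfolding subalg_def by (rule generate_ring.eng_add)

lemma subalg_mult: "x \<in> subalg A S \<Longrightarrow> y \<in> subalg A S \<Longrightarrow> x \<otimes> y \<in> subalg A S"
  unfolding subalg_def by (rule generate_ring.eng_mult)

lemma subalg_minus: "x \<in> subalg A S \<Longrightarrow> \<ominus> x \<in> subalg A S"
  unfolding subalg_def by (rule generate_ring.a_inv)

lemma subalg_smul: "x \<in> subalg A S \<Longrightarrow> smul A c x \<in> subalg A S"
  unfolding smul_def by (intro subalg_mult subalg_scal)

lemma subalg_zero: "\<zero> \<in> subalg A S"
  using subalg_scal[of 0] by (simp add: scal_zero)

lemma subalg_mon: "(\<And>i. i \<in> set w \<Longrightarrow> g i \<in> subalg A S) \<Longrightarrow> mon A g w \<in> subalg A S"
  by (induction w) (auto intro: subalg_mult subalg_one)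

lemma subalg_least:
  assumes "S \<subseteq> subalg A S'"
  shows "subalg A S \<subseteq> subalg A S'"
proof
  fix x assume "x \<in> subalg A S"
  then show "x \<in> subalg A S'"
    unfolding subalg_def[of A S]
    by induction (use assms subalg_scal in \<open>auto intro: subalg_one subalg_minus subalg_add subalg_mult\<close>)
qed

lemma lspan_subset_subalg: "M \<subseteq> subalg A S \<Longrightarrow> lspan A M \<subseteq> subalg A S"
proof
  fix u assume "M \<subseteq> subalg A S" "u \<in> lspan A M"
  from this(2,1) show "u \<in> subalg A S"
    by induction (auto intro: subalg_zero subalg_add subalg_smul)
qed

text \<open>Monomials multiply by concatenation, so their span is already closed under
  products.\<close>

lemma subalg_eq_lspan:
  assumes g: "g ` I \<subseteq> carrier A"
  shows "subalg A (g ` I) = lspan A (mon A g ` lists I)"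
proof
  let ?M = "mon A g ` lists I"
  have M: "?M \<subseteq> carrier A"
    using g by (auto intro!: mon_closed)
  have inM: "mon A g w \<in> lspan A ?M" if "w \<in> lists I" for w
    using that by (intro lspan_incl[OF M]) auto
  show "subalg A (g ` I) \<subseteq> lspan A ?M"
  proof
    fix x assume "x \<in> subalg A (g ` I)"
    then show "x \<in> lspan A ?M"
      unfolding subalg_def
    proof induction
      case one
      show ?case using inM[of "[]"] by simp
    next
      case (incl h)
      then consider i where "i \<in> I" "h = g i" | c where "h = scal A c" by auto
      then show ?case
      proof cases
        case 1
        then show ?thesis using inM[of "[i]"] g by (auto simp: subset_iff)
      next
        case 2
        then show ?thesis
          using lspan_smul[OF M inM[of "[]"], of c] by (simp add: smul_def)
      qed
    next
      case (a_inv h)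
      then show ?case by (simp add: lspan_minus[OF M])
    next
      case (eng_add h1 h2)
      then show ?case by (simp add: lspan_add[OF M])
    next
      case (eng_mult h1 h2)
      then show ?case by (simp add: lspan_mon_mult[OF g])
    qed
  qed
  show "lspan A ?M \<subseteq> subalg A (g ` I)"
    by (rule lspan_subset_subalg) (auto simp: in_lists_conv_set intro!: subalg_mon intro: subalg_incl)
qed

lemma finsum_double_swap:
  assumes "finite S" "finite T" "\<And>x y. x \<in> S \<Longrightarrow> y \<in> T \<Longrightarrow> f x y \<in> carrier A"
  shows "(\<Oplus>x\<in>S. \<Oplus>y\<in>T. f x y) = (\<Oplus>y\<in>T. \<Oplus>x\<in>S. f x y)"
  using assms
proof (induction S rule: finite_induct)
  case empty
  then show ?case by simp
next
  case (insert x S)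
  then have "(\<Oplus>x'\<in>insert x S. \<Oplus>y\<in>T. f x' y) = (\<Oplus>y\<in>T. f x y) \<oplus> (\<Oplus>y\<in>T. \<Oplus>x\<in>S. f x y)"
    by (subst finsum_insert) auto
  also have "\<dots> = (\<Oplus>y\<in>T. f x y \<oplus> (\<Oplus>x\<in>S. f x y))"
    using insert by (subst finsum_addf) (auto intro!: finsum_closed)
  also have "\<dots> = (\<Oplus>y\<in>T. \<Oplus>x'\<in>insert x S. f x' y)"
    using insert by (intro finsum_cong') (auto simp: finsum_insert intro!: finsum_closed)
  finally show ?case .
qed

text \<open>
  \<open>T h - \<chi> \<delta> h\<close> kills the weight space of weight \<open>\<delta>\<close>, so the weights
  other than \<open>\<gamma>\<close> can be removed from an expansion one at a time, without knowing that the
  sum of the weight spaces is direct.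
\<close>

lemma eigenvector_in_weight_span:
  assumes T_closed: "\<And>h u. h \<in> H \<Longrightarrow> u \<in> carrier A \<Longrightarrow> T h u \<in> carrier A"
    and T_add: "\<And>h u v. h \<in> H \<Longrightarrow> u \<in> carrier A \<Longrightarrow> v \<in> carrier A \<Longrightarrow> T h (u \<oplus> v) = T h u \<oplus> T h v"
    and T_smul: "\<And>h u c. h \<in> H \<Longrightarrow> u \<in> carrier A \<Longrightarrow> T h (smul A c u) = smul A c (T h u)"
    and m_closed: "\<And>w. w \<in> W \<Longrightarrow> m w \<in> carrier A"
    and T_m: "\<And>h w. h \<in> H \<Longrightarrow> w \<in> W \<Longrightarrow> T h (m w) = smul A (\<chi> (wt w) h) (m w)"
    and sep: "\<And>w. w \<in> W \<Longrightarrow> wt w \<noteq> \<gamma> \<Longrightarrow> \<exists>h\<in>H. \<chi> (wt w) h \<noteq> \<chi> \<gamma> h"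
    and u: "u \<in> lspan A (m ` W)" and Tu: "\<And>h. h \<in> H \<Longrightarrow> T h u = smul A (\<chi> \<gamma> h) u"
  shows "u \<in> lspan A (m ` {w \<in> W. wt w = \<gamma>})"
proof -
  define V where "V F = lspan A (m ` {w \<in> W. wt w \<in> F})" for F
  have Mc: "m ` {w \<in> W. P w} \<subseteq> carrier A" for P
    using m_closed by auto
  have Vc: "u \<in> carrier A" if "u \<in> V F" for u F
    using that lspan_closed[OF Mc[of "\<lambda>w. wt w \<in> F"], of u] unfolding V_def by simp
  have T_zero: "T h \<zero> = \<zero>" if "h \<in> H" for h
    using T_smul[OF that, of \<zero> 0] T_closed[OF that] by simp
  have kill: "T h v \<oplus> smul A (- \<chi> \<delta> h) v \<in> V (F - {\<delta>})"
    if v: "v \<in> V F" and h: "h \<in> H" for v F \<delta> h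
    using v unfolding V_def
  proof induction
    case zero
    then show ?case using T_zero[OF h] by (simp add: lspan.zero)
  next
    case (step m' v c)
    then obtain w where w: "w \<in> W" "wt w \<in> F" "m' = m w" by auto
    have v: "v \<in> carrier A" using step Vc[of v F] by (simp add: V_def)
    let ?d = "c * (\<chi> (wt w) h - \<chi> \<delta> h)"
    have 1: "T h (smul A c m' \<oplus> v) = smul A (c * \<chi> (wt w) h) (m w) \<oplus> T h v"
      using w v h m_closed by (simp add: T_add T_smul T_m)
    have 2: "smul A ?d (m w) =
        smul A (c * \<chi> (wt w) h) (m w) \<oplus> smul A (- (\<chi> \<delta> h * c)) (m w)"
      using w m_closed by (simp add: smul_add_left[symmetric] algebra_simps)
    have "T h (smul A c m' \<oplus> v) \<oplus> smul A (- \<chi> \<delta> h) (smul A c m' \<oplus> v)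
        = smul A ?d (m w) \<oplus> (T h v \<oplus> smul A (- \<chi> \<delta> h) v)"
      unfolding 1 2 using w v h m_closed T_closed by (simp add: smul_add a_ac)
    moreover have "smul A ?d (m w) \<oplus> (T h v \<oplus> smul A (- \<chi> \<delta> h) v)
        \<in> lspan A (m ` {w \<in> W. wt w \<in> F - {\<delta>}})"
    proof (cases "wt w = \<delta>")
      case True
      then show ?thesis using w v h m_closed T_closed step by simp
    next
      case False
      then show ?thesis using w step by (intro lspan.step) auto
    qed
    ultimately show ?case by simp
  qed
  have main: "u \<in> V {\<gamma>}" if "finite F" "u \<in> V F" "F \<subseteq> wt ` W" for F
    using that
  proof (induction "card (F - {\<gamma>})" arbitrary: F)
    case 0
    then have "F \<subseteq> {\<gamma>}" by auto
    then have "V F \<subseteq> V {\<gamma>}" unfolding V_def by (intro lspan_mono) auto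
    then show ?case using 0 by auto
  next
    case (Suc n)
    then obtain \<delta> where \<delta>: "\<delta> \<in> F" "\<delta> \<noteq> \<gamma>"
      by (metis Diff_eq_empty_iff card.empty insertI1 nat.simps(3) subsetI)
    then obtain h where h: "h \<in> H" "\<chi> \<delta> h \<noteq> \<chi> \<gamma> h"
      using sep Suc.prems by blast
    have uc: "u \<in> carrier A" using Suc.prems Vc by blast
    \<comment> \<open>The eigenvector is merely rescaled by T h - \<chi> \<delta> h, and by a
      nonzero factor, as \<open>h\<close> separates \<delta> from \<gamma>. Dividing the factor out
      leaves \<open>u\<close> itself in a span with one weight fewer.\<close>
    let ?d = "\<chi> \<gamma> h - \<chi> \<delta> h"
    have "smul A ?d u = T h u \<oplus> smul A (- \<chi> \<delta> h) u"
      using Tu[OF h(1)] uc by (simp add: smul_add_left[symmetric])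
    also have "\<dots> \<in> V (F - {\<delta>})"
      using kill[OF Suc.prems(2) h(1)] .
    finally have "smul A (inverse ?d) (smul A ?d u) \<in> V (F - {\<delta>})"
      unfolding V_def by (rule lspan_smul[OF Mc])
    moreover have "smul A (inverse ?d) (smul A ?d u) = u"
      using h uc by (metis eq_iff_diff_eq_0 left_inverse smul_one smul_smul)
    ultimately have "u \<in> V (F - {\<delta>})" by metis
    moreover have "n = card (F - {\<delta>} - {\<gamma>})"
    proof -
      have "F - {\<delta>} - {\<gamma>} = F - {\<gamma>} - {\<delta>}" by auto
      then show ?thesis using Suc.hyps(2) \<delta> Suc.prems(1) by simp
    qed
    ultimately show ?case using Suc.hyps(1)[of "F - {\<delta>}"] Suc.prems by auto
  qed
  obtain F where F: "finite F" "F \<subseteq> W" "u \<in> lspan A (m ` F)"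
    using lspan_finite_support[OF u] .
  have "lspan A (m ` F) \<subseteq> V (wt ` F)"
    unfolding V_def by (intro lspan_mono) (use F in auto)
  then have "u \<in> V {\<gamma>}" using main[of "wt ` F"] F by auto
  then show ?thesis by (simp add: V_def)
qed

lemma Span_coefficients:
  assumes "set us \<subseteq> carrier A" and "u \<in> Span (range (scal A)) us"
  shows "\<exists>c. u = (\<Oplus>r\<in>{..<length us}. smul A (c r) (us ! r))"
  using assms
proof (induction us arbitrary: u)
  case Nil
  then show ?case by simp
next
  case (Cons a us)
  then obtain c v where v: "v \<in> Span (range (scal A)) us" "u = smul A c a \<oplus> v"
    by (auto simp: line_extension_mem_iff smul_def)
  obtain d where d: "v = (\<Oplus>r\<in>{..<length us}. smul A (d r) (us ! r))"
    using Cons v by auto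
  have cl: "\<And>r. r < length us \<Longrightarrow> us ! r \<in> carrier A" using Cons.prems by auto
  let ?c = "\<lambda>r. case r of 0 \<Rightarrow> c | Suc k \<Rightarrow> d k"
  have "(\<Oplus>r\<in>{..<length (a # us)}. smul A (?c r) ((a # us) ! r))
      = smul A c a \<oplus> (\<Oplus>r\<in>Suc ` {..<length us}. smul A (?c r) ((a # us) ! r))"
  proof -
    have "{..<length (a # us)} = insert 0 (Suc ` {..<length us})"
      by (auto simp: image_iff less_Suc_eq_0_disj)
    then show ?thesis
      using Cons.prems cl by (simp only:) (subst finsum_insert, auto)
  qed
  also have "(\<Oplus>r\<in>Suc ` {..<length us}. smul A (?c r) ((a # us) ! r)) = v"
    unfolding d using cl by (subst finsum_reindex) auto
  finally show ?case using v by metis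
qed

text \<open>The image of \<open>scal\<close> is a field only if the algebra is nonzero, which
  \<open>kalg\<close> does not assert. The members are therefore exhibited in the span by explicit
  coefficients 0 and 1.\<close>

lemma set_subset_Span:
  assumes "set us \<subseteq> carrier A"
  shows "set us \<subseteq> Span (range (scal A)) us"
proof -
  have z: "\<zero> \<in> Span (range (scal A)) us" if "set us \<subseteq> carrier A" for us
    using that
  proof (induction us)
    case (Cons b us)
    then have "\<zero> = scal A 0 \<otimes> b \<oplus> \<zero>" "\<zero> \<in> Span (range (scal A)) us"
      by (simp_all add: scal_zero)
    then show ?case unfolding Span.simps foldr.simps o_apply line_extension_mem_iff by blast
  qed simp
  show ?thesis
    using assms
  proof (induction us)
    case (Cons a us)
    then have "\<exists>k\<in>range (scal A). a = k \<otimes> a \<oplus> \<zero>" by (auto simp: scal_one intro!: exI[of _ 1])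
    then have "a \<in> Span (range (scal A)) (a # us)"
      using z[of us] Cons.prems
      unfolding Span.simps foldr.simps o_apply line_extension_mem_iff by fastforce
    moreover have "v \<in> Span (range (scal A)) (a # us)" if "v \<in> set us" for v
    proof -
      have "v = scal A 0 \<otimes> a \<oplus> v" using that Cons.prems by (auto simp: scal_zero)
      then show ?thesis using that Cons by (auto simp: line_extension_mem_iff)
    qed
    ultimately show ?case by auto
  qed simp
qed

lemma kalg_subalg:
  assumes "S \<subseteq> carrier A"
  shows "kalg (A\<lparr>carrier := subalg A S\<rparr>)"
proof -
  have sub: "subring (subalg A S) A"
    unfolding subalg_def by (rule generate_ring_is_subring) (use assms in auto)
  interpret R: ring "A\<lparr>carrier := subalg A S\<rparr>"
    by (rule subring_is_ring[OF sub])
  show ?thesis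
    by unfold_locales
      (use subalg_subset[OF assms] in
        \<open>auto simp: subalg_scal scal_add scal_mult scal_one intro: scal_comm\<close>)
qed

end

section \<open>Free algebras and their quotients by relations as algebras over the central
  scalars\<close>

section \<open>Presented algebras\<close>

lemma poly_mapping_single_induct [consumes 1, case_names zero single]:
  fixes p :: "'s \<Rightarrow>\<^sub>0 'c::ab_group_add"
  assumes "Poly_Mapping.keys p \<subseteq> T"
    and "P 0"
    and "\<And>s c p. s \<in> T \<Longrightarrow> Poly_Mapping.keys p \<subseteq> T \<Longrightarrow> P p \<Longrightarrow> P (Poly_Mapping.single s c + p)"
  shows "P p"
  using assms(1)
proof (induction "card (Poly_Mapping.keys p)" arbitrary: p)
  case 0
  then have "p = 0" by simp
  then show ?case using assms(2) by simp
next
  case (Suc n)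
  then obtain s where s: "s \<in> Poly_Mapping.keys p" by fastforce
  define r where "r = p - Poly_Mapping.single s (Poly_Mapping.lookup p s)"
  have k: "Poly_Mapping.keys r = Poly_Mapping.keys p - {s}"
    by (auto simp: r_def in_keys_iff lookup_minus lookup_single when_def split: if_splits)
  have "P r" using Suc s by (intro Suc.hyps(1)) (auto simp: k)
  moreover have "p = Poly_Mapping.single s (Poly_Mapping.lookup p s) + r" by (simp add: r_def)
  ultimately show ?case using assms(3)[of s r "Poly_Mapping.lookup p s"] s Suc.prems k by auto
qed

lemma ring_extend [simp]:
  "carrier (ring.extend R m) = carrier R" "monoid.mult (ring.extend R m) = monoid.mult R"
  "one (ring.extend R m) = one R" "ring.zero (ring.extend R m) = ring.zero R"
  "add (ring.extend R m) = add R"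
  by (simp_all add: ring.extend_def)

lemma scal_extend [simp]: "scal (ring.extend R (kalgebra.fields s)) = s"
  by (simp add: ring.extend_def kalgebra.fields_def)

text \<open>\<open>ring.extend\<close> enlarges the record of a ring by \<open>scal\<close>; the
  ring axioms see the five ring components only, so they carry over to the extended record.\<close>

lemma ring_cong:
  assumes "ring R" and "carrier R' = carrier R" "monoid.mult R' = monoid.mult R" "one R' = one R"
    "ring.zero R' = ring.zero R" "add R' = add R"
  shows "ring R'"
proof -
  interpret R: ring R by fact
  have inv: "\<exists>y\<in>carrier R. y \<oplus>\<^bsub>R\<^esub> x = \<zero>\<^bsub>R\<^esub>" if "x \<in> carrier R" for x
    using that R.add.l_inv_ex by auto
  show ?thesis
    by (intro ringI abelian_groupI monoidI)
      (use inv in \<open>auto simp: assms(2-) R.a_assoc R.m_assoc R.l_distr R.r_distr intro: R.a_comm\<close>)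
qed

lemma (in kalg) kalg_quot:
  assumes "ideal J A"
  shows "kalg (alg_quot A J)"
proof -
  interpret J: ideal J A by fact
  interpret Q: ring "alg_quot A J"
    by (rule ring_cong[OF J.quotient_is_ring]) (simp_all add: alg_quot_def)
  show ?thesis
  proof unfold_locales
    fix c d x
    show "scal (alg_quot A J) c \<in> carrier (alg_quot A J)"
      by (simp add: alg_quot_def FactRing_simps) (use scal_closed in blast)
    show "scal (alg_quot A J) (c + d) =
        scal (alg_quot A J) c \<oplus>\<^bsub>alg_quot A J\<^esub> scal (alg_quot A J) d"
      by (simp add: alg_quot_def FactRing_def J.a_rcos_sum scal_add)
    show "scal (alg_quot A J) (c * d) =
        scal (alg_quot A J) c \<otimes>\<^bsub>alg_quot A J\<^esub> scal (alg_quot A J) d"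
      by (simp add: alg_quot_def FactRing_def J.rcoset_mult_add scal_mult)
    show "scal (alg_quot A J) 1 = \<one>\<^bsub>alg_quot A J\<^esub>"
      by (simp add: alg_quot_def FactRing_def scal_one)
    assume "x \<in> carrier (alg_quot A J)"
    then obtain a where "a \<in> carrier A" "x = J +> a"
      by (auto simp: alg_quot_def FactRing_simps)
    then show "scal (alg_quot A J) c \<otimes>\<^bsub>alg_quot A J\<^esub> x = x \<otimes>\<^bsub>alg_quot A J\<^esub> scal (alg_quot A J) c"
      by (simp add: alg_quot_def FactRing_def J.rcoset_mult_add scal_comm)
  qed
qed

lemma free_alg_simps:
  "carrier (free_alg G) = {p. \<forall>w\<in>Poly_Mapping.keys p. set (letters w) \<subseteq> G}"
  "monoid.mult (free_alg G) = (*)" "one (free_alg G) = 1" "ring.zero (free_alg G) = 0"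
  "add (free_alg G) = (+)" "scal (free_alg G) = kconst"
  by (simp_all add: free_alg_def ring_of_type_algebra_def)

lemma free_alg_closed:
  "0 \<in> carrier (free_alg G)" "1 \<in> carrier (free_alg G)" "kconst c \<in> carrier (free_alg G)"
  "g \<in> G \<Longrightarrow> letter g \<in> carrier (free_alg G)"
  "p \<in> carrier (free_alg G) \<Longrightarrow> r \<in> carrier (free_alg G) \<Longrightarrow> p + r \<in> carrier (free_alg G)"
  "p \<in> carrier (free_alg G) \<Longrightarrow> r \<in> carrier (free_alg G) \<Longrightarrow> p * r \<in> carrier (free_alg G)"
  "p \<in> carrier (free_alg G) \<Longrightarrow> - p \<in> carrier (free_alg G)"
  "p \<in> carrier (free_alg G) \<Longrightarrow> r \<in> carrier (free_alg G) \<Longrightarrow> p - r \<in> carrier (free_alg G)"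
proof -
  show add: "p + r \<in> carrier (free_alg G)"
    if "p \<in> carrier (free_alg G)" "r \<in> carrier (free_alg G)" for p r
    using that keys_add[of p r] by (auto simp: free_alg_simps)
  show "p * r \<in> carrier (free_alg G)"
    if "p \<in> carrier (free_alg G)" "r \<in> carrier (free_alg G)"
    using that keys_mult[of p r] by (fastforce simp: free_alg_simps plus_word_def)
  show neg: "- p \<in> carrier (free_alg G)" if "p \<in> carrier (free_alg G)" for p
    using that by (auto simp: free_alg_simps in_keys_iff)
  show "p - r \<in> carrier (free_alg G)"
    if "p \<in> carrier (free_alg G)" "r \<in> carrier (free_alg G)"
    using add[OF that(1) neg[OF that(2)]] by simp
qed (auto simp: free_alg_simps kconst_def letter_def zero_word_def in_keys_iff lookup_one
    lookup_single when_def)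

lemma free_alg_power_closed: "p \<in> carrier (free_alg G) \<Longrightarrow> p ^ n \<in> carrier (free_alg G)"
  by (induction n) (auto intro: free_alg_closed)

lemma free_alg_sum_closed:
  "(\<And>x. x \<in> T \<Longrightarrow> f x \<in> carrier (free_alg G)) \<Longrightarrow> sum f T \<in> carrier (free_alg G)"
  by (induction T rule: infinite_finite_induct) (auto intro: free_alg_closed)

text \<open>Words do not commute, but a constant is supported on the empty word, which is neutral on
  both sides, and the coefficients commute.\<close>

lemma kconst_central: "kconst c * p = p * kconst c"
proof (induction p rule: poly_mapping_single_induct[OF subset_UNIV])
  case (2 s d p)
  then show ?case
    by (simp add: kconst_def distrib_left distrib_right mult_single mult.commute)
qed simp

lemma kalg_free_alg: "kalg (free_alg G)"
proof -
  interpret ring "free_alg G"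
  proof (intro ringI abelian_groupI monoidI)
    fix x assume x: "x \<in> carrier (free_alg G)"
    show "\<exists>y\<in>carrier (free_alg G). y \<oplus>\<^bsub>free_alg G\<^esub> x = \<zero>\<^bsub>free_alg G\<^esub>"
      using free_alg_closed(7)[OF x] by (auto simp: free_alg_simps(2-) intro!: bexI[of _ "- x"])
  qed (auto simp: free_alg_simps(2-) algebra_simps intro: free_alg_closed)
  show ?thesis
  proof unfold_locales
    fix c x
    show "scal (free_alg G) c \<otimes>\<^bsub>free_alg G\<^esub> x = x \<otimes>\<^bsub>free_alg G\<^esub> scal (free_alg G) c"
      unfolding free_alg_simps by (rule kconst_central)
  qed (simp_all add: free_alg_simps(2-) free_alg_closed, simp_all add: kconst_def single_add mult_single)
qed

locale presentation =
  fixes G :: "'g set" and R :: "('g word \<Rightarrow>\<^sub>0 qfield) set"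
  assumes rels: "R \<subseteq> carrier (free_alg G)"
begin

abbreviation "PA \<equiv> presented G R"

sublocale F: kalg "free_alg G" by (rule kalg_free_alg)

sublocale J: ideal "genideal (free_alg G) R" "free_alg G"
  by (rule F.genideal_ideal[OF rels])

sublocale P: kalg PA
  unfolding presented_def by (rule F.kalg_quot[OF J.ideal_axioms])

lemma pclass_closed: "p \<in> carrier (free_alg G) \<Longrightarrow> pclass G R p \<in> carrier PA"
  by (simp add: presented_def pclass_def alg_quot_def FactRing_simps) blast

lemma pclass_add:
  "p \<in> carrier (free_alg G) \<Longrightarrow> r \<in> carrier (free_alg G) \<Longrightarrow>
    pclass G R (p + r) = pclass G R p \<oplus>\<^bsub>PA\<^esub> pclass G R r"
  using J.a_rcos_sum[of p r]
  by (simp add: presented_def pclass_def alg_quot_def FactRing_def free_alg_simps(5))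

lemma pclass_mult:
  "p \<in> carrier (free_alg G) \<Longrightarrow> r \<in> carrier (free_alg G) \<Longrightarrow>
    pclass G R (p * r) = pclass G R p \<otimes>\<^bsub>PA\<^esub> pclass G R r"
  using J.rcoset_mult_add[of p r]
  by (simp add: presented_def pclass_def alg_quot_def FactRing_def free_alg_simps(2))

lemma pclass_one: "pclass G R 1 = \<one>\<^bsub>PA\<^esub>"
  by (simp add: presented_def pclass_def alg_quot_def FactRing_def free_alg_simps)

lemma pclass_kconst: "pclass G R (kconst c) = scal PA c"
  by (simp add: presented_def pclass_def alg_quot_def free_alg_simps)

lemma pclass_zero: "pclass G R 0 = \<zero>\<^bsub>PA\<^esub>"
  using J.a_rcos_const[of 0] J.zero_closed
  by (simp add: presented_def pclass_def alg_quot_def FactRing_def free_alg_simps free_alg_closed)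

lemma pclass_eqI:
  assumes "p - r \<in> R" and p: "p \<in> carrier (free_alg G)" and r: "r \<in> carrier (free_alg G)"
  shows "pclass G R p = pclass G R r"
proof -
  have d: "p - r \<in> genideal (free_alg G) R"
    using F.genideal_self[OF rels] assms(1) by auto
  have "pclass G R (p - r) = \<zero>\<^bsub>PA\<^esub>"
    using J.a_rcos_const[OF d]
    by (simp add: presented_def pclass_def alg_quot_def FactRing_def)
  then have "pclass G R (p - r) \<oplus>\<^bsub>PA\<^esub> pclass G R r = pclass G R r"
    using pclass_closed[OF r] by simp
  then show ?thesis
    using pclass_add[OF free_alg_closed(8)[OF p r] r] by simp
qed

end

section \<open>Tensor products as rings, for multiplying out the coproducts of monomials\<close>

section \<open>Tensor products\<close>

locale kalg_pair = A: kalg A + C: kalg C for A :: "'a kalgebra" and C :: "'b kalgebra"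
begin

abbreviation "PR \<equiv> pair_alg A C"
abbreviation "TA \<equiv> tensor_alg A C"
abbreviation pm :: "'a \<times> 'b \<Rightarrow> 'a \<times> 'b \<Rightarrow> 'a \<times> 'b"
  where "pm s t \<equiv> (fst s \<otimes>\<^bsub>A\<^esub> fst t, snd s \<otimes>\<^bsub>C\<^esub> snd t)"

text \<open>The product is summed over the supports, which change under addition. Larger finite
  index sets add only zero terms and turn biadditivity into a termwise matter.\<close>

lemma pair_mult_superset:
  assumes "finite S" "finite T" "Poly_Mapping.keys p \<subseteq> S" "Poly_Mapping.keys r \<subseteq> T"
  shows "p \<otimes>\<^bsub>PR\<^esub> r = (\<Sum>s\<in>S. \<Sum>t\<in>T. Poly_Mapping.single (pm s t)
      (Poly_Mapping.lookup p s * Poly_Mapping.lookup r t))"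
proof -
  have "p \<otimes>\<^bsub>PR\<^esub> r = (\<Sum>s\<in>Poly_Mapping.keys p. \<Sum>t\<in>T. Poly_Mapping.single (pm s t)
      (Poly_Mapping.lookup p s * Poly_Mapping.lookup r t))"
    unfolding pair_alg_def using assms
    by (simp, intro sum.cong refl sum.mono_neutral_left) (auto simp: in_keys_iff)
  also have "\<dots> = (\<Sum>s\<in>S. \<Sum>t\<in>T. Poly_Mapping.single (pm s t)
      (Poly_Mapping.lookup p s * Poly_Mapping.lookup r t))"
    using assms by (intro sum.mono_neutral_left) (auto simp: in_keys_iff)
  finally show ?thesis .
qed

lemma pair_mult_add_left: "(p + p') \<otimes>\<^bsub>PR\<^esub> r = (p \<otimes>\<^bsub>PR\<^esub> r) + (p' \<otimes>\<^bsub>PR\<^esub> r)"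
proof -
  let ?S = "Poly_Mapping.keys p \<union> Poly_Mapping.keys p'" and ?T = "Poly_Mapping.keys r"
  show ?thesis
    using keys_add[of p p']
    by (simp add: pair_mult_superset[of ?S ?T] lookup_add distrib_right single_add sum.distrib)
qed

lemma pair_mult_add_right: "r \<otimes>\<^bsub>PR\<^esub> (p + p') = (r \<otimes>\<^bsub>PR\<^esub> p) + (r \<otimes>\<^bsub>PR\<^esub> p')"
proof -
  let ?S = "Poly_Mapping.keys p \<union> Poly_Mapping.keys p'" and ?T = "Poly_Mapping.keys r"
  show ?thesis
    using keys_add[of p p']
    by (simp add: pair_mult_superset[of ?T ?S] lookup_add distrib_left single_add sum.distrib)
qed

lemma pair_mult_zero: "0 \<otimes>\<^bsub>PR\<^esub> r = 0" "r \<otimes>\<^bsub>PR\<^esub> 0 = 0"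
  by (simp_all add: pair_alg_def)

lemma pair_mult_single:
  "Poly_Mapping.single s c \<otimes>\<^bsub>PR\<^esub> Poly_Mapping.single t d = Poly_Mapping.single (pm s t) (c * d)"
  by (subst pair_mult_superset[of "{s}" "{t}"]) auto

lemma pair_carrier: "carrier PR = {p. Poly_Mapping.keys p \<subseteq> carrier A \<times> carrier C}"
  by (simp add: pair_alg_def)

lemma pair_simps: "\<zero>\<^bsub>PR\<^esub> = 0" "add PR = (+)"
  "\<one>\<^bsub>PR\<^esub> = Poly_Mapping.single (\<one>\<^bsub>A\<^esub>, \<one>\<^bsub>C\<^esub>) 1"
  "scal PR = Poly_Mapping.single (\<one>\<^bsub>A\<^esub>, \<one>\<^bsub>C\<^esub>)"
  by (simp_all add: pair_alg_def)

lemma pair_single_closed: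
  "a \<in> carrier A \<Longrightarrow> b \<in> carrier C \<Longrightarrow> Poly_Mapping.single (a, b) c \<in> carrier PR"
  by (simp add: pair_carrier)

lemma pair_add_closed: "p \<in> carrier PR \<Longrightarrow> r \<in> carrier PR \<Longrightarrow> p + r \<in> carrier PR"
  using keys_add[of p r] by (auto simp: pair_carrier)

lemma pair_minus_closed: "p \<in> carrier PR \<Longrightarrow> - p \<in> carrier PR"
  by (auto simp: pair_carrier in_keys_iff)

lemma pair_diff_closed: "p \<in> carrier PR \<Longrightarrow> r \<in> carrier PR \<Longrightarrow> p - r \<in> carrier PR"
  using pair_add_closed[OF _ pair_minus_closed, of p r] by simp

lemma pair_induct [consumes 1, case_names zero single]:
  assumes "p \<in> carrier PR" and "P 0"
    and "\<And>a b c p. a \<in> carrier A \<Longrightarrow> b \<in> carrier C \<Longrightarrow> p \<in> carrier PR \<Longrightarrow> P p \<Longrightarrow>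
      P (Poly_Mapping.single (a, b) c + p)"
  shows "P p"
proof -
  have "Poly_Mapping.keys p \<subseteq> carrier A \<times> carrier C" using assms(1) by (simp add: pair_carrier)
  then show ?thesis
    by (induction rule: poly_mapping_single_induct) (use assms(2,3) in \<open>auto simp: pair_carrier\<close>)
qed

lemma pair_mult_closed: "p \<in> carrier PR \<Longrightarrow> r \<in> carrier PR \<Longrightarrow> p \<otimes>\<^bsub>PR\<^esub> r \<in> carrier PR"
proof (induction p rule: pair_induct)
  case (single a b c p)
  have "Poly_Mapping.single (a, b) c \<otimes>\<^bsub>PR\<^esub> r \<in> carrier PR"
    using \<open>r \<in> carrier PR\<close>
  proof (induction r rule: pair_induct)
    case (single a' b' c' r)
    then show ?case
      using \<open>a \<in> carrier A\<close> \<open>b \<in> carrier C\<close>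
      by (auto simp: pair_mult_add_right pair_mult_single intro!: pair_add_closed pair_single_closed)
  qed (simp add: pair_mult_zero pair_carrier)
  then show ?case using single by (auto simp: pair_mult_add_left intro!: pair_add_closed)
qed (simp add: pair_mult_zero pair_carrier)

lemma pair_mult_assoc:
  assumes "p \<in> carrier PR" "r \<in> carrier PR" "s \<in> carrier PR"
  shows "p \<otimes>\<^bsub>PR\<^esub> r \<otimes>\<^bsub>PR\<^esub> s = p \<otimes>\<^bsub>PR\<^esub> (r \<otimes>\<^bsub>PR\<^esub> s)"
  using assms(1)
proof (induction p rule: pair_induct)
  case p: (single a b c p)
  have "Poly_Mapping.single (a, b) c \<otimes>\<^bsub>PR\<^esub> r \<otimes>\<^bsub>PR\<^esub> s
      = Poly_Mapping.single (a, b) c \<otimes>\<^bsub>PR\<^esub> (r \<otimes>\<^bsub>PR\<^esub> s)"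
    using assms(2)
  proof (induction r rule: pair_induct)
    case r: (single a' b' c' r)
    have "Poly_Mapping.single (a, b) c \<otimes>\<^bsub>PR\<^esub> Poly_Mapping.single (a', b') c' \<otimes>\<^bsub>PR\<^esub> s
        = Poly_Mapping.single (a, b) c \<otimes>\<^bsub>PR\<^esub> (Poly_Mapping.single (a', b') c' \<otimes>\<^bsub>PR\<^esub> s)"
      using assms(3)
    proof (induction s rule: pair_induct)
      case (single a'' b'' c'' s)
      then show ?case
        using p r
        by (simp add: pair_mult_add_right pair_mult_single A.m_assoc C.m_assoc mult.assoc)
    qed (simp add: pair_mult_zero)
    then show ?case
      using r by (simp add: pair_mult_add_right pair_mult_add_left)
  qed (simp add: pair_mult_zero)
  then show ?case using p by (simp add: pair_mult_add_left)
qed (simp add: pair_mult_zero)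

lemma pair_mult_one: "p \<in> carrier PR \<Longrightarrow> \<one>\<^bsub>PR\<^esub> \<otimes>\<^bsub>PR\<^esub> p = p \<and> p \<otimes>\<^bsub>PR\<^esub> \<one>\<^bsub>PR\<^esub> = p"
proof (induction p rule: pair_induct)
qed (simp_all add: pair_mult_zero pair_mult_add_left pair_mult_add_right pair_simps pair_mult_single)

sublocale PR: ring PR
proof (intro ringI abelian_groupI monoidI)
  show "\<zero>\<^bsub>PR\<^esub> \<in> carrier PR" by (simp add: pair_simps pair_carrier)
  show "\<one>\<^bsub>PR\<^esub> \<in> carrier PR" by (simp add: pair_simps pair_carrier)
  fix x assume x: "x \<in> carrier PR"
  show "\<exists>y\<in>carrier PR. y \<oplus>\<^bsub>PR\<^esub> x = \<zero>\<^bsub>PR\<^esub>"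
    using pair_minus_closed[OF x] by (auto simp: pair_simps intro!: bexI[of _ "- x"])
qed (simp_all add: pair_mult_assoc pair_mult_one pair_mult_closed,
    simp_all add: pair_simps pair_add_closed pair_mult_add_left pair_mult_add_right add_ac)

lemma bilin_rels_closed: "bilin_rels A C \<subseteq> carrier PR"
  unfolding bilin_rels_def
  by (auto intro!: pair_diff_closed pair_single_closed)

sublocale K: ideal "genideal PR (bilin_rels A C)" PR
  by (rule PR.genideal_ideal[OF bilin_rels_closed])

sublocale TA: ring TA
  unfolding tensor_alg_def
  by (rule ring_cong[OF K.quotient_is_ring]) (simp_all add: alg_quot_def)

lemma tens_closed: "a \<in> carrier A \<Longrightarrow> b \<in> carrier C \<Longrightarrow> tens A C a b \<in> carrier TA"
  using pair_single_closed[of a b 1]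
  by (simp add: tens_def tensor_alg_def alg_quot_def FactRing_simps) blast

lemma tens_mult:
  "a \<in> carrier A \<Longrightarrow> b \<in> carrier C \<Longrightarrow> a' \<in> carrier A \<Longrightarrow> b' \<in> carrier C \<Longrightarrow>
    tens A C a b \<otimes>\<^bsub>TA\<^esub> tens A C a' b' = tens A C (a \<otimes>\<^bsub>A\<^esub> a') (b \<otimes>\<^bsub>C\<^esub> b')"
  using K.rcoset_mult_add[of "Poly_Mapping.single (a, b) 1" "Poly_Mapping.single (a', b') 1"]
  by (simp add: tens_def tensor_alg_def alg_quot_def FactRing_def pair_single_closed
      pair_mult_single)

lemma tens_one: "tens A C \<one>\<^bsub>A\<^esub> \<one>\<^bsub>C\<^esub> = \<one>\<^bsub>TA\<^esub>"
  by (simp add: tens_def tensor_alg_def alg_quot_def FactRing_def pair_simps)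

lemma tens_sum_Nil [simp]: "tens_sum A C [] = \<zero>\<^bsub>TA\<^esub>"
  and tens_sum_Cons [simp]: "tens_sum A C ((a, b) # ts) = tens A C a b \<oplus>\<^bsub>TA\<^esub> tens_sum A C ts"
  by (simp_all add: tens_sum_def)

lemma tens_sum_closed: "set ts \<subseteq> carrier A \<times> carrier C \<Longrightarrow> tens_sum A C ts \<in> carrier TA"
  by (induction ts) (auto simp: tens_closed)

lemma tens_sum_append:
  "set ts \<subseteq> carrier A \<times> carrier C \<Longrightarrow> set ts' \<subseteq> carrier A \<times> carrier C \<Longrightarrow>
    tens_sum A C (ts @ ts') = tens_sum A C ts \<oplus>\<^bsub>TA\<^esub> tens_sum A C ts'"
  by (induction ts) (auto simp: tens_closed tens_sum_closed TA.a_assoc)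

lemma tens_mult_sum:
  "set ts \<subseteq> carrier A \<times> carrier C \<Longrightarrow> a \<in> carrier A \<Longrightarrow> b \<in> carrier C \<Longrightarrow>
    tens A C a b \<otimes>\<^bsub>TA\<^esub> tens_sum A C ts
      = tens_sum A C (map (\<lambda>(a', b'). (a \<otimes>\<^bsub>A\<^esub> a', b \<otimes>\<^bsub>C\<^esub> b')) ts)"
  by (induction ts) (auto simp: tens_closed tens_sum_closed TA.r_distr tens_mult)

lemma tens_two_mult_sum:
  assumes "set ts \<subseteq> carrier A \<times> carrier C"
    and "a \<in> carrier A" "b \<in> carrier C" "a' \<in> carrier A" "b' \<in> carrier C"
  shows "(tens A C a b \<oplus>\<^bsub>TA\<^esub> tens A C a' b') \<otimes>\<^bsub>TA\<^esub> tens_sum A C ts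
      = tens_sum A C (map (\<lambda>(x, y). (a \<otimes>\<^bsub>A\<^esub> x, b \<otimes>\<^bsub>C\<^esub> y)) ts
          @ map (\<lambda>(x, y). (a' \<otimes>\<^bsub>A\<^esub> x, b' \<otimes>\<^bsub>C\<^esub> y)) ts)"
proof -
  have "set (map (\<lambda>(x, y). (c \<otimes>\<^bsub>A\<^esub> x, d \<otimes>\<^bsub>C\<^esub> y)) ts) \<subseteq> carrier A \<times> carrier C"
    if "c \<in> carrier A" "d \<in> carrier C" for c d
    using assms(1) that by auto
  then show ?thesis
    using assms
    by (subst tens_sum_append)
      (simp_all add: TA.l_distr tens_closed tens_sum_closed tens_mult_sum)
qed

end

section \<open>Powers of q, integrality of the pairings, separation of weights by lattice
  points\<close>

section \<open>Cartan data\<close>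

text \<open>\<open>qv ^ n\<close> is represented by a polynomial of degree n, whereas 1 has degree
  0. Thus q is no root of unity, which makes \<open>qpow\<close> injective on the integers and
  q_i^{-1} - q_i nonzero.\<close>

lemma qv_power_eq_1_iff: "qv ^ n = 1 \<longleftrightarrow> n = 0"
proof
  assume 1: "qv ^ n = 1"
  have "Fract ([:0, 1:] ^ n) 1 = qv ^ n"
  proof (induction n)
    case (Suc n)
    have *: "Fract ([:0, 1:] ^ Suc n) 1 = Fract [:0, 1:] 1 * Fract ([:0, 1:] ^ n) 1"
      by (simp only: mult_fract power_Suc mult_1_right)
    show ?case unfolding * Suc by (simp add: qv_def)
  qed (simp add: One_fract_def)
  then have "[:0, 1:] ^ n = (1 :: rat poly)"
    using 1 by (simp add: One_fract_def eq_fract)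
  then have "degree ([:0, 1 :: rat:] ^ n) = 0" by simp
  then show "n = 0" by (simp add: degree_power_eq)
qed simp

lemma qv_nonzero: "qv \<noteq> 0"
  by (simp add: qv_def Zero_fract_def eq_fract)

lemma qpow_nonzero [simp]: "qpow r \<noteq> 0"
  by (simp add: qpow_def qv_nonzero)

lemma qpow_0 [simp]: "qpow 0 = 1"
  by (simp add: qpow_def)

text \<open>\<open>qpow\<close> goes through the floor, which is additive on integers; this is the
  source of the integrality conditions below.\<close>

lemma qpow_add:
  assumes "r \<in> \<int>" "s \<in> \<int>"
  shows "qpow (r + s) = qpow r * qpow s"
proof -
  obtain k l where kl: "r = of_int k" "s = of_int l"
    using assms by (auto elim!: Ints_cases)
  have "\<lfloor>r + s\<rfloor> = k + l" unfolding kl by (metis floor_of_int of_int_add)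
  then show ?thesis by (simp add: qpow_def kl power_int_add qv_nonzero)
qed

lemma qpow_sum_list: "(\<forall>j. j \<in> set w \<longrightarrow> f j \<in> \<int>) \<Longrightarrow> qpow (\<Sum>j\<leftarrow>w. f j) = (\<Prod>j\<leftarrow>w. qpow (f j))"
proof (induction w)
  case (Cons a w)
  have "(\<forall>j. j \<in> set w \<longrightarrow> f j \<in> \<int>) \<Longrightarrow> (\<Sum>j\<leftarrow>w. f j) \<in> \<int>" by (induction w) auto
  then show ?case using Cons by (simp add: qpow_add)
qed simp

lemma qpow_inject: "r \<in> \<int> \<Longrightarrow> s \<in> \<int> \<Longrightarrow> qpow r = qpow s \<longleftrightarrow> r = s"
proof -
  have *: "r = s" if "r \<in> \<int>" "s \<in> \<int>" "qpow r = qpow s" "r \<le> s" for r s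
  proof -
    have "qpow s = qpow (s - r) * qpow r"
      using that qpow_add[of "s - r" r] by simp
    then have "qpow (s - r) = 1" using that by simp
    moreover have "s - r \<in> \<int>" using that by simp
    then obtain k :: int where k: "s - r = of_int k" by (rule Ints_cases)
    moreover have "k \<ge> 0" using k that(4) by (metis diff_ge_0_iff_ge of_int_0_le_iff)
    moreover define n where "n = nat k"
    ultimately have n: "s - r = of_nat n" and "qpow (s - r) = 1" by simp_all
    then have "qv ^ n = 1" by (simp add: qpow_def)
    then show "r = s" using qv_power_eq_1_iff n by simp
  qed
  assume "r \<in> \<int>" "s \<in> \<int>"
  then show ?thesis using *[of r s] *[of s r] by (metis linear)
qed

definition pairing :: "('i, 't) cartan_data \<Rightarrow> 'i \<Rightarrow> 'i \<Rightarrow> qfield"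
  where "pairing D i j = qpow (iprod D (sroot D i) (sroot D j))"

definition pairing_word :: "('i, 't) cartan_data \<Rightarrow> 'i \<Rightarrow> 'i list \<Rightarrow> qfield"
  where "pairing_word D i w = (\<Prod>j\<leftarrow>w. pairing D i j)"

definition words :: "('i, 't) cartan_data \<Rightarrow> ('i \<Rightarrow> nat) \<Rightarrow> 'i list set"
  where "words D \<beta> = {w \<in> lists (inds D). count (mset w) = \<beta>}"

locale cartan =
  fixes D :: "('i, 't::ab_group_add) cartan_data"
  assumes datum: "cartan_datum D"
begin

abbreviation "I \<equiv> inds D"
abbreviation "p \<equiv> pairing D"
abbreviation "pw \<equiv> pairing_word D"

lemma finite_I: "finite I"
  and sroot_dual: "i \<in> I \<Longrightarrow> sroot D i \<in> dual_space D"
  and sroot_indep: "(\<And>h. (\<Sum>i\<in>I. c i * sroot D i h) = 0) \<Longrightarrow> i \<in> I \<Longrightarrow> c i = 0"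
  and lattice: "lattice_in_dual D"
  and sroot_wlat: "i \<in> I \<Longrightarrow> sroot D i \<in> wlat D"
  and coroot_colat: "i \<in> I \<Longrightarrow> coroot D i \<in> colat D"
  and vs: "vector_space (tscale D)"
  and inner: "inner_product_on_dual D"
  using datum unfolding cartan_datum_def by (auto simp: image_subset_iff)

lemma half_norm_pos:
  assumes "i \<in> I"
  obtains d :: nat where "d > 0" "half_norm D i = of_nat d"
    "iprod D (sroot D i) (sroot D i) = 2 * of_nat d"
proof -
  have "\<exists>d::nat. d > 0 \<and> iprod D (sroot D i) (sroot D i) = 2 * of_nat d"
    using datum assms unfolding cartan_datum_def by blast
  then show ?thesis using that by (auto simp: half_norm_def)
qed

lemma coroot_eq:
  "i \<in> I \<Longrightarrow> \<xi> \<in> dual_space D \<Longrightarrow>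
    \<xi> (coroot D i) = 2 * iprod D (sroot D i) \<xi> / iprod D (sroot D i) (sroot D i)"
  using datum unfolding cartan_datum_def by blast

lemma dual_add: "\<xi> \<in> dual_space D \<Longrightarrow> \<xi> (h + h') = \<xi> h + \<xi> h'"
  and dual_scale: "\<xi> \<in> dual_space D \<Longrightarrow> \<xi> (tscale D c h) = c * \<xi> h"
  unfolding dual_space_def Vector_Spaces.linear_def module_hom_def module_hom_axioms_def by auto

lemma dual_zero: "\<xi> \<in> dual_space D \<Longrightarrow> \<xi> 0 = 0"
  using dual_add[of \<xi> 0 0] by simp

lemma dual_minus: "\<xi> \<in> dual_space D \<Longrightarrow> \<xi> (- h) = - \<xi> h"
  using dual_add[of \<xi> h "- h"] dual_zero[of \<xi>] by (simp add: add_eq_0_iff)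

lemma dual_comb:
  assumes "\<xi> \<in> dual_space D" "\<mu> \<in> dual_space D"
  shows "(\<lambda>h. a * \<xi> h + b * \<mu> h) \<in> dual_space D"
  using assms unfolding dual_space_def Vector_Spaces.linear_def module_hom_def module_hom_axioms_def
  by (auto simp: algebra_simps)

lemma zero_dual: "(\<lambda>h. 0) \<in> dual_space D"
proof -
  interpret V: vector_space "tscale D" by (rule vs)
  interpret R: vector_space "(*) :: rat \<Rightarrow> rat \<Rightarrow> rat"
    by unfold_locales (auto simp: algebra_simps)
  show ?thesis
    unfolding dual_space_def Vector_Spaces.linear_def module_hom_def module_hom_axioms_def
    by (auto intro: V.module_axioms R.module_axioms V.vector_space_axioms R.vector_space_axioms)
qed

lemma wlat_dual: "\<xi> \<in> wlat D \<Longrightarrow> \<xi> \<in> dual_space D"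
proof -
  assume \<xi>: "\<xi> \<in> wlat D"
  obtain n :: nat and b where b: "\<forall>k<n. b k \<in> dual_space D"
    and w: "wlat D = {(\<lambda>h. \<Sum>k<n. of_int (z k) * b k h) | z. True}"
    using lattice unfolding lattice_in_dual_def by blast
  obtain z where \<xi>z: "\<xi> = (\<lambda>h. \<Sum>k<n. of_int (z k) * b k h)" using \<xi> w by auto
  have "(\<lambda>h. \<Sum>k<m. of_int (z k) * b k h) \<in> dual_space D" if "m \<le> n" for m
    using that
  proof (induction m)
    case 0
    then show ?case by (simp add: zero_dual)
  next
    case (Suc m)
    then show ?case
      using dual_comb[of "\<lambda>h. \<Sum>k<m. of_int (z k) * b k h" "b m" 1 "of_int (z m)"] b by simp
  qed
  then show ?thesis using \<xi>z by simp
qed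

lemma colat_Ints: "h \<in> colat D \<Longrightarrow> i \<in> I \<Longrightarrow> sroot D i h \<in> \<int>"
  using sroot_wlat unfolding colat_def by blast

lemma colat_zero: "0 \<in> colat D"
  and colat_add: "h \<in> colat D \<Longrightarrow> h' \<in> colat D \<Longrightarrow> h + h' \<in> colat D"
  and colat_minus: "h \<in> colat D \<Longrightarrow> - h \<in> colat D"
  and colat_scale: "h \<in> colat D \<Longrightarrow> tscale D (of_nat n) h \<in> colat D"
  unfolding colat_def using wlat_dual
  by (auto simp: dual_zero dual_add dual_minus dual_scale)

lemma colat_sum: "(\<And>x. x \<in> T \<Longrightarrow> f x \<in> colat D) \<Longrightarrow> sum f T \<in> colat D"
  by (induction T rule: infinite_finite_induct) (auto intro: colat_zero colat_add)

lemma tcoroot_colat: "i \<in> I \<Longrightarrow> tcoroot D i \<in> colat D"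
  by (metis tcoroot_def half_norm_pos colat_scale coroot_colat)

lemma dual_tcoroot: "i \<in> I \<Longrightarrow> \<xi> \<in> dual_space D \<Longrightarrow> \<xi> (tcoroot D i) = iprod D (sroot D i) \<xi>"
  by (rule half_norm_pos[of i]) (auto simp: tcoroot_def dual_scale coroot_eq)

lemma ip_sym: "i \<in> I \<Longrightarrow> j \<in> I \<Longrightarrow> iprod D (sroot D i) (sroot D j) = iprod D (sroot D j) (sroot D i)"
  using inner sroot_dual unfolding inner_product_on_dual_def by blast

lemma sroot_tcoroot: "i \<in> I \<Longrightarrow> j \<in> I \<Longrightarrow> sroot D j (tcoroot D i) = iprod D (sroot D i) (sroot D j)"
  by (simp add: dual_tcoroot sroot_dual)

lemma ip_Ints: "i \<in> I \<Longrightarrow> j \<in> I \<Longrightarrow> iprod D (sroot D i) (sroot D j) \<in> \<int>"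
  using colat_Ints[OF tcoroot_colat, of i j] sroot_tcoroot by simp

lemma p_sym: "i \<in> I \<Longrightarrow> j \<in> I \<Longrightarrow> p i j = p j i"
  by (simp add: pairing_def ip_sym)

lemma qpow_sroot_tcoroot: "i \<in> I \<Longrightarrow> j \<in> I \<Longrightarrow> qpow (sroot D j (tcoroot D i)) = p i j"
  by (simp add: pairing_def sroot_tcoroot)

text \<open>Multiplying <h_i, \<alpha>_j> by (\<alpha>_i, \<alpha>_i)/2 gives (\<alpha>_i,
  \<alpha>_j), so the twist in the boson relation is symmetric in i and j.\<close>

lemma qi_powi: "i \<in> I \<Longrightarrow> j \<in> I \<Longrightarrow> qi D i powi \<lfloor>sroot D j (coroot D i)\<rfloor> = p i j"
proof -
  assume i: "i \<in> I" and j: "j \<in> I"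
  obtain d :: nat where d: "d > 0" "half_norm D i = of_nat d" using half_norm_pos[OF i] by metis
  obtain k :: int where k: "sroot D j (coroot D i) = of_int k"
    using colat_Ints[OF coroot_colat[OF i] j] by (auto elim: Ints_cases)
  have "sroot D j (tcoroot D i) = of_int (int d * k)"
    using k d by (simp add: tcoroot_def dual_scale sroot_dual j)
  then have "p i j = qv powi (int d * k)"
    using qpow_sroot_tcoroot[OF i j] by (metis floor_of_int qpow_def)
  also have "\<dots> = (qv ^ d) powi k"
    by (metis power_int_mult power_int_of_nat)
  finally show ?thesis using k d by (simp add: qi_def qpow_def)
qed

lemma qi_neq: "i \<in> I \<Longrightarrow> inverse (qi D i) - qi D i \<noteq> 0"
proof
  assume i: "i \<in> I" and 0: "inverse (qi D i) - qi D i = 0"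
  obtain d :: nat where d: "d > 0" "half_norm D i = of_nat d" using half_norm_pos[OF i] by metis
  have q: "qi D i = qv ^ d" using d by (simp add: qi_def qpow_def)
  then have "qv ^ d * qv ^ d = 1" using 0 qv_nonzero by (simp add: field_simps)
  then have "qv ^ (d + d) = 1" by (simp add: power_add)
  then show False using d unfolding qv_power_eq_1_iff by simp
qed

lemma wlat_basis:
  obtains n :: nat and b where "\<forall>k<n. b k \<in> dual_space D"
    "wlat D = {(\<lambda>h. \<Sum>k<n. of_int (z k) * b k h) | z. True}"
  using lattice unfolding lattice_in_dual_def by blast

text \<open>The lattice P has finite rank, so it is enough to clear the denominators of the finitely
  many values of its basis at \<open>h\<close>.\<close>

lemma colat_multiple: obtains N :: nat where "N > 0" "tscale D (of_nat N) h \<in> colat D"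
proof -
  obtain n :: nat and b where b: "\<forall>k<n. b k \<in> dual_space D"
    "wlat D = {(\<lambda>h. \<Sum>k<n. of_int (z k) * b k h) | z. True}"
    by (rule wlat_basis)
  have "\<exists>d::nat. d > 0 \<and> of_nat d * r \<in> \<int>" for r :: rat
  proof -
    obtain a c where "r = Rat.Fract a c" "c > 0" by (cases r)
    then show ?thesis
      by (intro exI[of _ "nat c"]) (auto simp: Fract_of_int_quotient)
  qed
  then have "\<forall>k. \<exists>d::nat. d > 0 \<and> of_nat d * b k h \<in> \<int>" by blast
  then obtain d :: "nat \<Rightarrow> nat" where d: "\<And>k. d k > 0" "\<And>k. of_nat (d k) * b k h \<in> \<int>"
    using choice[of "\<lambda>k d. d > 0 \<and> of_nat d * b k h \<in> \<int>"] by blast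
  define N where "N = (\<Prod>k<n. d k)"
  have "of_nat N * b k h \<in> \<int>" if "k < n" for k
  proof -
    have "N = (\<Prod>l\<in>{..<n} - {k}. d l) * d k"
      using that by (simp add: N_def prod.remove[of "{..<n}" k] mult.commute)
    then have "of_nat N * b k h = of_nat (\<Prod>l\<in>{..<n} - {k}. d l) * (of_nat (d k) * b k h)"
      by (simp add: mult.assoc)
    then show ?thesis using d(2)[of k] by (simp only: Ints_mult Ints_of_nat)
  qed
  then have "(\<Sum>k<n. of_int (z k) * b k (tscale D (of_nat N) h)) \<in> \<int>" for z :: "nat \<Rightarrow> int"
    using b(1) by (intro Ints_sum) (auto simp: dual_scale)
  then have "tscale D (of_nat N) h \<in> colat D"
    unfolding colat_def b(2) by auto
  moreover have "N > 0" using d by (simp add: N_def prod_pos)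
  ultimately show ?thesis using that by blast
qed

lemma Qweight_scale: "Qweight D \<beta> (tscale D c h) = c * Qweight D \<beta> h"
  by (auto simp: Qweight_def dual_scale sroot_dual sum_distrib_left algebra_simps intro!: sum.cong)

lemma Qweight_Ints: "h \<in> colat D \<Longrightarrow> Qweight D \<beta> h \<in> \<int>"
  by (auto simp: Qweight_def colat_Ints intro!: Ints_sum Ints_mult)

text \<open>Linear independence of the simple roots gives a separating vector in the Cartan
  subalgebra; by linearity of the weights a positive multiple of it still separates, and some such
  multiple lies in the dual lattice.\<close>

lemma Qweight_separates:
  assumes "\<beta> \<in> Qplus D" "\<gamma> \<in> Qplus D" "\<beta> \<noteq> \<gamma>"
  obtains h where "h \<in> colat D" "Qweight D \<beta> h \<noteq> Qweight D \<gamma> h"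
proof -
  have "\<exists>h. Qweight D \<beta> h \<noteq> Qweight D \<gamma> h"
  proof (rule ccontr)
    assume "\<not> ?thesis"
    then have "(\<Sum>i\<in>I. (of_nat (\<beta> i) - of_nat (\<gamma> i)) * sroot D i h) = 0" for h
      by (simp add: Qweight_def left_diff_distrib sum_subtractf)
    then have "\<beta> i = \<gamma> i" if "i \<in> I" for i
      using sroot_indep[of "\<lambda>i. of_nat (\<beta> i) - of_nat (\<gamma> i)" i] that by simp
    then have "\<beta> i = \<gamma> i" for i using assms by (cases "i \<in> I") (auto simp: Qplus_def)
    then have "\<beta> = \<gamma>" by auto
    then show False using assms by simp
  qed
  then obtain h where h: "Qweight D \<beta> h \<noteq> Qweight D \<gamma> h" by blast
  obtain N :: nat where "N > 0" "tscale D (of_nat N) h \<in> colat D" using colat_multiple .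
  then show ?thesis using h that[of "tscale D (of_nat N) h"] by (simp add: Qweight_scale)
qed

lemma words_Qplus: "w \<in> lists I \<Longrightarrow> count (mset w) \<in> Qplus D"
  by (auto simp: Qplus_def count_eq_zero_iff in_lists_conv_set)

lemma Qweight_word: "w \<in> lists I \<Longrightarrow> Qweight D (count (mset w)) h = (\<Sum>j\<leftarrow>w. sroot D j h)"
proof (induction w)
  case (Cons j w)
  have "Qweight D (count (mset (j # w))) h =
      (\<Sum>i\<in>I. of_nat (count (mset w) i) * sroot D i h + (if i = j then sroot D i h else 0))"
    unfolding Qweight_def by (intro sum.cong) (auto simp: algebra_simps)
  also have "\<dots> = Qweight D (count (mset w)) h + sroot D j h"
    using Cons finite_I by (simp add: Qweight_def sum.distrib)
  finally show ?case using Cons by (simp del: add_mset.rep_eq count_add_mset)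
qed (simp add: Qweight_def)

lemma Qheight_word: "w \<in> lists I \<Longrightarrow> Qheight D (count (mset w)) = length w"
proof (induction w)
  case (Cons j w)
  have "Qheight D (count (mset (j # w))) =
      (\<Sum>i\<in>I. count (mset w) i + (if i = j then 1 else 0))"
    unfolding Qheight_def by (intro sum.cong) auto
  also have "\<dots> = Qheight D (count (mset w)) + 1"
    using Cons finite_I by (simp add: Qheight_def sum.distrib)
  finally show ?case using Cons by (simp del: add_mset.rep_eq count_add_mset)
qed (simp add: Qheight_def)

lemma pw_Nil [simp]: "pw i [] = 1"
  and pw_Cons [simp]: "pw i (j # w) = p i j * pw i w"
  and pw_append [simp]: "pw i (v @ w) = pw i v * pw i w"
  by (simp_all add: pairing_word_def)

lemma pw_rev [simp]: "pw i (rev w) = pw i w"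
  by (induction w) auto

lemma pw_qpow:
  "i \<in> I \<Longrightarrow> w \<in> lists I \<Longrightarrow> pw i w = (\<Prod>j\<leftarrow>w. qpow (sroot D j (tcoroot D i)))"
  by (induction w) (auto simp: qpow_sroot_tcoroot)

text \<open>Nondegeneracy of the inner product makes the description in \<open>flat\<close> unique;
  existence is settled by naming the functional.\<close>

lemma flatI:
  assumes "\<xi> \<in> dual_space D" "\<And>\<kappa>. \<kappa> \<in> dual_space D \<Longrightarrow> iprod D \<xi> \<kappa> = \<kappa> h"
  shows "flat D h = \<xi>"
  unfolding flat_def
proof (rule the_equality)
  fix \<mu> assume \<mu>: "\<mu> \<in> dual_space D \<and> (\<forall>\<kappa>\<in>dual_space D. iprod D \<mu> \<kappa> = \<kappa> h)"
  let ?d = "\<lambda>h. 1 * \<mu> h + (- 1) * \<xi> h"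
  have "?d \<in> dual_space D" using \<mu> assms by (intro dual_comb) auto
  moreover have "iprod D ?d \<kappa> = 0" if "\<kappa> \<in> dual_space D" for \<kappa>
  proof -
    have "iprod D ?d \<kappa> = 1 * iprod D \<mu> \<kappa> + (- 1) * iprod D \<xi> \<kappa>"
      using inner \<mu> assms(1) that unfolding inner_product_on_dual_def by blast
    then show ?thesis using \<mu> assms(2) that by simp
  qed
  ultimately have "?d = (\<lambda>h. 0)" using inner unfolding inner_product_on_dual_def by blast
  then show "\<mu> = \<xi>" by (auto simp: fun_eq_iff)
qed (use assms in auto)

lemma iprod_comb:
  "\<xi> \<in> dual_space D \<Longrightarrow> \<mu> \<in> dual_space D \<Longrightarrow> \<kappa> \<in> dual_space D \<Longrightarrow>
    iprod D (\<lambda>h. a * \<xi> h + b * \<mu> h) \<kappa> = a * iprod D \<xi> \<kappa> + b * iprod D \<mu> \<kappa>"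
  using inner unfolding inner_product_on_dual_def by blast

lemma iprod_sym: "\<xi> \<in> dual_space D \<Longrightarrow> \<mu> \<in> dual_space D \<Longrightarrow> iprod D \<xi> \<mu> = iprod D \<mu> \<xi>"
  using inner unfolding inner_product_on_dual_def by blast

lemma iprod_zero: "\<kappa> \<in> dual_space D \<Longrightarrow> iprod D (\<lambda>h. 0) \<kappa> = 0"
  using iprod_comb[OF zero_dual zero_dual, of \<kappa> 0 0] by simp

lemma flat_zero: "flat D 0 = (\<lambda>h. 0)"
  by (rule flatI) (simp_all add: zero_dual iprod_zero dual_zero)

lemma flat_tcoroot: "i \<in> I \<Longrightarrow> flat D (tcoroot D i) = sroot D i"
  by (rule flatI) (simp_all add: sroot_dual dual_tcoroot)

lemma minus_sroot_dual: "i \<in> I \<Longrightarrow> (\<lambda>h. - sroot D i h) \<in> dual_space D"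
  using dual_comb[OF sroot_dual zero_dual, of i "- 1" 0] by simp

lemma iprod_minus: "i \<in> I \<Longrightarrow> \<kappa> \<in> dual_space D \<Longrightarrow>
    iprod D (\<lambda>h. - sroot D i h) \<kappa> = - iprod D (sroot D i) \<kappa>"
  using iprod_comb[OF sroot_dual zero_dual, of i \<kappa> "- 1" 0] by simp

lemma flat_minus_tcoroot: "i \<in> I \<Longrightarrow> flat D (- tcoroot D i) = (\<lambda>h. - sroot D i h)"
  by (rule flatI) (simp_all add: minus_sroot_dual iprod_minus dual_minus dual_tcoroot)

text \<open>These are the exponents that the coproducts of generators produce: t_i comes from the
  side of the e_i, t_i^{-1} from that of the f_i.\<close>

lemma tform_values:
  "tform D 0 0 = 0"
  "i \<in> I \<Longrightarrow> tform D 0 (- tcoroot D i) = 0"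
  "i \<in> I \<Longrightarrow> tform D (tcoroot D i) 0 = 0"
  "i \<in> I \<Longrightarrow> j \<in> I \<Longrightarrow> tform D (tcoroot D i) (- tcoroot D j) = - iprod D (sroot D i) (sroot D j)"
  by (simp_all add: tform_def flat_zero flat_tcoroot flat_minus_tcoroot iprod_zero zero_dual
      minus_sroot_dual sroot_dual iprod_sym[of "sroot D i" "\<lambda>h. 0"]
      iprod_sym[of "sroot D i" "\<lambda>h. - sroot D j h"] iprod_minus ip_sym)

end

section \<open>Eigenspaces of the torus action as spans of words\<close>

section \<open>Monomials and weight spaces\<close>

locale torus_alg = cartan D + kalg A
  for D :: "('i, 't::ab_group_add) cartan_data" and A :: "'a kalgebra" (structure) +
  fixes Q :: "'t \<Rightarrow> 'a"
  assumes Q_closed [simp]: "h \<in> colat D \<Longrightarrow> Q h \<in> carrier A"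
    and Q_zero: "Q 0 = \<one>"
    and Q_add: "h \<in> colat D \<Longrightarrow> h' \<in> colat D \<Longrightarrow> Q (h + h') = Q h \<otimes> Q h'"
begin

lemma Q_minus: "h \<in> colat D \<Longrightarrow> Q h \<otimes> Q (- h) = \<one>" "h \<in> colat D \<Longrightarrow> Q (- h) \<otimes> Q h = \<one>"
  using Q_add[of h "- h"] Q_add[of "- h" h] by (simp_all add: Q_zero colat_minus)

lemma inv_Q: "h \<in> colat D \<Longrightarrow> inv Q h = Q (- h)"
  by (rule inv_unique'[symmetric]) (simp_all add: Q_minus colat_minus)

end

text \<open>The sign \<open>s\<close> is \<open>1\<close> for raising and \<open>- 1\<close> for lowering generators.\<close>

locale torus_gens = torus_alg D A Q
  for D :: "('i, 't::ab_group_add) cartan_data" and A :: "'a kalgebra" (structure) and Q +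
  fixes g :: "'i \<Rightarrow> 'a" and s :: rat
  assumes g_closed [simp]: "i \<in> inds D \<Longrightarrow> g i \<in> carrier A"
    and s_cases: "s = 1 \<or> s = - 1"
    and conj_g: "h \<in> colat D \<Longrightarrow> i \<in> inds D \<Longrightarrow>
      Q h \<otimes> g i \<otimes> Q (- h) = smul A (qpow (s * sroot D i h)) (g i)"
begin

lemma mon_g_closed [simp]: "w \<in> lists I \<Longrightarrow> mon A g w \<in> carrier A"
  by (induction w) auto

lemma mon_g_append: "v \<in> lists I \<Longrightarrow> w \<in> lists I \<Longrightarrow> mon A g (v @ w) = mon A g v \<otimes> mon A g w"
  by (rule mon_append) auto

lemma s_Ints: "r \<in> \<int> \<Longrightarrow> s * r \<in> \<int>"
  using s_cases by auto

lemma Q_g: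
  assumes "h \<in> colat D" "i \<in> I"
  shows "Q h \<otimes> g i = smul A (qpow (s * sroot D i h)) (g i \<otimes> Q h)"
proof -
  have "Q h \<otimes> g i = Q h \<otimes> g i \<otimes> (Q (- h) \<otimes> Q h)"
    using assms by (simp add: Q_minus)
  also have "\<dots> = Q h \<otimes> g i \<otimes> Q (- h) \<otimes> Q h"
    using assms by (simp add: m_assoc colat_minus)
  finally show ?thesis using assms by (simp add: conj_g smul_mult_left)
qed

lemma Q_mon:
  assumes "h \<in> colat D" "w \<in> lists I"
  shows "Q h \<otimes> mon A g w = smul A (\<Prod>j\<leftarrow>w. qpow (s * sroot D j h)) (mon A g w \<otimes> Q h)"
  using assms(2)
proof (induction w)
  case (Cons j w)
  let ?c = "qpow (s * sroot D j h)" and ?d = "\<Prod>j\<leftarrow>w. qpow (s * sroot D j h)"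
  have "Q h \<otimes> mon A g (j # w) = (Q h \<otimes> g j) \<otimes> mon A g w"
    using Cons assms by (simp add: m_assoc)
  also have "\<dots> = smul A ?c (g j \<otimes> (Q h \<otimes> mon A g w))"
    using Cons assms by (simp add: Q_g smul_mult_left m_assoc)
  also have "\<dots> = smul A (?c * ?d) (g j \<otimes> mon A g w \<otimes> Q h)"
    using Cons assms by (simp add: smul_mult_right m_assoc)
  finally show ?case by simp
qed (use assms in simp)

lemma weight_scalar:
  assumes "h \<in> colat D" "w \<in> lists I"
  shows "(\<Prod>j\<leftarrow>w. qpow (s * sroot D j h)) = qpow (s * Qweight D (count (mset w)) h)"
proof -
  have "(\<Prod>j\<leftarrow>w. qpow (s * sroot D j h)) = qpow (\<Sum>j\<leftarrow>w. s * sroot D j h)"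
    using assms by (subst qpow_sum_list) (auto intro!: s_Ints colat_Ints)
  then show ?thesis
    using assms by (simp add: Qweight_word sum_list_const_mult)
qed

lemma conj_mon:
  assumes "h \<in> colat D" "w \<in> lists I"
  shows "Q h \<otimes> mon A g w \<otimes> Q (- h) = smul A (qpow (s * Qweight D (count (mset w)) h)) (mon A g w)"
proof -
  have "Q h \<otimes> mon A g w \<otimes> Q (- h)
      = smul A (qpow (s * Qweight D (count (mset w)) h)) (mon A g w \<otimes> (Q h \<otimes> Q (- h)))"
    using assms by (simp add: Q_mon weight_scalar smul_mult_left m_assoc colat_minus)
  then show ?thesis using assms by (simp add: Q_minus)
qed

text \<open>A monomial is an eigenvector whose weight is read off its letters, and different weights
  are separated on the lattice; so an eigenvector in the subalgebra involves only words of its own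
  weight. Statements about weight spaces become inductions over words.\<close>

lemma weight_space_eq:
  assumes \<gamma>: "\<gamma> \<in> Qplus D"
  shows "{u \<in> subalg A (g ` I). \<forall>h\<in>colat D.
      Q h \<otimes> u \<otimes> Q (- h) = scal A (qpow (s * Qweight D \<gamma> h)) \<otimes> u} = lspan A (mon A g ` words D \<gamma>)"
    (is "?L = ?R")
proof
  have gI: "g ` I \<subseteq> carrier A" by auto
  show "?L \<subseteq> ?R"
  proof
    fix u assume u: "u \<in> ?L"
    then have u1: "u \<in> lspan A (mon A g ` lists I)"
      using subalg_eq_lspan[OF gI] by simp
    have "u \<in> lspan A (mon A g ` {w \<in> lists I. count (mset w) = \<gamma>})"
    proof (rule eigenvector_in_weight_span[where H = "colat D" and T = "\<lambda>h u. Q h \<otimes> u \<otimes> Q (- h)"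
          and \<chi> = "\<lambda>\<beta> h. qpow (s * Qweight D \<beta> h)"])
      fix w assume w: "w \<in> lists I" "count (mset w) \<noteq> \<gamma>"
      obtain h where h: "h \<in> colat D" "Qweight D (count (mset w)) h \<noteq> Qweight D \<gamma> h"
        using Qweight_separates[OF words_Qplus[OF w(1)] \<gamma> w(2)] .
      then have "qpow (s * Qweight D (count (mset w)) h) \<noteq> qpow (s * Qweight D \<gamma> h)"
        using s_cases by (subst qpow_inject) (auto intro!: s_Ints Qweight_Ints)
      then show "\<exists>h\<in>colat D. qpow (s * Qweight D (count (mset w)) h) \<noteq> qpow (s * Qweight D \<gamma> h)"
        using h by blast
    qed (use u u1 in \<open>auto simp: l_distr r_distr colat_minus smul_mult_left smul_mult_right
        conj_mon smul_def[symmetric]\<close>)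
    then show "u \<in> ?R" by (simp add: words_def)
  qed
  show "?R \<subseteq> ?L"
  proof
    fix u assume "u \<in> ?R"
    then show "u \<in> ?L"
    proof induction
      case zero
      then show ?case by (simp add: subalg_zero colat_minus)
    next
      case (step m u c)
      then obtain w where w: "w \<in> lists I" "count (mset w) = \<gamma>" "m = mon A g w"
        by (auto simp: words_def)
      have m: "m \<in> subalg A (g ` I)"
        unfolding w(3) using w(1) by (intro subalg_mon) (auto intro: subalg_incl)
      have u: "u \<in> carrier A" using step subalg_subset[OF gI] by auto
      have "Q h \<otimes> (smul A c m \<oplus> u) \<otimes> Q (- h)
          = scal A (qpow (s * Qweight D \<gamma> h)) \<otimes> (smul A c m \<oplus> u)" if h: "h \<in> colat D" for h
      proof -
        have "Q h \<otimes> (smul A c m \<oplus> u) \<otimes> Q (- h)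
            = smul A c (Q h \<otimes> m \<otimes> Q (- h)) \<oplus> Q h \<otimes> u \<otimes> Q (- h)"
          using h w u by (simp add: l_distr r_distr colat_minus smul_mult_left smul_mult_right)
        also have "\<dots> = scal A (qpow (s * Qweight D \<gamma> h)) \<otimes> (smul A c m \<oplus> u)"
          using h w u step conj_mon[OF h w(1)]
          by (simp add: smul_def[symmetric] smul_add mult.commute)
        finally show ?thesis .
      qed
      then show ?case using m step by (auto intro: subalg_add subalg_smul)
    qed
  qed
qed

end

section \<open>The defining relations of U and B inside the common torus framework\<close>

section \<open>Generators and relations of \<open>U\<close> and \<open>B\<close>\<close>

context presentation
begin

text \<open>Lets a property of all elements be checked on generators; for B this is how right
  multiplication is shown to be continuous.\<close>

lemma carrier_eq_subalg: "carrier PA = subalg PA ((\<lambda>g. pclass G R (letter g)) ` G)"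
  (is "_ = ?S")
proof
  have gc: "(\<lambda>g. pclass G R (letter g)) ` G \<subseteq> carrier PA"
    by (auto intro: pclass_closed free_alg_closed)
  show "?S \<subseteq> carrier PA" by (rule P.subalg_subset[OF gc])
  have monomial: "pclass G R (Poly_Mapping.single (Word w) c) \<in> ?S \<and>
      Poly_Mapping.single (Word w) c \<in> carrier (free_alg G)" if "set w \<subseteq> G" for w c
    using that
  proof (induction w)
    case Nil
    have "(Poly_Mapping.single (Word []) c :: 'g word \<Rightarrow>\<^sub>0 qfield) = kconst c" by (simp add: kconst_def zero_word_def)
    then show ?case by (simp add: pclass_kconst P.subalg_scal free_alg_closed)
  next
    case (Cons x w)
    have "Poly_Mapping.single (Word (x # w)) c = letter x * Poly_Mapping.single (Word w) c"
      by (simp add: letter_def mult_single plus_word_def)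
    then show ?case
      using Cons by (auto simp: pclass_mult free_alg_closed intro: P.subalg_mult P.subalg_incl)
  qed
  show "carrier PA \<subseteq> ?S"
  proof
    fix x assume "x \<in> carrier PA"
    then obtain p where p: "p \<in> carrier (free_alg G)" "x = pclass G R p"
      by (auto simp: presented_def pclass_def alg_quot_def FactRing_simps)
    then have "Poly_Mapping.keys p \<subseteq> {w. set (letters w) \<subseteq> G}" by (auto simp: free_alg_simps)
    then have "pclass G R p \<in> ?S \<and> p \<in> carrier (free_alg G)"
    proof (induction p rule: poly_mapping_single_induct)
      case zero
      then show ?case by (simp add: pclass_zero P.subalg_zero free_alg_closed)
    next
      case (single w c p)
      then show ?case
        using single monomial[of "letters w" c]
        by (cases w) (auto simp: pclass_add free_alg_closed intro: P.subalg_add)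
    qed
    then show "x \<in> ?S" using p by simp
  qed
qed

end

context cartan
begin

lemma letter_closed:
  "i \<in> I \<Longrightarrow> letter (Egen i) \<in> carrier (free_alg (gens D))"
  "i \<in> I \<Longrightarrow> letter (Fgen i) \<in> carrier (free_alg (gens D))"
  "h \<in> colat D \<Longrightarrow> letter (Qgen h) \<in> carrier (free_alg (gens D))"
  by (auto simp: gens_def intro: free_alg_closed)

lemma torus_rels_closed: "torus_rels D \<subseteq> carrier (free_alg (gens D))"
  unfolding torus_rels_def
  by (auto intro!: free_alg_closed(2,3,6,8) letter_closed colat_zero colat_add colat_minus)

lemma serre_rels_closed:
  assumes "\<And>i. i \<in> I \<Longrightarrow> letter (gen i) \<in> carrier (free_alg (gens D))"
  shows "serre_rels D gen \<subseteq> carrier (free_alg (gens D))"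
  unfolding serre_rels_def divpow_def Let_def
  by (auto intro!: free_alg_sum_closed free_alg_closed(2,3,6,7) free_alg_power_closed assms)

lemma boson_rels_closed: "boson_rels D \<subseteq> carrier (free_alg (gens D))"
  unfolding boson_rels_def
  using torus_rels_closed serre_rels_closed[of Egen] serre_rels_closed[of Fgen]
  by (auto simp: letter_closed intro!: free_alg_closed(1,2,3,6,8) letter_closed)

lemma qgroup_rels_closed: "qgroup_rels D \<subseteq> carrier (free_alg (gens D))"
  unfolding qgroup_rels_def
  using torus_rels_closed serre_rels_closed[of Egen] serre_rels_closed[of Fgen]
  by (auto simp: letter_closed intro!: free_alg_closed(1,2,3,6,8) letter_closed
      tcoroot_colat colat_minus)

abbreviation "eU i \<equiv> Ugen D (Egen i)"
abbreviation "fU i \<equiv> Ugen D (Fgen i)"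
abbreviation "QU h \<equiv> Ugen D (Qgen h)"
abbreviation "eB i \<equiv> Bgen D (Egen i)"
abbreviation "fB i \<equiv> Bgen D (Fgen i)"
abbreviation "QB h \<equiv> Bgen D (Qgen h)"

text \<open>U and B share the torus relations, so one argument gives both of them their algebra
  structure and their weight calculus for raising and lowering generators.\<close>

lemma torus_relations:
  assumes R: "torus_rels D \<subseteq> R" "R \<subseteq> carrier (free_alg (gens D))"
  defines "c \<equiv> pclass (gens D) R" and "A \<equiv> presented (gens D) R"
  shows "torus_gens D A (\<lambda>h. c (letter (Qgen h))) (\<lambda>i. c (letter (Egen i))) 1"
    and "torus_gens D A (\<lambda>h. c (letter (Qgen h))) (\<lambda>i. c (letter (Fgen i))) (- 1)"
proof -
  interpret presentation "gens D" R by unfold_locales (rule R)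
  interpret A: kalg A unfolding A_def by (rule P.kalg_axioms)
  note [simp] = letter_closed free_alg_closed colat_zero colat_add colat_minus
  have rel: "c p = c r" if "p - r \<in> torus_rels D" "p \<in> carrier (free_alg (gens D))"
    "r \<in> carrier (free_alg (gens D))" for p r
    unfolding c_def using that R by (intro pclass_eqI) auto
  have Q0: "c (letter (Qgen 0)) = \<one>\<^bsub>A\<^esub>"
    using rel[of "letter (Qgen 0)" 1] unfolding torus_rels_def by (simp add: c_def A_def pclass_one)
  have Qadd: "c (letter (Qgen (h + h'))) = c (letter (Qgen h)) \<otimes>\<^bsub>A\<^esub> c (letter (Qgen h'))"
    if "h \<in> colat D" "h' \<in> colat D" for h h'
  proof -
    have "c (letter (Qgen (h + h'))) = c (letter (Qgen h) * letter (Qgen h'))"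
      using that by (intro rel) (auto simp: torus_rels_def)
    then show ?thesis using that by (simp add: c_def A_def pclass_mult)
  qed
  have E: "c (letter (Qgen h)) \<otimes>\<^bsub>A\<^esub> c (letter (Egen i)) \<otimes>\<^bsub>A\<^esub> c (letter (Qgen (- h)))
      = smul A (qpow (sroot D i h)) (c (letter (Egen i)))" if "h \<in> colat D" "i \<in> I" for h i
  proof -
    have "c (letter (Qgen h) * letter (Egen i) * letter (Qgen (- h)))
        = c (kconst (qpow (sroot D i h)) * letter (Egen i))"
      using that by (intro rel) (auto simp: torus_rels_def)
    then show ?thesis using that by (simp add: c_def A_def pclass_mult pclass_kconst smul_def)
  qed
  have F: "c (letter (Qgen h)) \<otimes>\<^bsub>A\<^esub> c (letter (Fgen i)) \<otimes>\<^bsub>A\<^esub> c (letter (Qgen (- h)))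
      = smul A (qpow (- sroot D i h)) (c (letter (Fgen i)))" if "h \<in> colat D" "i \<in> I" for h i
  proof -
    have "c (letter (Qgen h) * letter (Fgen i) * letter (Qgen (- h)))
        = c (kconst (qpow (- sroot D i h)) * letter (Fgen i))"
      using that by (intro rel) (auto simp: torus_rels_def)
    then show ?thesis using that by (simp add: c_def A_def pclass_mult pclass_kconst smul_def)
  qed
  have cl: "c p \<in> carrier A" if "p \<in> carrier (free_alg (gens D))" for p
    using that by (simp add: c_def A_def pclass_closed)
  show "torus_gens D A (\<lambda>h. c (letter (Qgen h))) (\<lambda>i. c (letter (Egen i))) 1"
    by unfold_locales (use Q0 Qadd E in \<open>auto intro: cl\<close>)
  show "torus_gens D A (\<lambda>h. c (letter (Qgen h))) (\<lambda>i. c (letter (Fgen i))) (- 1)"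
    by unfold_locales (use Q0 Qadd F in \<open>auto intro: cl\<close>)
qed

lemma torus_rels_subset: "torus_rels D \<subseteq> qgroup_rels D" "torus_rels D \<subseteq> boson_rels D"
  by (auto simp: qgroup_rels_def boson_rels_def)

sublocale U: kalg "Uq D"
  using torus_relations(1)[OF torus_rels_subset(1) qgroup_rels_closed]
  by (simp add: Uq_def torus_gens_def torus_alg_def)

sublocale B: kalg "Bq D"
  using torus_relations(1)[OF torus_rels_subset(2) boson_rels_closed]
  by (simp add: Bq_def torus_gens_def torus_alg_def)

sublocale Ue: torus_gens D "Uq D" QU eU 1
  using torus_relations(1)[OF torus_rels_subset(1) qgroup_rels_closed]
  by (simp add: Uq_def Ugen_def)

sublocale Uf: torus_gens D "Uq D" QU fU "- 1"
  using torus_relations(2)[OF torus_rels_subset(1) qgroup_rels_closed]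
  by (simp add: Uq_def Ugen_def)

sublocale Be: torus_gens D "Bq D" QB eB 1
  using torus_relations(1)[OF torus_rels_subset(2) boson_rels_closed]
  by (simp add: Bq_def Bgen_def)

sublocale Bf: torus_gens D "Bq D" QB fB "- 1"
  using torus_relations(2)[OF torus_rels_subset(2) boson_rels_closed]
  by (simp add: Bq_def Bgen_def)


lemma B_generated: "carrier (Bq D) = subalg (Bq D) (Bgen D ` gens D)"
proof -
  interpret presentation "gens D" "boson_rels D" by unfold_locales (rule boson_rels_closed)
  show ?thesis using carrier_eq_subalg by (simp add: Bq_def Bgen_def[abs_def])
qed

lemma boson_relation:
  assumes "i \<in> I" "j \<in> I"
  shows "eB i \<otimes>\<^bsub>Bq D\<^esub> fB j = smul (Bq D) (p i j) (fB j \<otimes>\<^bsub>Bq D\<^esub> eB i)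
      \<oplus>\<^bsub>Bq D\<^esub> (if i = j then \<one>\<^bsub>Bq D\<^esub> else \<zero>\<^bsub>Bq D\<^esub>)"
proof -
  interpret presentation "gens D" "boson_rels D" by unfold_locales (rule boson_rels_closed)
  note [simp] = letter_closed free_alg_closed
  let ?c = "pclass (gens D) (boson_rels D)"
  let ?d = "if i = j then 1 else 0 :: ('i, 't) ncpoly"
  have "?c (letter (Egen i) * letter (Fgen j))
      = ?c (kconst (p i j) * (letter (Fgen j) * letter (Egen i)) + ?d)"
  proof (rule pclass_eqI)
    have "letter (Egen i) * letter (Fgen j)
        - (kconst (p i j) * (letter (Fgen j) * letter (Egen i)) + ?d)
      = letter (Egen i) * letter (Fgen j)
        - kconst (qi D i powi \<lfloor>sroot D j (coroot D i)\<rfloor>) * letter (Fgen j) * letter (Egen i) - ?d"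
      using assms by (simp add: qi_powi mult.assoc)
    then show "letter (Egen i) * letter (Fgen j)
        - (kconst (p i j) * (letter (Fgen j) * letter (Egen i)) + ?d) \<in> boson_rels D"
      using assms unfolding boson_rels_def by blast
  qed (use assms in auto)
  also have "\<dots> = ?c (kconst (p i j) * (letter (Fgen j) * letter (Egen i))) \<oplus>\<^bsub>Bq D\<^esub> ?c ?d"
    using assms by (subst pclass_add) (auto simp: Bq_def)
  also have "?c ?d = (if i = j then \<one>\<^bsub>Bq D\<^esub> else \<zero>\<^bsub>Bq D\<^esub>)"
    by (simp add: pclass_one pclass_zero Bq_def)
  finally show ?thesis
    using assms by (simp add: Bgen_def Bq_def pclass_mult pclass_kconst smul_def)
qed

lemma Uplus_wt_eq: "\<beta> \<in> Qplus D \<Longrightarrow> Uplus_wt D \<beta> = lspan (Uq D) (mon (Uq D) eU ` words D \<beta>)"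
  using Ue.weight_space_eq[of \<beta>] by (simp add: Uplus_wt_def Uplus_def image_image)

lemma Uminus_wt_eq: "\<beta> \<in> Qplus D \<Longrightarrow> Uminus_wt D \<beta> = lspan (Uq D) (mon (Uq D) fU ` words D \<beta>)"
  using Uf.weight_space_eq[of \<beta>] by (simp add: Uminus_wt_def Uminus_def image_image)

lemma Bplus_wt_eq: "\<beta> \<in> Qplus D \<Longrightarrow> Bplus_wt D \<beta> = lspan (Bq D) (mon (Bq D) eB ` words D \<beta>)"
  using Be.weight_space_eq[of \<beta>] by (simp add: Bplus_wt_def Bplus_def image_image)

end

section \<open>Coproducts of words and the two adjoint derivations\<close>

section \<open>The Drinfeld--Killing form on monomials\<close>

declare in_listsD [rule del] in_listsI [rule del]

text \<open>
  The twisted derivations adjoint to multiplication by a generator: \<open>deriv_right\<close> is adjoint to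
  right multiplication by \<open>e\<^sub>i\<close>, and \<open>deriv_left\<close> to left multiplication by \<open>f\<^sub>i\<close>. They
  are linear combinations of words, given as lists of coefficients and words.
\<close>

primrec deriv_right :: "('i, 't) cartan_data \<Rightarrow> 'i \<Rightarrow> 'i list \<Rightarrow> (qfield \<times> 'i list) list"
  where
    "deriv_right D i [] = []"
  | "deriv_right D i (j # w) = (if j = i then [(pairing_word D i w, w)] else [])
      @ map (\<lambda>(c, v). (c, j # v)) (deriv_right D i w)"

primrec deriv_left :: "('i, 't) cartan_data \<Rightarrow> 'i \<Rightarrow> 'i list \<Rightarrow> (qfield \<times> 'i list) list"
  where
    "deriv_left D i [] = []"
  | "deriv_left D i (j # w) = (if j = i then [(1, w)] else [])
      @ map (\<lambda>(c, v). (pairing D i j * c, j # v)) (deriv_left D i w)"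

text \<open>Both the value <e_i, f_i> of the form and the scalar with which \<phi> sends e_i to
  e''_i.\<close>

definition ef_const :: "('i, 't) cartan_data \<Rightarrow> 'i \<Rightarrow> qfield"
  where "ef_const D i = 1 / (inverse (qi D i) - qi D i)"

text \<open>
  The coproducts of monomials as lists of elementary tensors; the first factor of
  \<open>\<Delta>(f\<^sub>w)\<close> and the second factor of \<open>\<Delta>(e\<^sub>w)\<close> involve no torus elements and are
  kept as words.
\<close>

primrec cop_f :: "('i, 't::ab_group_add) cartan_data \<Rightarrow> 'i list \<Rightarrow> ('i list \<times> ('i, 't) ncpoly set) list"
  where
    "cop_f D [] = [([], \<one>\<^bsub>Uq D\<^esub>)]"
  | "cop_f D (j # w) =
      map (\<lambda>(a, b). (j # a, Ugen D (Qgen (- tcoroot D j)) \<otimes>\<^bsub>Uq D\<^esub> b)) (cop_f D w)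
      @ map (\<lambda>(a, b). (a, Ugen D (Fgen j) \<otimes>\<^bsub>Uq D\<^esub> b)) (cop_f D w)"

primrec cop_e :: "('i, 't::ab_group_add) cartan_data \<Rightarrow> 'i list \<Rightarrow> (('i, 't) ncpoly set \<times> 'i list) list"
  where
    "cop_e D [] = [(\<one>\<^bsub>Uq D\<^esub>, [])]"
  | "cop_e D (j # w) =
      map (\<lambda>(a, b). (Ugen D (Egen j) \<otimes>\<^bsub>Uq D\<^esub> a, b)) (cop_e D w)
      @ map (\<lambda>(a, b). (Ugen D (Qgen (tcoroot D j)) \<otimes>\<^bsub>Uq D\<^esub> a, j # b)) (cop_e D w)"

lemma sum_list_map_cong: "(\<And>x. x \<in> set L \<Longrightarrow> f x = g x) \<Longrightarrow> (\<Sum>x\<leftarrow>L. f x) = (\<Sum>x\<leftarrow>L. g x)"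
  by (metis map_cong)

context cartan
begin

lemma deriv_right_closed: "w \<in> lists I \<Longrightarrow> (c, v) \<in> set (deriv_right D i w) \<Longrightarrow> v \<in> lists I"
  by (induction w arbitrary: c v) (auto split: if_splits)

lemma deriv_left_closed: "w \<in> lists I \<Longrightarrow> (c, v) \<in> set (deriv_left D i w) \<Longrightarrow> v \<in> lists I"
  by (induction w arbitrary: c v) (auto split: if_splits)

end

locale killing_form = cartan D for D :: "('i, 't::ab_group_add) cartan_data" +
  fixes \<Delta> :: "('i, 't) ncpoly set \<Rightarrow>
      (('i, 't) ncpoly set \<times> ('i, 't) ncpoly set \<Rightarrow>\<^sub>0 qfield) set"
    and \<rho> :: "rat \<Rightarrow> qfield alg_closure"
    and \<omega> :: "('i, 't) ncpoly set \<Rightarrow> ('i, 't) ncpoly set \<Rightarrow> qfield alg_closure"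
  assumes cop: "is_coproduct D \<Delta>" and rho: "rational_powers \<rho>" and form: "DK_form D \<Delta> \<rho> \<omega>"
begin

sublocale T: kalg_pair "Uq D" "Uq D" ..

abbreviation "MU \<equiv> mon (Uq D) eU"
abbreviation "NU \<equiv> mon (Uq D) fU"
abbreviation mU (infixl "\<cdot>" 70) where "x \<cdot> y \<equiv> x \<otimes>\<^bsub>Uq D\<^esub> y"

lemma eU_closed [simp]: "i \<in> I \<Longrightarrow> eU i \<in> carrier (Uq D)"
  and fU_closed [simp]: "i \<in> I \<Longrightarrow> fU i \<in> carrier (Uq D)"
  and QU_closed [simp]: "h \<in> colat D \<Longrightarrow> QU h \<in> carrier (Uq D)"
  by (simp_all add: Ue.g_closed Uf.g_closed Ue.Q_closed)

lemma tc [simp]: "i \<in> I \<Longrightarrow> tcoroot D i \<in> colat D" "i \<in> I \<Longrightarrow> - tcoroot D i \<in> colat D"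
  by (simp_all add: tcoroot_colat colat_minus)

lemma QU_torus: "h \<in> colat D \<Longrightarrow> QU h \<in> Utorus D"
  unfolding Utorus_def by (rule U.subalg_incl) auto

lemma Uge_eqs: "Uplus D \<subseteq> Uge D" "Utorus D \<subseteq> Uge D" "Uge D \<subseteq> carrier (Uq D)"
proof -
  have "Utorus D \<subseteq> carrier (Uq D)" "Uplus D \<subseteq> carrier (Uq D)"
    unfolding Utorus_def Uplus_def by (rule U.subalg_subset; force)+
  then show "Uplus D \<subseteq> Uge D" "Utorus D \<subseteq> Uge D" "Uge D \<subseteq> carrier (Uq D)"
    unfolding Uge_def using U.subalg_subset[of "Uplus D \<union> Utorus D"] U.subalg_incl by auto
qed

lemma Ule_eqs: "Uminus D \<subseteq> Ule D" "Utorus D \<subseteq> Ule D" "Ule D \<subseteq> carrier (Uq D)"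
proof -
  have "Utorus D \<subseteq> carrier (Uq D)" "Uminus D \<subseteq> carrier (Uq D)"
    unfolding Utorus_def Uminus_def by (rule U.subalg_subset; force)+
  then show "Uminus D \<subseteq> Ule D" "Utorus D \<subseteq> Ule D" "Ule D \<subseteq> carrier (Uq D)"
    unfolding Ule_def using U.subalg_subset[of "Uminus D \<union> Utorus D"] U.subalg_incl by auto
qed

lemma Uge_mult: "x \<in> Uge D \<Longrightarrow> y \<in> Uge D \<Longrightarrow> x \<cdot> y \<in> Uge D"
  and Ule_mult: "x \<in> Ule D \<Longrightarrow> y \<in> Ule D \<Longrightarrow> x \<cdot> y \<in> Ule D"
  and one_Uge: "\<one>\<^bsub>Uq D\<^esub> \<in> Uge D" and one_Ule: "\<one>\<^bsub>Uq D\<^esub> \<in> Ule D"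
  unfolding Uge_def Ule_def by (simp_all add: U.subalg_mult U.subalg_one)

lemma eU_Uplus: "i \<in> I \<Longrightarrow> eU i \<in> Uplus D" and fU_Uminus: "i \<in> I \<Longrightarrow> fU i \<in> Uminus D"
  unfolding Uplus_def Uminus_def by (simp_all add: U.subalg_incl)

lemma eU_Uge: "i \<in> I \<Longrightarrow> eU i \<in> Uge D" and QU_Uge: "h \<in> colat D \<Longrightarrow> QU h \<in> Uge D"
  and fU_Ule: "i \<in> I \<Longrightarrow> fU i \<in> Ule D" and QU_Ule: "h \<in> colat D \<Longrightarrow> QU h \<in> Ule D"
  by (meson subsetD Uge_eqs Ule_eqs QU_torus eU_Uplus fU_Uminus)+

lemma MU_Uplus: "w \<in> lists I \<Longrightarrow> MU w \<in> Uplus D"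
  using eU_Uplus unfolding Uplus_def by (intro U.subalg_mon) (simp add: in_lists_conv_set)

lemma NU_Uminus: "w \<in> lists I \<Longrightarrow> NU w \<in> Uminus D"
  using fU_Uminus unfolding Uminus_def by (intro U.subalg_mon) (simp add: in_lists_conv_set)

lemma MU_Uge: "w \<in> lists I \<Longrightarrow> MU w \<in> Uge D"
  by (rule subsetD[OF Uge_eqs(1) MU_Uplus])

lemma NU_Ule: "w \<in> lists I \<Longrightarrow> NU w \<in> Ule D"
  by (rule subsetD[OF Ule_eqs(1) NU_Uminus])

lemma Uplus_eq: "Uplus D = lspan (Uq D) (MU ` lists I)"
  unfolding Uplus_def using U.subalg_eq_lspan[of eU I] by (simp add: image_image image_subset_iff)

lemma Uminus_eq: "Uminus D = lspan (Uq D) (NU ` lists I)"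
  unfolding Uminus_def using U.subalg_eq_lspan[of fU I] by (simp add: image_image image_subset_iff)

lemma rho_0: "\<rho> 0 = 1"
proof -
  have "\<rho> 0 * \<rho> 1 = \<rho> 1" "\<rho> 1 \<noteq> 0"
    using rho unfolding rational_powers_def by (metis add_0, simp add: qv_nonzero)
  then show ?thesis by simp
qed

text \<open>Additivity and the value at 1 force the values at integers, whatever roots of q were
  chosen elsewhere; every exponent evaluated below is an integer.\<close>

lemma rho_Ints: "r \<in> \<int> \<Longrightarrow> \<rho> r = to_ac (qpow r)"
proof -
  have nat: "\<rho> (of_nat n) = to_ac (qv ^ n)" for n
    using rho rho_0 unfolding rational_powers_def by (induction n) auto
  have neg: "\<rho> (- of_nat n) = to_ac (inverse (qv ^ n))" for n
  proof -
    have "\<rho> (- of_nat n) * \<rho> (of_nat n) = 1"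
      using rho rho_0 unfolding rational_powers_def by (metis add.left_inverse)
    then show ?thesis by (simp add: nat qv_nonzero field_simps)
  qed
  assume "r \<in> \<int>"
  then obtain k where k: "r = of_int k" by (auto elim: Ints_cases)
  show ?thesis
  proof (cases "k \<ge> 0")
    case True
    then show ?thesis using nat[of "nat k"] k by (simp add: qpow_def power_int_def)
  next
    case False
    then show ?thesis using neg[of "nat (- k)"] k by (simp add: qpow_def power_int_def power_inverse)
  qed
qed

lemma \<omega>_add_left: "x \<in> Uge D \<Longrightarrow> x' \<in> Uge D \<Longrightarrow> y \<in> Ule D \<Longrightarrow> \<omega> (x \<oplus>\<^bsub>Uq D\<^esub> x') y = \<omega> x y + \<omega> x' y"
  and \<omega>_add_right: "x \<in> Uge D \<Longrightarrow> y \<in> Ule D \<Longrightarrow> y' \<in> Ule D \<Longrightarrow> \<omega> x (y \<oplus>\<^bsub>Uq D\<^esub> y') = \<omega> x y + \<omega> x y'"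
  and \<omega>_smul_left: "x \<in> Uge D \<Longrightarrow> y \<in> Ule D \<Longrightarrow> \<omega> (smul (Uq D) c x) y = to_ac c * \<omega> x y"
  and \<omega>_smul_right: "x \<in> Uge D \<Longrightarrow> y \<in> Ule D \<Longrightarrow> \<omega> x (smul (Uq D) c y) = to_ac c * \<omega> x y"
  using form unfolding DK_form_def smul_def by simp_all

lemma \<omega>_mult_right:
  "x \<in> Uge D \<Longrightarrow> y1 \<in> Ule D \<Longrightarrow> y2 \<in> Ule D \<Longrightarrow> set ts \<subseteq> Uge D \<times> Uge D \<Longrightarrow>
    \<Delta> x = tens_sum (Uq D) (Uq D) ts \<Longrightarrow> \<omega> x (y1 \<cdot> y2) = (\<Sum>(a, b)\<leftarrow>ts. \<omega> a y1 * \<omega> b y2)"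
  using form unfolding DK_form_def by blast

lemma \<omega>_mult_left:
  "x1 \<in> Uge D \<Longrightarrow> x2 \<in> Uge D \<Longrightarrow> y \<in> Ule D \<Longrightarrow> set ts \<subseteq> Ule D \<times> Ule D \<Longrightarrow>
    \<Delta> y = tens_sum (Uq D) (Uq D) ts \<Longrightarrow> \<omega> (x1 \<cdot> x2) y = (\<Sum>(a, b)\<leftarrow>ts. \<omega> x2 a * \<omega> x1 b)"
  using form unfolding DK_form_def by blast

lemma \<omega>_QQ: "h \<in> colat D \<Longrightarrow> h' \<in> colat D \<Longrightarrow> \<omega> (QU h) (QU h') = \<rho> (- tform D h h')"
  and \<omega>_Qf: "h \<in> colat D \<Longrightarrow> i \<in> I \<Longrightarrow> \<omega> (QU h) (fU i) = 0"
  and \<omega>_eQ: "h \<in> colat D \<Longrightarrow> i \<in> I \<Longrightarrow> \<omega> (eU i) (QU h) = 0"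
  and \<omega>_ef: "i \<in> I \<Longrightarrow> j \<in> I \<Longrightarrow> \<omega> (eU i) (fU j) = (if i = j then to_ac (ef_const D i) else 0)"
  using form QU_torus[of h] unfolding DK_form_def ef_const_def by simp_all

lemma QU_0: "QU 0 = \<one>\<^bsub>Uq D\<^esub>"
  by (rule Ue.Q_zero)

lemma \<omega>_1: "\<omega> \<one>\<^bsub>Uq D\<^esub> \<one>\<^bsub>Uq D\<^esub> = 1"
  "i \<in> I \<Longrightarrow> \<omega> \<one>\<^bsub>Uq D\<^esub> (QU (- tcoroot D i)) = 1"
  "i \<in> I \<Longrightarrow> \<omega> (QU (tcoroot D i)) \<one>\<^bsub>Uq D\<^esub> = 1"
  "i \<in> I \<Longrightarrow> \<omega> \<one>\<^bsub>Uq D\<^esub> (fU i) = 0"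
  "i \<in> I \<Longrightarrow> \<omega> (eU i) \<one>\<^bsub>Uq D\<^esub> = 0"
  using \<omega>_QQ[of 0 0] \<omega>_QQ[of 0 "- tcoroot D i"] \<omega>_QQ[of "tcoroot D i" 0] \<omega>_Qf[of 0 i] \<omega>_eQ[of 0 i]
  by (auto simp: QU_0 tform_values rho_0 colat_zero)

lemma \<omega>_QQ_roots: "i \<in> I \<Longrightarrow> j \<in> I \<Longrightarrow> \<omega> (QU (tcoroot D i)) (QU (- tcoroot D j)) = to_ac (p i j)"
  by (simp add: \<omega>_QQ tform_values rho_Ints ip_Ints pairing_def)

lemma \<Delta>_mult: "x \<in> carrier (Uq D) \<Longrightarrow> y \<in> carrier (Uq D) \<Longrightarrow> \<Delta> (x \<cdot> y) = \<Delta> x \<otimes>\<^bsub>T.TA\<^esub> \<Delta> y"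
  using cop unfolding is_coproduct_def alg_hom_def ring_hom_def by auto

lemma \<Delta>_one: "\<Delta> \<one>\<^bsub>Uq D\<^esub> = tens_sum (Uq D) (Uq D) [(\<one>\<^bsub>Uq D\<^esub>, \<one>\<^bsub>Uq D\<^esub>)]"
  using cop T.tens_closed[of "\<one>\<^bsub>Uq D\<^esub>" "\<one>\<^bsub>Uq D\<^esub>"] T.tens_one
  unfolding is_coproduct_def alg_hom_def ring_hom_def by simp

lemma \<Delta>_Q: "h \<in> colat D \<Longrightarrow> \<Delta> (QU h) = tens_sum (Uq D) (Uq D) [(QU h, QU h)]"
  using cop T.tens_closed[of "QU h" "QU h"] unfolding is_coproduct_def by simp

lemma \<Delta>_e: "i \<in> I \<Longrightarrow> \<Delta> (eU i) = tens (Uq D) (Uq D) (eU i) \<one>\<^bsub>Uq D\<^esub>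
    \<oplus>\<^bsub>T.TA\<^esub> tens (Uq D) (Uq D) (QU (tcoroot D i)) (eU i)"
  and \<Delta>_f: "i \<in> I \<Longrightarrow> \<Delta> (fU i) = tens (Uq D) (Uq D) (fU i) (QU (- tcoroot D i))
    \<oplus>\<^bsub>T.TA\<^esub> tens (Uq D) (Uq D) \<one>\<^bsub>Uq D\<^esub> (fU i)"
  using cop unfolding is_coproduct_def by blast+

lemma \<Delta>_f_list: "i \<in> I \<Longrightarrow> \<Delta> (fU i) = tens_sum (Uq D) (Uq D) [(fU i, QU (- tcoroot D i)), (\<one>\<^bsub>Uq D\<^esub>, fU i)]"
  using T.tens_closed[of "\<one>\<^bsub>Uq D\<^esub>" "fU i"] by (simp add: \<Delta>_f)

lemma \<Delta>_e_list: "i \<in> I \<Longrightarrow> \<Delta> (eU i) = tens_sum (Uq D) (Uq D) [(eU i, \<one>\<^bsub>Uq D\<^esub>), (QU (tcoroot D i), eU i)]"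
  using T.tens_closed[of "QU (tcoroot D i)" "eU i"] by (simp add: \<Delta>_e)

lemma cop_f_closed: "w \<in> lists I \<Longrightarrow> (a, b) \<in> set (cop_f D w) \<Longrightarrow> a \<in> lists I \<and> b \<in> Ule D"
proof (induction w arbitrary: a b)
  case (Cons j w)
  then have j: "j \<in> I" and w: "w \<in> lists I" by simp_all
  from Cons.prems(2) consider a' b' where "(a', b') \<in> set (cop_f D w)" "a = j # a'" "b = QU (- tcoroot D j) \<cdot> b'"
    | b' where "(a, b') \<in> set (cop_f D w)" "b = fU j \<cdot> b'"
    by auto
  then show ?case
    using Cons.IH[OF w] j by cases (simp_all add: Ule_mult fU_Ule QU_Ule)
qed (simp add: one_Ule)

lemma cop_e_closed: "w \<in> lists I \<Longrightarrow> (a, b) \<in> set (cop_e D w) \<Longrightarrow> a \<in> Uge D \<and> b \<in> lists I"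
proof (induction w arbitrary: a b)
  case (Cons j w)
  then have j: "j \<in> I" and w: "w \<in> lists I" by simp_all
  from Cons.prems(2) consider a' where "(a', b) \<in> set (cop_e D w)" "a = eU j \<cdot> a'"
    | a' b' where "(a', b') \<in> set (cop_e D w)" "a = QU (tcoroot D j) \<cdot> a'" "b = j # b'"
    by auto
  then show ?case
    using Cons.IH[OF w] j by cases (simp_all add: Uge_mult eU_Uge QU_Uge)
qed (simp add: one_Uge)

lemma cop_f_closed2: "w \<in> lists I \<Longrightarrow> set (map (\<lambda>(a, b). (NU a, b)) (cop_f D w)) \<subseteq> Ule D \<times> Ule D"
  using cop_f_closed[of w] NU_Ule by auto

lemma cop_e_closed2: "w \<in> lists I \<Longrightarrow> set (map (\<lambda>(a, b). (a, MU b)) (cop_e D w)) \<subseteq> Uge D \<times> Uge D"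
  using cop_e_closed[of w] MU_Uge by auto

lemma \<Delta>_NU: "w \<in> lists I \<Longrightarrow> \<Delta> (NU w) = tens_sum (Uq D) (Uq D) (map (\<lambda>(a, b). (NU a, b)) (cop_f D w))"
proof (induction w)
  case Nil
  then show ?case by (simp add: \<Delta>_one)
next
  case (Cons j w)
  then have j: "j \<in> I" by simp
  let ?ts = "map (\<lambda>(a, b). (NU a, b)) (cop_f D w)"
  have ts: "set ?ts \<subseteq> carrier (Uq D) \<times> carrier (Uq D)"
    using cop_f_closed2[of w] Cons.prems Ule_eqs(3) by auto
  have "\<Delta> (NU (j # w)) = \<Delta> (fU j) \<otimes>\<^bsub>T.TA\<^esub> tens_sum (Uq D) (Uq D) ?ts"
    using Cons by (simp add: \<Delta>_mult)
  also have "\<dots> = tens_sum (Uq D) (Uq D)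
      (map (\<lambda>(x, y). (fU j \<cdot> x, QU (- tcoroot D j) \<cdot> y)) ?ts
        @ map (\<lambda>(x, y). (\<one>\<^bsub>Uq D\<^esub> \<cdot> x, fU j \<cdot> y)) ?ts)"
    unfolding \<Delta>_f[OF j] by (rule T.tens_two_mult_sum[OF ts]) (use j in simp_all)
  also have "map (\<lambda>(x, y). (fU j \<cdot> x, QU (- tcoroot D j) \<cdot> y)) ?ts
        @ map (\<lambda>(x, y). (\<one>\<^bsub>Uq D\<^esub> \<cdot> x, fU j \<cdot> y)) ?ts = map (\<lambda>(a, b). (NU a, b)) (cop_f D (j # w))"
    using ts by (auto simp: image_subset_iff)
  finally show ?case .
qed

lemma \<Delta>_MU: "w \<in> lists I \<Longrightarrow> \<Delta> (MU w) = tens_sum (Uq D) (Uq D) (map (\<lambda>(a, b). (a, MU b)) (cop_e D w))"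
proof (induction w)
  case Nil
  then show ?case by (simp add: \<Delta>_one)
next
  case (Cons j w)
  then have j: "j \<in> I" by simp
  let ?ts = "map (\<lambda>(a, b). (a, MU b)) (cop_e D w)"
  have ts: "set ?ts \<subseteq> carrier (Uq D) \<times> carrier (Uq D)"
    using cop_e_closed2[of w] Cons.prems Uge_eqs(3) by auto
  have "\<Delta> (MU (j # w)) = \<Delta> (eU j) \<otimes>\<^bsub>T.TA\<^esub> tens_sum (Uq D) (Uq D) ?ts"
    using Cons by (simp add: \<Delta>_mult)
  also have "\<dots> = tens_sum (Uq D) (Uq D)
      (map (\<lambda>(x, y). (eU j \<cdot> x, \<one>\<^bsub>Uq D\<^esub> \<cdot> y)) ?ts
        @ map (\<lambda>(x, y). (QU (tcoroot D j) \<cdot> x, eU j \<cdot> y)) ?ts)"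
    unfolding \<Delta>_e[OF j] by (rule T.tens_two_mult_sum[OF ts]) (use j in simp_all)
  also have "map (\<lambda>(x, y). (eU j \<cdot> x, \<one>\<^bsub>Uq D\<^esub> \<cdot> y)) ?ts
        @ map (\<lambda>(x, y). (QU (tcoroot D j) \<cdot> x, eU j \<cdot> y)) ?ts = map (\<lambda>(a, b). (a, MU b)) (cop_e D (j # w))"
    using ts by (auto simp: image_subset_iff)
  finally show ?case .
qed

text \<open>Of the two branches for a letter one lengthens the word in the second factor. The word
  stays empty only if every letter takes the other branch, and then the first factor is the whole
  monomial.\<close>

lemma cop_e_counit:
  "w \<in> lists I \<Longrightarrow> (\<Sum>(a, b)\<leftarrow>cop_e D w. if b = [] then g a else 0) = (g (MU w) :: qfield alg_closure)"
proof (induction w arbitrary: g)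
  case (Cons j w)
  then show ?case using Cons.IH[of "\<lambda>a. g (eU j \<cdot> a)"]
    by (simp add: o_def case_prod_unfold cong: if_cong)
qed simp

lemma cop_f_counit:
  "w \<in> lists I \<Longrightarrow> (\<Sum>(a, b)\<leftarrow>cop_f D w. if a = [] then g b else 0) = (g (NU w) :: qfield alg_closure)"
proof (induction w arbitrary: g)
  case (Cons j w)
  then show ?case using Cons.IH[of "\<lambda>b. g (fU j \<cdot> b)"]
    by (simp add: o_def case_prod_unfold cong: if_cong)
qed simp

lemma \<omega>_MU_Q:
  assumes "w \<in> lists I" "i \<in> I"
  shows "\<omega> (MU w) (QU (- tcoroot D i)) = (if w = [] then 1 else 0)"
proof (cases w)
  case Nil
  then show ?thesis using assms by (simp add: \<omega>_1)
next
  case (Cons j v)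
  then show ?thesis
    using assms \<omega>_mult_left[OF eU_Uge MU_Uge QU_Ule _ \<Delta>_Q, of j v "- tcoroot D i"]
    by (simp add: \<omega>_eQ QU_Ule)
qed

text \<open>The second factors of \<Delta>(e_w) are words of e's without torus elements; such a word
  pairs with t_i^{-1} to zero unless it is empty, so only the term with first factor e_w
  survives.\<close>

lemma \<omega>_MU_right_torus:
  assumes "w \<in> lists I" "i \<in> I" "y \<in> Ule D"
  shows "\<omega> (MU w) (y \<cdot> QU (- tcoroot D i)) = \<omega> (MU w) y"
proof -
  have "\<omega> (MU w) (y \<cdot> QU (- tcoroot D i)) = (\<Sum>(a, b)\<leftarrow>cop_e D w. \<omega> a y * \<omega> (MU b) (QU (- tcoroot D i)))"
    using assms \<omega>_mult_right[OF MU_Uge _ QU_Ule cop_e_closed2 \<Delta>_MU, of w y "- tcoroot D i"]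
    by (simp add: o_def case_prod_unfold)
  also have "\<dots> = (\<Sum>(a, b)\<leftarrow>cop_e D w. if b = [] then \<omega> a y else 0)"
    using cop_e_closed[OF assms(1)] assms by (intro sum_list_map_cong) (auto simp: \<omega>_MU_Q)
  finally show ?thesis using assms by (simp add: cop_e_counit)
qed

lemma \<omega>_Uplus_right_torus:
  assumes "x \<in> Uplus D" "i \<in> I" "y \<in> Ule D"
  shows "\<omega> x (y \<cdot> QU (- tcoroot D i)) = \<omega> x y"
  using assms(1) unfolding Uplus_eq
proof induction
  case zero
  have "\<omega> \<zero>\<^bsub>Uq D\<^esub> z = 0" if "z \<in> Ule D" for z
    using \<omega>_smul_left[OF one_Uge that, of 0] by simp
  then show ?case using assms by (simp add: Ule_mult QU_Ule)
next
  case (step m u c)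
  then obtain w where w: "w \<in> lists I" "m = MU w" by auto
  have u: "u \<in> Uge D" using step.hyps Uplus_eq Uge_eqs by auto
  have m: "smul (Uq D) c m \<in> Uge D"
    using w MU_Uge unfolding Uge_def by (auto intro: U.subalg_smul)
  show ?case
    using w u m step assms
    by (simp add: \<omega>_add_left \<omega>_smul_left MU_Uge \<omega>_MU_right_torus Ule_mult QU_Ule)
qed

lemma \<omega>_one_NU:
  "w \<in> lists I \<Longrightarrow> \<omega> \<one>\<^bsub>Uq D\<^esub> (NU w) = (if w = [] then 1 else 0)"
proof (cases w)
  case (Cons j v)
  assume "w \<in> lists I"
  then show ?thesis
    using Cons \<omega>_mult_right[OF one_Uge fU_Ule NU_Ule _ \<Delta>_one, of j v]
    by (simp add: \<omega>_1 one_Uge)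
qed (simp add: \<omega>_1)

text \<open>Of the two terms of \<Delta>(e_i) the one with t_i vanishes, since torus elements are
  orthogonal to f_j; in the other one, 1 pairs nontrivially with the tail only if the tail is
  empty.\<close>

lemma \<omega>_e_NU:
  assumes "i \<in> I" "w \<in> lists I"
  shows "\<omega> (eU i) (NU w) = (if w = [i] then to_ac (ef_const D i) else 0)"
proof (cases w)
  case Nil
  then show ?thesis using assms by (simp add: \<omega>_1)
next
  case (Cons j v)
  then show ?thesis
    using assms \<omega>_mult_right[OF eU_Uge fU_Ule NU_Ule _ \<Delta>_e_list, of i j v]
    by (auto simp: \<omega>_one_NU \<omega>_ef \<omega>_Qf one_Uge eU_Uge QU_Uge)
qed

lemma Q_NU: "i \<in> I \<Longrightarrow> w \<in> lists I \<Longrightarrow>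
    QU (- tcoroot D i) \<cdot> NU w = smul (Uq D) (pw i w) (NU w \<cdot> QU (- tcoroot D i))"
  using Uf.Q_mon[of "- tcoroot D i" w]
  by (simp add: pw_qpow dual_minus sroot_dual in_lists_conv_set cong: map_cong)

text \<open>A term with first factor i has one letter i replaced by t_i^{-1} in its second factor.
  Moving t_i^{-1} to the right end costs the pairing with the letters behind it, which is the
  coefficient in \<open>deriv_right\<close>, and at the end it is invisible to the form. The prefix
  \<open>u\<close> collects the letters that were passed and kept.\<close>

lemma cop_f_deriv:
  assumes x: "x \<in> Uplus D" and i: "i \<in> I"
  shows "w \<in> lists I \<Longrightarrow> u \<in> lists I \<Longrightarrow>
    (\<Sum>(a, b)\<leftarrow>cop_f D w. if a = [i] then \<omega> x (NU u \<cdot> b) else 0)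
      = (\<Sum>(c, v)\<leftarrow>deriv_right D i w. to_ac c * \<omega> x (NU (u @ v)))"
proof (induction w arbitrary: u)
  case (Cons j w)
  then have j: "j \<in> I" and w: "w \<in> lists I" by auto
  have xg: "x \<in> Uge D" using x Uge_eqs by auto
  let ?Q = "QU (- tcoroot D j)"
  \<comment> \<open>The first letter is the one sent to the first factor. All remaining letters must
    stay out of that factor, and this leaves the single term of \<open>cop_f_counit\<close>.\<close>
  have 1: "(\<Sum>(a, b)\<leftarrow>cop_f D w. if j # a = [i] then \<omega> x (NU u \<cdot> (?Q \<cdot> b)) else 0)
      = (if j = i then to_ac (pw i w) * \<omega> x (NU (u @ w)) else 0)"
  proof (cases "j = i")
    case True
    have "(\<Sum>(a, b)\<leftarrow>cop_f D w. if j # a = [i] then \<omega> x (NU u \<cdot> (?Q \<cdot> b)) else 0)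
        = \<omega> x (NU u \<cdot> (?Q \<cdot> NU w))"
      using cop_f_counit[OF w, of "\<lambda>b. \<omega> x (NU u \<cdot> (?Q \<cdot> b))"] True by simp
    also have "NU u \<cdot> (?Q \<cdot> NU w) = smul (Uq D) (pw i w) (NU (u @ w) \<cdot> ?Q)"
      using True Cons.prems w i
      by (simp add: Q_NU U.smul_mult_right Uf.mon_g_append U.m_assoc)
    also have "\<omega> x \<dots> = to_ac (pw i w) * \<omega> x (NU (u @ w))"
      using True x xg Cons.prems w i
      by (subst \<omega>_smul_right) (auto simp: \<omega>_Uplus_right_torus NU_Ule QU_Ule intro!: Ule_mult)
    finally show ?thesis using True by simp
  next
    case False
    then show ?thesis by (simp add: case_prod_unfold)
  qed
  have 2: "(\<Sum>(a, b)\<leftarrow>cop_f D w. if a = [i] then \<omega> x (NU u \<cdot> (fU j \<cdot> b)) else 0)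
      = (\<Sum>(c, v)\<leftarrow>deriv_right D i w. to_ac c * \<omega> x (NU (u @ j # v)))"
  proof -
    have "NU u \<cdot> (fU j \<cdot> b) = NU (u @ [j]) \<cdot> b" if "(a, b) \<in> set (cop_f D w)" for a b
    proof -
      have "b \<in> carrier (Uq D)" using that cop_f_closed[OF w] Ule_eqs(3) by blast
      then show ?thesis using j Cons.prems by (simp add: Uf.mon_g_append U.m_assoc)
    qed
    then have "(\<Sum>(a, b)\<leftarrow>cop_f D w. if a = [i] then \<omega> x (NU u \<cdot> (fU j \<cdot> b)) else 0)
        = (\<Sum>(a, b)\<leftarrow>cop_f D w. if a = [i] then \<omega> x (NU (u @ [j]) \<cdot> b) else 0)"
      by (intro sum_list_map_cong) auto
    then show ?thesis using Cons.IH[OF w, of "u @ [j]"] Cons.prems j by simp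
  qed
  show ?case
    using 1 2 by (auto simp: o_def case_prod_unfold cong: if_cong)
qed simp

text \<open>Pairing with e_i selects in \<Delta>(f_w) the terms whose first factor is the one-letter
  word i.\<close>

theorem \<omega>_deriv_right:
  assumes x: "x \<in> Uplus D" and i: "i \<in> I" and w: "w \<in> lists I"
  shows "\<omega> (x \<cdot> eU i) (NU w)
    = to_ac (ef_const D i) * (\<Sum>(c, v)\<leftarrow>deriv_right D i w. to_ac c * \<omega> x (NU v))"
proof -
  have xg: "x \<in> Uge D" using x Uge_eqs by auto
  have "\<omega> (x \<cdot> eU i) (NU w) = (\<Sum>(a, b)\<leftarrow>cop_f D w. \<omega> (eU i) (NU a) * \<omega> x b)"
    using \<omega>_mult_left[OF xg eU_Uge[OF i] NU_Ule[OF w] cop_f_closed2[OF w] \<Delta>_NU[OF w]]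
    by (simp add: o_def case_prod_unfold)
  also have "\<dots> = (\<Sum>(a, b)\<leftarrow>cop_f D w. to_ac (ef_const D i) * (if a = [i] then \<omega> x (NU [] \<cdot> b) else 0))"
  proof (intro sum_list_map_cong, clarify)
    fix a b assume "(a, b) \<in> set (cop_f D w)"
    then have "a \<in> lists I" "b \<in> carrier (Uq D)" using cop_f_closed[OF w] Ule_eqs(3) by blast+
    then show "\<omega> (eU i) (NU a) * \<omega> x b = to_ac (ef_const D i) * (if a = [i] then \<omega> x (NU [] \<cdot> b) else 0)"
      using i by (simp add: \<omega>_e_NU)
  qed
  also have "\<dots> = to_ac (ef_const D i) * (\<Sum>(a, b)\<leftarrow>cop_f D w. if a = [i] then \<omega> x (NU [] \<cdot> b) else 0)"
    by (simp only: case_prod_unfold sum_list_const_mult)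
  also have "\<dots> = to_ac (ef_const D i) * (\<Sum>(c, v)\<leftarrow>deriv_right D i w. to_ac c * \<omega> x (NU v))"
    using cop_f_deriv[OF x i w, of "[]"] by simp
  finally show ?thesis .
qed

text \<open>Pairing with 1 is multiplicative, kills every e_j and sends t_j to 1. It is the counit,
  here applied to the first factor.\<close>

lemma cop_e_counit_form:
  "w \<in> lists I \<Longrightarrow> (\<Sum>(a, b)\<leftarrow>cop_e D w. \<omega> a \<one>\<^bsub>Uq D\<^esub> * G b) = G w"
proof (induction w arbitrary: G)
  case Nil
  then show ?case by (simp add: \<omega>_1)
next
  case (Cons j w)
  then have j: "j \<in> I" and w: "w \<in> lists I" by auto
  have m: "\<omega> (x \<cdot> a) \<one>\<^bsub>Uq D\<^esub> = \<omega> a \<one>\<^bsub>Uq D\<^esub> * \<omega> x \<one>\<^bsub>Uq D\<^esub>" if "x \<in> Uge D" "a \<in> Uge D" for x a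
    using \<omega>_mult_left[OF that one_Ule _ \<Delta>_one] by (simp add: one_Ule)
  have "(\<Sum>(a, b)\<leftarrow>cop_e D w. \<omega> (eU j \<cdot> a) \<one>\<^bsub>Uq D\<^esub> * G b) = (\<Sum>(a, b)\<leftarrow>cop_e D w. 0)"
    using cop_e_closed[OF w] j by (intro sum_list_map_cong) (auto simp: m eU_Uge \<omega>_1)
  moreover have "(\<Sum>(a, b)\<leftarrow>cop_e D w. \<omega> (QU (tcoroot D j) \<cdot> a) \<one>\<^bsub>Uq D\<^esub> * G (j # b))
      = (\<Sum>(a, b)\<leftarrow>cop_e D w. \<omega> a \<one>\<^bsub>Uq D\<^esub> * G (j # b))"
    using cop_e_closed[OF w] j by (intro sum_list_map_cong) (auto simp: m QU_Uge \<omega>_1)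
  ultimately show ?case using Cons.IH[OF w, of "\<lambda>b. G (j # b)"] by (simp add: o_def case_prod_unfold)
qed

text \<open>By the two terms of \<Delta>(f_i), exactly one letter i of the first factor meets f_i.
  Letters before it contribute t_j paired with t_i^{-1}, that is \<open>pairing D i j\<close>; what
  comes after it is paired with 1. \<open>G\<close> stands for the pairing of the second factor with
  a further element, and it has to vary because the recursion prefixes letters to the word.\<close>

lemma cop_e_deriv:
  assumes i: "i \<in> I"
  shows "w \<in> lists I \<Longrightarrow> (\<Sum>(a, b)\<leftarrow>cop_e D w. \<omega> a (fU i) * G b)
      = to_ac (ef_const D i) * (\<Sum>(c, v)\<leftarrow>deriv_left D i w. to_ac c * G v)"
proof (induction w arbitrary: G)
  case Nil
  then show ?case using i by (simp add: \<omega>_1)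
next
  case (Cons j w)
  then have j: "j \<in> I" and w: "w \<in> lists I" by auto
  have m: "\<omega> (x \<cdot> a) (fU i) = \<omega> a (fU i) * \<omega> x (QU (- tcoroot D i)) + \<omega> a \<one>\<^bsub>Uq D\<^esub> * \<omega> x (fU i)"
    if "x \<in> Uge D" "a \<in> Uge D" for x a
    using \<omega>_mult_left[OF that fU_Ule _ \<Delta>_f_list, of i] i by (simp add: one_Ule fU_Ule QU_Ule)
  have "(\<Sum>(a, b)\<leftarrow>cop_e D w. \<omega> (eU j \<cdot> a) (fU i) * G b)
      = (\<Sum>(a, b)\<leftarrow>cop_e D w. (if j = i then to_ac (ef_const D i) else 0) * (\<omega> a \<one>\<^bsub>Uq D\<^esub> * G b))"
    using cop_e_closed[OF w] j i
    by (intro sum_list_map_cong) (auto simp: m eU_Uge \<omega>_ef \<omega>_eQ)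
  also have "\<dots> = (if j = i then to_ac (ef_const D i) else 0) * G w"
    using cop_e_counit_form[OF w, of G] by (simp only: case_prod_unfold sum_list_const_mult)
  finally have 1: "(\<Sum>(a, b)\<leftarrow>cop_e D w. \<omega> (eU j \<cdot> a) (fU i) * G b)
      = (if j = i then to_ac (ef_const D i) else 0) * G w" .
  have "(\<Sum>(a, b)\<leftarrow>cop_e D w. \<omega> (QU (tcoroot D j) \<cdot> a) (fU i) * G (j # b))
      = (\<Sum>(a, b)\<leftarrow>cop_e D w. to_ac (p i j) * (\<omega> a (fU i) * G (j # b)))"
    using cop_e_closed[OF w] j i
    by (intro sum_list_map_cong) (auto simp: m QU_Uge \<omega>_Qf \<omega>_QQ_roots p_sym[of i j])
  also have "\<dots> = to_ac (ef_const D i)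
      * (to_ac (p i j) * (\<Sum>(c, v)\<leftarrow>deriv_left D i w. to_ac c * G (j # v)))"
    using Cons.IH[OF w, of "\<lambda>b. G (j # b)"] by (simp only: case_prod_unfold sum_list_const_mult mult.left_commute)
  finally have 2: "(\<Sum>(a, b)\<leftarrow>cop_e D w. \<omega> (QU (tcoroot D j) \<cdot> a) (fU i) * G (j # b))
      = to_ac (ef_const D i) * (\<Sum>(c, v)\<leftarrow>deriv_left D i w. to_ac (p i j * c) * G (j # v))"
    by (simp add: case_prod_unfold mult.assoc sum_list_const_mult)
  show ?case using 1 2 by (auto simp: o_def case_prod_unfold distrib_left)
qed

theorem \<omega>_deriv_left:
  assumes y: "y \<in> Ule D" and i: "i \<in> I" and w: "w \<in> lists I"
  shows "\<omega> (MU w) (fU i \<cdot> y)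
    = to_ac (ef_const D i) * (\<Sum>(c, v)\<leftarrow>deriv_left D i w. to_ac c * \<omega> (MU v) y)"
proof -
  have "\<omega> (MU w) (fU i \<cdot> y) = (\<Sum>(a, b)\<leftarrow>cop_e D w. \<omega> a (fU i) * \<omega> (MU b) y)"
    using \<omega>_mult_right[OF MU_Uge[OF w] fU_Ule[OF i] y cop_e_closed2[OF w] \<Delta>_MU[OF w]]
    by (simp add: o_def case_prod_unfold)
  then show ?thesis using cop_e_deriv[OF i w, of "\<lambda>b. \<omega> (MU b) y"] by simp
qed

end

section \<open>Moving e''_i and f_i across words of the opposite kind\<close>

section \<open>Commutation rules in \<open>B\<close>\<close>

lemma (in kalg) smul_lincomb:
  "(\<forall>v\<in>snd ` set L. m v \<in> carrier A) \<Longrightarrow> smul A c (lincomb A m L) = lincomb A (\<lambda>v. smul A c (m v)) L"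
  by (induction L) (auto simp: smul_add mult.commute)

lemma (in kalg) smul_lincomb_coeff:
  "(\<forall>v\<in>snd ` set L. m v \<in> carrier A) \<Longrightarrow>
    smul A c (lincomb A m L) = lincomb A m (map (\<lambda>(d, v). (c * d, v)) L)"
  by (induction L) (auto simp: smul_add)

text \<open>This is q^{(\<alpha>_i, \<beta>)}, the value of \<open>pairing_word\<close> on every
  word of weight \<beta>.\<close>

definition pairing_weight :: "('i, 't) cartan_data \<Rightarrow> 'i \<Rightarrow> ('i \<Rightarrow> nat) \<Rightarrow> qfield"
  where "pairing_weight D i \<beta> = (\<Prod>j\<in>inds D. pairing D i j ^ \<beta> j)"

text \<open>For a word of length n, (-1)^n times the product of q^{(\<alpha>_j, \<alpha>_k)} over
  all pairs of positions. It is the scalar by which k_\<beta>^{-1} S^{-1}(f_w) differs from the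
  reversed word.\<close>

primrec word_sign :: "('i, 't) cartan_data \<Rightarrow> 'i list \<Rightarrow> qfield"
  where
    "word_sign D [] = 1"
  | "word_sign D (j # w) = - pairing_word D j w * word_sign D w"

lemma deriv_right_mset: "(c, v) \<in> set (deriv_right D i w) \<Longrightarrow> mset w = add_mset i (mset v)"
  by (induction w arbitrary: c v) (auto split: if_splits)

lemma deriv_left_mset: "(c, v) \<in> set (deriv_left D i w) \<Longrightarrow> mset w = add_mset i (mset v)"
  by (induction w arbitrary: c v) (auto split: if_splits)

lemma count_minus_letter:
  "mset w = add_mset i (mset v) \<Longrightarrow> count (mset w) = \<gamma> \<Longrightarrow> \<gamma> i \<noteq> 0 \<and> count (mset v) = \<gamma>(i := \<gamma> i - 1)"
  by auto

context cartan
begin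

abbreviation "P \<equiv> pairing_weight D"
abbreviation "eps \<equiv> word_sign D"
abbreviation "MB \<equiv> mon (Bq D) eB"
abbreviation "NB \<equiv> mon (Bq D) fB"

lemma eB_closed [simp]: "i \<in> I \<Longrightarrow> eB i \<in> carrier (Bq D)"
  and fB_closed [simp]: "i \<in> I \<Longrightarrow> fB i \<in> carrier (Bq D)"
  by (simp_all add: Be.g_closed Bf.g_closed)

lemma rev_lists [simp]: "rev w \<in> lists I \<longleftrightarrow> w \<in> lists I"
  by (simp add: in_lists_conv_set)

lemma NB_closed [simp]: "w \<in> lists I \<Longrightarrow> NB w \<in> carrier (Bq D)"
  and MB_closed [simp]: "w \<in> lists I \<Longrightarrow> MB w \<in> carrier (Bq D)"
  by (simp_all add: Be.mon_g_closed Bf.mon_g_closed)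

lemma pw_eq: "w \<in> lists I \<Longrightarrow> pw i w = P i (count (mset w))"
proof (induction w)
  case (Cons j w)
  have "P i (count (mset (j # w))) = (\<Prod>l\<in>I. p i l ^ count (mset w) l * (if l = j then p i l else 1))"
    unfolding pairing_weight_def by (intro prod.cong) auto
  also have "\<dots> = P i (count (mset w)) * p i j"
    using Cons finite_I by (simp add: pairing_weight_def prod.distrib)
  finally show ?case using Cons by (simp del: count_add_mset add_mset.rep_eq)
qed (simp add: pairing_weight_def)

lemma eps_move: "i \<in> I \<Longrightarrow> a \<in> lists I \<Longrightarrow> b \<in> lists I \<Longrightarrow> eps (a @ i # b) = eps (i # a @ b)"
  by (induction a) (auto simp: p_sym[of _ i])

text \<open>The pairing is symmetric, so permuting letters permutes the factors. Hence the ratio of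
  the scalars of a word and of the word with one letter i removed is constant on a weight space and
  can be taken out of a linear combination.\<close>

lemma eps_mset: "v \<in> lists I \<Longrightarrow> w \<in> lists I \<Longrightarrow> mset v = mset w \<Longrightarrow> eps v = eps w"
proof (induction v arbitrary: w)
  case (Cons i v)
  then have "i \<in> set w" by (metis list.set_intros(1) set_mset_mset)
  then obtain a b where w: "w = a @ i # b" by (meson split_list)
  then have "eps v = eps (a @ b)" using Cons by (intro Cons.IH) auto
  moreover have "pw i v = pw i (a @ b)"
    using Cons w by (subst (1 2) pw_eq) auto
  ultimately show ?case using eps_move[of i a b] Cons w by simp
qed simp

lemma eps_deriv:
  assumes "w \<in> lists I" "v \<in> lists I" "i \<in> I" "mset w = add_mset i (mset v)"
  shows "eps w = - P i (count (mset v)) * eps v"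
  using eps_mset[of w "i # v"] assms by (simp add: pw_eq)

text \<open>Entering \<open>rev w\<close> from the left, e''_i crosses the letters that stand behind
  a given letter i of \<open>w\<close> before this letter absorbs it; their pairings are the
  coefficient in \<open>deriv_right\<close>. The same list is the adjoint of right multiplication by
  e_i, and on this coincidence the cancellation rests.\<close>

lemma eB_NB_rev:
  assumes i: "i \<in> I"
  shows "w \<in> lists I \<Longrightarrow> eB i \<otimes>\<^bsub>Bq D\<^esub> NB (rev w) = smul (Bq D) (pw i w) (NB (rev w) \<otimes>\<^bsub>Bq D\<^esub> eB i)
    \<oplus>\<^bsub>Bq D\<^esub> lincomb (Bq D) (\<lambda>v. NB (rev v)) (deriv_right D i w)"
proof (induction w)
  case Nil
  then show ?case using i by simp
next
  case (Cons j w)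
  then have j: "j \<in> I" and w: "w \<in> lists I" by simp_all
  let ?L = "deriv_right D i w" and ?n = "NB (rev w)"
  let ?d = "if i = j then \<one>\<^bsub>Bq D\<^esub> else \<zero>\<^bsub>Bq D\<^esub>"
  have L: "\<forall>v\<in>snd ` set ?L. v \<in> lists I" using deriv_right_closed[OF w] by auto
  then have Lc: "lincomb (Bq D) (\<lambda>v. NB (rev v)) ?L \<in> carrier (Bq D)"
    by (intro B.lincomb_closed) auto
  have snoc: "NB (rev (j # v)) = NB (rev v) \<otimes>\<^bsub>Bq D\<^esub> fB j" if "v \<in> lists I" for v
    using that j by (simp add: Bf.mon_g_append)
  have "eB i \<otimes>\<^bsub>Bq D\<^esub> NB (rev (j # w)) = (eB i \<otimes>\<^bsub>Bq D\<^esub> ?n) \<otimes>\<^bsub>Bq D\<^esub> fB j"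
    using i j w by (simp add: snoc B.m_assoc del: rev.simps)
  also have "\<dots> = smul (Bq D) (pw i w) (?n \<otimes>\<^bsub>Bq D\<^esub> (eB i \<otimes>\<^bsub>Bq D\<^esub> fB j))
      \<oplus>\<^bsub>Bq D\<^esub> lincomb (Bq D) (\<lambda>v. NB (rev v)) ?L \<otimes>\<^bsub>Bq D\<^esub> fB j"
    using i j w Lc Cons.IH[OF w] by (simp add: B.l_distr B.smul_mult_left B.m_assoc)
  also have "?n \<otimes>\<^bsub>Bq D\<^esub> (eB i \<otimes>\<^bsub>Bq D\<^esub> fB j)
      = smul (Bq D) (p i j) (NB (rev (j # w)) \<otimes>\<^bsub>Bq D\<^esub> eB i) \<oplus>\<^bsub>Bq D\<^esub> ?n \<otimes>\<^bsub>Bq D\<^esub> ?d"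
    using i j w
    by (simp add: snoc boson_relation B.r_distr B.smul_mult_right B.m_assoc del: rev.simps)
  also have "lincomb (Bq D) (\<lambda>v. NB (rev v)) ?L \<otimes>\<^bsub>Bq D\<^esub> fB j
      = lincomb (Bq D) (\<lambda>v. NB (rev v)) (map (\<lambda>(c, v). (c, j # v)) ?L)"
    unfolding B.lincomb_map using L j
    by (subst B.lincomb_mult_right) (auto intro!: B.lincomb_cong simp: snoc simp del: rev.simps)
  finally show ?case
    using i j w L Lc
    by (auto simp: B.smul_add B.lincomb_map B.a_assoc mult.commute simp del: rev.simps)
qed

end

locale projector_data = killing_form D \<Delta> \<rho> \<omega>
  for D :: "('i, 't::ab_group_add) cartan_data" and \<Delta> \<rho> \<omega> +
  fixes S \<phi> \<iota> :: "('i, 't) ncpoly set \<Rightarrow> ('i, 't) ncpoly set"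
    and xs ys :: "('i \<Rightarrow> nat) \<Rightarrow> ('i, 't) ncpoly set list"
  assumes antipode: "is_antipode D S" and phi: "is_phi D \<phi>" and ident: "is_identification D \<iota>"
    and dual: "dual_bases D \<omega> xs ys"
begin

abbreviation mB (infixl "\<bullet>" 70) where "x \<bullet> y \<equiv> x \<otimes>\<^bsub>Bq D\<^esub> y"
abbreviation aB (infixl "\<^bold>+" 65) where "x \<^bold>+ y \<equiv> x \<oplus>\<^bsub>Bq D\<^esub> y"
abbreviation "sB \<equiv> smul (Bq D)"
abbreviation "sU \<equiv> smul (Uq D)"

lemma phi_closed [simp]: "x \<in> Uge D \<Longrightarrow> \<phi> x \<in> carrier (Bq D)"
  and phi_mult: "x \<in> Uge D \<Longrightarrow> y \<in> Uge D \<Longrightarrow> \<phi> (x \<cdot> y) = \<phi> y \<bullet> \<phi> x"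
  and phi_add: "x \<in> Uge D \<Longrightarrow> y \<in> Uge D \<Longrightarrow> \<phi> (x \<oplus>\<^bsub>Uq D\<^esub> y) = \<phi> x \<^bold>+ \<phi> y"
  and phi_one: "\<phi> \<one>\<^bsub>Uq D\<^esub> = \<one>\<^bsub>Bq D\<^esub>"
  and phi_scal: "\<phi> (scal (Uq D) c) = scal (Bq D) c"
  using phi unfolding is_phi_def alg_antihom_def alg_hom_def ring_hom_def by auto

lemma scal_Uge: "scal (Uq D) c \<in> Uge D"
  unfolding Uge_def by (rule U.subalg_scal)

lemma phi_smul: "x \<in> Uge D \<Longrightarrow> \<phi> (sU c x) = sB c (\<phi> x)"
  by (simp add: smul_def phi_mult scal_Uge phi_scal B.scal_comm)

lemma ef_const_phi: "ef_const D i = - (1 / (qi D i - inverse (qi D i)))"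
  unfolding ef_const_def by (metis minus_diff_eq minus_divide_right)

lemma ef_const_nonzero: "i \<in> I \<Longrightarrow> ef_const D i \<noteq> 0"
  using qi_neq by (simp add: ef_const_def)

lemma phi_e: "i \<in> I \<Longrightarrow> \<phi> (eU i) = sB (ef_const D i) (eB i)"
  using phi unfolding is_phi_def by (simp add: ef_const_phi smul_def)

lemma phi_MU_B:
  "w \<in> lists I \<Longrightarrow> \<phi> (MU w) = sB (\<Prod>j\<leftarrow>w. ef_const D j) (MB (rev w))"
proof (induction w)
  case (Cons j w)
  then show ?case
    by (simp add: phi_mult eU_Uge MU_Uge phi_e B.smul_mult_left B.smul_mult_right Be.mon_g_append mult.commute)
qed (simp add: phi_one)

text \<open>\<phi> reverses words, so f_i, moving to the left, meets the letters of \<open>w\<close>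
  in their order; those crossed before it is absorbed give the coefficients of
  \<open>deriv_left\<close>. The absorbed e''_i leaves behind the scalar that \<phi> had attached to
  it.\<close>

lemma phi_MU_fB:
  assumes i: "i \<in> I"
  shows "w \<in> lists I \<Longrightarrow> \<phi> (MU w) \<bullet> fB i = sB (pw i w) (fB i \<bullet> \<phi> (MU w))
    \<^bold>+ sB (ef_const D i) (lincomb (Bq D) (\<lambda>v. \<phi> (MU v)) (deriv_left D i w))"
proof (induction w)
  case Nil
  then show ?case using i by (simp add: phi_one)
next
  case (Cons j w)
  then have j: "j \<in> I" and w: "w \<in> lists I" by simp_all
  let ?L = "deriv_left D i w" and ?n = "\<phi> (MU w)"
  let ?d = "if j = i then \<one>\<^bsub>Bq D\<^esub> else \<zero>\<^bsub>Bq D\<^esub>"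
  let ?X = "lincomb (Bq D) (\<lambda>v. \<phi> (MU v)) ?L"
  let ?Y = "lincomb (Bq D) (\<lambda>v. \<phi> (MU (j # v))) ?L"
  have L: "\<forall>v\<in>snd ` set ?L. v \<in> lists I" using deriv_left_closed[OF w] by auto
  have Xc: "?X \<in> carrier (Bq D)" using L by (intro B.lincomb_closed) (auto simp: MU_Uge)
  have Yc: "?Y \<in> carrier (Bq D)" using L j by (intro B.lincomb_closed) (auto simp: MU_Uge simp del: mon.simps)
  have n: "?n \<in> carrier (Bq D)" using w by (simp add: MU_Uge)
  have cons: "\<phi> (MU (j # v)) = sB (ef_const D j) (\<phi> (MU v) \<bullet> eB j)" if "v \<in> lists I" for v
    using that j by (simp add: phi_mult eU_Uge MU_Uge phi_e B.smul_mult_right)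
  have XY: "sB (ef_const D j) (?X \<bullet> eB j) = ?Y"
    using L j by (subst B.lincomb_mult_right)
      (auto simp: MU_Uge B.smul_lincomb cons simp del: mon.simps intro!: B.lincomb_cong)
  have coeff: "lincomb (Bq D) (\<lambda>v. \<phi> (MU v)) (map (\<lambda>(c, v). (p i j * c, j # v)) ?L) = sB (p i j) ?Y"
  proof -
    have "map (\<lambda>(c, v). (p i j * c, j # v)) ?L
        = map (\<lambda>(c, v). (c, j # v)) (map (\<lambda>(c, v). (p i j * c, v)) ?L)" by (auto simp: o_def)
    then have "lincomb (Bq D) (\<lambda>v. \<phi> (MU v)) (map (\<lambda>(c, v). (p i j * c, j # v)) ?L)
        = lincomb (Bq D) (\<lambda>v. \<phi> (MU (j # v))) (map (\<lambda>(c, v). (p i j * c, v)) ?L)"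
      by (simp only: B.lincomb_map)
    moreover have "\<forall>v\<in>snd ` set ?L. \<phi> (MU (j # v)) \<in> carrier (Bq D)"
      using L j by (simp add: MU_Uge del: mon.simps)
    ultimately show ?thesis by (simp only: B.smul_lincomb_coeff)
  qed
  have "\<phi> (MU (j # w)) \<bullet> fB i = sB (ef_const D j) (?n \<bullet> (eB j \<bullet> fB i))"
    using i j w n by (simp add: cons B.smul_mult_left B.m_assoc del: mon.simps)
  also have "?n \<bullet> (eB j \<bullet> fB i) = sB (p i j) ((?n \<bullet> fB i) \<bullet> eB j) \<^bold>+ ?n \<bullet> ?d"
    using i j w n
    by (simp add: boson_relation B.r_distr B.smul_mult_right B.m_assoc p_sym[of i j])
  also have "(?n \<bullet> fB i) \<bullet> eB j = sB (pw i w) (fB i \<bullet> (?n \<bullet> eB j))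
      \<^bold>+ sB (ef_const D i) (?X \<bullet> eB j)"
    using Cons.IH[OF w] i j n Xc by (simp add: B.l_distr B.smul_mult_left B.m_assoc)
  finally have 1: "\<phi> (MU (j # w)) \<bullet> fB i = sB (ef_const D j)
      (sB (p i j) (sB (pw i w) (fB i \<bullet> (?n \<bullet> eB j)) \<^bold>+ sB (ef_const D i) (?X \<bullet> eB j)) \<^bold>+ ?n \<bullet> ?d)" .
  have 2: "fB i \<bullet> \<phi> (MU (j # w)) = sB (ef_const D j) (fB i \<bullet> (?n \<bullet> eB j))"
    using i j n w by (simp add: cons B.smul_mult_right del: mon.simps)
  have 3: "sB (ef_const D j) (sB (p i j) (sB (ef_const D i) (?X \<bullet> eB j))) = sB (ef_const D i) (sB (p i j) ?Y)"
    using j Xc by (simp add: XY[symmetric] mult.assoc mult.commute mult.left_commute del: mon.simps)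
  have 4: "\<phi> (MU (j # w)) \<bullet> fB i = sB (p i j * pw i w) (fB i \<bullet> \<phi> (MU (j # w)))
      \<^bold>+ sB (ef_const D i) (sB (p i j) ?Y) \<^bold>+ sB (ef_const D j) (?n \<bullet> ?d)"
    unfolding 1 2 3[symmetric] using i j n Xc
    by (simp add: B.smul_add mult.assoc mult.commute mult.left_commute)
  show ?case
  proof (cases "j = i")
    case True
    have "lincomb (Bq D) (\<lambda>v. \<phi> (MU v)) (deriv_left D i (j # w)) = ?n \<^bold>+ sB (p i j) ?Y"
      using True coeff n by simp
    then show ?thesis
      using 4 True i n Yc MU_Uge[of "j # w"] w j
      by (simp add: B.smul_add B.a_ac del: mon.simps deriv_left.simps)
  next
    case False
    have "lincomb (Bq D) (\<lambda>v. \<phi> (MU v)) (deriv_left D i (j # w)) = sB (p i j) ?Y"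
      using False coeff by simp
    then show ?thesis
      using 4 False i n Yc MU_Uge[of "j # w"] w j
      by (simp del: mon.simps deriv_left.simps)
  qed
qed

end

section \<open>The twisted inverse antipode on U^- and the derivatives of homogeneous
  elements\<close>

section \<open>The homogeneous components of the projector\<close>

context projector_data
begin

lemma S_hom:
  "x \<in> carrier (Uq D) \<Longrightarrow> S x \<in> carrier (Uq D)"
  "x \<in> carrier (Uq D) \<Longrightarrow> y \<in> carrier (Uq D) \<Longrightarrow> S (x \<cdot> y) = S y \<cdot> S x"
  "x \<in> carrier (Uq D) \<Longrightarrow> y \<in> carrier (Uq D) \<Longrightarrow> S (x \<oplus>\<^bsub>Uq D\<^esub> y) = S x \<oplus>\<^bsub>Uq D\<^esub> S y"
  "S \<one>\<^bsub>Uq D\<^esub> = \<one>\<^bsub>Uq D\<^esub>" "S (scal (Uq D) c) = scal (Uq D) c"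
proof -
  have S: "S \<in> ring_hom (Uq D) (Uq D\<lparr>monoid.mult := \<lambda>x y. y \<cdot> x\<rparr>)" "\<forall>c. S (scal (Uq D) c) = scal (Uq D) c"
    using antipode unfolding is_antipode_def alg_antihom_def alg_hom_def by simp_all
  show "x \<in> carrier (Uq D) \<Longrightarrow> S x \<in> carrier (Uq D)"
    "x \<in> carrier (Uq D) \<Longrightarrow> y \<in> carrier (Uq D) \<Longrightarrow> S (x \<cdot> y) = S y \<cdot> S x"
    "x \<in> carrier (Uq D) \<Longrightarrow> y \<in> carrier (Uq D) \<Longrightarrow> S (x \<oplus>\<^bsub>Uq D\<^esub> y) = S x \<oplus>\<^bsub>Uq D\<^esub> S y"
    "S \<one>\<^bsub>Uq D\<^esub> = \<one>\<^bsub>Uq D\<^esub>" "S (scal (Uq D) c) = scal (Uq D) c"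
    using ring_hom_closed[OF S(1)] ring_hom_mult[OF S(1)] ring_hom_add[OF S(1)] ring_hom_one[OF S(1)] S(2)
    by simp_all
qed

lemma S_smul: "x \<in> carrier (Uq D) \<Longrightarrow> S (sU c x) = sU c (S x)"
  by (simp add: smul_def S_hom U.scal_comm)

abbreviation "Sinv \<equiv> inv_into (carrier (Uq D)) S"

lemma S_bij: "bij_betw S (carrier (Uq D)) (carrier (Uq D))"
  using antipode unfolding is_antipode_def by blast

lemma Sinv_closed [simp]: "x \<in> carrier (Uq D) \<Longrightarrow> Sinv x \<in> carrier (Uq D)"
  using bij_betwE[OF bij_betw_inv_into[OF S_bij]] by simp

lemma S_Sinv: "x \<in> carrier (Uq D) \<Longrightarrow> S (Sinv x) = x"
  by (rule bij_betw_inv_into_right[OF S_bij])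

lemma SinvI: "x \<in> carrier (Uq D) \<Longrightarrow> S x = y \<Longrightarrow> Sinv y = x"
  using bij_betw_inv_into_left[OF S_bij, of x] by blast

lemma Sinv_add: "x \<in> carrier (Uq D) \<Longrightarrow> y \<in> carrier (Uq D) \<Longrightarrow> Sinv (x \<oplus>\<^bsub>Uq D\<^esub> y) = Sinv x \<oplus>\<^bsub>Uq D\<^esub> Sinv y"
  by (rule SinvI) (simp_all add: S_hom S_Sinv)

lemma Sinv_mult: "x \<in> carrier (Uq D) \<Longrightarrow> y \<in> carrier (Uq D) \<Longrightarrow> Sinv (x \<cdot> y) = Sinv y \<cdot> Sinv x"
  by (rule SinvI) (simp_all add: S_hom S_Sinv)

lemma Sinv_smul: "x \<in> carrier (Uq D) \<Longrightarrow> Sinv (sU c x) = sU c (Sinv x)"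
  by (rule SinvI) (simp_all add: S_smul S_Sinv)

lemma Sinv_one: "Sinv \<one>\<^bsub>Uq D\<^esub> = \<one>\<^bsub>Uq D\<^esub>"
  by (rule SinvI) (simp_all add: S_hom)

lemma Sinv_f:
  assumes "i \<in> I"
  shows "Sinv (fU i) = sU (- 1) (QU (tcoroot D i) \<cdot> fU i)"
proof (rule SinvI)
  have S: "S (fU i) = \<ominus>\<^bsub>Uq D\<^esub> (fU i \<cdot> QU (tcoroot D i))" "S (QU (tcoroot D i)) = QU (- tcoroot D i)"
    using antipode assms tc unfolding is_antipode_def by blast+
  have "S (sU (- 1) (QU (tcoroot D i) \<cdot> fU i))
      = sU (- 1) (\<ominus>\<^bsub>Uq D\<^esub> (fU i \<cdot> QU (tcoroot D i)) \<cdot> QU (- tcoroot D i))"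
    using assms by (simp add: S_smul S_hom S)
  also have "\<dots> = fU i \<cdot> (QU (tcoroot D i) \<cdot> QU (- tcoroot D i))"
    using assms by (simp add: U.smul_minus_one U.l_minus U.m_assoc)
  finally show "S (sU (- 1) (QU (tcoroot D i) \<cdot> fU i)) = fU i"
    using assms by (simp add: Ue.Q_minus)
qed (use assms in simp)

definition kvec :: "('i \<Rightarrow> nat) \<Rightarrow> 't"
  where "kvec m = (\<Sum>i\<in>I. tscale D (of_nat (m i)) (tcoroot D i))"

lemma kvec_colat [simp]: "kvec m \<in> colat D" "- kvec m \<in> colat D"
  by (auto simp: kvec_def intro!: colat_minus colat_sum colat_scale)

lemma inv_kbeta: "inv\<^bsub>Uq D\<^esub> (kbeta D m) = QU (- kvec m)"
  unfolding kbeta_def kvec_def[symmetric] by (rule Ue.inv_Q) simp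

lemma kvec_Cons: "j \<in> I \<Longrightarrow> kvec (count (mset (j # w))) = kvec (count (mset w)) + tcoroot D j"
proof -
  assume j: "j \<in> I"
  interpret V: vector_space "tscale D" by (rule vs)
  have "kvec (count (mset (j # w))) = (\<Sum>i\<in>I. tscale D (of_nat (count (mset w) i)) (tcoroot D i)
      + (if i = j then tcoroot D i else 0))"
    unfolding kvec_def by (intro sum.cong) (auto simp: V.scale_left_distrib)
  also have "\<dots> = kvec (count (mset w)) + tcoroot D j"
    using j finite_I by (simp add: sum.distrib kvec_def)
  finally show ?thesis .
qed

lemma kvec_Nil: "kvec (count (mset [])) = 0"
proof -
  interpret V: vector_space "tscale D" by (rule vs)
  show ?thesis by (simp add: kvec_def)
qed

lemma NU_closed [simp]: "w \<in> lists I \<Longrightarrow> NU w \<in> carrier (Uq D)"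
  and MU_closed [simp]: "w \<in> lists I \<Longrightarrow> MU w \<in> carrier (Uq D)"
  by (simp_all add: Uf.mon_g_closed Ue.mon_g_closed)

text \<open>S^{-1}(f_j) = - t_j f_j puts t_j to the right of the word reversed so far. The new
  factor t_j^{-1} of k^{-1} is moved from the left across that word, which costs
  \<open>pw j w\<close>, and cancels t_j. Together with the sign this is the recursion of
  \<open>word_sign\<close>.\<close>

lemma k_Sinv_NU:
  "w \<in> lists I \<Longrightarrow> QU (- kvec (count (mset w))) \<cdot> Sinv (NU w) = sU (eps w) (NU (rev w))"
proof (induction w)
  case Nil
  then show ?case using Ue.Q_zero unfolding kvec_Nil by (simp add: Sinv_one)
next
  case (Cons j w)
  then have j: "j \<in> I" and w: "w \<in> lists I" by simp_all
  let ?k = "QU (- kvec (count (mset w)))" and ?t = "QU (tcoroot D j)" and ?t' = "QU (- tcoroot D j)"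
  have "QU (- kvec (count (mset (j # w)))) = ?t' \<cdot> ?k"
    using Ue.Q_add[of "- tcoroot D j" "- kvec (count (mset w))"] j
    by (simp only: kvec_Cons minus_add_distrib add.commute) simp
  moreover have "Sinv (NU (j # w)) = Sinv (NU w) \<cdot> sU (- 1) (?t \<cdot> fU j)"
    using j w by (simp add: Sinv_mult Sinv_f)
  ultimately have "QU (- kvec (count (mset (j # w)))) \<cdot> Sinv (NU (j # w))
      = sU (- 1) (?t' \<cdot> (?k \<cdot> Sinv (NU w)) \<cdot> ?t \<cdot> fU j)"
    using j w by (simp add: U.smul_mult_right U.m_assoc)
  also have "?t' \<cdot> (?k \<cdot> Sinv (NU w)) = sU (eps w * pw j w) (NU (rev w) \<cdot> ?t')"
    using Cons.IH[OF w] j w Q_NU[of j "rev w"] by (simp add: U.smul_mult_right)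
  also have "\<dots> \<cdot> ?t \<cdot> fU j = sU (eps w * pw j w) (NU (rev w) \<cdot> (?t' \<cdot> ?t) \<cdot> fU j)"
    using j w by (simp add: U.smul_mult_left U.m_assoc)
  also have "\<dots> = sU (eps w * pw j w) (NU (rev (j # w)))"
    using j w by (simp add: Ue.Q_minus Uf.mon_g_append)
  finally show ?case using j w by (simp add: mult.commute)
qed

lemma iota_hom: "\<iota> \<in> ring_hom ((Uq D)\<lparr>carrier := Ule D\<rparr>) (Bq D)"
  and iota_scal: "\<iota> (scal (Uq D) c) = scal (Bq D) c"
  and iota_f: "i \<in> I \<Longrightarrow> \<iota> (fU i) = fB i"
  using ident unfolding is_identification_def alg_hom_def by simp_all

lemma iota_closed: "x \<in> Ule D \<Longrightarrow> \<iota> x \<in> carrier (Bq D)"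
  and iota_mult: "x \<in> Ule D \<Longrightarrow> y \<in> Ule D \<Longrightarrow> \<iota> (x \<cdot> y) = \<iota> x \<bullet> \<iota> y"
  and iota_add: "x \<in> Ule D \<Longrightarrow> y \<in> Ule D \<Longrightarrow> \<iota> (x \<oplus>\<^bsub>Uq D\<^esub> y) = \<iota> x \<^bold>+ \<iota> y"
  and iota_one: "\<iota> \<one>\<^bsub>Uq D\<^esub> = \<one>\<^bsub>Bq D\<^esub>"
  using ring_hom_closed[OF iota_hom] ring_hom_mult[OF iota_hom] ring_hom_add[OF iota_hom]
    ring_hom_one[OF iota_hom]
  by simp_all

lemma scal_Ule: "scal (Uq D) c \<in> Ule D"
  unfolding Ule_def by (rule U.subalg_scal)

lemma smul_Ule: "x \<in> Ule D \<Longrightarrow> sU c x \<in> Ule D" and smul_Uge: "x \<in> Uge D \<Longrightarrow> sU c x \<in> Uge D"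
  and add_Ule: "x \<in> Ule D \<Longrightarrow> y \<in> Ule D \<Longrightarrow> x \<oplus>\<^bsub>Uq D\<^esub> y \<in> Ule D"
  and zero_Ule: "\<zero>\<^bsub>Uq D\<^esub> \<in> Ule D" and zero_Uge: "\<zero>\<^bsub>Uq D\<^esub> \<in> Uge D"
  unfolding Ule_def Uge_def by (simp_all add: U.subalg_smul U.subalg_add U.subalg_zero)

lemma iota_smul: "x \<in> Ule D \<Longrightarrow> \<iota> (sU c x) = sB c (\<iota> x)"
  by (simp add: smul_def iota_mult scal_Ule iota_scal)

lemma iota_NU: "w \<in> lists I \<Longrightarrow> \<iota> (NU w) = NB w"
  by (induction w) (simp_all add: iota_one iota_mult fU_Ule NU_Ule iota_f)

text \<open>On \<open>U\<^sup>-\<close> of weight \<open>- \<beta>\<close> this is, up to a scalar, the anti-automorphism fixing all \<open>f\<^sub>i\<close>.\<close>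

definition Psi :: "('i \<Rightarrow> nat) \<Rightarrow> ('i, 't) ncpoly set \<Rightarrow> ('i, 't) ncpoly set"
  where "Psi m y = \<iota> (QU (- kvec m) \<cdot> Sinv y)"

lemma proj_term_eq: "proj_term D S \<phi> \<iota> xs ys (\<beta>, r) = Psi \<beta> (ys \<beta> ! r) \<bullet> \<phi> (xs \<beta> ! r)"
  by (simp add: proj_term_def Psi_def inv_kbeta)

lemma Uminus_Ule: "y \<in> Uminus D \<Longrightarrow> y \<in> Ule D" and Uplus_Uge: "x \<in> Uplus D \<Longrightarrow> x \<in> Uge D"
  using Ule_eqs Uge_eqs by blast+

lemma Ule_carrier: "y \<in> Ule D \<Longrightarrow> y \<in> carrier (Uq D)" and Uge_carrier: "x \<in> Uge D \<Longrightarrow> x \<in> carrier (Uq D)"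
  using Ule_eqs Uge_eqs by blast+

lemma Sinv_zero: "Sinv \<zero>\<^bsub>Uq D\<^esub> = \<zero>\<^bsub>Uq D\<^esub>"
  using Sinv_smul[of "\<one>\<^bsub>Uq D\<^esub>" 0] by (simp add: Sinv_one)

text \<open>\<iota> is controlled on U^{<=} only, so S^{-1} must not lead out of it before \<iota>
  is applied.\<close>

lemma Sinv_Ule: "y \<in> Uminus D \<Longrightarrow> Sinv y \<in> Ule D"
  unfolding Uminus_eq
proof (induction rule: lspan.induct)
  case zero
  then show ?case by (simp add: Sinv_zero zero_Ule)
next
  case (step m u c)
  then obtain w where w: "w \<in> lists I" "m = NU w" by auto
  have "Sinv (NU w) \<in> Ule D" using w(1)
    by (induction w) (simp_all add: Sinv_one one_Ule Sinv_mult Sinv_f Ule_mult smul_Ule fU_Ule QU_Ule)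
  moreover have "u \<in> carrier (Uq D)"
    using step.hyps(2) Uminus_eq Uminus_Ule Ule_carrier by auto
  ultimately show ?case using w step by (simp add: Sinv_add Sinv_smul add_Ule smul_Ule)
qed

lemma Psi_closed: "y \<in> Uminus D \<Longrightarrow> Psi m y \<in> carrier (Bq D)"
  unfolding Psi_def by (intro iota_closed Ule_mult QU_Ule Sinv_Ule) simp_all

lemma Psi_add:
  assumes "y \<in> Uminus D" "y' \<in> Uminus D"
  shows "Psi m (y \<oplus>\<^bsub>Uq D\<^esub> y') = Psi m y \<^bold>+ Psi m y'"
proof -
  have "y \<in> carrier (Uq D)" "y' \<in> carrier (Uq D)" using assms Uminus_Ule Ule_carrier by blast+
  then show ?thesis
    using assms unfolding Psi_def
    by (simp add: Sinv_add U.r_distr iota_add Ule_mult QU_Ule Sinv_Ule)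
qed

lemma Psi_smul:
  assumes "y \<in> Uminus D"
  shows "Psi m (sU c y) = sB c (Psi m y)"
proof -
  have "y \<in> carrier (Uq D)" using assms Uminus_Ule Ule_carrier by blast
  then show ?thesis
    using assms unfolding Psi_def
    by (simp add: Sinv_smul U.smul_mult_right iota_smul Ule_mult QU_Ule Sinv_Ule)
qed

lemma Psi_NU: "w \<in> lists I \<Longrightarrow> count (mset w) = \<beta> \<Longrightarrow> Psi \<beta> (NU w) = sB (eps w) (NB (rev w))"
  using k_Sinv_NU[of w] by (auto simp: Psi_def iota_smul NU_Ule iota_NU)

lemma smul_Uminus: "y \<in> Uminus D \<Longrightarrow> sU c y \<in> Uminus D"
  and add_Uminus: "y \<in> Uminus D \<Longrightarrow> y' \<in> Uminus D \<Longrightarrow> y \<oplus>\<^bsub>Uq D\<^esub> y' \<in> Uminus D"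
  and zero_Uminus: "\<zero>\<^bsub>Uq D\<^esub> \<in> Uminus D"
  and smul_Uplus: "x \<in> Uplus D \<Longrightarrow> sU c x \<in> Uplus D"
  and add_Uplus: "x \<in> Uplus D \<Longrightarrow> x' \<in> Uplus D \<Longrightarrow> x \<oplus>\<^bsub>Uq D\<^esub> x' \<in> Uplus D"
  and zero_Uplus: "\<zero>\<^bsub>Uq D\<^esub> \<in> Uplus D"
  unfolding Uminus_def Uplus_def by (simp_all add: U.subalg_smul U.subalg_add U.subalg_mult U.subalg_zero)

lemma Psi_zero: "Psi m \<zero>\<^bsub>Uq D\<^esub> = \<zero>\<^bsub>Bq D\<^esub>"
  using Psi_smul[OF zero_Uminus, of m 0] Psi_closed[OF zero_Uminus, of m] by simp

lemma phi_zero: "\<phi> \<zero>\<^bsub>Uq D\<^esub> = \<zero>\<^bsub>Bq D\<^esub>"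
  using phi_smul[OF zero_Uge, of 0] phi_closed[OF zero_Uge] by simp

lemma lincomb_Uminus: "\<forall>v\<in>snd ` set L. v \<in> lists I \<Longrightarrow> lincomb (Uq D) NU L \<in> Uminus D"
  by (induction L) (auto simp: zero_Uminus NU_Uminus intro!: add_Uminus smul_Uminus)

lemma lincomb_Uplus: "\<forall>v\<in>snd ` set L. v \<in> lists I \<Longrightarrow> lincomb (Uq D) MU L \<in> Uplus D"
  by (induction L) (auto simp: zero_Uplus MU_Uplus intro!: add_Uplus smul_Uplus)

lemma Psi_lincomb:
  "\<forall>v\<in>snd ` set L. v \<in> lists I \<Longrightarrow> Psi m (lincomb (Uq D) NU L) = lincomb (Bq D) (\<lambda>v. Psi m (NU v)) L"
  by (induction L) (auto simp: Psi_zero Psi_add Psi_smul lincomb_Uminus smul_Uminus NU_Uminus)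

lemma phi_lincomb:
  "\<forall>v\<in>snd ` set L. v \<in> lists I \<Longrightarrow> \<phi> (lincomb (Uq D) MU L) = lincomb (Bq D) (\<lambda>v. \<phi> (MU v)) L"
  by (induction L) (auto simp: phi_zero phi_add phi_smul lincomb_Uplus smul_Uplus MU_Uplus Uplus_Uge)

lemma \<omega>_zero: "y \<in> Ule D \<Longrightarrow> \<omega> \<zero>\<^bsub>Uq D\<^esub> y = 0" "x \<in> Uge D \<Longrightarrow> \<omega> x \<zero>\<^bsub>Uq D\<^esub> = 0"
  using \<omega>_smul_left[OF zero_Uge, of y 0] \<omega>_smul_right[OF _ zero_Ule, of x 0] by simp_all

lemma \<omega>_lincomb_right:
  "\<forall>v\<in>snd ` set L. v \<in> lists I \<Longrightarrow> x \<in> Uge D \<Longrightarrow>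
    \<omega> x (lincomb (Uq D) NU L) = (\<Sum>(c, v)\<leftarrow>L. to_ac c * \<omega> x (NU v))"
  by (induction L)
    (auto simp: \<omega>_zero \<omega>_add_right \<omega>_smul_right Uminus_Ule lincomb_Uminus smul_Ule NU_Ule)

lemma \<omega>_lincomb_left:
  "\<forall>v\<in>snd ` set L. v \<in> lists I \<Longrightarrow> y \<in> Ule D \<Longrightarrow>
    \<omega> (lincomb (Uq D) MU L) y = (\<Sum>(c, v)\<leftarrow>L. to_ac c * \<omega> (MU v) y)"
  by (induction L)
    (auto simp: \<omega>_zero \<omega>_add_left \<omega>_smul_left Uplus_Uge lincomb_Uplus smul_Uge MU_Uge)

abbreviation lower :: "'i \<Rightarrow> ('i \<Rightarrow> nat) \<Rightarrow> 'i \<Rightarrow> nat"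
  where "lower i \<gamma> \<equiv> \<gamma>(i := \<gamma> i - 1)"

lemma lower_Qplus: "\<gamma> \<in> Qplus D \<Longrightarrow> lower i \<gamma> \<in> Qplus D"
  by (auto simp: Qplus_def)

lemma Um_Uminus: "y \<in> Uminus_wt D \<beta> \<Longrightarrow> y \<in> Uminus D" and Up_Uplus: "x \<in> Uplus_wt D \<beta> \<Longrightarrow> x \<in> Uplus D"
  by (simp_all add: Uminus_wt_def Uplus_wt_def)

lemma wordsD: "w \<in> words D \<beta> \<Longrightarrow> w \<in> lists I" "w \<in> words D \<beta> \<Longrightarrow> count (mset w) = \<beta>"
  by (simp_all add: words_def)

lemma words_NU: "NU ` words D \<beta> \<subseteq> carrier (Uq D)" and words_MU: "MU ` words D \<beta> \<subseteq> carrier (Uq D)"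
  by (auto simp: words_def)

text \<open>By linearity from words, where \<open>eB_NB_rev\<close> and
  \<open>\<omega>_deriv_right\<close> involve the same list; the scalar - P i of the lowered weight
  is the ratio of the two values of \<open>word_sign\<close>. A derivative \<open>z\<close> with
  both properties is claimed to exist, instead of a map, because the list depends on how
  \<open>y\<close> is written in words. If \<gamma> i = 0, truncated subtraction makes
  \<open>lower i \<gamma>\<close> equal to \<gamma>, and no letter can be deleted; hence the clause
  for \<open>z\<close>.\<close>

lemma Psi_deriv:
  assumes \<gamma>: "\<gamma> \<in> Qplus D" and i: "i \<in> I" and y: "y \<in> Uminus_wt D \<gamma>"
  shows "\<exists>z\<in>Uminus_wt D (lower i \<gamma>). (\<gamma> i = 0 \<longrightarrow> z = \<zero>\<^bsub>Uq D\<^esub>) \<and>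
    eB i \<bullet> Psi \<gamma> y = sB (P i \<gamma>) (Psi \<gamma> y \<bullet> eB i) \<^bold>+ sB (- P i (lower i \<gamma>)) (Psi (lower i \<gamma>) z) \<and>
    (\<forall>x\<in>Uplus D. \<omega> (x \<cdot> eU i) y = to_ac (ef_const D i) * \<omega> x z)"
  using y unfolding Uminus_wt_eq[OF \<gamma>] Uminus_wt_eq[OF lower_Qplus[OF \<gamma>]]
proof (induction rule: lspan.induct)
  case zero
  have "\<omega> (x \<cdot> eU i) \<zero>\<^bsub>Uq D\<^esub> = to_ac (ef_const D i) * \<omega> x \<zero>\<^bsub>Uq D\<^esub>" if "x \<in> Uplus D" for x
    using that i by (simp add: \<omega>_zero Uge_mult Uplus_Uge eU_Uge)
  then show ?case
    using i by (intro bexI[OF _ lspan.zero]) (simp add: Psi_zero)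
next
  case (step m u c)
  let ?\<beta> = "lower i \<gamma>"
  obtain w where w: "w \<in> words D \<gamma>" "m = NU w" using step.hyps(1) by auto
  note wl = wordsD(1)[OF w(1)] and wc = wordsD(2)[OF w(1)]
  have u: "u \<in> Uminus D" using step.hyps(2) Uminus_wt_eq[OF \<gamma>] Um_Uminus by blast
  from step.IH obtain z where z: "z \<in> lspan (Uq D) (NU ` words D ?\<beta>)" "\<gamma> i = 0 \<longrightarrow> z = \<zero>\<^bsub>Uq D\<^esub>"
    "eB i \<bullet> Psi \<gamma> u = sB (P i \<gamma>) (Psi \<gamma> u \<bullet> eB i) \<^bold>+ sB (- P i ?\<beta>) (Psi ?\<beta> z)"
    "\<forall>x\<in>Uplus D. \<omega> (x \<cdot> eU i) u = to_ac (ef_const D i) * \<omega> x z" by (elim bexE conjE) (rule that)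
  have zU: "z \<in> Uminus D" using z(1) Uminus_wt_eq[OF lower_Qplus[OF \<gamma>]] Um_Uminus by blast
  let ?L = "deriv_right D i w"
  let ?z = "lincomb (Uq D) NU ?L"
  have L: "\<forall>v\<in>snd ` set ?L. v \<in> lists I" using deriv_right_closed[OF wl] by auto
  have Lw: "\<gamma> i \<noteq> 0 \<and> v \<in> words D ?\<beta> \<and> eps w = - P i ?\<beta> * eps v" if "(d, v) \<in> set ?L" for d v
  proof -
    have v: "v \<in> lists I" using L that by force
    note m = deriv_right_mset[OF that]
    have "\<gamma> i \<noteq> 0" "count (mset v) = ?\<beta>" using count_minus_letter[OF m wc] by simp_all
    then show ?thesis using eps_deriv[OF wl v i m] v by (simp add: words_def)
  qed
  have zw: "?z \<in> lspan (Uq D) (NU ` words D ?\<beta>)"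
    using Lw by (intro U.lincomb_in_lspan) auto
  have zwU: "?z \<in> Uminus D" using L by (rule lincomb_Uminus)
  have z0: "?z = \<zero>\<^bsub>Uq D\<^esub>" if "\<gamma> i = 0"
  proof -
    have "?L = []" using Lw that by (cases ?L) auto
    then show ?thesis by simp
  qed
  have Pw: "eB i \<bullet> Psi \<gamma> (NU w) = sB (P i \<gamma>) (Psi \<gamma> (NU w) \<bullet> eB i) \<^bold>+ sB (- P i ?\<beta>) (Psi ?\<beta> ?z)"
  proof -
    have "sB (- P i ?\<beta>) (Psi ?\<beta> ?z) = lincomb (Bq D) (\<lambda>v. sB (- P i ?\<beta>) (Psi ?\<beta> (NU v))) ?L"
      using L by (simp add: Psi_lincomb, subst B.smul_lincomb) (auto intro: Psi_closed NU_Uminus)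
    also have "\<dots> = lincomb (Bq D) (\<lambda>v. sB (eps w) (NB (rev v))) ?L"
    proof (intro B.lincomb_cong ballI)
      fix v assume "v \<in> snd ` set ?L"
      then obtain d where dv: "(d, v) \<in> set ?L" by auto
      then have v: "v \<in> words D ?\<beta>" "eps w = - P i ?\<beta> * eps v" using Lw by blast+
      then show "sB (- P i ?\<beta>) (Psi ?\<beta> (NU v)) = sB (eps w) (NB (rev v))"
        using wordsD[OF v(1)] by (simp add: Psi_NU)
    qed
    also have "\<dots> = sB (eps w) (lincomb (Bq D) (\<lambda>v. NB (rev v)) ?L)"
      using L by (subst B.smul_lincomb) auto
    finally have 1: "sB (- P i ?\<beta>) (Psi ?\<beta> ?z) = sB (eps w) (lincomb (Bq D) (\<lambda>v. NB (rev v)) ?L)" .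
    have "lincomb (Bq D) (\<lambda>v. NB (rev v)) ?L \<in> carrier (Bq D)"
      using L by (intro B.lincomb_closed) auto
    then show ?thesis
      unfolding 1 using wl i wc eB_NB_rev[OF i wl] pw_eq[OF wl, of i]
      by (simp add: Psi_NU[OF wl wc] B.smul_mult_right B.smul_mult_left B.smul_add mult.commute)
  qed
  have Pm: "Psi \<gamma> (sU c m \<oplus>\<^bsub>Uq D\<^esub> u) = sB c (Psi \<gamma> (NU w)) \<^bold>+ Psi \<gamma> u"
    using wl u w by (simp add: Psi_add Psi_smul smul_Uminus NU_Uminus)
  have Pz: "Psi ?\<beta> (sU c ?z \<oplus>\<^bsub>Uq D\<^esub> z) = sB c (Psi ?\<beta> ?z) \<^bold>+ Psi ?\<beta> z"
    using zU zwU by (simp add: Psi_add Psi_smul smul_Uminus)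
  have cl: "Psi \<gamma> (NU w) \<in> carrier (Bq D)" "Psi \<gamma> u \<in> carrier (Bq D)"
    "Psi ?\<beta> ?z \<in> carrier (Bq D)" "Psi ?\<beta> z \<in> carrier (Bq D)"
    using wl u zU zwU by (auto intro: Psi_closed NU_Uminus)
  show ?case
  proof (intro bexI[of _ "sU c ?z \<oplus>\<^bsub>Uq D\<^esub> z"] conjI impI ballI)
    show "sU c ?z \<oplus>\<^bsub>Uq D\<^esub> z \<in> lspan (Uq D) (NU ` words D ?\<beta>)"
      using zw z(1) by (intro U.lspan_add U.lspan_smul words_NU)
    show "sU c ?z \<oplus>\<^bsub>Uq D\<^esub> z = \<zero>\<^bsub>Uq D\<^esub>" if "\<gamma> i = 0" using z0 z(2) that by simp
    show "eB i \<bullet> Psi \<gamma> (sU c m \<oplus>\<^bsub>Uq D\<^esub> u) = sB (P i \<gamma>) (Psi \<gamma> (sU c m \<oplus>\<^bsub>Uq D\<^esub> u) \<bullet> eB i)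
        \<^bold>+ sB (- P i ?\<beta>) (Psi ?\<beta> (sU c ?z \<oplus>\<^bsub>Uq D\<^esub> z))"
    proof -
      have "eB i \<bullet> Psi \<gamma> (sU c m \<oplus>\<^bsub>Uq D\<^esub> u) = sB c (eB i \<bullet> Psi \<gamma> (NU w)) \<^bold>+ eB i \<bullet> Psi \<gamma> u"
        unfolding Pm using cl i by (simp add: B.r_distr B.smul_mult_right)
      also have "\<dots> = (sB (P i \<gamma>) (sB c (Psi \<gamma> (NU w) \<bullet> eB i)) \<^bold>+ sB (- P i ?\<beta>) (sB c (Psi ?\<beta> ?z)))
          \<^bold>+ (sB (P i \<gamma>) (Psi \<gamma> u \<bullet> eB i) \<^bold>+ sB (- P i ?\<beta>) (Psi ?\<beta> z))"
        unfolding Pw z(3) using cl i by (simp add: B.smul_add mult.commute)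
      also have "\<dots> = sB (P i \<gamma>) (Psi \<gamma> (sU c m \<oplus>\<^bsub>Uq D\<^esub> u) \<bullet> eB i)
          \<^bold>+ sB (- P i ?\<beta>) (Psi ?\<beta> (sU c ?z \<oplus>\<^bsub>Uq D\<^esub> z))"
        unfolding Pm Pz using cl i by (simp add: B.smul_add B.l_distr B.smul_mult_left B.a_ac)
      finally show ?thesis .
    qed
    show "\<omega> (x \<cdot> eU i) (sU c m \<oplus>\<^bsub>Uq D\<^esub> u) = to_ac (ef_const D i) * \<omega> x (sU c ?z \<oplus>\<^bsub>Uq D\<^esub> z)"
      if x: "x \<in> Uplus D" for x
      using x i wl u zU zwU w z(4) \<omega>_deriv_right[OF x i wl] \<omega>_lincomb_right[OF L Uplus_Uge[OF x]]
      by (simp add: \<omega>_add_right \<omega>_smul_right Uge_mult Uplus_Uge eU_Uge Uminus_Ule smul_Ule NU_Ule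
          distrib_left)
  qed
qed

text \<open>The mirror image of \<open>Psi_deriv\<close>, with the derivation adjoint to left
  multiplication by f_i. In \<Delta>(e_w) the torus sits in the first factor, which is used up by
  f_i, so the other argument may range over all of U^{<=}.\<close>

lemma phi_deriv:
  assumes \<gamma>: "\<gamma> \<in> Qplus D" and i: "i \<in> I" and x: "x \<in> Uplus_wt D \<gamma>"
  shows "\<exists>z\<in>Uplus_wt D (lower i \<gamma>). (\<gamma> i = 0 \<longrightarrow> z = \<zero>\<^bsub>Uq D\<^esub>) \<and>
    \<phi> x \<bullet> fB i = sB (P i \<gamma>) (fB i \<bullet> \<phi> x) \<^bold>+ sB (ef_const D i) (\<phi> z) \<and>
    (\<forall>y\<in>Ule D. \<omega> x (fU i \<cdot> y) = to_ac (ef_const D i) * \<omega> z y)"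
  using x unfolding Uplus_wt_eq[OF \<gamma>] Uplus_wt_eq[OF lower_Qplus[OF \<gamma>]]
proof (induction rule: lspan.induct)
  case zero
  have "\<omega> \<zero>\<^bsub>Uq D\<^esub> (fU i \<cdot> y) = to_ac (ef_const D i) * \<omega> \<zero>\<^bsub>Uq D\<^esub> y" if "y \<in> Ule D" for y
    using that i by (simp add: \<omega>_zero Ule_mult fU_Ule)
  then show ?case
    using i by (intro bexI[OF _ lspan.zero]) (simp add: phi_zero)
next
  case (step m u c)
  let ?\<beta> = "lower i \<gamma>"
  obtain w where w: "w \<in> words D \<gamma>" "m = MU w" using step.hyps(1) by auto
  note wl = wordsD(1)[OF w(1)] and wc = wordsD(2)[OF w(1)]
  have u: "u \<in> Uplus D" using step.hyps(2) Uplus_wt_eq[OF \<gamma>] Up_Uplus by blast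
  from step.IH obtain z where z: "z \<in> lspan (Uq D) (MU ` words D ?\<beta>)" "\<gamma> i = 0 \<longrightarrow> z = \<zero>\<^bsub>Uq D\<^esub>"
    "\<phi> u \<bullet> fB i = sB (P i \<gamma>) (fB i \<bullet> \<phi> u) \<^bold>+ sB (ef_const D i) (\<phi> z)"
    "\<forall>y\<in>Ule D. \<omega> u (fU i \<cdot> y) = to_ac (ef_const D i) * \<omega> z y" by (elim bexE conjE) (rule that)
  have zU: "z \<in> Uplus D" using z(1) Uplus_wt_eq[OF lower_Qplus[OF \<gamma>]] Up_Uplus by blast
  let ?L = "deriv_left D i w"
  let ?z = "lincomb (Uq D) MU ?L"
  have L: "\<forall>v\<in>snd ` set ?L. v \<in> lists I" using deriv_left_closed[OF wl] by auto
  have Lw: "\<gamma> i \<noteq> 0 \<and> v \<in> words D ?\<beta>" if "(d, v) \<in> set ?L" for d v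
  proof -
    have v: "v \<in> lists I" using L that by force
    have "\<gamma> i \<noteq> 0" "count (mset v) = ?\<beta>"
      using count_minus_letter[OF deriv_left_mset[OF that] wc] by simp_all
    then show ?thesis using v by (simp add: words_def)
  qed
  have zw: "?z \<in> lspan (Uq D) (MU ` words D ?\<beta>)"
    using Lw by (intro U.lincomb_in_lspan) auto
  have zwU: "?z \<in> Uplus D" using L by (rule lincomb_Uplus)
  have z0: "?z = \<zero>\<^bsub>Uq D\<^esub>" if "\<gamma> i = 0"
  proof -
    have "?L = []" using Lw that by (cases ?L) auto
    then show ?thesis by simp
  qed
  have Pw: "\<phi> (MU w) \<bullet> fB i = sB (P i \<gamma>) (fB i \<bullet> \<phi> (MU w)) \<^bold>+ sB (ef_const D i) (\<phi> ?z)"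
    using phi_MU_fB[OF i wl] pw_eq[OF wl, of i] wc phi_lincomb[OF L] by simp
  have Pm: "\<phi> (sU c m \<oplus>\<^bsub>Uq D\<^esub> u) = sB c (\<phi> (MU w)) \<^bold>+ \<phi> u"
    using wl u w by (simp add: phi_add phi_smul smul_Uge MU_Uge Uplus_Uge)
  have Pz: "\<phi> (sU c ?z \<oplus>\<^bsub>Uq D\<^esub> z) = sB c (\<phi> ?z) \<^bold>+ \<phi> z"
    using zU zwU by (simp add: phi_add phi_smul smul_Uge Uplus_Uge)
  have cl: "\<phi> (MU w) \<in> carrier (Bq D)" "\<phi> u \<in> carrier (Bq D)" "\<phi> ?z \<in> carrier (Bq D)" "\<phi> z \<in> carrier (Bq D)"
    using wl u zU zwU by (auto simp: MU_Uge Uplus_Uge)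
  show ?case
  proof (intro bexI[of _ "sU c ?z \<oplus>\<^bsub>Uq D\<^esub> z"] conjI impI ballI)
    show "sU c ?z \<oplus>\<^bsub>Uq D\<^esub> z \<in> lspan (Uq D) (MU ` words D ?\<beta>)"
      using zw z(1) by (intro U.lspan_add U.lspan_smul words_MU)
    show "sU c ?z \<oplus>\<^bsub>Uq D\<^esub> z = \<zero>\<^bsub>Uq D\<^esub>" if "\<gamma> i = 0" using z0 z(2) that by simp
    have "\<phi> (sU c m \<oplus>\<^bsub>Uq D\<^esub> u) \<bullet> fB i = sB c (\<phi> (MU w) \<bullet> fB i) \<^bold>+ \<phi> u \<bullet> fB i"
      unfolding Pm using cl i by (simp add: B.l_distr B.smul_mult_left)
    also have "\<dots> = (sB (P i \<gamma>) (sB c (fB i \<bullet> \<phi> (MU w))) \<^bold>+ sB (ef_const D i) (sB c (\<phi> ?z)))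
        \<^bold>+ (sB (P i \<gamma>) (fB i \<bullet> \<phi> u) \<^bold>+ sB (ef_const D i) (\<phi> z))"
      unfolding Pw z(3) using cl i by (simp add: B.smul_add mult.commute)
    also have "\<dots> = sB (P i \<gamma>) (fB i \<bullet> \<phi> (sU c m \<oplus>\<^bsub>Uq D\<^esub> u)) \<^bold>+ sB (ef_const D i) (\<phi> (sU c ?z \<oplus>\<^bsub>Uq D\<^esub> z))"
      unfolding Pm Pz using cl i by (simp add: B.smul_add B.r_distr B.smul_mult_right B.a_ac)
    finally show "\<phi> (sU c m \<oplus>\<^bsub>Uq D\<^esub> u) \<bullet> fB i = sB (P i \<gamma>) (fB i \<bullet> \<phi> (sU c m \<oplus>\<^bsub>Uq D\<^esub> u))
        \<^bold>+ sB (ef_const D i) (\<phi> (sU c ?z \<oplus>\<^bsub>Uq D\<^esub> z))" .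
    show "\<omega> (sU c m \<oplus>\<^bsub>Uq D\<^esub> u) (fU i \<cdot> y) = to_ac (ef_const D i) * \<omega> (sU c ?z \<oplus>\<^bsub>Uq D\<^esub> z) y"
      if y: "y \<in> Ule D" for y
      using y i wl u zU zwU w z(4) \<omega>_deriv_left[OF y i wl] \<omega>_lincomb_left[OF L y]
      by (simp add: \<omega>_add_left \<omega>_smul_left Ule_mult Uplus_Uge fU_Ule smul_Uge MU_Uge distrib_left)
  qed
qed

end

section \<open>Expansions in dual bases and the products of a component with e''_i and f_i\<close>

context projector_data
begin

text \<open>\<open>Psi\<close> reverses words, so multiplication by f_i changes sides; the scalar is
  the ratio of \<open>word_sign\<close> at \<open>i # w\<close> and at \<open>w\<close>, constant on
  the weight space.\<close>

lemma Psi_raise: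
  assumes \<beta>: "\<beta> \<in> Qplus D" and i: "i \<in> I" and y: "y \<in> Uminus_wt D \<beta>"
  shows "fU i \<cdot> y \<in> Uminus_wt D (\<beta>(i := Suc (\<beta> i))) \<and>
    Psi (\<beta>(i := Suc (\<beta> i))) (fU i \<cdot> y) = sB (- P i \<beta>) (Psi \<beta> y \<bullet> fB i)"
proof -
  define \<gamma> where "\<gamma> = \<beta>(i := Suc (\<beta> i))"
  have \<gamma>: "\<gamma> \<in> Qplus D" using \<beta> i by (auto simp: \<gamma>_def Qplus_def)
  show ?thesis
    using y unfolding \<gamma>_def[symmetric] Uminus_wt_eq[OF \<beta>] Uminus_wt_eq[OF \<gamma>]
  proof (induction rule: lspan.induct)
    case zero
    then show ?case using i by (simp add: lspan.zero Psi_zero)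
  next
    case (step m u c)
    then obtain w where w: "w \<in> words D \<beta>" "m = NU w" by auto
    note wl = wordsD(1)[OF w(1)] and wc = wordsD(2)[OF w(1)]
    have iw: "i # w \<in> lists I" "count (mset (i # w)) = \<gamma>" using wl wc i by (auto simp: \<gamma>_def)
    have u: "u \<in> Uminus D" using step.hyps(2) Uminus_wt_eq[OF \<beta>] Um_Uminus by blast
    have fu: "fU i \<cdot> u \<in> Uminus D" using step.IH Uminus_wt_eq[OF \<gamma>] Um_Uminus by blast
    have uc: "u \<in> carrier (Uq D)" using u Uminus_Ule Ule_carrier by blast
    have eq: "fU i \<cdot> (sU c m \<oplus>\<^bsub>Uq D\<^esub> u) = sU c (NU (i # w)) \<oplus>\<^bsub>Uq D\<^esub> fU i \<cdot> u"
      using w wl uc i by (simp add: U.r_distr U.smul_mult_right)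
    have "NU (i # w) \<in> NU ` words D \<gamma>" using iw by (simp add: words_def del: mon.simps)
    then have "fU i \<cdot> (sU c m \<oplus>\<^bsub>Uq D\<^esub> u) \<in> lspan (Uq D) (NU ` words D \<gamma>)"
      unfolding eq using step.IH by (intro lspan.step) simp_all
    moreover have "Psi \<gamma> (fU i \<cdot> (sU c m \<oplus>\<^bsub>Uq D\<^esub> u))
        = sB c (Psi \<gamma> (NU (i # w))) \<^bold>+ Psi \<gamma> (fU i \<cdot> u)"
      unfolding eq using fu NU_Uminus[OF iw(1)]
      by (simp add: Psi_add Psi_smul smul_Uminus del: mon.simps)
    moreover have "Psi \<gamma> (NU (i # w)) = sB (- P i \<beta>) (Psi \<beta> (NU w) \<bullet> fB i)"
    proof -
      have "NB (rev (i # w)) = NB (rev w) \<bullet> fB i" using wl i by (simp add: Bf.mon_g_append)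
      then show ?thesis
        using Psi_NU[OF iw] Psi_NU[OF wl wc] wl wc i pw_eq[OF wl, of i]
        by (simp add: B.smul_mult_left del: mon.simps rev.simps)
    qed
    moreover have "Psi \<beta> (sU c m \<oplus>\<^bsub>Uq D\<^esub> u) = sB c (Psi \<beta> (NU w)) \<^bold>+ Psi \<beta> u"
      using w wl u by (simp add: Psi_add Psi_smul smul_Uminus NU_Uminus)
    ultimately show ?case
      using step.IH i u wl
      by (simp add: Psi_closed NU_Uminus B.l_distr B.smul_mult_left B.smul_add mult.commute)
  qed
qed

lemma phi_raise:
  assumes \<beta>: "\<beta> \<in> Qplus D" and i: "i \<in> I" and x: "x \<in> Uplus_wt D \<beta>"
  shows "x \<cdot> eU i \<in> Uplus_wt D (\<beta>(i := Suc (\<beta> i)))"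
proof -
  define \<gamma> where "\<gamma> = \<beta>(i := Suc (\<beta> i))"
  have \<gamma>: "\<gamma> \<in> Qplus D" using \<beta> i by (auto simp: \<gamma>_def Qplus_def)
  show ?thesis
    using x unfolding \<gamma>_def[symmetric] Uplus_wt_eq[OF \<beta>] Uplus_wt_eq[OF \<gamma>]
  proof (induction rule: lspan.induct)
    case zero
    then show ?case using i by (simp add: lspan.zero)
  next
    case (step m u c)
    then obtain w where w: "w \<in> words D \<beta>" "m = MU w" by auto
    note wl = wordsD(1)[OF w(1)] and wc = wordsD(2)[OF w(1)]
    have iw: "w @ [i] \<in> lists I" "count (mset (w @ [i])) = \<gamma>" using wl wc i by (auto simp: \<gamma>_def)
    have "u \<in> Uplus D" using step.hyps(2) Uplus_wt_eq[OF \<beta>] Up_Uplus by blast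
    then have uc: "u \<in> carrier (Uq D)" using Uplus_Uge Uge_carrier by blast
    have eq: "(sU c m \<oplus>\<^bsub>Uq D\<^esub> u) \<cdot> eU i = sU c (MU (w @ [i])) \<oplus>\<^bsub>Uq D\<^esub> u \<cdot> eU i"
      using w wl uc i by (simp add: U.l_distr U.smul_mult_left Ue.mon_g_append)
    have "MU (w @ [i]) \<in> MU ` words D \<gamma>" using iw by (simp add: words_def del: mon.simps)
    then show ?case unfolding eq using step.IH by (intro lspan.step) simp_all
  qed
qed

lemma Psi_Bminus: "\<beta> \<in> Qplus D \<Longrightarrow> y \<in> Uminus_wt D \<beta> \<Longrightarrow> Psi \<beta> y \<in> Bminus D"
proof -
  assume \<beta>: "\<beta> \<in> Qplus D" and y: "y \<in> Uminus_wt D \<beta>"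
  show ?thesis
    using y unfolding Uminus_wt_eq[OF \<beta>]
  proof (induction rule: lspan.induct)
    case zero
    then show ?case by (simp add: Psi_zero Bminus_def B.subalg_zero)
  next
    case (step m u c)
    then obtain w where w: "w \<in> words D \<beta>" "m = NU w" by auto
    note wl = wordsD(1)[OF w(1)] and wc = wordsD(2)[OF w(1)]
    have u: "u \<in> Uminus D" using step.hyps(2) Uminus_wt_eq[OF \<beta>] Um_Uminus by blast
    have "NB (rev w) \<in> Bminus D"
      unfolding Bminus_def using wl
      by (intro B.subalg_mon B.subalg_incl) (auto simp: in_lists_conv_set)
    then show ?case
      using step.IH u w wl Psi_NU[OF wl wc]
      by (simp add: Psi_add Psi_smul smul_Uminus NU_Uminus Bminus_def B.subalg_add B.subalg_smul)
  qed
qed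

lemma phi_Bplus_wt: "\<beta> \<in> Qplus D \<Longrightarrow> x \<in> Uplus_wt D \<beta> \<Longrightarrow> \<phi> x \<in> Bplus_wt D \<beta>"
proof -
  assume \<beta>: "\<beta> \<in> Qplus D" and x: "x \<in> Uplus_wt D \<beta>"
  have M: "MB ` words D \<beta> \<subseteq> carrier (Bq D)" by (auto simp: words_def)
  show ?thesis
    using x unfolding Uplus_wt_eq[OF \<beta>] Bplus_wt_eq[OF \<beta>]
  proof (induction rule: lspan.induct)
    case zero
    then show ?case by (simp add: phi_zero lspan.zero)
  next
    case (step m u c)
    then obtain w where w: "w \<in> words D \<beta>" "m = MU w" by auto
    note wl = wordsD(1)[OF w(1)] and wc = wordsD(2)[OF w(1)]
    have u: "u \<in> Uplus D" using step.hyps(2) Uplus_wt_eq[OF \<beta>] Up_Uplus by blast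
    have "MB (rev w) \<in> MB ` words D \<beta>" using wl wc by (simp add: words_def)
    then have "\<phi> (MU w) \<in> lspan (Bq D) (MB ` words D \<beta>)"
      unfolding phi_MU_B[OF wl] by (intro B.lspan_smul[OF M] B.lspan_incl[OF M])
    then show ?case
      using step.IH u w wl
      by (simp add: phi_add phi_smul smul_Uge MU_Uge Uplus_Uge B.lspan_add[OF M] B.lspan_smul[OF M])
  qed
qed

abbreviation "dimw \<beta> \<equiv> length (xs \<beta>)"
abbreviation "Xb \<beta> r \<equiv> xs \<beta> ! r"
abbreviation "Yb \<beta> r \<equiv> ys \<beta> ! r"

lemma bases:
  assumes "\<beta> \<in> Qplus D"
  shows "set (xs \<beta>) \<subseteq> carrier (Uq D)" "set (ys \<beta>) \<subseteq> carrier (Uq D)"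
    "U.Span (range (scal (Uq D))) (xs \<beta>) = Uplus_wt D \<beta>"
    "U.Span (range (scal (Uq D))) (ys \<beta>) = Uminus_wt D \<beta>"
    "length (ys \<beta>) = dimw \<beta>"
    "r < dimw \<beta> \<Longrightarrow> s < dimw \<beta> \<Longrightarrow> \<omega> (Xb \<beta> r) (Yb \<beta> s) = (if r = s then 1 else 0)"
proof -
  have b: "basis_list (Uq D) (Uplus_wt D \<beta>) (xs \<beta>)" "basis_list (Uq D) (Uminus_wt D \<beta>) (ys \<beta>)"
    "length (ys \<beta>) = dimw \<beta>"
    "\<forall>r<dimw \<beta>. \<forall>s<length (ys \<beta>). \<omega> (Xb \<beta> r) (Yb \<beta> s) = (if r = s then 1 else 0)"
    using dual assms unfolding dual_bases_def by blast+
  show "set (xs \<beta>) \<subseteq> carrier (Uq D)" "set (ys \<beta>) \<subseteq> carrier (Uq D)"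
    using b(1,2) U.independent_in_carrier unfolding basis_list_def by blast+
  show "U.Span (range (scal (Uq D))) (xs \<beta>) = Uplus_wt D \<beta>"
    "U.Span (range (scal (Uq D))) (ys \<beta>) = Uminus_wt D \<beta>"
    using b(1,2) unfolding basis_list_def by blast+
  show "length (ys \<beta>) = dimw \<beta>" by (rule b(3))
  show "r < dimw \<beta> \<Longrightarrow> s < dimw \<beta> \<Longrightarrow> \<omega> (Xb \<beta> r) (Yb \<beta> s) = (if r = s then 1 else 0)"
    using b(3,4) by simp
qed

lemma X_wt: "\<beta> \<in> Qplus D \<Longrightarrow> r < dimw \<beta> \<Longrightarrow> Xb \<beta> r \<in> Uplus_wt D \<beta>"
  using U.set_subset_Span[OF bases(1), of \<beta>] bases(3)[of \<beta>] nth_mem[of r "xs \<beta>"] by blast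

lemma Y_wt: "\<beta> \<in> Qplus D \<Longrightarrow> r < dimw \<beta> \<Longrightarrow> Yb \<beta> r \<in> Uminus_wt D \<beta>"
  using U.set_subset_Span[OF bases(2), of \<beta>] bases(4,5)[of \<beta>] nth_mem[of r "ys \<beta>"] by auto

lemma X_Uplus: "\<beta> \<in> Qplus D \<Longrightarrow> r < dimw \<beta> \<Longrightarrow> Xb \<beta> r \<in> Uplus D"
  and Y_Uminus: "\<beta> \<in> Qplus D \<Longrightarrow> r < dimw \<beta> \<Longrightarrow> Yb \<beta> r \<in> Uminus D"
  by (meson X_wt Up_Uplus) (meson Y_wt Um_Uminus)

lemma sum_Uminus: "finite F \<Longrightarrow> (\<And>r. r \<in> F \<Longrightarrow> f r \<in> Uminus D) \<Longrightarrow> (\<Oplus>\<^bsub>Uq D\<^esub>r\<in>F. f r) \<in> Uminus D"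
proof (induction F rule: finite_induct)
  case (insert x F)
  then have "f \<in> F \<rightarrow> carrier (Uq D)" "f x \<in> carrier (Uq D)"
    using Uminus_Ule Ule_carrier by blast+
  then show ?case using insert by (simp add: add_Uminus)
qed (simp add: zero_Uminus)

lemma sum_Uplus: "finite F \<Longrightarrow> (\<And>r. r \<in> F \<Longrightarrow> f r \<in> Uplus D) \<Longrightarrow> (\<Oplus>\<^bsub>Uq D\<^esub>r\<in>F. f r) \<in> Uplus D"
proof (induction F rule: finite_induct)
  case (insert x F)
  then have "f \<in> F \<rightarrow> carrier (Uq D)" "f x \<in> carrier (Uq D)"
    using Uplus_Uge Uge_carrier by blast+
  then show ?case using insert by (simp add: add_Uplus)
qed (simp add: zero_Uplus)

lemma Psi_sum:
  "finite F \<Longrightarrow> (\<And>r. r \<in> F \<Longrightarrow> y r \<in> Uminus D) \<Longrightarrow>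
    Psi \<beta> (\<Oplus>\<^bsub>Uq D\<^esub>r\<in>F. sU (d r) (y r)) = (\<Oplus>\<^bsub>Bq D\<^esub>r\<in>F. sB (d r) (Psi \<beta> (y r)))"
proof (induction F rule: finite_induct)
  case (insert x F)
  have "(\<lambda>r. sU (d r) (y r)) \<in> F \<rightarrow> carrier (Uq D)" "sU (d x) (y x) \<in> carrier (Uq D)"
    using insert.prems Uminus_Ule Ule_carrier smul_Uminus by blast+
  moreover have "(\<lambda>r. sB (d r) (Psi \<beta> (y r))) \<in> F \<rightarrow> carrier (Bq D)"
    "sB (d x) (Psi \<beta> (y x)) \<in> carrier (Bq D)"
    using insert.prems by (auto simp: Psi_closed)
  ultimately show ?case
    using insert by (simp add: Psi_add Psi_smul smul_Uminus sum_Uminus)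
qed (simp add: Psi_zero)

lemma phi_sum:
  "finite F \<Longrightarrow> (\<And>r. r \<in> F \<Longrightarrow> x r \<in> Uplus D) \<Longrightarrow>
    \<phi> (\<Oplus>\<^bsub>Uq D\<^esub>r\<in>F. sU (d r) (x r)) = (\<Oplus>\<^bsub>Bq D\<^esub>r\<in>F. sB (d r) (\<phi> (x r)))"
proof (induction F rule: finite_induct)
  case (insert a F)
  have "(\<lambda>r. sU (d r) (x r)) \<in> F \<rightarrow> carrier (Uq D)" "sU (d a) (x a) \<in> carrier (Uq D)"
    using insert.prems Uplus_Uge Uge_carrier smul_Uplus by blast+
  moreover have "(\<lambda>r. sB (d r) (\<phi> (x r))) \<in> F \<rightarrow> carrier (Bq D)"
    "sB (d a) (\<phi> (x a)) \<in> carrier (Bq D)"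
    using insert.prems by (auto simp: Uplus_Uge)
  ultimately show ?case
    using insert by (simp add: phi_add phi_smul smul_Uge sum_Uplus Uplus_Uge smul_Uplus)
qed (simp add: phi_zero)

lemma \<omega>_sum_right:
  "finite F \<Longrightarrow> (\<And>r. r \<in> F \<Longrightarrow> y r \<in> Uminus D) \<Longrightarrow> x \<in> Uge D \<Longrightarrow>
    \<omega> x (\<Oplus>\<^bsub>Uq D\<^esub>r\<in>F. sU (d r) (y r)) = (\<Sum>r\<in>F. to_ac (d r) * \<omega> x (y r))"
proof (induction F rule: finite_induct)
  case (insert a F)
  have "(\<lambda>r. sU (d r) (y r)) \<in> F \<rightarrow> carrier (Uq D)" "sU (d a) (y a) \<in> carrier (Uq D)"
    using insert.prems Uminus_Ule Ule_carrier smul_Uminus by blast+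
  then show ?case
    using insert by (simp add: \<omega>_add_right \<omega>_smul_right smul_Ule Uminus_Ule sum_Uminus smul_Uminus)
qed (simp add: \<omega>_zero)

lemma \<omega>_sum_left:
  "finite F \<Longrightarrow> (\<And>r. r \<in> F \<Longrightarrow> x r \<in> Uplus D) \<Longrightarrow> y \<in> Ule D \<Longrightarrow>
    \<omega> (\<Oplus>\<^bsub>Uq D\<^esub>r\<in>F. sU (d r) (x r)) y = (\<Sum>r\<in>F. to_ac (d r) * \<omega> (x r) y)"
proof (induction F rule: finite_induct)
  case (insert a F)
  have "(\<lambda>r. sU (d r) (x r)) \<in> F \<rightarrow> carrier (Uq D)" "sU (d a) (x a) \<in> carrier (Uq D)"
    using insert.prems Uplus_Uge Uge_carrier smul_Uplus by blast+
  then show ?case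
    using insert by (simp add: \<omega>_add_left \<omega>_smul_left smul_Uge Uplus_Uge sum_Uplus smul_Uplus)
qed (simp add: \<omega>_zero)

text \<open>The coefficients come from the span and so lie in Q(q); pairing with the dual basis then
  identifies their images under \<open>to_ac\<close>. In this way values of the form, which a priori
  lie in the algebraic closure, become scalars of the algebra.\<close>

lemma expand_minus:
  assumes \<beta>: "\<beta> \<in> Qplus D" and y: "y \<in> Uminus_wt D \<beta>"
  shows "\<exists>d. y = (\<Oplus>\<^bsub>Uq D\<^esub>r\<in>{..<dimw \<beta>}. sU (d r) (Yb \<beta> r)) \<and> (\<forall>r<dimw \<beta>. to_ac (d r) = \<omega> (Xb \<beta> r) y)"
proof -
  obtain d where d: "y = (\<Oplus>\<^bsub>Uq D\<^esub>r\<in>{..<dimw \<beta>}. sU (d r) (Yb \<beta> r))"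
    using U.Span_coefficients[OF bases(2)[OF \<beta>], of y] bases(4,5)[OF \<beta>] y by auto
  have "\<omega> (Xb \<beta> s) y = to_ac (d s)" if s: "s < dimw \<beta>" for s
  proof -
    have "\<omega> (Xb \<beta> s) y = (\<Sum>r\<in>{..<dimw \<beta>}. to_ac (d r) * \<omega> (Xb \<beta> s) (Yb \<beta> r))"
      unfolding d using \<beta> s by (intro \<omega>_sum_right) (simp_all add: Y_Uminus X_Uplus Uplus_Uge)
    also have "\<dots> = (\<Sum>r\<in>{..<dimw \<beta>}. if s = r then to_ac (d r) else 0)"
      using \<beta> s bases(6) by (intro sum.cong) auto
    finally show ?thesis using s by simp
  qed
  then show ?thesis using d by (intro exI[of _ d]) simp
qed

lemma expand_plus:
  assumes \<beta>: "\<beta> \<in> Qplus D" and x: "x \<in> Uplus_wt D \<beta>"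
  shows "\<exists>d. x = (\<Oplus>\<^bsub>Uq D\<^esub>r\<in>{..<dimw \<beta>}. sU (d r) (Xb \<beta> r)) \<and> (\<forall>r<dimw \<beta>. to_ac (d r) = \<omega> x (Yb \<beta> r))"
proof -
  obtain d where d: "x = (\<Oplus>\<^bsub>Uq D\<^esub>r\<in>{..<dimw \<beta>}. sU (d r) (Xb \<beta> r))"
    using U.Span_coefficients[OF bases(1)[OF \<beta>], of x] bases(3)[OF \<beta>] x by auto
  have "\<omega> x (Yb \<beta> s) = to_ac (d s)" if s: "s < dimw \<beta>" for s
  proof -
    have "\<omega> x (Yb \<beta> s) = (\<Sum>r\<in>{..<dimw \<beta>}. to_ac (d r) * \<omega> (Xb \<beta> r) (Yb \<beta> s))"
      unfolding d using \<beta> s by (intro \<omega>_sum_left) (simp_all add: Y_Uminus X_Uplus Uminus_Ule)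
    also have "\<dots> = (\<Sum>r\<in>{..<dimw \<beta>}. if s = r then to_ac (d r) else 0)"
      using \<beta> s bases(6) by (intro sum.cong) auto
    finally show ?thesis using s by simp
  qed
  then show ?thesis using d by (intro exI[of _ d]) simp
qed

definition comp :: "('i \<Rightarrow> nat) \<Rightarrow> ('i, 't) ncpoly set"
  where "comp \<beta> = (\<Oplus>\<^bsub>Bq D\<^esub>r\<in>{..<dimw \<beta>}. Psi \<beta> (Yb \<beta> r) \<bullet> \<phi> (Xb \<beta> r))"

text \<open>The component of weight \<beta> with \<open>g\<close> inserted between its two halves.
  For g = e''_i or g = f_i this is what remains of the product with the component once
  \<open>g\<close> has crossed the outer half without being absorbed.\<close>

definition ins :: "('i, 't) ncpoly set \<Rightarrow> 'i \<Rightarrow> ('i \<Rightarrow> nat) \<Rightarrow> ('i, 't) ncpoly set"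
  where "ins g i \<beta> = sB (P i \<beta>) (\<Oplus>\<^bsub>Bq D\<^esub>r\<in>{..<dimw \<beta>}. Psi \<beta> (Yb \<beta> r) \<bullet> (g \<bullet> \<phi> (Xb \<beta> r)))"

lemma Psi_Y_closed [simp]: "\<beta> \<in> Qplus D \<Longrightarrow> r < dimw \<beta> \<Longrightarrow> Psi m (Yb \<beta> r) \<in> carrier (Bq D)"
  and phi_X_closed [simp]: "\<beta> \<in> Qplus D \<Longrightarrow> r < dimw \<beta> \<Longrightarrow> \<phi> (Xb \<beta> r) \<in> carrier (Bq D)"
  by (simp_all add: Psi_closed Y_Uminus X_Uplus Uplus_Uge)

lemma comp_closed [simp]: "\<beta> \<in> Qplus D \<Longrightarrow> comp \<beta> \<in> carrier (Bq D)"
  by (auto simp: comp_def)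

lemma ins_closed [simp]: "\<beta> \<in> Qplus D \<Longrightarrow> g \<in> carrier (Bq D) \<Longrightarrow> ins g i \<beta> \<in> carrier (Bq D)"
  by (auto simp: ins_def)

lemma raise_lower: "\<gamma> i \<noteq> 0 \<Longrightarrow> (lower i \<gamma>)(i := Suc (lower i \<gamma> i)) = \<gamma>"
  by auto

text \<open>Where e''_i is absorbed, the sum of Psi(z_s) \<phi>(x_s) arises, with z_s the derivative
  of y_s. Expanding z_s in the y_r of lower weight gives coefficients <x_r, z_s>. Expanding x_r e_i
  in the x_s gives <x_r e_i, y_s>, which by adjointness is a constant multiple of them. Exchanging
  the two sums turns the absorbed part into minus the insertion one step lower.\<close>

theorem eB_comp:
  assumes \<gamma>: "\<gamma> \<in> Qplus D" and i: "i \<in> I"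
  shows "eB i \<bullet> comp \<gamma> = ins (eB i) i \<gamma> \<^bold>+
    (if \<gamma> i = 0 then \<zero>\<^bsub>Bq D\<^esub> else \<ominus>\<^bsub>Bq D\<^esub> ins (eB i) i (lower i \<gamma>))"
proof -
  let ?\<beta> = "lower i \<gamma>" and ?n = "{..<dimw \<gamma>}" and ?m = "{..<dimw (lower i \<gamma>)}"
  have \<beta>: "?\<beta> \<in> Qplus D" by (rule lower_Qplus[OF \<gamma>])
  have "\<forall>s. \<exists>z. s < dimw \<gamma> \<longrightarrow> z \<in> Uminus_wt D ?\<beta> \<and> (\<gamma> i = 0 \<longrightarrow> z = \<zero>\<^bsub>Uq D\<^esub>) \<and>
    eB i \<bullet> Psi \<gamma> (Yb \<gamma> s) = sB (P i \<gamma>) (Psi \<gamma> (Yb \<gamma> s) \<bullet> eB i) \<^bold>+ sB (- P i ?\<beta>) (Psi ?\<beta> z) \<and>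
    (\<forall>x\<in>Uplus D. \<omega> (x \<cdot> eU i) (Yb \<gamma> s) = to_ac (ef_const D i) * \<omega> x z)"
    using Psi_deriv[OF \<gamma> i Y_wt[OF \<gamma>]] by blast
  then obtain z where z: "\<And>s. s < dimw \<gamma> \<Longrightarrow> z s \<in> Uminus_wt D ?\<beta>"
    "\<And>s. s < dimw \<gamma> \<Longrightarrow> \<gamma> i = 0 \<Longrightarrow> z s = \<zero>\<^bsub>Uq D\<^esub>"
    "\<And>s. s < dimw \<gamma> \<Longrightarrow> eB i \<bullet> Psi \<gamma> (Yb \<gamma> s)
      = sB (P i \<gamma>) (Psi \<gamma> (Yb \<gamma> s) \<bullet> eB i) \<^bold>+ sB (- P i ?\<beta>) (Psi ?\<beta> (z s))"
    "\<And>s x. s < dimw \<gamma> \<Longrightarrow> x \<in> Uplus D \<Longrightarrow> \<omega> (x \<cdot> eU i) (Yb \<gamma> s) = to_ac (ef_const D i) * \<omega> x (z s)"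
    using choice[of "\<lambda>s z. s < dimw \<gamma> \<longrightarrow> z \<in> Uminus_wt D ?\<beta> \<and> (\<gamma> i = 0 \<longrightarrow> z = \<zero>\<^bsub>Uq D\<^esub>) \<and>
      eB i \<bullet> Psi \<gamma> (Yb \<gamma> s) = sB (P i \<gamma>) (Psi \<gamma> (Yb \<gamma> s) \<bullet> eB i) \<^bold>+ sB (- P i ?\<beta>) (Psi ?\<beta> z) \<and>
      (\<forall>x\<in>Uplus D. \<omega> (x \<cdot> eU i) (Yb \<gamma> s) = to_ac (ef_const D i) * \<omega> x z)"] by blast
  have zc: "Psi ?\<beta> (z s) \<in> carrier (Bq D)" if "s < dimw \<gamma>" for s
    using z(1)[OF that] Um_Uminus Psi_closed by blast
  let ?R = "\<Oplus>\<^bsub>Bq D\<^esub>s\<in>?n. Psi ?\<beta> (z s) \<bullet> \<phi> (Xb \<gamma> s)"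
  have "eB i \<bullet> comp \<gamma> = (\<Oplus>\<^bsub>Bq D\<^esub>s\<in>?n. eB i \<bullet> (Psi \<gamma> (Yb \<gamma> s) \<bullet> \<phi> (Xb \<gamma> s)))"
    unfolding comp_def using \<gamma> i by (intro B.finsum_rdistr) auto
  also have "\<dots> = (\<Oplus>\<^bsub>Bq D\<^esub>s\<in>?n. sB (P i \<gamma>) (Psi \<gamma> (Yb \<gamma> s) \<bullet> (eB i \<bullet> \<phi> (Xb \<gamma> s)))
      \<^bold>+ sB (- P i ?\<beta>) (Psi ?\<beta> (z s) \<bullet> \<phi> (Xb \<gamma> s)))"
  proof (intro B.finsum_cong')
    fix s assume "s \<in> ?n"
    then have s: "s < dimw \<gamma>" by simp
    have "eB i \<bullet> (Psi \<gamma> (Yb \<gamma> s) \<bullet> \<phi> (Xb \<gamma> s)) = (eB i \<bullet> Psi \<gamma> (Yb \<gamma> s)) \<bullet> \<phi> (Xb \<gamma> s)"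
      using s \<gamma> i by (simp add: B.m_assoc)
    then show "eB i \<bullet> (Psi \<gamma> (Yb \<gamma> s) \<bullet> \<phi> (Xb \<gamma> s)) = sB (P i \<gamma>) (Psi \<gamma> (Yb \<gamma> s) \<bullet> (eB i \<bullet> \<phi> (Xb \<gamma> s)))
      \<^bold>+ sB (- P i ?\<beta>) (Psi ?\<beta> (z s) \<bullet> \<phi> (Xb \<gamma> s))"
      unfolding z(3)[OF s] using s \<gamma> i zc[OF s] by (simp add: B.l_distr B.smul_mult_left B.m_assoc)
  qed (use \<gamma> i zc in auto)
  also have "\<dots> = (\<Oplus>\<^bsub>Bq D\<^esub>s\<in>?n. sB (P i \<gamma>) (Psi \<gamma> (Yb \<gamma> s) \<bullet> (eB i \<bullet> \<phi> (Xb \<gamma> s))))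
      \<^bold>+ (\<Oplus>\<^bsub>Bq D\<^esub>s\<in>?n. sB (- P i ?\<beta>) (Psi ?\<beta> (z s) \<bullet> \<phi> (Xb \<gamma> s)))"
    using \<gamma> i zc by (intro B.finsum_addf) auto
  also have "\<dots> = ins (eB i) i \<gamma> \<^bold>+ sB (- P i ?\<beta>) ?R"
    unfolding ins_def using \<gamma> i zc by (subst (1 2) B.smul_finsum) auto
  finally have main: "eB i \<bullet> comp \<gamma> = ins (eB i) i \<gamma> \<^bold>+ sB (- P i ?\<beta>) ?R" .
  show ?thesis
  proof (cases "\<gamma> i = 0")
    case True
    have "?R = (\<Oplus>\<^bsub>Bq D\<^esub>s\<in>?n. \<zero>\<^bsub>Bq D\<^esub>)"
      using z(2) True \<gamma> by (intro B.finsum_cong') (auto simp: Psi_zero)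
    then show ?thesis using main True by simp
  next
    case False
    define c where "c = ef_const D i"
    have c: "c \<noteq> 0" unfolding c_def by (rule ef_const_nonzero[OF i])
    have "\<forall>s. \<exists>d. s < dimw \<gamma> \<longrightarrow> z s = (\<Oplus>\<^bsub>Uq D\<^esub>r\<in>?m. sU (d r) (Yb ?\<beta> r)) \<and>
        (\<forall>r<dimw ?\<beta>. to_ac (d r) = \<omega> (Xb ?\<beta> r) (z s))"
      using expand_minus[OF \<beta> z(1)] by blast
    then obtain d where d: "\<And>s. s < dimw \<gamma> \<Longrightarrow> z s = (\<Oplus>\<^bsub>Uq D\<^esub>r\<in>?m. sU (d s r) (Yb ?\<beta> r))"
      "\<And>s r. s < dimw \<gamma> \<Longrightarrow> r < dimw ?\<beta> \<Longrightarrow> to_ac (d s r) = \<omega> (Xb ?\<beta> r) (z s)"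
      using choice[of "\<lambda>s d. s < dimw \<gamma> \<longrightarrow> z s = (\<Oplus>\<^bsub>Uq D\<^esub>r\<in>?m. sU (d r) (Yb ?\<beta> r)) \<and>
        (\<forall>r<dimw ?\<beta>. to_ac (d r) = \<omega> (Xb ?\<beta> r) (z s))"] by blast
    have eX: "eB i \<bullet> \<phi> (Xb ?\<beta> r) = (\<Oplus>\<^bsub>Bq D\<^esub>s\<in>?n. sB (d s r) (\<phi> (Xb \<gamma> s)))" if r: "r < dimw ?\<beta>" for r
    proof -
      have "Xb ?\<beta> r \<cdot> eU i \<in> Uplus_wt D \<gamma>"
        using phi_raise[OF \<beta> i X_wt[OF \<beta> r]] unfolding raise_lower[of \<gamma> i, OF False] .
      then obtain m where m: "Xb ?\<beta> r \<cdot> eU i = (\<Oplus>\<^bsub>Uq D\<^esub>s\<in>?n. sU (m s) (Xb \<gamma> s))"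
        "\<forall>s<dimw \<gamma>. to_ac (m s) = \<omega> (Xb ?\<beta> r \<cdot> eU i) (Yb \<gamma> s)" using expand_plus[OF \<gamma>] by blast
      have ms: "m s = c * d s r" if s: "s < dimw \<gamma>" for s
      proof -
        have "to_ac (m s) = to_ac (c * d s r)"
          using m(2) s z(4)[OF s X_Uplus[OF \<beta> r]] d(2)[OF s r] by (simp add: c_def)
        then show ?thesis by (simp only: to_ac_eq_iff)
      qed
      \<comment> \<open>This \<open>c\<close> stems from \<phi>(e_i), the one in \<open>m s\<close>
        from adjointness. They are the same nonzero constant and cancel at the end.\<close>
      have "sB c (eB i \<bullet> \<phi> (Xb ?\<beta> r)) = \<phi> (Xb ?\<beta> r \<cdot> eU i)"
        using i r \<beta> by (simp add: phi_mult X_Uplus Uplus_Uge eU_Uge phi_e B.smul_mult_left c_def)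
      also have "\<dots> = (\<Oplus>\<^bsub>Bq D\<^esub>s\<in>?n. sB (m s) (\<phi> (Xb \<gamma> s)))"
        unfolding m(1) using \<gamma> by (intro phi_sum) (auto intro: X_Uplus)
      also have "\<dots> = (\<Oplus>\<^bsub>Bq D\<^esub>s\<in>?n. sB c (sB (d s r) (\<phi> (Xb \<gamma> s))))"
        using \<gamma> ms by (intro B.finsum_cong') auto
      also have "\<dots> = sB c (\<Oplus>\<^bsub>Bq D\<^esub>s\<in>?n. sB (d s r) (\<phi> (Xb \<gamma> s)))"
        using \<gamma> by (subst B.smul_finsum) auto
      finally have eq: "sB c (eB i \<bullet> \<phi> (Xb ?\<beta> r)) = sB c (\<Oplus>\<^bsub>Bq D\<^esub>s\<in>?n. sB (d s r) (\<phi> (Xb \<gamma> s)))" .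
      have cl: "eB i \<bullet> \<phi> (Xb ?\<beta> r) \<in> carrier (Bq D)"
        "(\<Oplus>\<^bsub>Bq D\<^esub>s\<in>?n. sB (d s r) (\<phi> (Xb \<gamma> s))) \<in> carrier (Bq D)"
        using i r \<beta> \<gamma> by (auto intro!: B.finsum_closed)
      have "eB i \<bullet> \<phi> (Xb ?\<beta> r) = sB (inverse c) (sB c (eB i \<bullet> \<phi> (Xb ?\<beta> r)))"
        using c cl(1) by simp
      also have "\<dots> = (\<Oplus>\<^bsub>Bq D\<^esub>s\<in>?n. sB (d s r) (\<phi> (Xb \<gamma> s)))"
        unfolding eq using c cl(2) by simp
      finally show ?thesis .
    qed
    have "?R = (\<Oplus>\<^bsub>Bq D\<^esub>s\<in>?n. \<Oplus>\<^bsub>Bq D\<^esub>r\<in>?m. sB (d s r) (Psi ?\<beta> (Yb ?\<beta> r) \<bullet> \<phi> (Xb \<gamma> s)))"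
    proof (intro B.finsum_cong')
      fix s assume "s \<in> ?n"
      then have s: "s < dimw \<gamma>" by simp
      have "Psi ?\<beta> (z s) = (\<Oplus>\<^bsub>Bq D\<^esub>r\<in>?m. sB (d s r) (Psi ?\<beta> (Yb ?\<beta> r)))"
        unfolding d(1)[OF s] using \<beta> by (intro Psi_sum) (auto intro: Y_Uminus)
      then have "Psi ?\<beta> (z s) \<bullet> \<phi> (Xb \<gamma> s) = (\<Oplus>\<^bsub>Bq D\<^esub>r\<in>?m. sB (d s r) (Psi ?\<beta> (Yb ?\<beta> r)) \<bullet> \<phi> (Xb \<gamma> s))"
        using \<beta> \<gamma> s by (simp add: B.finsum_ldistr Pi_def)
      also have "\<dots> = (\<Oplus>\<^bsub>Bq D\<^esub>r\<in>?m. sB (d s r) (Psi ?\<beta> (Yb ?\<beta> r) \<bullet> \<phi> (Xb \<gamma> s)))"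
        using \<beta> \<gamma> s by (intro B.finsum_cong') (auto simp: B.smul_mult_left)
      finally show "Psi ?\<beta> (z s) \<bullet> \<phi> (Xb \<gamma> s)
          = (\<Oplus>\<^bsub>Bq D\<^esub>r\<in>?m. sB (d s r) (Psi ?\<beta> (Yb ?\<beta> r) \<bullet> \<phi> (Xb \<gamma> s)))" .
    qed (use \<beta> \<gamma> in \<open>auto intro!: B.finsum_closed\<close>)
    also have "\<dots> = (\<Oplus>\<^bsub>Bq D\<^esub>r\<in>?m. \<Oplus>\<^bsub>Bq D\<^esub>s\<in>?n. sB (d s r) (Psi ?\<beta> (Yb ?\<beta> r) \<bullet> \<phi> (Xb \<gamma> s)))"
      using \<beta> \<gamma> by (intro B.finsum_double_swap) auto
    also have "\<dots> = (\<Oplus>\<^bsub>Bq D\<^esub>r\<in>?m. Psi ?\<beta> (Yb ?\<beta> r) \<bullet> (eB i \<bullet> \<phi> (Xb ?\<beta> r)))"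
    proof (intro B.finsum_cong')
      fix r assume "r \<in> ?m"
      then have r: "r < dimw ?\<beta>" by simp
      have "Psi ?\<beta> (Yb ?\<beta> r) \<bullet> (eB i \<bullet> \<phi> (Xb ?\<beta> r))
          = (\<Oplus>\<^bsub>Bq D\<^esub>s\<in>?n. Psi ?\<beta> (Yb ?\<beta> r) \<bullet> sB (d s r) (\<phi> (Xb \<gamma> s)))"
        unfolding eX[OF r] using \<beta> \<gamma> r by (simp add: B.finsum_rdistr Pi_def)
      also have "\<dots> = (\<Oplus>\<^bsub>Bq D\<^esub>s\<in>?n. sB (d s r) (Psi ?\<beta> (Yb ?\<beta> r) \<bullet> \<phi> (Xb \<gamma> s)))"
        using \<beta> \<gamma> r by (intro B.finsum_cong') (auto simp: B.smul_mult_right)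
      finally show "(\<Oplus>\<^bsub>Bq D\<^esub>s\<in>?n. sB (d s r) (Psi ?\<beta> (Yb ?\<beta> r) \<bullet> \<phi> (Xb \<gamma> s)))
          = Psi ?\<beta> (Yb ?\<beta> r) \<bullet> (eB i \<bullet> \<phi> (Xb ?\<beta> r))" by simp
    qed (use \<beta> \<gamma> i in auto)
    finally have "sB (P i ?\<beta>) ?R = ins (eB i) i ?\<beta>" unfolding ins_def by simp
    moreover have "?R \<in> carrier (Bq D)" using \<gamma> zc by auto
    ultimately show ?thesis using main False by (simp add: B.smul_minus)
  qed
qed

text \<open>The roles are exchanged: \<phi>(x_s) is derived, and f_i y_r is expanded in the y_s with
  coefficients <x_s, f_i y_r> = c <z_s, y_r>. \<open>Psi_raise\<close> turns f_i y_r into a multiple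
  of Psi(y_r) f_i, so \<open>c\<close> is absorbed into the expansion.\<close>

theorem comp_fB:
  assumes \<gamma>: "\<gamma> \<in> Qplus D" and i: "i \<in> I"
  shows "comp \<gamma> \<bullet> fB i = ins (fB i) i \<gamma> \<^bold>+
    (if \<gamma> i = 0 then \<zero>\<^bsub>Bq D\<^esub> else \<ominus>\<^bsub>Bq D\<^esub> ins (fB i) i (lower i \<gamma>))"
proof -
  let ?\<beta> = "lower i \<gamma>" and ?n = "{..<dimw \<gamma>}" and ?m = "{..<dimw (lower i \<gamma>)}"
  define c where "c = ef_const D i"
  have \<beta>: "?\<beta> \<in> Qplus D" by (rule lower_Qplus[OF \<gamma>])
  have "\<forall>s. \<exists>z. s < dimw \<gamma> \<longrightarrow> z \<in> Uplus_wt D ?\<beta> \<and> (\<gamma> i = 0 \<longrightarrow> z = \<zero>\<^bsub>Uq D\<^esub>) \<and>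
    \<phi> (Xb \<gamma> s) \<bullet> fB i = sB (P i \<gamma>) (fB i \<bullet> \<phi> (Xb \<gamma> s)) \<^bold>+ sB c (\<phi> z) \<and>
    (\<forall>y\<in>Ule D. \<omega> (Xb \<gamma> s) (fU i \<cdot> y) = to_ac c * \<omega> z y)"
    using phi_deriv[OF \<gamma> i X_wt[OF \<gamma>]] unfolding c_def by blast
  then obtain z where z: "\<And>s. s < dimw \<gamma> \<Longrightarrow> z s \<in> Uplus_wt D ?\<beta>"
    "\<And>s. s < dimw \<gamma> \<Longrightarrow> \<gamma> i = 0 \<Longrightarrow> z s = \<zero>\<^bsub>Uq D\<^esub>"
    "\<And>s. s < dimw \<gamma> \<Longrightarrow> \<phi> (Xb \<gamma> s) \<bullet> fB i = sB (P i \<gamma>) (fB i \<bullet> \<phi> (Xb \<gamma> s)) \<^bold>+ sB c (\<phi> (z s))"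
    "\<And>s y. s < dimw \<gamma> \<Longrightarrow> y \<in> Ule D \<Longrightarrow> \<omega> (Xb \<gamma> s) (fU i \<cdot> y) = to_ac c * \<omega> (z s) y"
    using choice[of "\<lambda>s z. s < dimw \<gamma> \<longrightarrow> z \<in> Uplus_wt D ?\<beta> \<and> (\<gamma> i = 0 \<longrightarrow> z = \<zero>\<^bsub>Uq D\<^esub>) \<and>
      \<phi> (Xb \<gamma> s) \<bullet> fB i = sB (P i \<gamma>) (fB i \<bullet> \<phi> (Xb \<gamma> s)) \<^bold>+ sB c (\<phi> z) \<and>
      (\<forall>y\<in>Ule D. \<omega> (Xb \<gamma> s) (fU i \<cdot> y) = to_ac c * \<omega> z y)"] by blast
  have zc: "\<phi> (z s) \<in> carrier (Bq D)" if "s < dimw \<gamma>" for s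
    using z(1)[OF that] Up_Uplus Uplus_Uge phi_closed by blast
  let ?R = "\<Oplus>\<^bsub>Bq D\<^esub>s\<in>?n. sB c (Psi \<gamma> (Yb \<gamma> s) \<bullet> \<phi> (z s))"
  have "comp \<gamma> \<bullet> fB i = (\<Oplus>\<^bsub>Bq D\<^esub>s\<in>?n. Psi \<gamma> (Yb \<gamma> s) \<bullet> \<phi> (Xb \<gamma> s) \<bullet> fB i)"
    unfolding comp_def using \<gamma> i by (intro B.finsum_ldistr) auto
  also have "\<dots> = (\<Oplus>\<^bsub>Bq D\<^esub>s\<in>?n. sB (P i \<gamma>) (Psi \<gamma> (Yb \<gamma> s) \<bullet> (fB i \<bullet> \<phi> (Xb \<gamma> s)))
      \<^bold>+ sB c (Psi \<gamma> (Yb \<gamma> s) \<bullet> \<phi> (z s)))"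
  proof (intro B.finsum_cong')
    fix s assume "s \<in> ?n"
    then have s: "s < dimw \<gamma>" by simp
    have "Psi \<gamma> (Yb \<gamma> s) \<bullet> \<phi> (Xb \<gamma> s) \<bullet> fB i = Psi \<gamma> (Yb \<gamma> s) \<bullet> (\<phi> (Xb \<gamma> s) \<bullet> fB i)"
      using s \<gamma> i by (simp add: B.m_assoc)
    then show "Psi \<gamma> (Yb \<gamma> s) \<bullet> \<phi> (Xb \<gamma> s) \<bullet> fB i = sB (P i \<gamma>) (Psi \<gamma> (Yb \<gamma> s) \<bullet> (fB i \<bullet> \<phi> (Xb \<gamma> s)))
      \<^bold>+ sB c (Psi \<gamma> (Yb \<gamma> s) \<bullet> \<phi> (z s))"
      unfolding z(3)[OF s] using s \<gamma> i zc[OF s] by (simp add: B.r_distr B.smul_mult_right)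
  qed (use \<gamma> i zc in auto)
  also have "\<dots> = (\<Oplus>\<^bsub>Bq D\<^esub>s\<in>?n. sB (P i \<gamma>) (Psi \<gamma> (Yb \<gamma> s) \<bullet> (fB i \<bullet> \<phi> (Xb \<gamma> s)))) \<^bold>+ ?R"
    using \<gamma> i zc by (intro B.finsum_addf) auto
  also have "\<dots> = ins (fB i) i \<gamma> \<^bold>+ ?R"
    unfolding ins_def using \<gamma> i zc by (subst B.smul_finsum) auto
  finally have main: "comp \<gamma> \<bullet> fB i = ins (fB i) i \<gamma> \<^bold>+ ?R" .
  show ?thesis
  proof (cases "\<gamma> i = 0")
    case True
    have "?R = (\<Oplus>\<^bsub>Bq D\<^esub>s\<in>?n. \<zero>\<^bsub>Bq D\<^esub>)"
      using z(2) True \<gamma> by (intro B.finsum_cong') (auto simp: phi_zero)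
    then show ?thesis using main True by simp
  next
    case False
    have "\<forall>s. \<exists>d. s < dimw \<gamma> \<longrightarrow> z s = (\<Oplus>\<^bsub>Uq D\<^esub>r\<in>?m. sU (d r) (Xb ?\<beta> r)) \<and>
        (\<forall>r<dimw ?\<beta>. to_ac (d r) = \<omega> (z s) (Yb ?\<beta> r))"
      using expand_plus[OF \<beta> z(1)] by blast
    then obtain d where d: "\<And>s. s < dimw \<gamma> \<Longrightarrow> z s = (\<Oplus>\<^bsub>Uq D\<^esub>r\<in>?m. sU (d s r) (Xb ?\<beta> r))"
      "\<And>s r. s < dimw \<gamma> \<Longrightarrow> r < dimw ?\<beta> \<Longrightarrow> to_ac (d s r) = \<omega> (z s) (Yb ?\<beta> r)"
      using choice[of "\<lambda>s d. s < dimw \<gamma> \<longrightarrow> z s = (\<Oplus>\<^bsub>Uq D\<^esub>r\<in>?m. sU (d r) (Xb ?\<beta> r)) \<and>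
        (\<forall>r<dimw ?\<beta>. to_ac (d r) = \<omega> (z s) (Yb ?\<beta> r))"] by blast
    have fY: "sB (- P i ?\<beta>) (Psi ?\<beta> (Yb ?\<beta> r) \<bullet> fB i) = (\<Oplus>\<^bsub>Bq D\<^esub>s\<in>?n. sB (c * d s r) (Psi \<gamma> (Yb \<gamma> s)))"
      if r: "r < dimw ?\<beta>" for r
    proof -
      have fy: "fU i \<cdot> Yb ?\<beta> r \<in> Uminus_wt D \<gamma>"
        "Psi \<gamma> (fU i \<cdot> Yb ?\<beta> r) = sB (- P i ?\<beta>) (Psi ?\<beta> (Yb ?\<beta> r) \<bullet> fB i)"
        using Psi_raise[OF \<beta> i Y_wt[OF \<beta> r]] unfolding raise_lower[of \<gamma> i, OF False] by simp_all
      then obtain m where m: "fU i \<cdot> Yb ?\<beta> r = (\<Oplus>\<^bsub>Uq D\<^esub>s\<in>?n. sU (m s) (Yb \<gamma> s))"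
        "\<forall>s<dimw \<gamma>. to_ac (m s) = \<omega> (Xb \<gamma> s) (fU i \<cdot> Yb ?\<beta> r)" using expand_minus[OF \<gamma>] by blast
      have ms: "m s = c * d s r" if s: "s < dimw \<gamma>" for s
      proof -
        have "to_ac (m s) = to_ac (c * d s r)"
          using m(2) s z(4)[OF s Uminus_Ule[OF Y_Uminus[OF \<beta> r]]] d(2)[OF s r] by simp
        then show ?thesis by (simp only: to_ac_eq_iff)
      qed
      have "Psi \<gamma> (fU i \<cdot> Yb ?\<beta> r) = (\<Oplus>\<^bsub>Bq D\<^esub>s\<in>?n. sB (m s) (Psi \<gamma> (Yb \<gamma> s)))"
        unfolding m(1) using \<gamma> by (intro Psi_sum) (auto intro: Y_Uminus)
      also have "\<dots> = (\<Oplus>\<^bsub>Bq D\<^esub>s\<in>?n. sB (c * d s r) (Psi \<gamma> (Yb \<gamma> s)))"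
        using \<gamma> ms by (intro B.finsum_cong') auto
      finally show ?thesis unfolding fy(2) .
    qed
    have "?R = (\<Oplus>\<^bsub>Bq D\<^esub>s\<in>?n. \<Oplus>\<^bsub>Bq D\<^esub>r\<in>?m. sB (c * d s r) (Psi \<gamma> (Yb \<gamma> s) \<bullet> \<phi> (Xb ?\<beta> r)))"
    proof (intro B.finsum_cong')
      fix s assume "s \<in> ?n"
      then have s: "s < dimw \<gamma>" by simp
      have "\<phi> (z s) = (\<Oplus>\<^bsub>Bq D\<^esub>r\<in>?m. sB (d s r) (\<phi> (Xb ?\<beta> r)))"
        unfolding d(1)[OF s] using \<beta> by (intro phi_sum) (auto intro: X_Uplus)
      then have "sB c (Psi \<gamma> (Yb \<gamma> s) \<bullet> \<phi> (z s))
          = (\<Oplus>\<^bsub>Bq D\<^esub>r\<in>?m. sB c (Psi \<gamma> (Yb \<gamma> s) \<bullet> sB (d s r) (\<phi> (Xb ?\<beta> r))))"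
        using \<beta> \<gamma> s by (simp add: B.finsum_rdistr B.smul_finsum Pi_def)
      also have "\<dots> = (\<Oplus>\<^bsub>Bq D\<^esub>r\<in>?m. sB (c * d s r) (Psi \<gamma> (Yb \<gamma> s) \<bullet> \<phi> (Xb ?\<beta> r)))"
        using \<beta> \<gamma> s by (intro B.finsum_cong') (auto simp: B.smul_mult_right)
      finally show "sB c (Psi \<gamma> (Yb \<gamma> s) \<bullet> \<phi> (z s))
          = (\<Oplus>\<^bsub>Bq D\<^esub>r\<in>?m. sB (c * d s r) (Psi \<gamma> (Yb \<gamma> s) \<bullet> \<phi> (Xb ?\<beta> r)))" .
    qed (use \<beta> \<gamma> in \<open>auto intro!: B.finsum_closed\<close>)
    also have "\<dots> = (\<Oplus>\<^bsub>Bq D\<^esub>r\<in>?m. \<Oplus>\<^bsub>Bq D\<^esub>s\<in>?n. sB (c * d s r) (Psi \<gamma> (Yb \<gamma> s) \<bullet> \<phi> (Xb ?\<beta> r)))"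
      using \<beta> \<gamma> by (intro B.finsum_double_swap) auto
    also have "\<dots> = (\<Oplus>\<^bsub>Bq D\<^esub>r\<in>?m. sB (- P i ?\<beta>) (Psi ?\<beta> (Yb ?\<beta> r) \<bullet> (fB i \<bullet> \<phi> (Xb ?\<beta> r))))"
    proof (intro B.finsum_cong')
      fix r assume "r \<in> ?m"
      then have r: "r < dimw ?\<beta>" by simp
      have "sB (- P i ?\<beta>) (Psi ?\<beta> (Yb ?\<beta> r) \<bullet> (fB i \<bullet> \<phi> (Xb ?\<beta> r)))
          = sB (- P i ?\<beta>) (Psi ?\<beta> (Yb ?\<beta> r) \<bullet> fB i) \<bullet> \<phi> (Xb ?\<beta> r)"
        using \<beta> r i by (simp add: B.m_assoc B.smul_mult_left)
      also have "\<dots> = (\<Oplus>\<^bsub>Bq D\<^esub>s\<in>?n. sB (c * d s r) (Psi \<gamma> (Yb \<gamma> s)) \<bullet> \<phi> (Xb ?\<beta> r))"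
        unfolding fY[OF r] using \<beta> \<gamma> r by (simp add: B.finsum_ldistr Pi_def)
      also have "\<dots> = (\<Oplus>\<^bsub>Bq D\<^esub>s\<in>?n. sB (c * d s r) (Psi \<gamma> (Yb \<gamma> s) \<bullet> \<phi> (Xb ?\<beta> r)))"
        using \<beta> \<gamma> r by (intro B.finsum_cong') (auto simp: B.smul_mult_left)
      finally show "(\<Oplus>\<^bsub>Bq D\<^esub>s\<in>?n. sB (c * d s r) (Psi \<gamma> (Yb \<gamma> s) \<bullet> \<phi> (Xb ?\<beta> r)))
          = sB (- P i ?\<beta>) (Psi ?\<beta> (Yb ?\<beta> r) \<bullet> (fB i \<bullet> \<phi> (Xb ?\<beta> r)))" by simp
    qed (use \<beta> \<gamma> i in auto)
    also have "\<dots> = sB (- P i ?\<beta>) (\<Oplus>\<^bsub>Bq D\<^esub>r\<in>?m. Psi ?\<beta> (Yb ?\<beta> r) \<bullet> (fB i \<bullet> \<phi> (Xb ?\<beta> r)))"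
      using \<beta> i by (subst B.smul_finsum) auto
    also have "\<dots> = \<ominus>\<^bsub>Bq D\<^esub> ins (fB i) i ?\<beta>"
      unfolding ins_def using \<beta> i by (intro B.smul_minus) auto
    finally show ?thesis using main False by simp
  qed
qed

text \<open>The weight-zero spaces are spanned by 1. If 1 is the sum of the d_r y_r, then x_r is d_r
  times 1, because d_r = <x_r, 1>; the component therefore reassembles to \<open>Psi\<close> of
  1.\<close>

lemma comp_zero: "comp (\<lambda>_. 0) = \<one>\<^bsub>Bq D\<^esub>"
proof -
  let ?o = "\<lambda>_::'i. 0::nat"
  have o: "?o \<in> Qplus D" by (simp add: Qplus_def)
  have w: "words D ?o = {[]}" by (auto simp: words_def fun_eq_iff count_eq_zero_iff)
  have "\<one>\<^bsub>Uq D\<^esub> \<in> Uminus_wt D ?o"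
    unfolding Uminus_wt_eq[OF o] w by (intro U.lspan_incl) auto
  then obtain d where d: "\<one>\<^bsub>Uq D\<^esub> = (\<Oplus>\<^bsub>Uq D\<^esub>r\<in>{..<dimw ?o}. sU (d r) (Yb ?o r))"
    "\<forall>r<dimw ?o. to_ac (d r) = \<omega> (Xb ?o r) \<one>\<^bsub>Uq D\<^esub>" using expand_minus[OF o] by blast
  have phi: "\<phi> (Xb ?o r) = sB (d r) \<one>\<^bsub>Bq D\<^esub>" if r: "r < dimw ?o" for r
  proof -
    have "Xb ?o r \<in> lspan (Uq D) {\<one>\<^bsub>Uq D\<^esub>}"
      using X_wt[OF o r] unfolding Uplus_wt_eq[OF o] w by simp
    then have "\<exists>e. Xb ?o r = sU e \<one>\<^bsub>Uq D\<^esub>"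
    proof (induction rule: lspan.induct)
      case zero
      show ?case by (intro exI[of _ 0]) simp
    next
      case (step m u c)
      then obtain e where "u = sU e \<one>\<^bsub>Uq D\<^esub>" by blast
      then show ?case using step by (intro exI[of _ "c + e"]) (simp add: U.smul_add_left)
    qed
    then obtain e where e: "Xb ?o r = sU e \<one>\<^bsub>Uq D\<^esub>" by blast
    have "\<omega> (Xb ?o r) \<one>\<^bsub>Uq D\<^esub> = to_ac e"
      unfolding e by (simp add: \<omega>_smul_left one_Uge one_Ule \<omega>_1)
    then have "d r = e" using d(2) r by (metis to_ac_eq_iff)
    then show ?thesis by (simp add: e phi_smul one_Uge phi_one)
  qed
  have "comp ?o = (\<Oplus>\<^bsub>Bq D\<^esub>r\<in>{..<dimw ?o}. sB (d r) (Psi ?o (Yb ?o r)))"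
    unfolding comp_def using o phi by (intro B.finsum_cong') (auto simp: B.smul_mult_right)
  also have "\<dots> = Psi ?o \<one>\<^bsub>Uq D\<^esub>"
    unfolding d(1) using o by (intro Psi_sum[symmetric]) (auto intro: Y_Uminus)
  also have "\<dots> = \<one>\<^bsub>Bq D\<^esub>"
    using Psi_NU[of "[]" ?o] by (simp add: fun_eq_iff)
  finally show ?thesis .
qed

end

section \<open>Completions handled through sequences of representatives\<close>

section \<open>Completions\<close>

locale filtered_group = ring R for R :: "('a, 'm) ring_scheme" (structure) +
  fixes J :: "nat \<Rightarrow> 'a set"
  assumes J_subgroup: "additive_subgroup (J l) R" and J_Suc: "J (Suc l) \<subseteq> J l"
begin

abbreviation "CR \<equiv> completion R J"

text \<open>Every point of the inverse limit has such a sequence of representatives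
  (\<open>limit_pointE\<close>), so identities in the completion reduce to congruences modulo the
  \<open>J l\<close>.\<close>

definition coherent :: "(nat \<Rightarrow> 'a) \<Rightarrow> bool"
  where "coherent x \<longleftrightarrow> (\<forall>l. x l \<in> carrier R \<and> x (Suc l) \<ominus> x l \<in> J l)"

definition limit_point :: "(nat \<Rightarrow> 'a) \<Rightarrow> nat \<Rightarrow> 'a set"
  where "limit_point x = (\<lambda>l. J l +> x l)"

lemma J_abelian: "abelian_subgroup (J l) R"
  by (rule abelian_subgroupI3[OF J_subgroup]) (rule is_abelian_group)

lemma J_carrier: "x \<in> J l \<Longrightarrow> x \<in> carrier R"
  using additive_subgroup.a_Hcarr[OF J_subgroup] by blast

lemma J_add: "x \<in> J l \<Longrightarrow> y \<in> J l \<Longrightarrow> x \<oplus> y \<in> J l"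
  by (rule additive_subgroup.a_closed[OF J_subgroup])

lemma J_minus: "x \<in> J l \<Longrightarrow> \<ominus> x \<in> J l"
  by (rule additive_subgroup.a_inv_closed[OF J_subgroup])

lemma J_zero: "\<zero> \<in> J l"
  by (rule additive_subgroup.zero_closed[OF J_subgroup])

lemma J_mono: "l \<le> m \<Longrightarrow> J m \<subseteq> J l"
  by (rule lift_Suc_antimono_le[of J]) (rule J_Suc)

lemma J_finsum: "(\<And>k. k \<in> F \<Longrightarrow> f k \<in> J l) \<Longrightarrow> (\<Oplus>k\<in>F. f k) \<in> J l"
proof (induction F rule: infinite_finite_induct)
  case (insert x F)
  then have "f \<in> F \<rightarrow> carrier R" "f x \<in> carrier R" using J_carrier by blast+
  then show ?case using insert by (simp add: J_add)
qed (simp_all add: J_zero)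

lemma J_diff_trans:
  assumes "a \<in> carrier R" "b \<in> carrier R" "c \<in> carrier R" "a \<ominus> b \<in> J l" "b \<ominus> c \<in> J l"
  shows "a \<ominus> c \<in> J l"
proof -
  have "a \<ominus> c = (a \<ominus> b) \<oplus> (b \<ominus> c)" using assms(1-3) by algebra
  then show ?thesis using J_add[OF assms(4,5)] by simp
qed

lemma J_diff_sym:
  assumes "a \<in> carrier R" "b \<in> carrier R" "a \<ominus> b \<in> J l"
  shows "b \<ominus> a \<in> J l"
proof -
  have "b \<ominus> a = \<ominus> (a \<ominus> b)" using assms(1,2) by algebra
  then show ?thesis using J_minus[OF assms(3)] by simp
qed

lemma coset_mem: "a \<in> carrier R \<Longrightarrow> x \<in> J l +> a \<longleftrightarrow> x \<in> carrier R \<and> x \<ominus> a \<in> J l"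
proof -
  assume a: "a \<in> carrier R"
  have "x \<in> carrier R" if "x \<in> J l +> a"
    using that a J_carrier by (auto simp: a_r_coset_def')
  then show ?thesis
    using abelian_subgroup.a_rcos_module_minus[OF J_abelian ring_axioms a] by blast
qed

lemma coset_eq:
  assumes a: "a \<in> carrier R" and b: "b \<in> carrier R" and ab: "a \<ominus> b \<in> J l"
  shows "J l +> a = J l +> b"
proof (intro Set.set_eqI iffI)
  fix x
  show "x \<in> J l +> b" if "x \<in> J l +> a"
    using that J_diff_trans[of x a b l] a b ab by (simp add: coset_mem)
  show "x \<in> J l +> a" if "x \<in> J l +> b"
    using that J_diff_trans[of x b a l] J_diff_sym[OF a b ab] a b by (simp add: coset_mem)
qed

lemma coset_self: "a \<in> carrier R \<Longrightarrow> a \<in> J l +> a"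
  by (simp add: coset_mem J_zero minus_eq r_neg)

lemma coherent_closed: "coherent x \<Longrightarrow> x l \<in> carrier R"
  by (simp add: coherent_def)

lemma coherent_diff:
  assumes x: "coherent x" and "l \<le> m"
  shows "x m \<ominus> x l \<in> J l"
  using assms(2)
proof (induction m rule: dec_induct)
  case base
  show ?case using coherent_closed[OF x] J_zero by (simp add: minus_eq r_neg)
next
  case (step m)
  have "x (Suc m) \<ominus> x m \<in> J l" using J_mono[OF step(1)] x unfolding coherent_def by blast
  then show ?case
    using J_diff_trans[OF coherent_closed[OF x] coherent_closed[OF x] coherent_closed[OF x] _ step(3)]
    by blast
qed

lemma coherent_const: "a \<in> carrier R \<Longrightarrow> coherent (\<lambda>_. a)"
  by (simp add: coherent_def J_zero minus_eq r_neg)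

lemma coherent_add: "coherent x \<Longrightarrow> coherent y \<Longrightarrow> coherent (\<lambda>l. x l \<oplus> y l)"
proof -
  assume x: "coherent x" and y: "coherent y"
  have "(x (Suc l) \<oplus> y (Suc l)) \<ominus> (x l \<oplus> y l) = (x (Suc l) \<ominus> x l) \<oplus> (y (Suc l) \<ominus> y l)" for l
    using coherent_closed[OF x, of l] coherent_closed[OF y, of l]
      coherent_closed[OF x, of "Suc l"] coherent_closed[OF y, of "Suc l"] by algebra
  moreover have "(x (Suc l) \<ominus> x l) \<oplus> (y (Suc l) \<ominus> y l) \<in> J l" for l
    using x y by (simp add: coherent_def J_add)
  ultimately show ?thesis using x y by (simp add: coherent_def)
qed

lemma limit_point_closed: "coherent x \<Longrightarrow> limit_point x \<in> carrier CR"
proof -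
  assume x: "coherent x"
  have "J l +> x l \<in> a_rcosets (J l)" for l
    using coherent_closed[OF x] J_carrier by (intro a_rcosetsI) auto
  moreover have "J (Suc l) +> x (Suc l) \<subseteq> J l +> x l" for l
  proof
    fix a assume "a \<in> J (Suc l) +> x (Suc l)"
    then have a: "a \<in> carrier R" "a \<ominus> x (Suc l) \<in> J l"
      using coset_mem[OF coherent_closed[OF x]] J_Suc by blast+
    have "x (Suc l) \<ominus> x l \<in> J l" using x by (simp add: coherent_def)
    then have "a \<ominus> x l \<in> J l"
      by (rule J_diff_trans[OF a(1) coherent_closed[OF x] coherent_closed[OF x] a(2)])
    then show "a \<in> J l +> x l" using a x by (simp add: coset_mem coherent_closed)
  qed
  ultimately show ?thesis by (simp add: completion_def limit_point_def)
qed

lemma limit_pointE: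
  assumes "s \<in> carrier CR"
  obtains x where "coherent x" "s = limit_point x"
proof -
  have s: "s l \<in> a_rcosets (J l)" "s (Suc l) \<subseteq> s l" for l
    using assms by (auto simp: completion_def)
  have "\<exists>a. a \<in> carrier R \<and> s l = J l +> a" for l
    using s(1)[of l] by (auto simp: A_RCOSETS_def')
  then obtain x where x: "\<And>l. x l \<in> carrier R" "\<And>l. s l = J l +> x l" by metis
  have "x (Suc l) \<in> J l +> x l" for l
    using s(2)[of l] coset_self[OF x(1), of "Suc l" "Suc l"] x(2) by auto
  then have "coherent x" using x(1) by (auto simp: coherent_def coset_mem)
  moreover have "s = limit_point x" using x(2) by (auto simp: limit_point_def)
  ultimately show ?thesis using that by blast
qed

lemma limit_point_add:
  "coherent x \<Longrightarrow> coherent y \<Longrightarrow> limit_point x \<oplus>\<^bsub>CR\<^esub> limit_point y = limit_point (\<lambda>l. x l \<oplus> y l)"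
  using abelian_subgroup.a_rcos_sum[OF J_abelian]
  by (simp add: completion_def limit_point_def coherent_closed)

lemma limit_point_zero: "limit_point (\<lambda>_. \<zero>) = \<zero>\<^bsub>CR\<^esub>"
  using abelian_subgroup.a_rcos_const[OF J_abelian J_zero]
  by (simp add: completion_def limit_point_def)

lemma limit_point_one: "limit_point (\<lambda>_. \<one>) = \<one>\<^bsub>CR\<^esub>"
  by (simp add: completion_def limit_point_def)

lemma to_completion_eq: "to_completion R J a = limit_point (\<lambda>_. a)"
  by (simp add: to_completion_def limit_point_def)

sublocale CR: abelian_monoid CR
proof (rule abelian_monoidI)
  show "\<zero>\<^bsub>CR\<^esub> \<in> carrier CR"
    unfolding limit_point_zero[symmetric] by (intro limit_point_closed coherent_const) simp
next
  fix s t assume "s \<in> carrier CR" "t \<in> carrier CR"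
  then obtain x y where xy: "coherent x" "coherent y" "s = limit_point x" "t = limit_point y"
    by (metis limit_pointE)
  show "s \<oplus>\<^bsub>CR\<^esub> t \<in> carrier CR"
    using xy by (simp add: limit_point_add coherent_add limit_point_closed)
  show "s \<oplus>\<^bsub>CR\<^esub> t = t \<oplus>\<^bsub>CR\<^esub> s"
    using xy by (simp add: limit_point_add a_comm coherent_closed)
next
  fix s t r assume "s \<in> carrier CR" "t \<in> carrier CR" "r \<in> carrier CR"
  then obtain x y z where xy: "coherent x" "coherent y" "coherent z"
    "s = limit_point x" "t = limit_point y" "r = limit_point z"
    by (metis limit_pointE)
  show "s \<oplus>\<^bsub>CR\<^esub> t \<oplus>\<^bsub>CR\<^esub> r = s \<oplus>\<^bsub>CR\<^esub> (t \<oplus>\<^bsub>CR\<^esub> r)"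
    using xy by (simp add: limit_point_add coherent_add a_assoc coherent_closed)
next
  fix s assume "s \<in> carrier CR"
  then obtain x where xy: "coherent x" "s = limit_point x" by (metis limit_pointE)
  show "\<zero>\<^bsub>CR\<^esub> \<oplus>\<^bsub>CR\<^esub> s = s"
    using xy by (simp add: limit_point_add coherent_const coherent_closed flip: limit_point_zero)
qed

lemma coherent_finsum:
  "finite F \<Longrightarrow> (\<And>k. k \<in> F \<Longrightarrow> coherent (f k)) \<Longrightarrow> coherent (\<lambda>l. \<Oplus>k\<in>F. f k l)"
proof (induction F rule: finite_induct)
  case (insert x F)
  have "coherent (\<lambda>l. f x l \<oplus> (\<Oplus>k\<in>F. f k l))"
    using insert by (intro coherent_add) auto
  moreover have "(\<lambda>l. \<Oplus>k\<in>insert x F. f k l) = (\<lambda>l. f x l \<oplus> (\<Oplus>k\<in>F. f k l))"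
    using insert by (intro ext finsum_insert) (auto simp: coherent_closed)
  ultimately show ?case by simp
qed (simp add: coherent_const)

lemma finsum_limit_point:
  "finite F \<Longrightarrow> (\<And>k. k \<in> F \<Longrightarrow> coherent (f k)) \<Longrightarrow>
    finsum CR (\<lambda>k. limit_point (f k)) F = limit_point (\<lambda>l. \<Oplus>k\<in>F. f k l)"
proof (induction F rule: finite_induct)
  case (insert x F)
  have "finsum CR (\<lambda>k. limit_point (f k)) (insert x F)
      = limit_point (f x) \<oplus>\<^bsub>CR\<^esub> limit_point (\<lambda>l. \<Oplus>k\<in>F. f k l)"
    using insert by (subst CR.finsum_insert) (auto simp: limit_point_closed)
  also have "\<dots> = limit_point (\<lambda>l. f x l \<oplus> (\<Oplus>k\<in>F. f k l))"
    using insert by (intro limit_point_add coherent_finsum) auto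
  also have "(\<lambda>l. f x l \<oplus> (\<Oplus>k\<in>F. f k l)) = (\<lambda>l. \<Oplus>k\<in>insert x F. f k l)"
    using insert by (intro ext finsum_insert[symmetric]) (auto simp: coherent_closed)
  finally show ?case .
qed (simp add: limit_point_zero)

text \<open>\<open>F l\<close> is the witness at level l: a larger finite set adds only elements of
  the subgroup \<open>J l\<close>. The terms may themselves vary with the level, as needed for
  products with the projector.\<close>

lemma has_csumI:
  assumes f: "\<And>k. k \<in> A \<Longrightarrow> coherent (f k)" and z: "coherent z"
    and F: "\<And>l. finite (F l)" "\<And>l. F l \<subseteq> A"
    and sum: "\<And>l. (\<Oplus>k\<in>F l. f k l) \<ominus> z l \<in> J l"
    and small: "\<And>l k. k \<in> A - F l \<Longrightarrow> f k l \<in> J l"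
  shows "has_csum CR (\<lambda>k. limit_point (f k)) A (limit_point z)"
  unfolding has_csum_def
proof (intro conjI allI)
  show "limit_point z \<in> carrier CR" by (rule limit_point_closed[OF z])
  show "(\<lambda>k. limit_point (f k)) ` A \<subseteq> carrier CR" using f by (auto intro: limit_point_closed)
  fix l
  show "\<exists>S0. finite S0 \<and> S0 \<subseteq> A \<and> (\<forall>S. finite S \<and> S0 \<subseteq> S \<and> S \<subseteq> A \<longrightarrow>
      finsum CR (\<lambda>k. limit_point (f k)) S l = limit_point z l)"
  proof (intro exI[of _ "F l"] conjI allI impI)
    fix S assume S: "finite S \<and> F l \<subseteq> S \<and> S \<subseteq> A"
    then have c: "\<And>k. k \<in> S \<Longrightarrow> f k l \<in> carrier R" using f coherent_closed by blast
    have "F l \<union> (S - F l) = S" using S by auto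
    moreover have "(\<Oplus>k\<in>F l \<union> (S - F l). f k l) = (\<Oplus>k\<in>F l. f k l) \<oplus> (\<Oplus>k\<in>S - F l. f k l)"
      using S F(1) c by (intro finsum_Un_disjoint) auto
    ultimately have eq: "(\<Oplus>k\<in>S. f k l) = (\<Oplus>k\<in>F l. f k l) \<oplus> (\<Oplus>k\<in>S - F l. f k l)" by simp
    have r: "(\<Oplus>k\<in>S - F l. f k l) \<in> J l" using S small by (intro J_finsum) auto
    have cl: "(\<Oplus>k\<in>F l. f k l) \<in> carrier R" "z l \<in> carrier R" "(\<Oplus>k\<in>S. f k l) \<in> carrier R"
      using S c z coherent_closed by (auto intro!: finsum_closed)
    have "u \<oplus> v \<ominus> w = (u \<ominus> w) \<oplus> v" if "u \<in> carrier R" "v \<in> carrier R" "w \<in> carrier R" for u v w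
      using that by algebra
    then have "(\<Oplus>k\<in>S. f k l) \<ominus> z l = ((\<Oplus>k\<in>F l. f k l) \<ominus> z l) \<oplus> (\<Oplus>k\<in>S - F l. f k l)"
      unfolding eq using cl(1,2) J_carrier[OF r] by blast
    then have "(\<Oplus>k\<in>S. f k l) \<ominus> z l \<in> J l" using J_add[OF sum r] by simp
    then show "finsum CR (\<lambda>k. limit_point (f k)) S l = limit_point z l"
      using coset_eq[OF cl(3,2)] finsum_limit_point[of S f] S f by (simp add: limit_point_def subset_iff)
  qed (use F in auto)
qed

end

text \<open>At each level the union of two witness sets serves both sums; this justifies the
  definite description in \<open>csum\<close>.\<close>

lemma has_csum_unique: "has_csum C f A s \<Longrightarrow> has_csum C f A s' \<Longrightarrow> s = s'"
proof
  fix l assume s: "has_csum C f A s" and s': "has_csum C f A s'"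
  obtain S0 where S0: "finite S0" "S0 \<subseteq> A" "\<And>S. finite S \<and> S0 \<subseteq> S \<and> S \<subseteq> A \<Longrightarrow> finsum C f S l = s l"
    using s unfolding has_csum_def by meson
  obtain S1 where S1: "finite S1" "S1 \<subseteq> A" "\<And>S. finite S \<and> S1 \<subseteq> S \<and> S \<subseteq> A \<Longrightarrow> finsum C f S l = s' l"
    using s' unfolding has_csum_def by meson
  show "s l = s' l" using S0(3)[of "S0 \<union> S1"] S1(3)[of "S0 \<union> S1"] S0 S1 by simp
qed

lemma csum_eq: "has_csum C f A s \<Longrightarrow> csum C f A = s"
  unfolding csum_def by (blast intro: has_csum_unique)

lemma has_csum_cong: "has_csum C f A s \<Longrightarrow> (\<And>k. k \<in> A \<Longrightarrow> f k = g k) \<Longrightarrow> abelian_monoid C \<Longrightarrow> has_csum C g A s"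
proof -
  assume s: "has_csum C f A s" and fg: "\<And>k. k \<in> A \<Longrightarrow> f k = g k" and C: "abelian_monoid C"
  interpret abelian_monoid C by (rule C)
  have f: "f ` A \<subseteq> carrier C" using s by (simp add: has_csum_def)
  have "finsum C g S = finsum C f S" if "S \<subseteq> A" for S
    using that fg f by (intro finsum_cong') (auto simp: image_subset_iff)
  moreover have "f ` A = g ` A" using fg by auto
  ultimately show ?thesis using s unfolding has_csum_def by metis
qed

lemma has_csum_reindex:
  assumes s: "has_csum C (f \<circ> h) A s" and h: "inj_on h A" and C: "abelian_monoid C"
  shows "has_csum C f (h ` A) s"
proof -
  interpret abelian_monoid C by (rule C)
  have f: "(f \<circ> h) ` A \<subseteq> carrier C" "s \<in> carrier C" using s by (simp_all add: has_csum_def)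
  have fin: "finsum C f (h ` S) = finsum C (f \<circ> h) S" if "S \<subseteq> A" for S
    using finsum_reindex[of f h S] that f h by (auto simp: o_def inj_on_subset image_subset_iff)
  show ?thesis
    unfolding has_csum_def
  proof (intro conjI allI)
    fix l
    obtain S0 where S0: "finite S0" "S0 \<subseteq> A"
      "\<And>S. finite S \<and> S0 \<subseteq> S \<and> S \<subseteq> A \<Longrightarrow> finsum C (f \<circ> h) S l = s l"
      using s unfolding has_csum_def by meson
    show "\<exists>S0. finite S0 \<and> S0 \<subseteq> h ` A \<and> (\<forall>S. finite S \<and> S0 \<subseteq> S \<and> S \<subseteq> h ` A \<longrightarrow> finsum C f S l = s l)"
    proof (intro exI[of _ "h ` S0"] conjI allI impI)
      fix S assume S: "finite S \<and> h ` S0 \<subseteq> S \<and> S \<subseteq> h ` A"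
      then obtain T where T: "T \<subseteq> A" "S = h ` T" by (auto simp: subset_image_iff)
      then have "finite T" using S h by (meson finite_imageD inj_on_subset)
      moreover have "S0 \<subseteq> T"
      proof
        fix t assume t: "t \<in> S0"
        then have "h t \<in> h ` T" "t \<in> A" using S S0(2) T by auto
        then show "t \<in> T" using inj_on_image_mem_iff[OF h _ T(1)] by blast
      qed
      ultimately have "finite T \<and> S0 \<subseteq> T \<and> T \<subseteq> A" using T by simp
      then show "finsum C f S l = s l" using S0(3)[of T] fin[OF T(1)] T(2) by simp
    qed (use S0 in auto)
  qed (use f in auto)
qed

text \<open>The \<open>J l\<close> are left ideals only. \<open>J_right\<close> states that right
  multiplication by a fixed element is continuous, in place of two-sidedness.\<close>

locale filtered_ring = filtered_group +
  assumes J_left: "a \<in> carrier R \<Longrightarrow> x \<in> J l \<Longrightarrow> a \<otimes> x \<in> J l"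
    and J_right: "b \<in> carrier R \<Longrightarrow> \<exists>N. \<forall>x\<in>J N. x \<otimes> b \<in> J l"
begin

lemma mult_diff_left:
  assumes "a \<in> carrier R" "b \<in> carrier R" "c \<in> carrier R" "b \<ominus> c \<in> J l"
  shows "a \<otimes> b \<ominus> a \<otimes> c \<in> J l"
proof -
  have "a \<otimes> b \<ominus> a \<otimes> c = a \<otimes> (b \<ominus> c)" using assms(1-3) by algebra
  then show ?thesis using J_left[OF assms(1,4)] by simp
qed

text \<open>Left multiplication preserves \<open>J l\<close>, so the right factor can be frozen at
  \<open>y l\<close>; for this fixed element \<open>J_right\<close> makes the representative of the
  left factor immaterial. Hence in the hypothesis only the index of \<open>x\<close> tends to
  infinity.\<close>

lemma limit_point_mult:
  assumes x: "coherent x" and y: "coherent y" and z: "\<And>l. z l \<in> carrier R"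
    and lim: "\<And>l. \<exists>N. \<forall>m\<ge>N. x m \<otimes> y l \<ominus> z l \<in> J l"
  shows "limit_point x \<otimes>\<^bsub>CR\<^esub> limit_point y = limit_point z"
proof
  fix l
  obtain N1 where N1: "\<And>m. m \<ge> N1 \<Longrightarrow> x m \<otimes> y l \<ominus> z l \<in> J l" using lim by blast
  obtain N2 where N2: "\<And>j. j \<in> J N2 \<Longrightarrow> j \<otimes> y l \<in> J l" using J_right coherent_closed[OF y] by blast
  \<comment> \<open>\<open>N1\<close> makes the hypothesis apply, \<open>N2\<close> controls right
    multiplication by \<open>y l\<close>, and \<open>l\<close> ensures that \<open>y m\<close> and
    \<open>y l\<close> agree modulo \<open>J l\<close>.\<close>
  define N where "N = Max {N1, N2, l}"
  have N: "N1 \<le> N" "N2 \<le> N" "l \<le> N" by (simp_all add: N_def)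
  have key: "a \<otimes> b \<ominus> z l \<in> J l" if m: "m \<ge> N" and a: "a \<in> J m +> x m" and b: "b \<in> J m +> y m" for m a b
  proof -
    have xc: "x m \<in> carrier R" and yc: "y m \<in> carrier R" "y l \<in> carrier R"
      using x y by (simp_all add: coherent_closed)
    have a': "a \<in> carrier R" "a \<ominus> x m \<in> J m" and b': "b \<in> carrier R" "b \<ominus> y m \<in> J m"
      using a b xc yc by (simp_all add: coset_mem)
    have "b \<ominus> y m \<in> J l" using b'(2) J_mono[of l m] m N by auto
    moreover have "y m \<ominus> y l \<in> J l" using coherent_diff[OF y, of l m] m N by simp
    ultimately have byl: "b \<ominus> y l \<in> J l" by (rule J_diff_trans[OF b'(1) yc])
    have 1: "a \<otimes> b \<ominus> a \<otimes> y l \<in> J l" by (rule mult_diff_left[OF a'(1) b'(1) yc(2) byl])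
    have "a \<ominus> x m \<in> J N2" using a'(2) J_mono[of N2 m] m N by auto
    then have "(a \<ominus> x m) \<otimes> y l \<in> J l" by (rule N2)
    moreover have "(a \<ominus> x m) \<otimes> y l = a \<otimes> y l \<ominus> x m \<otimes> y l"
      using a'(1) xc yc(2) by algebra
    ultimately have 2: "a \<otimes> y l \<ominus> x m \<otimes> y l \<in> J l" by simp
    have 3: "x m \<otimes> y l \<ominus> z l \<in> J l" using N1 m N by auto
    have cl: "a \<otimes> y l \<in> carrier R" "x m \<otimes> y l \<in> carrier R" "a \<otimes> b \<in> carrier R"
      using a'(1) b'(1) xc yc by simp_all
    show ?thesis
      by (rule J_diff_trans[OF cl(3,1) z 1 J_diff_trans[OF cl(1,2) z 2 3]])
  qed
  have "(limit_point x \<otimes>\<^bsub>CR\<^esub> limit_point y) l = {w \<in> carrier R.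
      \<exists>N. \<forall>m\<ge>N. \<forall>a\<in>J m +> x m. \<forall>b\<in>J m +> y m. w \<ominus> a \<otimes> b \<in> J l}" (is "_ = ?M")
    by (simp add: completion_def limit_point_def)
  also have "\<dots> = J l +> z l"
  proof (intro Set.set_eqI iffI)
    fix w assume "w \<in> ?M"
    then obtain N' where w: "w \<in> carrier R"
      "\<And>m a b. m \<ge> N' \<Longrightarrow> a \<in> J m +> x m \<Longrightarrow> b \<in> J m +> y m \<Longrightarrow> w \<ominus> a \<otimes> b \<in> J l" by blast
    let ?m = "max N N'"
    have xm: "x ?m \<in> J ?m +> x ?m" "y ?m \<in> J ?m +> y ?m"
      using x y by (simp_all add: coset_self coherent_closed)
    have "w \<ominus> x ?m \<otimes> y ?m \<in> J l" "x ?m \<otimes> y ?m \<ominus> z l \<in> J l"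
      using w(2)[of ?m, OF _ xm] key[of ?m, OF _ xm] by simp_all
    moreover have "x ?m \<otimes> y ?m \<in> carrier R" using x y by (simp add: coherent_closed)
    ultimately have "w \<ominus> z l \<in> J l" using J_diff_trans[OF w(1) _ z] by blast
    then show "w \<in> J l +> z l" using w z by (simp add: coset_mem)
  next
    fix w assume "w \<in> J l +> z l"
    then have w: "w \<in> carrier R" "w \<ominus> z l \<in> J l" using z by (simp_all add: coset_mem)
    have "w \<ominus> a \<otimes> b \<in> J l" if "m \<ge> N" "a \<in> J m +> x m" "b \<in> J m +> y m" for m a b
    proof -
      have "a \<in> carrier R" "b \<in> carrier R" using that x y by (simp_all add: coset_mem coherent_closed)
      then have ab: "a \<otimes> b \<in> carrier R" by simp
      show ?thesis by (rule J_diff_trans[OF w(1) z ab w(2) J_diff_sym[OF ab z key[OF that]]])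
    qed
    then show "w \<in> ?M" using w by blast
  qed
  finally show "(limit_point x \<otimes>\<^bsub>CR\<^esub> limit_point y) l = limit_point z l"
    by (simp add: limit_point_def)
qed

end

section \<open>The filtration by word length and the continuity of right multiplication\<close>

section \<open>The filtration of \<open>B\<close>\<close>

lemma (in ring) finsum_Sigma:
  "finite S \<Longrightarrow> (\<And>x. x \<in> S \<Longrightarrow> finite (T x)) \<Longrightarrow>
    (\<And>x y. x \<in> S \<Longrightarrow> y \<in> T x \<Longrightarrow> f (x, y) \<in> carrier R) \<Longrightarrow>
    (\<Oplus>k\<in>Sigma S T. f k) = (\<Oplus>x\<in>S. \<Oplus>y\<in>T x. f (x, y))"
proof (induction S rule: finite_induct)
  case (insert x S)
  have S: "Sigma (insert x S) T = Pair x ` T x \<union> Sigma S T" by auto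
  have "(\<Oplus>k\<in>Sigma (insert x S) T. f k) = (\<Oplus>k\<in>Pair x ` T x. f k) \<oplus> (\<Oplus>k\<in>Sigma S T. f k)"
    unfolding S using insert by (intro finsum_Un_disjoint) auto
  also have "(\<Oplus>k\<in>Pair x ` T x. f k) = (\<Oplus>y\<in>T x. f (x, y))"
    using insert by (intro finsum_reindex) (auto simp: inj_on_def)
  also have "(\<Oplus>k\<in>Sigma S T. f k) = (\<Oplus>x\<in>S. \<Oplus>y\<in>T x. f (x, y))"
    using insert by auto
  also have "(\<Oplus>y\<in>T x. f (x, y)) \<oplus> (\<Oplus>x\<in>S. \<Oplus>y\<in>T x. f (x, y)) = (\<Oplus>x\<in>insert x S. \<Oplus>y\<in>T x. f (x, y))"
    using insert by (intro finsum_insert[symmetric]) (auto intro!: finsum_closed)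
  finally show ?case .
qed simp

context filtered_group
begin

lemma finsum_split:
  assumes "finite F'" "F \<subseteq> F'" "\<And>k. k \<in> F' \<Longrightarrow> f k \<in> carrier R"
  shows "(\<Oplus>k\<in>F'. f k) = (\<Oplus>k\<in>F. f k) \<oplus> (\<Oplus>k\<in>F' - F. f k)"
proof -
  have "F \<union> (F' - F) = F'" using assms(2) by auto
  moreover have "(\<Oplus>k\<in>F \<union> (F' - F). f k) = (\<Oplus>k\<in>F. f k) \<oplus> (\<Oplus>k\<in>F' - F. f k)"
    using assms finite_subset[OF assms(2,1)] by (intro finsum_Un_disjoint) auto
  ultimately show ?thesis by simp
qed

lemma finsum_diff_closed:
  assumes "finite F'" "F \<subseteq> F'" "\<And>k. k \<in> F' \<Longrightarrow> f k \<in> carrier R" "\<And>k. k \<in> F' - F \<Longrightarrow> f k \<in> J l"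
  shows "(\<Oplus>k\<in>F'. f k) \<ominus> (\<Oplus>k\<in>F. f k) \<in> J l"
proof -
  have r: "(\<Oplus>k\<in>F' - F. f k) \<in> J l" using assms(4) by (rule J_finsum)
  have s: "(\<Oplus>k\<in>F. f k) \<in> carrier R" using assms by (auto intro!: finsum_closed)
  have "u \<oplus> v \<ominus> u = v" if "u \<in> carrier R" "v \<in> carrier R" for u v using that by algebra
  then have "(\<Oplus>k\<in>F. f k) \<oplus> (\<Oplus>k\<in>F' - F. f k) \<ominus> (\<Oplus>k\<in>F. f k) \<in> J l"
    using r s J_carrier[OF r] by simp
  then show ?thesis using finsum_split[of F' F f] assms(1-3) by simp
qed

lemma summable_family:
  assumes f: "\<And>k. k \<in> A \<Longrightarrow> f k \<in> carrier R"
    and F: "\<And>l. finite (F l)" "\<And>l. F l \<subseteq> A" "\<And>l. F l \<subseteq> F (Suc l)"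
    and small: "\<And>l k. k \<in> A - F l \<Longrightarrow> f k \<in> J l"
  shows "coherent (\<lambda>l. \<Oplus>k\<in>F l. f k)"
    and "has_csum CR (\<lambda>k. to_completion R J (f k)) A (limit_point (\<lambda>l. \<Oplus>k\<in>F l. f k))"
proof -
  have c: "(\<Oplus>k\<in>F l. f k) \<in> carrier R" for l using f F(2)[of l] by (auto intro!: finsum_closed)
  show coh: "coherent (\<lambda>l. \<Oplus>k\<in>F l. f k)"
    unfolding coherent_def
  proof (intro allI conjI c finsum_diff_closed F)
    fix l k
    show "k \<in> F (Suc l) \<Longrightarrow> f k \<in> carrier R" using f F(2)[of "Suc l"] by blast
    show "k \<in> F (Suc l) - F l \<Longrightarrow> f k \<in> J l" using small F(2)[of "Suc l"] by blast
  qed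
  show "has_csum CR (\<lambda>k. to_completion R J (f k)) A (limit_point (\<lambda>l. \<Oplus>k\<in>F l. f k))"
    unfolding to_completion_eq
    by (rule has_csumI[where F = F])
      (use f F small coh c in \<open>simp_all add: coherent_const J_zero minus_eq r_neg\<close>)
qed

end

context cartan
begin

text \<open>The filtration in terms of monomials, whose length can be followed through the
  commutation relations; \<open>Bfilt_eq\<close> identifies the two.\<close>

definition fil :: "nat \<Rightarrow> ('i, 't) ncpoly set set"
  where "fil l = lspan (Bq D) {b \<otimes>\<^bsub>Bq D\<^esub> MB w | b w. b \<in> carrier (Bq D) \<and> w \<in> lists I \<and> l \<le> length w}"

lemma fil_gens: "{b \<otimes>\<^bsub>Bq D\<^esub> MB w | b w. b \<in> carrier (Bq D) \<and> w \<in> lists I \<and> l \<le> length w} \<subseteq> carrier (Bq D)"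
  by auto

lemma fil_incl: "b \<in> carrier (Bq D) \<Longrightarrow> w \<in> lists I \<Longrightarrow> l \<le> length w \<Longrightarrow> b \<otimes>\<^bsub>Bq D\<^esub> MB w \<in> fil l"
  unfolding fil_def by (rule B.lspan_incl[OF fil_gens]) blast

lemma fil_closed: "x \<in> fil l \<Longrightarrow> x \<in> carrier (Bq D)"
  unfolding fil_def by (rule B.lspan_closed[OF fil_gens])

lemma fil_add: "x \<in> fil l \<Longrightarrow> y \<in> fil l \<Longrightarrow> x \<oplus>\<^bsub>Bq D\<^esub> y \<in> fil l"
  unfolding fil_def by (rule B.lspan_add[OF fil_gens])

lemma fil_smul: "x \<in> fil l \<Longrightarrow> smul (Bq D) c x \<in> fil l"
  unfolding fil_def by (rule B.lspan_smul[OF fil_gens])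

lemma fil_minus: "x \<in> fil l \<Longrightarrow> \<ominus>\<^bsub>Bq D\<^esub> x \<in> fil l"
  unfolding fil_def by (rule B.lspan_minus[OF fil_gens])

lemma fil_zero: "\<zero>\<^bsub>Bq D\<^esub> \<in> fil l"
  unfolding fil_def by (rule lspan.zero)

lemma fil_mono: "l \<le> m \<Longrightarrow> fil m \<subseteq> fil l"
  unfolding fil_def by (rule B.lspan_mono) (use le_trans in blast)

lemma fil_0: "x \<in> carrier (Bq D) \<Longrightarrow> x \<in> fil 0"
  using fil_incl[of x "[]" 0] by simp

lemma fil_induct [consumes 1, case_names zero step]:
  assumes "x \<in> fil l" and "Q \<zero>\<^bsub>Bq D\<^esub>"
    and "\<And>b w u c. b \<in> carrier (Bq D) \<Longrightarrow> w \<in> lists I \<Longrightarrow> l \<le> length w \<Longrightarrow> u \<in> fil l \<Longrightarrow> Q u \<Longrightarrow>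
      Q (smul (Bq D) c (b \<otimes>\<^bsub>Bq D\<^esub> MB w) \<oplus>\<^bsub>Bq D\<^esub> u)"
  shows "Q x"
  using assms(1) unfolding fil_def
proof induction
  case zero
  show ?case by (rule assms(2))
next
  case (step m u c)
  then show ?case using assms(3)[of _ _ u c] by (auto simp: fil_def)
qed

lemma fil_mult_right:
  assumes x: "x \<in> fil l" and g: "g \<in> carrier (Bq D)"
    and M: "\<And>w. w \<in> lists I \<Longrightarrow> l \<le> length w \<Longrightarrow> MB w \<otimes>\<^bsub>Bq D\<^esub> g \<in> fil l'"
    and left: "\<And>a y. a \<in> carrier (Bq D) \<Longrightarrow> y \<in> fil l' \<Longrightarrow> a \<otimes>\<^bsub>Bq D\<^esub> y \<in> fil l'"
  shows "x \<otimes>\<^bsub>Bq D\<^esub> g \<in> fil l'"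
  using x
proof (induction rule: fil_induct)
  case zero
  then show ?case using g by (simp add: fil_zero)
next
  case (step b w u c)
  have "(smul (Bq D) c (b \<otimes>\<^bsub>Bq D\<^esub> MB w) \<oplus>\<^bsub>Bq D\<^esub> u) \<otimes>\<^bsub>Bq D\<^esub> g
      = smul (Bq D) c (b \<otimes>\<^bsub>Bq D\<^esub> (MB w \<otimes>\<^bsub>Bq D\<^esub> g)) \<oplus>\<^bsub>Bq D\<^esub> u \<otimes>\<^bsub>Bq D\<^esub> g"
    using step g fil_closed[OF step(4)] by (simp add: B.l_distr B.smul_mult_left B.m_assoc)
  then show ?case using step M left by (simp add: fil_add fil_smul)
qed

lemma fil_left:
  assumes a: "a \<in> carrier (Bq D)" and x: "x \<in> fil l"
  shows "a \<otimes>\<^bsub>Bq D\<^esub> x \<in> fil l"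
  using x
proof (induction rule: fil_induct)
  case zero
  then show ?case using a by (simp add: fil_zero)
next
  case (step b w u c)
  have "a \<otimes>\<^bsub>Bq D\<^esub> (smul (Bq D) c (b \<otimes>\<^bsub>Bq D\<^esub> MB w) \<oplus>\<^bsub>Bq D\<^esub> u)
      = smul (Bq D) c ((a \<otimes>\<^bsub>Bq D\<^esub> b) \<otimes>\<^bsub>Bq D\<^esub> MB w) \<oplus>\<^bsub>Bq D\<^esub> a \<otimes>\<^bsub>Bq D\<^esub> u"
    using step a fil_closed[OF step(4)] by (simp add: B.r_distr B.smul_mult_right B.m_assoc)
  then show ?case using step a by (simp add: fil_add fil_smul fil_incl)
qed

lemma MB_snoc: "w \<in> lists I \<Longrightarrow> j \<in> I \<Longrightarrow> MB (w @ [j]) = MB w \<otimes>\<^bsub>Bq D\<^esub> eB j"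
  by (simp add: Be.mon_g_append)

lemma MB_fil: "w \<in> lists I \<Longrightarrow> l \<le> length w \<Longrightarrow> MB w \<in> fil l"
  using fil_incl[of "\<one>\<^bsub>Bq D\<^esub>" w l] by simp

lemma fil_MB:
  assumes x: "x \<in> fil l" and v: "v \<in> lists I"
  shows "x \<otimes>\<^bsub>Bq D\<^esub> MB v \<in> fil (l + length v)"
proof (rule fil_mult_right[OF x _ _ fil_left])
  fix w assume w: "w \<in> lists I" "l \<le> length w"
  have "MB w \<otimes>\<^bsub>Bq D\<^esub> MB v = MB (w @ v)" using w v by (simp add: Be.mon_g_append)
  then show "MB w \<otimes>\<^bsub>Bq D\<^esub> MB v \<in> fil (l + length v)" using w v by (simp add: MB_fil)
qed (use v in simp_all)

lemma fil_e: "x \<in> fil l \<Longrightarrow> j \<in> I \<Longrightarrow> x \<otimes>\<^bsub>Bq D\<^esub> eB j \<in> fil (Suc l)"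
  using fil_MB[of x l "[j]"] by simp

text \<open>Words are weight vectors, so q^h passes them with an invertible scalar.\<close>

lemma fil_Q:
  assumes x: "x \<in> fil l" and h: "h \<in> colat D"
  shows "x \<otimes>\<^bsub>Bq D\<^esub> QB h \<in> fil l"
proof (rule fil_mult_right[OF x _ _ fil_left])
  fix w assume w: "w \<in> lists I" "l \<le> length w"
  let ?c = "qpow (1 * Qweight D (count (mset w)) h)"
  have "QB h \<otimes>\<^bsub>Bq D\<^esub> MB w = smul (Bq D) ?c (MB w \<otimes>\<^bsub>Bq D\<^esub> QB h)"
    using Be.Q_mon[OF h w(1)] Be.weight_scalar[OF h w(1)] by simp
  then have "smul (Bq D) (inverse ?c) (QB h \<otimes>\<^bsub>Bq D\<^esub> MB w) = MB w \<otimes>\<^bsub>Bq D\<^esub> QB h"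
    using w h by (simp add: Be.Q_closed)
  moreover have "smul (Bq D) (inverse ?c) (QB h \<otimes>\<^bsub>Bq D\<^esub> MB w) \<in> fil l"
    using w h by (simp add: fil_smul fil_incl Be.Q_closed)
  ultimately show "MB w \<otimes>\<^bsub>Bq D\<^esub> QB h \<in> fil l" by simp
qed (use h in \<open>simp_all add: Be.Q_closed\<close>)

text \<open>Crossing f_i deletes at most one e''. For the empty word the truncated subtraction gives
  level 0, which is the whole algebra.\<close>

lemma MB_f: "w \<in> lists I \<Longrightarrow> i \<in> I \<Longrightarrow> MB w \<otimes>\<^bsub>Bq D\<^esub> fB i \<in> fil (length w - 1)"
proof (induction w rule: rev_induct)
  case Nil
  then show ?case by (simp add: fil_0)
next
  case (snoc j w)
  then have j: "j \<in> I" and w: "w \<in> lists I" by simp_all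
  let ?d = "if j = i then \<one>\<^bsub>Bq D\<^esub> else \<zero>\<^bsub>Bq D\<^esub>"
  have "MB (w @ [j]) \<otimes>\<^bsub>Bq D\<^esub> fB i = MB w \<otimes>\<^bsub>Bq D\<^esub> (eB j \<otimes>\<^bsub>Bq D\<^esub> fB i)"
    using w j snoc.prems by (simp add: MB_snoc B.m_assoc)
  also have "\<dots> = smul (Bq D) (p j i) ((MB w \<otimes>\<^bsub>Bq D\<^esub> fB i) \<otimes>\<^bsub>Bq D\<^esub> eB j) \<oplus>\<^bsub>Bq D\<^esub> MB w \<otimes>\<^bsub>Bq D\<^esub> ?d"
    using w j snoc.prems by (simp add: boson_relation B.r_distr B.smul_mult_right B.m_assoc)
  also have "\<dots> \<in> fil (length w)"
  proof (intro fil_add fil_smul)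
    have "(MB w \<otimes>\<^bsub>Bq D\<^esub> fB i) \<otimes>\<^bsub>Bq D\<^esub> eB j \<in> fil (Suc (length w - 1))"
      using snoc w j by (intro fil_e) auto
    \<comment> \<open>For nonempty \<open>w\<close> the index equals \<open>length w\<close>; for
      empty \<open>w\<close> it is 1, one more than required, and monotonicity applies.\<close>
    then show "(MB w \<otimes>\<^bsub>Bq D\<^esub> fB i) \<otimes>\<^bsub>Bq D\<^esub> eB j \<in> fil (length w)"
      using fil_mono[of "length w" "Suc (length w - 1)"] by (cases "length w") auto
    show "MB w \<otimes>\<^bsub>Bq D\<^esub> ?d \<in> fil (length w)" using w by (simp add: MB_fil fil_zero)
  qed
  finally show ?case by simp
qed

lemma fil_f:
  assumes x: "x \<in> fil (Suc l)" and i: "i \<in> I"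
  shows "x \<otimes>\<^bsub>Bq D\<^esub> fB i \<in> fil l"
proof (rule fil_mult_right[OF x _ _ fil_left])
  fix w assume w: "w \<in> lists I" "Suc l \<le> length w"
  then have "fil (length w - 1) \<subseteq> fil l" by (intro fil_mono) simp
  then show "MB w \<otimes>\<^bsub>Bq D\<^esub> fB i \<in> fil l" using MB_f[OF w(1) i] by blast
qed (use i in simp_all)

text \<open>The induction needs one loss \<open>d\<close> valid at all levels, so that losses add up
  under products. Among the generators only f_i loses a level.\<close>

lemma fil_right:
  assumes b: "b \<in> carrier (Bq D)"
  shows "\<exists>N. \<forall>x\<in>fil N. x \<otimes>\<^bsub>Bq D\<^esub> b \<in> fil l"
proof -
  have gc: "Bgen D ` gens D \<subseteq> carrier (Bq D)"
    by (auto simp: gens_def Be.Q_closed)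
  have "b \<in> subalg (Bq D) (Bgen D ` gens D)" using b B_generated by simp
  then have "b \<in> carrier (Bq D) \<and> (\<exists>d. \<forall>l. \<forall>x\<in>fil (l + d). x \<otimes>\<^bsub>Bq D\<^esub> b \<in> fil l)"
    unfolding subalg_def
  proof induction
    case one
    show ?case using fil_closed by (auto intro!: exI[of _ 0])
  next
    case (incl h)
    then have hc: "h \<in> carrier (Bq D)" using gc B.scal_closed by auto
    from incl consider j where "j \<in> I" "h = eB j" | j where "j \<in> I" "h = fB j"
      | h' where "h' \<in> colat D" "h = QB h'" | c where "h = scal (Bq D) c"
      by (auto simp: gens_def)
    then show ?case
    proof cases
      case 1
      have "\<forall>l. \<forall>x\<in>fil (l + 0). x \<otimes>\<^bsub>Bq D\<^esub> h \<in> fil l"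
        using fil_e 1 fil_mono[of l "Suc l" for l] by (simp add: subset_iff)
      then show ?thesis using hc by blast
    next
      case 2
      have "\<forall>l. \<forall>x\<in>fil (l + 1). x \<otimes>\<^bsub>Bq D\<^esub> h \<in> fil l" using fil_f 2 by simp
      then show ?thesis using hc by blast
    next
      case 3
      have "\<forall>l. \<forall>x\<in>fil (l + 0). x \<otimes>\<^bsub>Bq D\<^esub> h \<in> fil l" using fil_Q 3 by simp
      then show ?thesis using hc by blast
    next
      case 4
      have "x \<otimes>\<^bsub>Bq D\<^esub> h \<in> fil l" if "x \<in> fil (l + 0)" for x l
        using fil_smul[of x l c] fil_closed[of x l] that 4 by (simp add: smul_def B.scal_comm)
      then show ?thesis using hc by blast
    qed
  next
    case (a_inv h)
    then obtain d where d: "\<And>l x. x \<in> fil (l + d) \<Longrightarrow> x \<otimes>\<^bsub>Bq D\<^esub> h \<in> fil l" by blast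
    have "x \<otimes>\<^bsub>Bq D\<^esub> (\<ominus>\<^bsub>Bq D\<^esub> h) \<in> fil l" if x: "x \<in> fil (l + d)" for x l
      using fil_minus[OF d[OF x]] a_inv fil_closed[OF x] by (simp add: B.r_minus)
    then show ?case using a_inv by (simp, blast)
  next
    case (eng_add h1 h2)
    then obtain d1 d2 where d: "\<And>l x. x \<in> fil (l + d1) \<Longrightarrow> x \<otimes>\<^bsub>Bq D\<^esub> h1 \<in> fil l"
      "\<And>l x. x \<in> fil (l + d2) \<Longrightarrow> x \<otimes>\<^bsub>Bq D\<^esub> h2 \<in> fil l" by blast
    have "x \<otimes>\<^bsub>Bq D\<^esub> (h1 \<oplus>\<^bsub>Bq D\<^esub> h2) \<in> fil l" if x: "x \<in> fil (l + (d1 + d2))" for x l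
    proof -
      have "x \<in> fil (l + d1)" "x \<in> fil (l + d2)"
        using x fil_mono[of "l + d1" "l + (d1 + d2)"] fil_mono[of "l + d2" "l + (d1 + d2)"] by auto
      then show ?thesis
        using d eng_add fil_closed[OF x] by (simp add: B.r_distr fil_add)
    qed
    then show ?case using eng_add by (simp, blast)
  next
    case (eng_mult h1 h2)
    then obtain d1 d2 where d: "\<And>l x. x \<in> fil (l + d1) \<Longrightarrow> x \<otimes>\<^bsub>Bq D\<^esub> h1 \<in> fil l"
      "\<And>l x. x \<in> fil (l + d2) \<Longrightarrow> x \<otimes>\<^bsub>Bq D\<^esub> h2 \<in> fil l" by blast
    have "x \<otimes>\<^bsub>Bq D\<^esub> (h1 \<otimes>\<^bsub>Bq D\<^esub> h2) \<in> fil l" if x: "x \<in> fil (l + (d2 + d1))" for x l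
    proof -
      have "x \<otimes>\<^bsub>Bq D\<^esub> h1 \<otimes>\<^bsub>Bq D\<^esub> h2 \<in> fil l"
        using d(2)[OF d(1)[of x "l + d2"]] x by (simp add: add.assoc)
      then show ?thesis using eng_mult fil_closed[OF x] by (simp add: B.m_assoc)
    qed
    then show ?case using eng_mult by (simp, blast)
  qed
  then show ?thesis by blast
qed

lemma words_length: "w \<in> words D m \<Longrightarrow> length w = Qheight D m"
  by (auto simp: words_def Qheight_word)

lemma Bplus_wt_fil: "m \<in> Qplus D \<Longrightarrow> u \<in> Bplus_wt D m \<Longrightarrow> x \<in> fil l \<Longrightarrow> x \<otimes>\<^bsub>Bq D\<^esub> u \<in> fil (l + Qheight D m)"
proof -
  assume m: "m \<in> Qplus D" and u: "u \<in> Bplus_wt D m" and x: "x \<in> fil l"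
  have M: "MB ` words D m \<subseteq> carrier (Bq D)" by (auto simp: words_def)
  show ?thesis
    using u unfolding Bplus_wt_eq[OF m]
  proof induction
    case zero
    then show ?case using fil_closed[OF x] by (simp add: fil_zero)
  next
    case (step a u c)
    then obtain w where w: "w \<in> words D m" "a = MB w" by auto
    then have wl: "w \<in> lists I" by (simp add: words_def)
    have "u \<in> carrier (Bq D)" using step(2) B.lspan_closed[OF M] by blast
    then have "x \<otimes>\<^bsub>Bq D\<^esub> (smul (Bq D) c a \<oplus>\<^bsub>Bq D\<^esub> u)
        = smul (Bq D) c (x \<otimes>\<^bsub>Bq D\<^esub> MB w) \<oplus>\<^bsub>Bq D\<^esub> x \<otimes>\<^bsub>Bq D\<^esub> u"
      using w wl fil_closed[OF x] by (simp add: B.r_distr B.smul_mult_right)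
    moreover have "x \<otimes>\<^bsub>Bq D\<^esub> MB w \<in> fil (l + Qheight D m)"
      using fil_MB[OF x wl] words_length[OF w(1)] by simp
    ultimately show ?case using step by (simp add: fil_add fil_smul)
  qed
qed

lemma Bplus_ge_carrier: "Bplus_ge D l \<subseteq> carrier (Bq D)"
proof -
  have "Bplus D \<subseteq> carrier (Bq D)"
    unfolding Bplus_def by (rule B.subalg_subset) auto
  then have "(\<Union>m\<in>{m \<in> Qplus D. l \<le> Qheight D m}. Bplus_wt D m) \<subseteq> carrier (Bq D)"
    by (auto simp: Bplus_wt_def)
  then show ?thesis unfolding Bplus_ge_def using B.add.generate_incl by simp
qed

lemma add_monoid_inv: "inv\<^bsub>add_monoid A\<^esub> x = \<ominus>\<^bsub>A\<^esub> x"
  by (simp add: a_inv_def)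

lemma Bplus_ge_fil: "u \<in> Bplus_ge D l \<Longrightarrow> b \<in> carrier (Bq D) \<Longrightarrow> b \<otimes>\<^bsub>Bq D\<^esub> u \<in> fil l"
proof -
  assume u: "u \<in> Bplus_ge D l" and b: "b \<in> carrier (Bq D)"
  have base: "v \<in> carrier (Bq D) \<and> b \<otimes>\<^bsub>Bq D\<^esub> v \<in> fil l"
    if "v \<in> (\<Union>m\<in>{m \<in> Qplus D. l \<le> Qheight D m}. Bplus_wt D m)" for v
  proof -
    obtain m where m: "m \<in> Qplus D" "l \<le> Qheight D m" "v \<in> Bplus_wt D m" using \<open>v \<in> _\<close> by auto
    have "v \<in> Bplus_ge D l" unfolding Bplus_ge_def using that by (rule generate.incl)
    then have "v \<in> carrier (Bq D)" using Bplus_ge_carrier by blast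
    moreover have "b \<otimes>\<^bsub>Bq D\<^esub> v \<in> fil (Qheight D m)"
      using Bplus_wt_fil[OF m(1,3) fil_0[OF b]] by simp
    ultimately show ?thesis using fil_mono[OF m(2)] by blast
  qed
  have "u \<in> carrier (Bq D) \<and> b \<otimes>\<^bsub>Bq D\<^esub> u \<in> fil l"
    using u unfolding Bplus_ge_def
  proof induction
    case one
    then show ?case using b by (simp add: fil_zero)
  next
    case (incl h)
    then show ?case by (rule base)
  next
    case (inv h)
    then show ?case using base[OF inv] b fil_minus[of "b \<otimes>\<^bsub>Bq D\<^esub> h" l] by (simp add: add_monoid_inv B.r_minus)
  next
    case (eng h1 h2)
    then show ?case using b by (simp add: B.r_distr fil_add)
  qed
  then show ?thesis by blast
qed

lemma MB_Bplus_ge: "w \<in> lists I \<Longrightarrow> l \<le> length w \<Longrightarrow> MB w \<in> Bplus_ge D l"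
proof -
  assume w: "w \<in> lists I" "l \<le> length w"
  let ?m = "count (mset w)"
  have m: "?m \<in> Qplus D" "l \<le> Qheight D ?m" using w words_Qplus Qheight_word by auto
  have M: "MB ` words D ?m \<subseteq> carrier (Bq D)" by (auto simp: words_def)
  have "MB w \<in> Bplus_wt D ?m"
    unfolding Bplus_wt_eq[OF m(1)] using w by (intro B.lspan_incl[OF M]) (auto simp: words_def)
  then show ?thesis unfolding Bplus_ge_def using m by (intro generate.incl) blast
qed

text \<open>B^+_\<beta> is spanned by words of weight \<beta>, and these all have length
  |\<beta>|.\<close>

lemma Bfilt_eq: "Bfilt D l = fil l"
proof
  have gen: "h \<in> fil l" if "h \<in> {b \<otimes>\<^bsub>Bq D\<^esub> u | b u. b \<in> carrier (Bq D) \<and> u \<in> Bplus_ge D l}" for h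
    using that Bplus_ge_fil by blast
  show "Bfilt D l \<subseteq> fil l"
  proof
    fix x assume "x \<in> Bfilt D l"
    then show "x \<in> fil l"
      unfolding Bfilt_def left_span_def
    proof induction
      case one
      then show ?case by (simp add: fil_zero)
    next
      case (incl h)
      then show ?case by (rule gen)
    next
      case (inv h)
      then show ?case using fil_minus[OF gen[OF inv]] by (simp add: add_monoid_inv)
    next
      case (eng h1 h2)
      then show ?case by (simp add: fil_add)
    qed
  qed
  show "fil l \<subseteq> Bfilt D l"
  proof
    fix x assume "x \<in> fil l"
    then show "x \<in> Bfilt D l"
    proof (induction rule: fil_induct)
      case zero
      then show ?case unfolding Bfilt_def left_span_def using generate.one[of "add_monoid (Bq D)"] by simp
    next
      case (step b w u c)
      have "smul (Bq D) c b \<otimes>\<^bsub>Bq D\<^esub> MB w \<in> Bfilt D l"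
        unfolding Bfilt_def left_span_def using step MB_Bplus_ge
        by (intro generate.incl CollectI exI[of _ "smul (Bq D) c b"] exI[of _ "MB w"]) auto
      then have "smul (Bq D) c (b \<otimes>\<^bsub>Bq D\<^esub> MB w) \<in> Bfilt D l"
        using step by (simp add: B.smul_mult_left)
      then show ?case
        using step(5) generate.eng[of _ "add_monoid (Bq D)"] unfolding Bfilt_def left_span_def by simp
    qed
  qed
qed

sublocale BF: filtered_ring "Bq D" "Bfilt D"
proof (intro filtered_ring.intro filtered_group.intro filtered_group_axioms.intro
    filtered_ring_axioms.intro B.ring_axioms)
  fix l
  show "additive_subgroup (Bfilt D l) (Bq D)"
    using fil_closed
    by (intro additive_subgroup.intro subgroup.intro)
      (auto simp: Bfilt_eq add_monoid_inv fil_minus fil_add fil_zero)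
  show "Bfilt D (Suc l) \<subseteq> Bfilt D l" by (simp add: Bfilt_eq fil_mono)
  show "a \<otimes>\<^bsub>Bq D\<^esub> x \<in> Bfilt D l" if "a \<in> carrier (Bq D)" "x \<in> Bfilt D l" for a x
    using that by (simp add: Bfilt_eq fil_left)
  show "\<exists>N. \<forall>x\<in>Bfilt D N. x \<otimes>\<^bsub>Bq D\<^esub> b \<in> Bfilt D l" if "b \<in> carrier (Bq D)" for b
    using that by (simp add: Bfilt_eq fil_right)
qed

lemma Bhat_eq: "Bhat D = BF.CR" by (simp add: Bhat_def)

lemma to_Bhat_eq: "to_Bhat D a = BF.limit_point (\<lambda>_. a)"
  by (simp add: to_Bhat_def BF.to_completion_eq)

end

section \<open>The completion of the subalgebra generated by the e''_i and f_i, and telescoping sums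
  over weights\<close>

section \<open>The extremal projector\<close>

lemma finsum_subring_eq:
  assumes "ring A" "ring (A\<lparr>carrier := V\<rparr>)" "V \<subseteq> carrier A" "finite F" "f ` F \<subseteq> V"
  shows "finsum (A\<lparr>carrier := V\<rparr>) f F = finsum A f F"
proof -
  interpret A: ring A by (rule assms(1))
  interpret V: ring "A\<lparr>carrier := V\<rparr>" by (rule assms(2))
  show ?thesis
    using assms(4,5)
  proof (induction F rule: finite_induct)
    case (insert x F)
    have "f \<in> F \<rightarrow> V" "f x \<in> V" "f \<in> F \<rightarrow> carrier A" "f x \<in> carrier A"
      using insert.prems assms(3) by auto
    then show ?case using insert by simp
  qed simp
qed

context cartan
begin

lemma Bminus_Bvee: "Bminus D \<subseteq> Bvee D" and Bplus_Bvee: "Bplus D \<subseteq> Bvee D"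
  unfolding Bminus_def Bplus_def Bvee_def by (rule B.subalg_least; auto intro: B.subalg_incl)+

lemma Bvee_carrier: "Bvee D \<subseteq> carrier (Bq D)"
  unfolding Bvee_def by (rule B.subalg_subset) auto

lemma Bplus_carrier: "Bplus D \<subseteq> carrier (Bq D)"
  using Bplus_Bvee Bvee_carrier by blast

lemma kalg_Bvee: "kalg (Bvee_alg D)"
  unfolding Bvee_alg_def Bvee_def by (rule B.kalg_subalg) auto

sublocale V: kalg "Bvee_alg D" by (rule kalg_Bvee)

lemma Bvee_alg_simps: "carrier (Bvee_alg D) = Bvee D" "monoid.mult (Bvee_alg D) = monoid.mult (Bq D)"
  "add (Bvee_alg D) = add (Bq D)" "\<zero>\<^bsub>Bvee_alg D\<^esub> = \<zero>\<^bsub>Bq D\<^esub>" "\<one>\<^bsub>Bvee_alg D\<^esub> = \<one>\<^bsub>Bq D\<^esub>"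
  by (simp_all add: Bvee_alg_def)

lemma Bvee_minus: "x \<in> Bvee D \<Longrightarrow> \<ominus>\<^bsub>Bvee_alg D\<^esub> x = \<ominus>\<^bsub>Bq D\<^esub> x"
proof -
  assume x: "x \<in> Bvee D"
  have "\<ominus>\<^bsub>Bvee_alg D\<^esub> x \<in> Bvee D" "\<ominus>\<^bsub>Bvee_alg D\<^esub> x \<oplus>\<^bsub>Bq D\<^esub> x = \<zero>\<^bsub>Bq D\<^esub>"
    using V.a_inv_closed[of x] V.l_neg[of x] x by (simp_all add: Bvee_alg_simps)
  moreover have "x \<in> carrier (Bq D)" "\<ominus>\<^bsub>Bvee_alg D\<^esub> x \<in> carrier (Bq D)"
    using x calculation(1) Bvee_carrier by blast+
  ultimately show ?thesis using B.minus_equality by simp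
qed

lemma Bplus_ge_Bplus: "Bplus_ge D l \<subseteq> Bplus D"
proof
  fix u assume "u \<in> Bplus_ge D l"
  then show "u \<in> Bplus D"
    unfolding Bplus_ge_def
  proof induction
    case one
    show ?case by (simp add: Bplus_def B.subalg_zero)
  next
    case (incl h)
    then show ?case by (auto simp: Bplus_wt_def)
  next
    case (inv h)
    then have "h \<in> Bplus D" by (auto simp: Bplus_wt_def)
    then show ?case by (simp add: add_monoid_inv Bplus_def B.subalg_minus)
  next
    case (eng h1 h2)
    then show ?case by (simp add: Bplus_def B.subalg_add)
  qed
qed

abbreviation "vee_gens l \<equiv> {b \<otimes>\<^bsub>Bvee_alg D\<^esub> u | b u. b \<in> carrier (Bvee_alg D) \<and> u \<in> Bplus_ge D l}"

lemma vee_gens_closed: "vee_gens l \<subseteq> carrier (Bvee_alg D)"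
  using Bplus_ge_Bplus Bplus_Bvee V.m_closed by (force simp: Bvee_alg_simps)

lemma Bvee_filt_incl: "b \<in> Bvee D \<Longrightarrow> u \<in> Bplus_ge D l \<Longrightarrow> b \<otimes>\<^bsub>Bq D\<^esub> u \<in> Bvee_filt D l"
  unfolding Bvee_filt_def left_span_def
  by (intro generate.incl CollectI exI[of _ b] exI[of _ u]) (simp add: Bvee_alg_simps)

lemma vee_gens_fil: "h \<in> vee_gens l \<Longrightarrow> h \<in> Bvee D \<and> h \<in> fil l"
proof -
  assume h: "h \<in> vee_gens l"
  then obtain b u where bu: "h = b \<otimes>\<^bsub>Bq D\<^esub> u" "b \<in> Bvee D" "u \<in> Bplus_ge D l"
    by (auto simp: Bvee_alg_simps)
  have "h \<in> Bvee D" using vee_gens_closed h Bvee_alg_simps(1) by blast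
  moreover have "h \<in> fil l"
    unfolding bu(1) using bu(2) Bvee_carrier by (intro Bplus_ge_fil[OF bu(3)]) blast
  ultimately show ?thesis by blast
qed

lemma Bvee_filt_fil: "Bvee_filt D l \<subseteq> Bfilt D l"
proof
  fix x assume "x \<in> Bvee_filt D l"
  then have "x \<in> Bvee D \<and> x \<in> fil l"
    unfolding Bvee_filt_def left_span_def
  proof induction
    case one
    show ?case using V.zero_closed by (simp add: Bvee_alg_simps fil_zero)
  next
    case (incl h)
    then show ?case by (rule vee_gens_fil)
  next
    case (inv h)
    then have "h \<in> Bvee D \<and> h \<in> fil l" by (rule vee_gens_fil)
    then show ?case using V.a_inv_closed[of h] unfolding add_monoid_inv
      by (simp add: Bvee_minus fil_minus Bvee_alg_simps)
  next
    case (eng h1 h2)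
    then show ?case using V.a_closed[of h1 h2] by (simp add: fil_add Bvee_alg_simps)
  qed
  then show "x \<in> Bfilt D l" by (simp add: Bfilt_eq)
qed

sublocale VF: filtered_group "Bvee_alg D" "Bvee_filt D"
proof (intro filtered_group.intro filtered_group_axioms.intro V.ring_axioms)
  fix l
  show "additive_subgroup (Bvee_filt D l) (Bvee_alg D)"
    unfolding Bvee_filt_def left_span_def
    using V.add.generate_is_subgroup[OF vee_gens_closed[of l]]
    by (intro additive_subgroup.intro) simp
  have "Bplus_ge D (Suc l) \<subseteq> Bplus_ge D l"
    unfolding Bplus_ge_def by (rule B.add.mono_generate) auto
  then have "vee_gens (Suc l) \<subseteq> vee_gens l" by blast
  then show "Bvee_filt D (Suc l) \<subseteq> Bvee_filt D l"
    unfolding Bvee_filt_def left_span_def by (rule V.add.mono_generate)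
qed

definition low :: "nat \<Rightarrow> ('i \<Rightarrow> nat) set"
  where "low n = {\<beta> \<in> Qplus D. Qheight D \<beta> < n}"

lemma le_Qheight: "i \<in> I \<Longrightarrow> \<beta> i \<le> Qheight D \<beta>"
  unfolding Qheight_def using finite_I by (intro member_le_sum) auto

lemma finite_low: "finite (low n)"
proof (rule finite_subset)
  show "low n \<subseteq> {f. \<forall>i. (i \<in> I \<longrightarrow> f i \<in> {..<n}) \<and> (i \<notin> I \<longrightarrow> f i = 0)}"
    by (auto simp: low_def Qplus_def intro: le_less_trans[OF le_Qheight])
qed (intro finite_set_of_finite_funs finite_I, simp)

lemma Qheight_lower: "i \<in> I \<Longrightarrow> \<gamma> i \<noteq> 0 \<Longrightarrow> Suc (Qheight D (\<gamma>(i := \<gamma> i - 1))) = Qheight D \<gamma>"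
proof -
  assume i: "i \<in> I" and \<gamma>: "\<gamma> i \<noteq> 0"
  have "(\<Sum>j\<in>I - {i}. (\<gamma>(i := \<gamma> i - 1)) j) = (\<Sum>j\<in>I - {i}. \<gamma> j)" by (intro sum.cong) auto
  then show ?thesis
    using \<gamma> finite_I i by (simp add: Qheight_def sum.remove[of I i])
qed

text \<open>Lowering the i-th coefficient maps the weights of height at most n with nonzero i-th
  coefficient bijectively onto the weights of height below n. All terms cancel except those of
  height exactly n, which lie in \<open>Bfilt D n\<close>.\<close>

lemma telescope:
  assumes i: "i \<in> I" and T: "\<And>\<gamma>. \<gamma> \<in> Qplus D \<Longrightarrow> t \<gamma> \<in> Bfilt D (Qheight D \<gamma>)"
  shows "(\<Oplus>\<^bsub>Bq D\<^esub>\<gamma>\<in>low (Suc n). t \<gamma> \<oplus>\<^bsub>Bq D\<^esub>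
      (if \<gamma> i = 0 then \<zero>\<^bsub>Bq D\<^esub> else \<ominus>\<^bsub>Bq D\<^esub> t (\<gamma>(i := \<gamma> i - 1)))) \<in> Bfilt D n"
proof -
  let ?low = "\<lambda>\<gamma>. \<gamma>(i := \<gamma> i - 1)" and ?S = "{\<gamma> \<in> low (Suc n). \<gamma> i \<noteq> 0}"
  have tc: "t \<gamma> \<in> carrier (Bq D)" if "\<gamma> \<in> Qplus D" for \<gamma> using BF.J_carrier[OF T[OF that]] .
  have lowQ: "?low \<gamma> \<in> Qplus D" if "\<gamma> \<in> Qplus D" for \<gamma> using that by (auto simp: Qplus_def)
  have lQ: "\<gamma> \<in> Qplus D" if "\<gamma> \<in> low m" for \<gamma> m using that by (simp add: low_def)
  have bij: "?low ` ?S = low n"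
  proof
    show "?low ` ?S \<subseteq> low n"
    proof
      fix \<beta> assume "\<beta> \<in> ?low ` ?S"
      then obtain \<gamma> where \<gamma>: "\<gamma> \<in> low (Suc n)" "\<gamma> i \<noteq> 0" and \<beta>: "\<beta> = ?low \<gamma>" by blast
      show "\<beta> \<in> low n"
        unfolding \<beta> using \<gamma>(1) Qheight_lower[OF i, of \<gamma>, OF \<gamma>(2)] lowQ[OF lQ[OF \<gamma>(1)]]
        by (simp add: low_def del: fun_upd_apply)
    qed
    show "low n \<subseteq> ?low ` ?S"
    proof
      fix \<beta> assume \<beta>: "\<beta> \<in> low n"
      let ?\<gamma> = "\<beta>(i := Suc (\<beta> i))"
      have "?low ?\<gamma> = \<beta>" by auto
      moreover have "?\<gamma> \<in> Qplus D" using \<beta> i by (auto simp: low_def Qplus_def)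
      moreover have "Qheight D ?\<gamma> = Suc (Qheight D \<beta>)"
        using Qheight_lower[OF i, of ?\<gamma>] \<open>?low ?\<gamma> = \<beta>\<close> by simp
      ultimately have "?\<gamma> \<in> ?S" using \<beta> by (simp add: low_def)
      then show "\<beta> \<in> ?low ` ?S" 
        by (rule image_eqI[where f = ?low and x = ?\<gamma>, OF sym[OF \<open>?low ?\<gamma> = \<beta>\<close>]])
    qed
  qed
  have inj: "inj_on ?low ?S"
  proof (rule inj_onI)
    fix \<gamma> \<gamma>' assume "\<gamma> \<in> ?S" "\<gamma>' \<in> ?S" and eq: "?low \<gamma> = ?low \<gamma>'"
    then have nz: "\<gamma> i \<noteq> 0" "\<gamma>' i \<noteq> 0" by auto
    have "\<gamma> j = \<gamma>' j" for j
      using fun_cong[OF eq, of j] nz by (cases "j = i") auto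
    then show "\<gamma> = \<gamma>'" by auto
  qed
  let ?u = "\<lambda>\<gamma>. if \<gamma> i = 0 then \<zero>\<^bsub>Bq D\<^esub> else \<ominus>\<^bsub>Bq D\<^esub> t (?low \<gamma>)"
  have uc: "?u \<gamma> \<in> carrier (Bq D)" if "\<gamma> \<in> low (Suc n)" for \<gamma>
    using tc[OF lowQ[OF lQ[OF that]]] by simp
  have tPi: "t \<in> low m \<rightarrow> carrier (Bq D)" for m using tc[OF lQ] by (rule Pi_I)
  have uPi: "?u \<in> low (Suc n) \<rightarrow> carrier (Bq D)" using uc by (rule Pi_I)
  have split: "(\<Oplus>\<^bsub>Bq D\<^esub>\<gamma>\<in>low (Suc n). ?u \<gamma>)
      = (\<Oplus>\<^bsub>Bq D\<^esub>\<gamma>\<in>?S. ?u \<gamma>) \<oplus>\<^bsub>Bq D\<^esub> (\<Oplus>\<^bsub>Bq D\<^esub>\<gamma>\<in>low (Suc n) - ?S. ?u \<gamma>)"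
    by (rule BF.finsum_split[OF finite_low _ uc]) auto
  have zero: "(\<Oplus>\<^bsub>Bq D\<^esub>\<gamma>\<in>low (Suc n) - ?S. ?u \<gamma>) = (\<Oplus>\<^bsub>Bq D\<^esub>\<gamma>\<in>low (Suc n) - ?S. \<zero>\<^bsub>Bq D\<^esub>)"
    by (rule B.finsum_cong') auto
  have Sc: "(\<Oplus>\<^bsub>Bq D\<^esub>\<gamma>\<in>?S. ?u \<gamma>) \<in> carrier (Bq D)"
    by (rule B.finsum_closed, rule Pi_I, rule uc) simp
  have "(\<Oplus>\<^bsub>Bq D\<^esub>\<gamma>\<in>low (Suc n). t \<gamma> \<oplus>\<^bsub>Bq D\<^esub> ?u \<gamma>)
      = (\<Oplus>\<^bsub>Bq D\<^esub>\<gamma>\<in>low (Suc n). t \<gamma>) \<oplus>\<^bsub>Bq D\<^esub> (\<Oplus>\<^bsub>Bq D\<^esub>\<gamma>\<in>low (Suc n). ?u \<gamma>)"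
    by (rule B.finsum_addf[OF tPi uPi])
  also have "(\<Oplus>\<^bsub>Bq D\<^esub>\<gamma>\<in>low (Suc n). ?u \<gamma>) = (\<Oplus>\<^bsub>Bq D\<^esub>\<gamma>\<in>?S. ?u \<gamma>)"
    unfolding split zero B.finsum_zero using Sc by (rule B.r_zero)
  also have "(\<Oplus>\<^bsub>Bq D\<^esub>\<gamma>\<in>?S. ?u \<gamma>) = (\<Oplus>\<^bsub>Bq D\<^esub>\<gamma>\<in>?S. \<ominus>\<^bsub>Bq D\<^esub> t (?low \<gamma>))"
    by (rule B.finsum_cong') (use tc[OF lowQ[OF lQ]] in auto)
  also have "\<dots> = (\<Oplus>\<^bsub>Bq D\<^esub>\<beta>\<in>?low ` ?S. \<ominus>\<^bsub>Bq D\<^esub> t \<beta>)"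
    by (rule B.finsum_reindex[symmetric, OF _ inj]) (use tc[OF lQ] bij in auto)
  also have "\<dots> = (\<Oplus>\<^bsub>Bq D\<^esub>\<beta>\<in>low n. smul (Bq D) (- 1) (t \<beta>))"
    unfolding bij by (rule B.finsum_cong') (use tc[OF lQ] in \<open>auto simp: B.smul_minus_one\<close>)
  also have "\<dots> = \<ominus>\<^bsub>Bq D\<^esub> (\<Oplus>\<^bsub>Bq D\<^esub>\<beta>\<in>low n. t \<beta>)"
    using tPi[of n] by (simp add: B.smul_finsum[symmetric] B.smul_minus_one)
  also have "(\<Oplus>\<^bsub>Bq D\<^esub>\<gamma>\<in>low (Suc n). t \<gamma>) \<oplus>\<^bsub>Bq D\<^esub> \<ominus>\<^bsub>Bq D\<^esub> (\<Oplus>\<^bsub>Bq D\<^esub>\<beta>\<in>low n. t \<beta>) \<in> Bfilt D n"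
    unfolding a_minus_def[symmetric]
  proof (rule BF.finsum_diff_closed[OF finite_low])
    show "low n \<subseteq> low (Suc n)" by (auto simp: low_def)
    show "t \<gamma> \<in> carrier (Bq D)" if "\<gamma> \<in> low (Suc n)" for \<gamma> using tc[OF lQ[OF that]] .
    fix \<gamma> assume "\<gamma> \<in> low (Suc n) - low n"
    then have "\<gamma> \<in> Qplus D" "Qheight D \<gamma> = n" by (auto simp: low_def)
    then show "t \<gamma> \<in> Bfilt D n" using T[of \<gamma>] by simp
  qed
  finally show ?thesis .
qed

end

section \<open>The partial sums of the projector: annihilation, idempotency, descent to the smaller
  completion\<close>

context projector_data
begin

abbreviation "\<theta> \<equiv> proj_term D S \<phi> \<iota> xs ys"
abbreviation "N \<equiv> proj_index D xs"

lemma theta_eq: "\<theta> (\<beta>, r) = Psi \<beta> (Yb \<beta> r) \<bullet> \<phi> (Xb \<beta> r)"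
  by (rule proj_term_eq)

lemma N_iff: "(\<beta>, r) \<in> N \<longleftrightarrow> \<beta> \<in> Qplus D \<and> r < dimw \<beta>"
  by (simp add: proj_index_def)

lemma Bplus_wt_ge: "m \<in> Qplus D \<Longrightarrow> l \<le> Qheight D m \<Longrightarrow> u \<in> Bplus_wt D m \<Longrightarrow> u \<in> Bplus_ge D l"
  unfolding Bplus_ge_def by (intro generate.incl) blast

lemma term_fil:
  assumes "\<beta> \<in> Qplus D" "r < dimw \<beta>" "b \<in> carrier (Bq D)" "l \<le> Qheight D \<beta>"
  shows "b \<bullet> \<phi> (Xb \<beta> r) \<in> Bfilt D l"
  unfolding Bfilt_eq
  by (rule Bplus_ge_fil[OF Bplus_wt_ge[OF assms(1,4) phi_Bplus_wt[OF assms(1) X_wt[OF assms(1,2)]]] assms(3)])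

lemma ins_fil: "\<beta> \<in> Qplus D \<Longrightarrow> g \<in> carrier (Bq D) \<Longrightarrow> ins g i \<beta> \<in> Bfilt D (Qheight D \<beta>)"
proof -
  assume \<beta>: "\<beta> \<in> Qplus D" and g: "g \<in> carrier (Bq D)"
  have "Psi \<beta> (Yb \<beta> r) \<bullet> (g \<bullet> \<phi> (Xb \<beta> r)) \<in> Bfilt D (Qheight D \<beta>)" if "r \<in> {..<dimw \<beta>}" for r
    using that \<beta> g by (intro BF.J_left[OF Psi_Y_closed] term_fil) simp_all
  then have "(\<Oplus>\<^bsub>Bq D\<^esub>r\<in>{..<dimw \<beta>}. Psi \<beta> (Yb \<beta> r) \<bullet> (g \<bullet> \<phi> (Xb \<beta> r))) \<in> Bfilt D (Qheight D \<beta>)"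
    by (rule BF.J_finsum)
  then show ?thesis unfolding ins_def Bfilt_eq by (rule fil_smul)
qed

definition G :: "nat \<Rightarrow> ('i, 't) ncpoly set"
  where "G l = (\<Oplus>\<^bsub>Bq D\<^esub>\<beta>\<in>low l. comp \<beta>)"

lemma low_Q: "\<beta> \<in> low l \<Longrightarrow> \<beta> \<in> Qplus D"
  by (simp add: low_def)

lemma G_closed: "G l \<in> carrier (Bq D)"
  unfolding G_def by (intro B.finsum_closed) (auto simp: low_Q)

lemma eB_G_Suc: "i \<in> I \<Longrightarrow> eB i \<bullet> G (Suc n) \<in> Bfilt D n"
proof -
  assume i: "i \<in> I"
  have "eB i \<bullet> G (Suc n) = (\<Oplus>\<^bsub>Bq D\<^esub>\<gamma>\<in>low (Suc n). eB i \<bullet> comp \<gamma>)"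
    unfolding G_def using i by (intro B.finsum_rdistr finite_low) (auto simp: low_Q)
  also have "\<dots> = (\<Oplus>\<^bsub>Bq D\<^esub>\<gamma>\<in>low (Suc n). ins (eB i) i \<gamma> \<^bold>+
      (if \<gamma> i = 0 then \<zero>\<^bsub>Bq D\<^esub> else \<ominus>\<^bsub>Bq D\<^esub> ins (eB i) i (lower i \<gamma>)))"
  proof (intro B.finsum_cong')
    show "(\<lambda>\<gamma>. ins (eB i) i \<gamma> \<^bold>+ (if \<gamma> i = 0 then \<zero>\<^bsub>Bq D\<^esub> else \<ominus>\<^bsub>Bq D\<^esub> ins (eB i) i (lower i \<gamma>)))
        \<in> low (Suc n) \<rightarrow> carrier (Bq D)"
    proof (rule Pi_I)
      fix \<gamma> assume "\<gamma> \<in> low (Suc n)"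
      then have "\<gamma> \<in> Qplus D" "lower i \<gamma> \<in> Qplus D" by (simp_all only: low_Q lower_Qplus)
      then show "ins (eB i) i \<gamma> \<^bold>+ (if \<gamma> i = 0 then \<zero>\<^bsub>Bq D\<^esub> else \<ominus>\<^bsub>Bq D\<^esub> ins (eB i) i (lower i \<gamma>))
          \<in> carrier (Bq D)" using i by simp
    qed
    show "eB i \<bullet> comp \<gamma> = ins (eB i) i \<gamma> \<^bold>+
      (if \<gamma> i = 0 then \<zero>\<^bsub>Bq D\<^esub> else \<ominus>\<^bsub>Bq D\<^esub> ins (eB i) i (lower i \<gamma>))" if "\<gamma> \<in> low (Suc n)" for \<gamma>
      by (rule eB_comp[OF low_Q[OF that] i])
  qed simp
  also have "\<dots> \<in> Bfilt D n"
    using i by (intro telescope ins_fil) simp_all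
  finally show ?thesis .
qed

lemma G_Suc_fB: "i \<in> I \<Longrightarrow> G (Suc n) \<bullet> fB i \<in> Bfilt D n"
proof -
  assume i: "i \<in> I"
  have "G (Suc n) \<bullet> fB i = (\<Oplus>\<^bsub>Bq D\<^esub>\<gamma>\<in>low (Suc n). comp \<gamma> \<bullet> fB i)"
    unfolding G_def using i by (intro B.finsum_ldistr finite_low) (auto simp: low_Q)
  also have "\<dots> = (\<Oplus>\<^bsub>Bq D\<^esub>\<gamma>\<in>low (Suc n). ins (fB i) i \<gamma> \<^bold>+
      (if \<gamma> i = 0 then \<zero>\<^bsub>Bq D\<^esub> else \<ominus>\<^bsub>Bq D\<^esub> ins (fB i) i (lower i \<gamma>)))"
  proof (intro B.finsum_cong')
    show "(\<lambda>\<gamma>. ins (fB i) i \<gamma> \<^bold>+ (if \<gamma> i = 0 then \<zero>\<^bsub>Bq D\<^esub> else \<ominus>\<^bsub>Bq D\<^esub> ins (fB i) i (lower i \<gamma>)))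
        \<in> low (Suc n) \<rightarrow> carrier (Bq D)"
    proof (rule Pi_I)
      fix \<gamma> assume "\<gamma> \<in> low (Suc n)"
      then have "\<gamma> \<in> Qplus D" "lower i \<gamma> \<in> Qplus D" by (simp_all only: low_Q lower_Qplus)
      then show "ins (fB i) i \<gamma> \<^bold>+ (if \<gamma> i = 0 then \<zero>\<^bsub>Bq D\<^esub> else \<ominus>\<^bsub>Bq D\<^esub> ins (fB i) i (lower i \<gamma>))
          \<in> carrier (Bq D)" using i by simp
    qed
    show "comp \<gamma> \<bullet> fB i = ins (fB i) i \<gamma> \<^bold>+
      (if \<gamma> i = 0 then \<zero>\<^bsub>Bq D\<^esub> else \<ominus>\<^bsub>Bq D\<^esub> ins (fB i) i (lower i \<gamma>))" if "\<gamma> \<in> low (Suc n)" for \<gamma>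
      by (rule comp_fB[OF low_Q[OF that] i])
  qed simp
  also have "\<dots> \<in> Bfilt D n"
    using i by (intro telescope ins_fil) simp_all
  finally show ?thesis .
qed

definition index_below :: "nat \<Rightarrow> (('i \<Rightarrow> nat) \<times> nat) set"
  where "index_below l = Sigma (low l) (\<lambda>\<beta>. {..<dimw \<beta>})"

lemma index_below_props:
  "finite (index_below l)" "index_below l \<subseteq> N" "index_below l \<subseteq> index_below (Suc l)"
  "(\<beta>, r) \<in> N - index_below l \<Longrightarrow> \<beta> \<in> Qplus D \<and> r < dimw \<beta> \<and> l \<le> Qheight D \<beta>"
  using finite_low by (auto simp: index_below_def low_def proj_index_def)

lemma theta_closed: "k \<in> N \<Longrightarrow> \<theta> k \<in> carrier (Bq D)"
  by (cases k) (simp add: theta_eq N_iff)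

lemma theta_small: "k \<in> N - index_below l \<Longrightarrow> \<theta> k \<in> Bfilt D l"
proof -
  assume k: "k \<in> N - index_below l"
  obtain \<beta> r where br: "k = (\<beta>, r)" by (cases k)
  have "\<beta> \<in> Qplus D" "r < dimw \<beta>" "l \<le> Qheight D \<beta>" using index_below_props(4)[of \<beta> r l] k br by simp_all
  then show ?thesis unfolding br theta_eq by (intro term_fil) simp_all
qed

lemma G_eq: "G l = (\<Oplus>\<^bsub>Bq D\<^esub>k\<in>index_below l. \<theta> k)"
proof -
  have "(\<Oplus>\<^bsub>Bq D\<^esub>k\<in>index_below l. \<theta> k) = (\<Oplus>\<^bsub>Bq D\<^esub>\<beta>\<in>low l. \<Oplus>\<^bsub>Bq D\<^esub>r\<in>{..<dimw \<beta>}. \<theta> (\<beta>, r))"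
    unfolding index_below_def
    by (rule B.finsum_Sigma[OF finite_low]) (simp_all add: theta_eq low_Q)
  then show ?thesis unfolding G_def comp_def by (simp add: theta_eq)
qed

lemma coherent_G: "BF.coherent G"
  and has_csum_G: "has_csum (Bhat D) (\<lambda>k. to_Bhat D (\<theta> k)) N (BF.limit_point G)"
proof -
  have "G = (\<lambda>l. \<Oplus>\<^bsub>Bq D\<^esub>k\<in>index_below l. \<theta> k)" by (rule ext) (rule G_eq)
  then show "BF.coherent G" "has_csum (Bhat D) (\<lambda>k. to_Bhat D (\<theta> k)) N (BF.limit_point G)"
    using BF.summable_family[where A = N and f = \<theta> and F = index_below, OF theta_closed index_below_props(1,2,3) theta_small]
    by (simp_all add: Bhat_def to_Bhat_def[abs_def])
qed

lemma projector_eq: "extremal_projector D S \<phi> \<iota> xs ys = BF.limit_point G"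
  unfolding extremal_projector_def by (rule csum_eq[OF has_csum_G])

text \<open>Telescoping controls \<open>G (Suc l)\<close>; the difference from \<open>G l\<close>
  lies in the left ideal \<open>Bfilt D l\<close>, so the estimate passes to \<open>G l\<close>.
  This sharper index is required because \<open>limit_point_mult\<close> freezes a right factor at
  level l.\<close>

lemma eB_G: "i \<in> I \<Longrightarrow> eB i \<bullet> G l \<in> Bfilt D l"
proof -
  assume i: "i \<in> I"
  have d: "G (Suc l) \<ominus>\<^bsub>Bq D\<^esub> G l \<in> Bfilt D l" using coherent_G by (simp add: BF.coherent_def)
  have "x \<bullet> a \<ominus>\<^bsub>Bq D\<^esub> x \<bullet> (a \<ominus>\<^bsub>Bq D\<^esub> b) = x \<bullet> b"
    if "x \<in> carrier (Bq D)" "a \<in> carrier (Bq D)" "b \<in> carrier (Bq D)" for x a b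
    using that by (simp add: B.minus_eq B.r_distr B.r_minus B.minus_add B.r_neg1 B.r_neg2 B.a_assoc)
  from this[OF eB_closed[OF i] G_closed G_closed, of "Suc l" l, symmetric]
  show ?thesis
    using BF.J_add[OF eB_G_Suc[OF i] BF.J_minus[OF BF.J_left[OF eB_closed[OF i] d]]]
    by (simp add: B.minus_eq)
qed

text \<open>A word of nonzero weight ends in some e''_i, and this letter stands directly in front of
  \<open>G l\<close>.\<close>

lemma Bplus_wt_G:
  assumes \<beta>: "\<beta> \<in> Qplus D" "\<beta> \<noteq> (\<lambda>_. 0)" and u: "u \<in> Bplus_wt D \<beta>"
  shows "u \<bullet> G l \<in> Bfilt D l"
  using u unfolding Bplus_wt_eq[OF \<beta>(1)]
proof induction
  case zero
  then show ?case by (simp add: G_closed BF.J_zero)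
next
  case (step m u c)
  then obtain w where w: "w \<in> lists I" "count (mset w) = \<beta>" "m = MB w" by (auto simp: words_def)
  have uc: "u \<in> carrier (Bq D)"
    by (rule B.lspan_closed[OF _ step(2)]) (auto simp: words_def)
  have "w \<noteq> []" using w(2) \<beta>(2) by (auto simp: fun_eq_iff)
  then obtain v i where v: "w = v @ [i]" by (metis append_butlast_last_id)
  have "MB w \<bullet> G l = MB v \<bullet> (eB i \<bullet> G l)"
    using w(1) v by (simp add: MB_snoc B.m_assoc G_closed)
  also have "\<dots> \<in> Bfilt D l" using w(1) v by (intro BF.J_left eB_G) simp_all
  finally have "MB w \<bullet> G l \<in> Bfilt D l" .
  moreover have "(sB c m \<^bold>+ u) \<bullet> G l = sB c (MB w \<bullet> G l) \<^bold>+ u \<bullet> G l"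
    using w uc by (simp add: B.l_distr B.smul_mult_left G_closed)
  ultimately show ?case using step by (simp add: Bfilt_eq fil_add fil_smul)
qed

lemma zero_low: "(\<lambda>_. 0) \<in> low (Suc n)"
  by (simp add: low_def Qplus_def Qheight_def)

lemma G_Suc_eq: "G (Suc n) = \<one>\<^bsub>Bq D\<^esub> \<^bold>+ (\<Oplus>\<^bsub>Bq D\<^esub>\<beta>\<in>low (Suc n) - {\<lambda>_. 0}. comp \<beta>)"
proof -
  have "G (Suc n) = (\<Oplus>\<^bsub>Bq D\<^esub>\<beta>\<in>insert (\<lambda>_. 0) (low (Suc n) - {\<lambda>_. 0}). comp \<beta>)"
    unfolding G_def using zero_low by (simp only: insert_Diff)
  also have "\<dots> = comp (\<lambda>_. 0) \<^bold>+ (\<Oplus>\<^bsub>Bq D\<^esub>\<beta>\<in>low (Suc n) - {\<lambda>_. 0}. comp \<beta>)"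
    using finite_low zero_low[of n] by (intro B.finsum_insert) (auto simp: low_Q)
  finally show ?thesis by (simp add: comp_zero)
qed

lemma comp_G: "\<beta> \<in> Qplus D \<Longrightarrow> \<beta> \<noteq> (\<lambda>_. 0) \<Longrightarrow> comp \<beta> \<bullet> G l \<in> Bfilt D l"
proof -
  assume \<beta>: "\<beta> \<in> Qplus D" "\<beta> \<noteq> (\<lambda>_. 0)"
  have "comp \<beta> \<bullet> G l = (\<Oplus>\<^bsub>Bq D\<^esub>r\<in>{..<dimw \<beta>}. Psi \<beta> (Yb \<beta> r) \<bullet> \<phi> (Xb \<beta> r) \<bullet> G l)"
    unfolding comp_def using \<beta> by (intro B.finsum_ldistr) (auto simp: G_closed)
  also have "\<dots> \<in> Bfilt D l"
  proof (rule BF.J_finsum)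
    fix r assume "r \<in> {..<dimw \<beta>}"
    then have r: "r < dimw \<beta>" by simp
    have "Psi \<beta> (Yb \<beta> r) \<bullet> \<phi> (Xb \<beta> r) \<bullet> G l = Psi \<beta> (Yb \<beta> r) \<bullet> (\<phi> (Xb \<beta> r) \<bullet> G l)"
      using \<beta> r by (simp add: B.m_assoc G_closed)
    also have "\<dots> \<in> Bfilt D l"
      using \<beta> r by (intro BF.J_left Bplus_wt_G[OF \<beta>] phi_Bplus_wt X_wt) simp_all
    finally show "Psi \<beta> (Yb \<beta> r) \<bullet> \<phi> (Xb \<beta> r) \<bullet> G l \<in> Bfilt D l" .
  qed
  finally show ?thesis .
qed

text \<open>The left factor is 1 plus components of nonzero weight; each of those ends in an element
  of B^+ of nonzero weight, which annihilates \<open>G l\<close> modulo level l.\<close>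

lemma G_G: "G (Suc n) \<bullet> G l \<ominus>\<^bsub>Bq D\<^esub> G l \<in> Bfilt D l"
proof -
  let ?R = "\<Oplus>\<^bsub>Bq D\<^esub>\<beta>\<in>low (Suc n) - {\<lambda>_. 0}. comp \<beta>"
  have Rc: "?R \<in> carrier (Bq D)" by (intro B.finsum_closed) (auto simp: low_Q)
  have "?R \<bullet> G l = (\<Oplus>\<^bsub>Bq D\<^esub>\<beta>\<in>low (Suc n) - {\<lambda>_. 0}. comp \<beta> \<bullet> G l)"
    using finite_low by (intro B.finsum_ldistr) (auto simp: G_closed low_Q)
  also have "\<dots> \<in> Bfilt D l" by (rule BF.J_finsum) (auto intro!: comp_G simp: low_Q)
  finally have R: "?R \<bullet> G l \<in> Bfilt D l" .
  have "(\<one>\<^bsub>Bq D\<^esub> \<^bold>+ x) \<bullet> y \<ominus>\<^bsub>Bq D\<^esub> y = x \<bullet> y" if "x \<in> carrier (Bq D)" "y \<in> carrier (Bq D)" for x y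
    using that by algebra
  from this[OF Rc G_closed, of l] show ?thesis unfolding G_Suc_eq using R by simp
qed

lemma eB_projector:
  assumes i: "i \<in> I"
  shows "to_Bhat D (eB i) \<otimes>\<^bsub>Bhat D\<^esub> BF.limit_point G = \<zero>\<^bsub>Bhat D\<^esub>"
  unfolding to_Bhat_eq Bhat_eq BF.limit_point_zero[symmetric]
proof (rule BF.limit_point_mult[OF BF.coherent_const coherent_G])
  fix l
  show "\<exists>N. \<forall>m\<ge>N. eB i \<bullet> G l \<ominus>\<^bsub>Bq D\<^esub> \<zero>\<^bsub>Bq D\<^esub> \<in> Bfilt D l"
    using eB_G[OF i, of l] i by (simp add: B.minus_eq G_closed)
qed (use i in simp_all)

lemma projector_fB:
  assumes i: "i \<in> I"
  shows "BF.limit_point G \<otimes>\<^bsub>Bhat D\<^esub> to_Bhat D (fB i) = \<zero>\<^bsub>Bhat D\<^esub>"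
  unfolding to_Bhat_eq Bhat_eq BF.limit_point_zero[symmetric]
proof (rule BF.limit_point_mult[OF coherent_G BF.coherent_const])
  fix l
  \<comment> \<open>As a left factor the projector is taken at indices \<open>m\<close> tending to
    infinity, so the loss of one level in \<open>G_Suc_fB\<close> does no harm.\<close>
  have "G m \<bullet> fB i \<ominus>\<^bsub>Bq D\<^esub> \<zero>\<^bsub>Bq D\<^esub> \<in> Bfilt D l" if m: "m \<ge> Suc l" for m
  proof -
    obtain n where n: "m = Suc n" "l \<le> n" using m by (cases m) auto
    then have "G m \<bullet> fB i \<in> Bfilt D l" using G_Suc_fB[OF i, of n] BF.J_mono[of l n] by blast
    then show ?thesis using i by (simp add: B.minus_eq G_closed)
  qed
  then show "\<exists>N. \<forall>m\<ge>N. G m \<bullet> fB i \<ominus>\<^bsub>Bq D\<^esub> \<zero>\<^bsub>Bq D\<^esub> \<in> Bfilt D l" by blast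
qed (use i in simp_all)

lemma projector_idem: "BF.limit_point G \<otimes>\<^bsub>Bhat D\<^esub> BF.limit_point G = BF.limit_point G"
  unfolding Bhat_eq
proof (rule BF.limit_point_mult[OF coherent_G coherent_G G_closed])
  fix l
  have "G m \<bullet> G l \<ominus>\<^bsub>Bq D\<^esub> G l \<in> Bfilt D l" if "m \<ge> 1" for m
    using that G_G[of "m - 1" l] by (cases m) auto
  then show "\<exists>N. \<forall>m\<ge>N. G m \<bullet> G l \<ominus>\<^bsub>Bq D\<^esub> G l \<in> Bfilt D l" by blast
qed

lemma theta_Bvee: "\<theta> ` N \<subseteq> Bvee D"
proof
  fix x assume "x \<in> \<theta> ` N"
  then obtain \<beta> r where x: "x = \<theta> (\<beta>, r)" "\<beta> \<in> Qplus D" "r < dimw \<beta>" by (auto simp: proj_index_def)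
  have "Psi \<beta> (Yb \<beta> r) \<in> Bvee D" using Psi_Bminus[OF x(2) Y_wt[OF x(2,3)]] Bminus_Bvee by blast
  moreover have "\<phi> (Xb \<beta> r) \<in> Bvee D"
    using phi_Bplus_wt[OF x(2) X_wt[OF x(2,3)]] Bplus_Bvee by (auto simp: Bplus_wt_def)
  ultimately show "x \<in> Bvee D" unfolding x(1) theta_eq Bvee_def by (rule B.subalg_mult)
qed

lemma theta_small_Bvee: "k \<in> N - index_below l \<Longrightarrow> \<theta> k \<in> Bvee_filt D l"
proof -
  assume k: "k \<in> N - index_below l"
  obtain \<beta> r where br: "k = (\<beta>, r)" by (cases k)
  have x: "\<beta> \<in> Qplus D" "r < dimw \<beta>" "l \<le> Qheight D \<beta>" using index_below_props(4)[of \<beta> r l] k br by simp_all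
  have "Psi \<beta> (Yb \<beta> r) \<in> Bvee D" using Psi_Bminus[OF x(1) Y_wt[OF x(1,2)]] Bminus_Bvee by blast
  then show ?thesis unfolding br theta_eq
    by (rule Bvee_filt_incl[OF _ Bplus_wt_ge[OF x(1,3) phi_Bplus_wt[OF x(1) X_wt[OF x(1,2)]]]])
qed

lemma G_Bvee: "(\<Oplus>\<^bsub>Bvee_alg D\<^esub>k\<in>index_below l. \<theta> k) = G l"
  unfolding G_eq Bvee_alg_def
  by (rule finsum_subring_eq[OF B.ring_axioms V.ring_axioms[unfolded Bvee_alg_def] Bvee_carrier
        index_below_props(1)])
    (use theta_Bvee index_below_props(2) in blast)

lemma has_csum_G_Bvee: "VF.coherent G"
  "has_csum (Bvee_hat D) (\<lambda>k. to_Bvee_hat D (\<theta> k)) N (VF.limit_point G)"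
proof -
  have c: "\<theta> k \<in> carrier (Bvee_alg D)" if "k \<in> N" for k
    using theta_Bvee that by (auto simp: Bvee_alg_simps)
  show "VF.coherent G" "has_csum (Bvee_hat D) (\<lambda>k. to_Bvee_hat D (\<theta> k)) N (VF.limit_point G)"
    using VF.summable_family[where A = N and f = \<theta> and F = index_below, OF c index_below_props(1,2,3) theta_small_Bvee]
    by (simp_all add: G_Bvee Bvee_hat_def to_Bvee_hat_def[abs_def])
qed

text \<open>Both limits have the same representatives \<open>G l\<close>; adding
  \<open>Bfilt D l\<close> to a coset absorbs the smaller subgroup
  \<open>Bvee_filt D l\<close>.\<close>

lemma Bvee_hat_to_Bhat_G: "Bvee_hat_to_Bhat D (VF.limit_point G) = BF.limit_point G"
proof
  fix l
  have GV: "G l \<in> Bvee D" using VF.coherent_closed[OF has_csum_G_Bvee(1), of l] by (simp add: Bvee_alg_simps)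
  have "Bfilt D l <+>\<^bsub>Bq D\<^esub> (Bvee_filt D l +>\<^bsub>Bvee_alg D\<^esub> G l) = Bfilt D l +>\<^bsub>Bq D\<^esub> G l"
  proof
    show "Bfilt D l <+>\<^bsub>Bq D\<^esub> (Bvee_filt D l +>\<^bsub>Bvee_alg D\<^esub> G l) \<subseteq> Bfilt D l +>\<^bsub>Bq D\<^esub> G l"
    proof
      fix x assume "x \<in> Bfilt D l <+>\<^bsub>Bq D\<^esub> (Bvee_filt D l +>\<^bsub>Bvee_alg D\<^esub> G l)"
      then obtain a b where ab: "a \<in> Bfilt D l" "b \<in> Bvee_filt D l" "x = a \<^bold>+ (b \<^bold>+ G l)"
        by (auto simp: set_add_def' a_r_coset_def' Bvee_alg_simps)
      then have "b \<in> Bfilt D l" using Bvee_filt_fil by blast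
      then have "x = (a \<^bold>+ b) \<^bold>+ G l" "a \<^bold>+ b \<in> Bfilt D l"
        using ab BF.J_carrier[of _ l] G_closed by (simp_all add: B.a_assoc BF.J_add)
      then show "x \<in> Bfilt D l +>\<^bsub>Bq D\<^esub> G l" by (auto simp: a_r_coset_def')
    qed
    show "Bfilt D l +>\<^bsub>Bq D\<^esub> G l \<subseteq> Bfilt D l <+>\<^bsub>Bq D\<^esub> (Bvee_filt D l +>\<^bsub>Bvee_alg D\<^esub> G l)"
    proof
      fix x assume "x \<in> Bfilt D l +>\<^bsub>Bq D\<^esub> G l"
      then obtain a where a: "a \<in> Bfilt D l" "x = a \<^bold>+ G l" by (auto simp: a_r_coset_def')
      moreover have "G l \<in> Bvee_filt D l +>\<^bsub>Bvee_alg D\<^esub> G l"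
        using VF.coset_self[of "G l" l] GV by (simp add: Bvee_alg_simps)
      ultimately show "x \<in> Bfilt D l <+>\<^bsub>Bq D\<^esub> (Bvee_filt D l +>\<^bsub>Bvee_alg D\<^esub> G l)"
        by (auto simp: set_add_def')
    qed
  qed
  then show "Bvee_hat_to_Bhat D (VF.limit_point G) l = BF.limit_point G l"
    by (simp add: Bvee_hat_to_Bhat_def VF.limit_point_def BF.limit_point_def)
qed

end

section \<open>The resolution of 1, indexed by lists of terms of nonzero weight\<close>

context projector_data
begin

text \<open>
  Since the leading term of the projector is \<open>1\<close>, we have
  \<open>1 = \<Gamma> - \<Sum> a\<^sub>k \<cdot> 1 \<cdot> b\<^sub>k\<close> over the terms \<open>a\<^sub>k b\<^sub>k\<close> of nonzero weight.
  Substituting this for the inner \<open>1\<close> over and over gives an expansion of \<open>1\<close> indexed by lists of such terms.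
\<close>

definition higher :: "(('i \<Rightarrow> nat) \<times> nat) set"
  where "higher = {k \<in> N. fst k \<noteq> (\<lambda>_. 0)}"

definition aterm :: "('i \<Rightarrow> nat) \<times> nat \<Rightarrow> ('i, 't) ncpoly set"
  where "aterm k = Psi (fst k) (Yb (fst k) (snd k))"

definition bterm :: "('i \<Rightarrow> nat) \<times> nat \<Rightarrow> ('i, 't) ncpoly set"
  where "bterm k = \<phi> (Xb (fst k) (snd k))"

text \<open>The head of a list is the term substituted last, hence the innermost one: it enters on
  the right here and on the left in \<open>blist\<close>. The sign of each substitution is carried
  on this side.\<close>

primrec alist :: "(('i \<Rightarrow> nat) \<times> nat) list \<Rightarrow> ('i, 't) ncpoly set"
  where "alist [] = \<one>\<^bsub>Bq D\<^esub>" | "alist (k # L) = \<ominus>\<^bsub>Bq D\<^esub> (alist L \<bullet> aterm k)"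

primrec blist :: "(('i \<Rightarrow> nat) \<times> nat) list \<Rightarrow> ('i, 't) ncpoly set"
  where "blist [] = \<one>\<^bsub>Bq D\<^esub>" | "blist (k # L) = bterm k \<bullet> blist L"

definition hlist :: "(('i \<Rightarrow> nat) \<times> nat) list \<Rightarrow> nat"
  where "hlist L = (\<Sum>k\<leftarrow>L. Qheight D (fst k))"

definition lists_below :: "nat \<Rightarrow> (('i \<Rightarrow> nat) \<times> nat) list set"
  where "lists_below l = {L \<in> lists higher. hlist L < l}"

definition higher_below :: "nat \<Rightarrow> (('i \<Rightarrow> nat) \<times> nat) set"
  where "higher_below l = Sigma (low l - {\<lambda>_. 0}) (\<lambda>\<beta>. {..<dimw \<beta>})"

lemma higherD:
  assumes "k \<in> higher"
  shows "fst k \<in> Qplus D" "snd k < dimw (fst k)" "1 \<le> Qheight D (fst k)" "fst k \<noteq> (\<lambda>_. 0)"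
proof -
  show 1: "fst k \<in> Qplus D" "snd k < dimw (fst k)" "fst k \<noteq> (\<lambda>_. 0)"
    using assms by (auto simp: higher_def proj_index_def)
  obtain i where i: "fst k i \<noteq> 0" using 1(3) by (auto simp: fun_eq_iff)
  then have "i \<in> I" using 1(1) by (auto simp: Qplus_def)
  then show "1 \<le> Qheight D (fst k)" using le_Qheight[of i "fst k"] i by simp
qed

lemma higher_below_iff: "k \<in> higher_below l \<longleftrightarrow> k \<in> higher \<and> Qheight D (fst k) < l"
  by (cases k) (auto simp: higher_below_def higher_def proj_index_def low_def)

lemma finite_higher_below: "finite (higher_below l)"
  unfolding higher_below_def using finite_low by auto

lemma aterm_Bminus: "k \<in> higher \<Longrightarrow> aterm k \<in> Bminus D"
  unfolding aterm_def by (intro Psi_Bminus Y_wt higherD)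

lemma bterm_wt: "k \<in> higher \<Longrightarrow> bterm k \<in> Bplus_wt D (fst k)"
  unfolding bterm_def by (intro phi_Bplus_wt X_wt higherD)

lemma Bminus_carrier: "Bminus D \<subseteq> carrier (Bq D)"
  using Bminus_Bvee Bvee_carrier by blast

lemma aterm_closed [simp]: "k \<in> higher \<Longrightarrow> aterm k \<in> carrier (Bq D)"
  using aterm_Bminus Bminus_carrier by blast

lemma bterm_Bplus: "k \<in> higher \<Longrightarrow> bterm k \<in> Bplus D"
  using bterm_wt by (simp add: Bplus_wt_def)

lemma bterm_closed [simp]: "k \<in> higher \<Longrightarrow> bterm k \<in> carrier (Bq D)"
  using bterm_Bplus Bplus_carrier by blast

lemma alist_Bminus: "L \<in> lists higher \<Longrightarrow> alist L \<in> Bminus D"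
proof (induction L)
  case Nil
  show ?case by (simp add: Bminus_def B.subalg_one)
next
  case (Cons k L)
  then show ?case using aterm_Bminus[of k] by (simp add: Bminus_def B.subalg_minus B.subalg_mult)
qed

lemma blist_Bplus: "L \<in> lists higher \<Longrightarrow> blist L \<in> Bplus D"
proof (induction L)
  case Nil
  show ?case by (simp add: Bplus_def B.subalg_one)
next
  case (Cons k L)
  then show ?case using bterm_Bplus[of k] by (simp add: Bplus_def B.subalg_mult)
qed

lemma alist_closed [simp]: "L \<in> lists higher \<Longrightarrow> alist L \<in> carrier (Bq D)"
  using alist_Bminus Bminus_carrier by blast

lemma blist_closed [simp]: "L \<in> lists higher \<Longrightarrow> blist L \<in> carrier (Bq D)"
  using blist_Bplus Bplus_carrier by blast

text \<open>Right multiplication by an element of B^+_\<beta> raises the filtration by |\<beta>|. So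
  \<open>blist L\<close> costs no level, unlike a general right factor, and terms of large total
  height are small.\<close>

lemma fil_blist: "L \<in> lists higher \<Longrightarrow> x \<in> fil n \<Longrightarrow> x \<bullet> blist L \<in> fil (n + hlist L)"
proof (induction L arbitrary: x n)
  case Nil
  then show ?case using fil_closed by (simp add: hlist_def)
next
  case (Cons k L)
  then have k: "k \<in> higher" and L: "L \<in> lists higher" by simp_all
  have "x \<bullet> bterm k \<in> fil (n + Qheight D (fst k))"
    by (rule Bplus_wt_fil[OF higherD(1)[OF k] bterm_wt[OF k] Cons.prems(2)])
  then have "x \<bullet> bterm k \<bullet> blist L \<in> fil (n + Qheight D (fst k) + hlist L)" by (rule Cons.IH[OF L])
  then show ?case using k L fil_closed[OF Cons.prems(2)] by (simp add: hlist_def B.m_assoc add.assoc)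
qed

lemma length_le_hlist: "L \<in> lists higher \<Longrightarrow> length L \<le> hlist L"
proof (induction L)
  case (Cons k L)
  then show ?case using higherD(3)[of k] by (simp add: hlist_def)
qed simp

lemma mem_le_hlist: "k \<in> set L \<Longrightarrow> Qheight D (fst k) \<le> hlist L"
  unfolding hlist_def by (induction L) auto

text \<open>Nonzero weights have height at least 1, so a bound on the total height bounds the length
  of a list as well as its entries.\<close>

lemma finite_lists_below: "finite (lists_below l)"
proof (rule finite_subset)
  show "lists_below l \<subseteq> {L. set L \<subseteq> higher_below l \<and> length L \<le> l}"
  proof
    fix L assume "L \<in> lists_below l"
    then have L: "L \<in> lists higher" "hlist L < l" by (simp_all add: lists_below_def)
    have "k \<in> higher_below l" if "k \<in> set L" for k
      using mem_le_hlist[OF that] L that by (auto simp: higher_below_iff in_lists_conv_set)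
    then show "L \<in> {L. set L \<subseteq> higher_below l \<and> length L \<le> l}"
      using length_le_hlist[OF L(1)] L(2) by auto
  qed
qed (rule finite_lists_length_le[OF finite_higher_below])

lemma theta_terms: "\<theta> k = aterm k \<bullet> bterm k"
  by (cases k) (simp add: theta_eq aterm_def bterm_def)

lemma G_Suc_terms: "G (Suc n) = \<one>\<^bsub>Bq D\<^esub> \<^bold>+ (\<Oplus>\<^bsub>Bq D\<^esub>k\<in>higher_below (Suc n). aterm k \<bullet> bterm k)"
proof -
  have "(\<Oplus>\<^bsub>Bq D\<^esub>k\<in>higher_below (Suc n). \<theta> k)
      = (\<Oplus>\<^bsub>Bq D\<^esub>\<beta>\<in>low (Suc n) - {\<lambda>_. 0}. \<Oplus>\<^bsub>Bq D\<^esub>r\<in>{..<dimw \<beta>}. \<theta> (\<beta>, r))"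
    unfolding higher_below_def
  proof (rule B.finsum_Sigma)
    show "\<theta> (\<beta>, r) \<in> carrier (Bq D)" if "\<beta> \<in> low (Suc n) - {\<lambda>_. 0}" "r \<in> {..<dimw \<beta>}" for \<beta> r
      using that low_Q[of \<beta> "Suc n"] by (simp add: theta_eq)
  qed (simp_all add: finite_low)
  then show ?thesis unfolding G_Suc_eq comp_def by (simp add: theta_eq theta_terms[symmetric])
qed

definition wlist :: "(('i \<Rightarrow> nat) \<times> nat) list \<Rightarrow> ('i, 't) ncpoly set"
  where "wlist L = alist L \<bullet> blist L"

lemma wlist_closed [simp]: "L \<in> lists higher \<Longrightarrow> wlist L \<in> carrier (Bq D)"
  by (simp add: wlist_def)

lemma wlist_fil: "L \<in> lists higher \<Longrightarrow> l \<le> hlist L \<Longrightarrow> wlist L \<in> Bfilt D l"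
proof -
  assume L: "L \<in> lists higher" and l: "l \<le> hlist L"
  have "wlist L \<in> fil (0 + hlist L)"
    unfolding wlist_def by (rule fil_blist[OF L fil_0[OF alist_closed[OF L]]])
  then show ?thesis using fil_mono[OF l] by (auto simp: Bfilt_eq)
qed

text \<open>\<open>G (Suc n)\<close> is 1 plus the higher terms: the 1 leaves
  \<open>wlist L\<close>, and a higher term placed in the middle extends \<open>L\<close> at its
  head, with the sign built into \<open>alist\<close>.\<close>

lemma sandwich:
  assumes L: "L \<in> lists higher"
  shows "alist L \<bullet> G (Suc n) \<bullet> blist L
    = wlist L \<^bold>+ (\<Oplus>\<^bsub>Bq D\<^esub>k\<in>higher_below (Suc n). \<ominus>\<^bsub>Bq D\<^esub> wlist (k # L))"
proof -
  let ?K = "higher_below (Suc n)" and ?a = "alist L" and ?b = "blist L"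
  have h: "k \<in> higher" if "k \<in> ?K" for k using that by (simp add: higher_below_iff)
  have c1: "(\<lambda>k. aterm k \<bullet> bterm k) \<in> ?K \<rightarrow> carrier (Bq D)"
    by (rule Pi_I) (use h in \<open>simp add: B.m_closed\<close>)
  have c2: "(\<lambda>k. ?a \<bullet> (aterm k \<bullet> bterm k)) \<in> ?K \<rightarrow> carrier (Bq D)"
    by (rule Pi_I) (use h L in simp)
  have s: "(\<Oplus>\<^bsub>Bq D\<^esub>k\<in>?K. aterm k \<bullet> bterm k) \<in> carrier (Bq D)" by (rule B.finsum_closed[OF c1])
  have "?a \<bullet> G (Suc n) \<bullet> ?b = ?a \<bullet> ?b \<^bold>+ ?a \<bullet> (\<Oplus>\<^bsub>Bq D\<^esub>k\<in>?K. aterm k \<bullet> bterm k) \<bullet> ?b"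
    unfolding G_Suc_terms using L s by (simp add: B.r_distr B.l_distr)
  also have "?a \<bullet> (\<Oplus>\<^bsub>Bq D\<^esub>k\<in>?K. aterm k \<bullet> bterm k) \<bullet> ?b
      = (\<Oplus>\<^bsub>Bq D\<^esub>k\<in>?K. ?a \<bullet> (aterm k \<bullet> bterm k) \<bullet> ?b)"
    using B.finsum_rdistr[OF finite_higher_below alist_closed[OF L] c1]
      B.finsum_ldistr[OF finite_higher_below blist_closed[OF L] c2] by simp
  also have "\<dots> = (\<Oplus>\<^bsub>Bq D\<^esub>k\<in>?K. \<ominus>\<^bsub>Bq D\<^esub> wlist (k # L))"
  proof (rule B.finsum_cong')
    show "(\<lambda>k. \<ominus>\<^bsub>Bq D\<^esub> wlist (k # L)) \<in> ?K \<rightarrow> carrier (Bq D)"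
      by (rule Pi_I) (use h L in \<open>simp add: wlist_def\<close>)
    show "?a \<bullet> (aterm k \<bullet> bterm k) \<bullet> ?b = \<ominus>\<^bsub>Bq D\<^esub> wlist (k # L)" if "k \<in> ?K" for k
      using h[OF that] L by (simp add: wlist_def B.l_minus B.m_assoc)
  qed simp
  finally show ?thesis by (simp add: wlist_def)
qed

text \<open>Summed over the lists of total height below \<open>l\<close>, the contribution of a
  nonempty list cancels against that of the same list as an extension of its tail. There remain the
  empty list, which contributes 1, and extensions of total height at least \<open>l\<close>, which
  are negligible at this level.\<close>

lemma sandwich_sum:
  "(\<Oplus>\<^bsub>Bq D\<^esub>L\<in>lists_below l. alist L \<bullet> G l \<bullet> blist L) \<ominus>\<^bsub>Bq D\<^esub> \<one>\<^bsub>Bq D\<^esub> \<in> Bfilt D l"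
proof (cases l)
  case 0
  then have "lists_below l = {}" by (simp add: lists_below_def)
  then show ?thesis using 0 fil_0 by (simp add: Bfilt_eq B.minus_closed)
next
  case (Suc n)
  let ?LL = "lists_below l" and ?K = "higher_below l" and ?c = "\<lambda>(L, k). k # L"
  let ?M = "?c ` (?LL \<times> ?K)" and ?w = "wlist"
  have LL: "L \<in> lists higher" if "L \<in> ?LL" for L using that by (simp add: lists_below_def)
  have K: "k \<in> higher" if "k \<in> ?K" for k using that by (simp add: higher_below_iff)
  have M: "L \<in> lists higher" if "L \<in> ?M" for L using that LL K by auto
  have fM: "finite ?M" using finite_lists_below finite_higher_below by blast
  have nc: "\<ominus>\<^bsub>Bq D\<^esub> ?w (k # L) \<in> carrier (Bq D)" if "L \<in> ?LL" "k \<in> ?K" for L k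
    using wlist_closed[of "k # L"] LL[OF that(1)] K[OF that(2)] by (simp del: lists.simps)
  have "(\<Oplus>\<^bsub>Bq D\<^esub>L\<in>?LL. alist L \<bullet> G l \<bullet> blist L)
      = (\<Oplus>\<^bsub>Bq D\<^esub>L\<in>?LL. ?w L \<^bold>+ (\<Oplus>\<^bsub>Bq D\<^esub>k\<in>?K. \<ominus>\<^bsub>Bq D\<^esub> ?w (k # L)))"
  proof (rule B.finsum_cong')
    show "(\<lambda>L. ?w L \<^bold>+ (\<Oplus>\<^bsub>Bq D\<^esub>k\<in>?K. \<ominus>\<^bsub>Bq D\<^esub> ?w (k # L))) \<in> ?LL \<rightarrow> carrier (Bq D)"
      using LL nc by (intro Pi_I B.a_closed B.finsum_closed wlist_closed) simp_all
    show "alist L \<bullet> G l \<bullet> blist L = ?w L \<^bold>+ (\<Oplus>\<^bsub>Bq D\<^esub>k\<in>?K. \<ominus>\<^bsub>Bq D\<^esub> ?w (k # L))"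
      if "L \<in> ?LL" for L
      unfolding Suc by (rule sandwich[OF LL[OF that]])
  qed simp
  also have "\<dots> = (\<Oplus>\<^bsub>Bq D\<^esub>L\<in>?LL. ?w L) \<^bold>+ (\<Oplus>\<^bsub>Bq D\<^esub>L\<in>?LL. \<Oplus>\<^bsub>Bq D\<^esub>k\<in>?K. \<ominus>\<^bsub>Bq D\<^esub> ?w (k # L))"
    using LL nc by (intro B.finsum_addf Pi_I B.finsum_closed wlist_closed) simp_all
  also have "(\<Oplus>\<^bsub>Bq D\<^esub>L\<in>?LL. \<Oplus>\<^bsub>Bq D\<^esub>k\<in>?K. \<ominus>\<^bsub>Bq D\<^esub> ?w (k # L))
      = (\<Oplus>\<^bsub>Bq D\<^esub>x\<in>?LL \<times> ?K. \<ominus>\<^bsub>Bq D\<^esub> ?w (?c x))"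
    using B.finsum_Sigma[where S = ?LL and T = "\<lambda>_. ?K" and f = "\<lambda>x. \<ominus>\<^bsub>Bq D\<^esub> ?w (?c x)"]
      finite_lists_below finite_higher_below nc by simp
  also have "\<dots> = (\<Oplus>\<^bsub>Bq D\<^esub>L\<in>?M. \<ominus>\<^bsub>Bq D\<^esub> ?w L)"
    using M by (intro B.finsum_reindex[symmetric]) (auto simp: inj_on_def simp del: lists.simps)
  also have "\<dots> = (\<Oplus>\<^bsub>Bq D\<^esub>L\<in>?M. sB (- 1) (?w L))"
    by (rule B.finsum_cong') (use M in \<open>auto simp: B.smul_minus_one\<close>)
  also have "\<dots> = \<ominus>\<^bsub>Bq D\<^esub> (\<Oplus>\<^bsub>Bq D\<^esub>L\<in>?M. ?w L)"
  proof -
    have "?w \<in> ?M \<rightarrow> carrier (Bq D)" by (rule Pi_I) (rule wlist_closed[OF M])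
    then show ?thesis by (simp add: B.smul_finsum[symmetric] B.smul_minus_one)
  qed
  finally have sum: "(\<Oplus>\<^bsub>Bq D\<^esub>L\<in>?LL. alist L \<bullet> G l \<bullet> blist L)
      = (\<Oplus>\<^bsub>Bq D\<^esub>L\<in>?LL. ?w L) \<^bold>+ \<ominus>\<^bsub>Bq D\<^esub> (\<Oplus>\<^bsub>Bq D\<^esub>L\<in>?M. ?w L)" .
  let ?R = "\<Oplus>\<^bsub>Bq D\<^esub>L\<in>?LL - {[]}. ?w L"
  have nil: "[] \<in> ?LL" using Suc by (simp add: lists_below_def hlist_def)
  have Rc: "?R \<in> carrier (Bq D)" by (rule B.finsum_closed, rule Pi_I) (use LL in simp)
  have "(\<Oplus>\<^bsub>Bq D\<^esub>L\<in>?LL. ?w L) = (\<Oplus>\<^bsub>Bq D\<^esub>L\<in>insert [] (?LL - {[]}). ?w L)"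
    using nil by (simp only: insert_Diff)
  also have "\<dots> = ?w [] \<^bold>+ ?R"
    using finite_lists_below LL by (intro B.finsum_insert) (auto simp: wlist_def)
  finally have first: "(\<Oplus>\<^bsub>Bq D\<^esub>L\<in>?LL. ?w L) = \<one>\<^bsub>Bq D\<^esub> \<^bold>+ ?R" by (simp add: wlist_def)
  have Mc: "(\<Oplus>\<^bsub>Bq D\<^esub>L\<in>?M. ?w L) \<in> carrier (Bq D)"
    by (rule B.finsum_closed, rule Pi_I) (rule wlist_closed[OF M])
  \<comment> \<open>A nonempty list of total height below \<open>l\<close> extends its tail by one
    term, and both tail and term are below \<open>l\<close> again.\<close>
  have sub: "?LL - {[]} \<subseteq> ?M"
  proof
    fix L assume "L \<in> ?LL - {[]}"
    then obtain k L' where kL: "L = k # L'" "L \<in> ?LL" by (cases L) auto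
    then have "k \<in> higher" "L' \<in> lists higher" "hlist L' + Qheight D (fst k) < l"
      by (auto simp: lists_below_def hlist_def)
    then have "(L', k) \<in> ?LL \<times> ?K" by (simp add: lists_below_def higher_below_iff)
    then show "L \<in> ?M" unfolding kL(1) by (rule rev_image_eqI) simp
  qed
  \<comment> \<open>The lists that \<open>?M\<close> has in excess are nonempty and not below
    \<open>l\<close>, so their total height is at least \<open>l\<close>.\<close>
  have diff: "(\<Oplus>\<^bsub>Bq D\<^esub>L\<in>?M. ?w L) \<ominus>\<^bsub>Bq D\<^esub> ?R \<in> Bfilt D l"
  proof (rule BF.finsum_diff_closed[OF fM sub wlist_closed[OF M]])
    fix L assume L: "L \<in> ?M - (?LL - {[]})"
    then have "L \<in> lists higher" "L \<noteq> []" using M by auto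
    moreover have "l \<le> hlist L" using L calculation by (auto simp: lists_below_def)
    ultimately show "?w L \<in> Bfilt D l" by (intro wlist_fil)
  qed
  have "\<one>\<^bsub>Bq D\<^esub> \<^bold>+ r \<^bold>+ \<ominus>\<^bsub>Bq D\<^esub> m \<ominus>\<^bsub>Bq D\<^esub> \<one>\<^bsub>Bq D\<^esub> = \<ominus>\<^bsub>Bq D\<^esub> (m \<ominus>\<^bsub>Bq D\<^esub> r)"
    if "r \<in> carrier (Bq D)" "m \<in> carrier (Bq D)" for r m
    using that by algebra
  from this[OF Rc Mc] show ?thesis unfolding sum first using BF.J_minus[OF diff] by simp
qed

text \<open>Left factors preserve the levels and \<open>blist L\<close> does not lower them, so both
  products can be formed at level l with \<open>G l\<close> itself.\<close>

lemma sandwich_limit: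
  assumes L: "L \<in> lists higher"
  shows "BF.coherent (\<lambda>l. alist L \<bullet> G l \<bullet> blist L)"
    and "to_Bhat D (alist L) \<otimes>\<^bsub>Bhat D\<^esub> BF.limit_point G \<otimes>\<^bsub>Bhat D\<^esub> to_Bhat D (blist L)
      = BF.limit_point (\<lambda>l. alist L \<bullet> G l \<bullet> blist L)"
proof -
  let ?a = "alist L" and ?b = "blist L"
  have a: "?a \<in> carrier (Bq D)" and b: "?b \<in> carrier (Bq D)" using L by simp_all
  have aG: "BF.coherent (\<lambda>l. ?a \<bullet> G l)"
    unfolding BF.coherent_def
  proof (intro allI conjI)
    fix l
    show "?a \<bullet> G l \<in> carrier (Bq D)" using a G_closed by simp
    show "?a \<bullet> G (Suc l) \<ominus>\<^bsub>Bq D\<^esub> ?a \<bullet> G l \<in> Bfilt D l"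
      using coherent_G by (intro BF.mult_diff_left a G_closed) (simp add: BF.coherent_def)
  qed
  have diff: "?a \<bullet> G m \<bullet> ?b \<ominus>\<^bsub>Bq D\<^esub> ?a \<bullet> G l \<bullet> ?b \<in> Bfilt D l" if lm: "l \<le> m" for l m
  proof -
    have "?a \<bullet> G m \<ominus>\<^bsub>Bq D\<^esub> ?a \<bullet> G l \<in> fil l"
      using BF.coherent_diff[OF aG lm] by (simp add: Bfilt_eq)
    then have "(?a \<bullet> G m \<ominus>\<^bsub>Bq D\<^esub> ?a \<bullet> G l) \<bullet> ?b \<in> fil (l + hlist L)" by (rule fil_blist[OF L])
    then have "(?a \<bullet> G m \<ominus>\<^bsub>Bq D\<^esub> ?a \<bullet> G l) \<bullet> ?b \<in> fil l" using fil_mono[of l "l + hlist L"] by auto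
    moreover have "(x \<ominus>\<^bsub>Bq D\<^esub> y) \<bullet> z = x \<bullet> z \<ominus>\<^bsub>Bq D\<^esub> y \<bullet> z"
      if "x \<in> carrier (Bq D)" "y \<in> carrier (Bq D)" "z \<in> carrier (Bq D)" for x y z
      using that by algebra
    ultimately show ?thesis using a b G_closed by (simp add: Bfilt_eq)
  qed
  show "BF.coherent (\<lambda>l. ?a \<bullet> G l \<bullet> ?b)"
    unfolding BF.coherent_def using a b diff G_closed by simp
  have 1: "to_Bhat D ?a \<otimes>\<^bsub>Bhat D\<^esub> BF.limit_point G = BF.limit_point (\<lambda>l. ?a \<bullet> G l)"
    unfolding to_Bhat_eq Bhat_eq
    by (rule BF.limit_point_mult[OF BF.coherent_const[OF a] coherent_G])
      (use a G_closed in \<open>simp_all add: B.minus_eq B.r_neg BF.J_zero\<close>)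
  show "to_Bhat D ?a \<otimes>\<^bsub>Bhat D\<^esub> BF.limit_point G \<otimes>\<^bsub>Bhat D\<^esub> to_Bhat D ?b
      = BF.limit_point (\<lambda>l. ?a \<bullet> G l \<bullet> ?b)"
    unfolding 1 unfolding to_Bhat_eq Bhat_eq
    by (rule BF.limit_point_mult[OF aG BF.coherent_const[OF b]])
      (use a b G_closed diff in \<open>auto intro: exI[of _ l for l]\<close>)
qed

lemma resolution:
  "has_csum (Bhat D) (\<lambda>L. to_Bhat D (alist L) \<otimes>\<^bsub>Bhat D\<^esub> BF.limit_point G \<otimes>\<^bsub>Bhat D\<^esub> to_Bhat D (blist L))
    (lists higher) \<one>\<^bsub>Bhat D\<^esub>"
proof -
  have "has_csum BF.CR (\<lambda>L. BF.limit_point (\<lambda>l. alist L \<bullet> G l \<bullet> blist L)) (lists higher)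
      (BF.limit_point (\<lambda>_. \<one>\<^bsub>Bq D\<^esub>))"
  proof (rule BF.has_csumI[where F = lists_below])
    show "BF.coherent (\<lambda>l. alist L \<bullet> G l \<bullet> blist L)" if "L \<in> lists higher" for L
      by (rule sandwich_limit(1)[OF that])
    show "BF.coherent (\<lambda>_. \<one>\<^bsub>Bq D\<^esub>)" by (simp add: BF.coherent_const)
    show "lists_below l \<subseteq> lists higher" for l by (auto simp: lists_below_def)
    show "alist L \<bullet> G l \<bullet> blist L \<in> Bfilt D l" if L: "L \<in> lists higher - lists_below l" for l L
    proof -
      have Lh: "L \<in> lists higher" "l \<le> hlist L" using L by (auto simp: lists_below_def)
      have "alist L \<bullet> G l \<in> fil 0" using Lh G_closed by (intro fil_0) simp
      then have "alist L \<bullet> G l \<bullet> blist L \<in> fil (0 + hlist L)" by (rule fil_blist[OF Lh(1)])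
      then show ?thesis using fil_mono[OF Lh(2)] by (auto simp: Bfilt_eq)
    qed
  qed (rule finite_lists_below sandwich_sum)+
  then have "has_csum (Bhat D) (\<lambda>L. BF.limit_point (\<lambda>l. alist L \<bullet> G l \<bullet> blist L)) (lists higher) \<one>\<^bsub>Bhat D\<^esub>"
    unfolding BF.limit_point_one Bhat_eq .
  then show ?thesis
    by (rule has_csum_cong)
      (simp_all only: sandwich_limit(2), simp add: Bhat_eq BF.CR.abelian_monoid_axioms)
qed

lemma countable_higher: "countable higher"
proof -
  have "higher \<subseteq> (\<Union>l. index_below l)"
  proof
    fix k assume k: "k \<in> higher"
    then have "k \<in> index_below (Suc (Qheight D (fst k)))"
      using higherD[OF k] by (cases k) (simp add: index_below_def low_def)
    then show "k \<in> (\<Union>l. index_below l)" by blast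
  qed
  moreover have "countable (\<Union>l. index_below l)"
    using index_below_props(1) by (intro countable_UN) (auto intro: countable_finite)
  ultimately show ?thesis by (rule countable_subset)
qed

text \<open>The expansion is indexed by lists of pairs (weight, position in the basis); these are
  countable, since only finitely many weights lie below a given height, and an enumeration moves the
  sum to a set of natural numbers.\<close>

lemma resolution_nat:
  "\<exists>(K :: nat set) a b. a ` K \<subseteq> Bminus D \<and> b ` K \<subseteq> Bplus D \<and>
    has_csum (Bhat D)
      (\<lambda>k. to_Bhat D (a k) \<otimes>\<^bsub>Bhat D\<^esub> BF.limit_point G \<otimes>\<^bsub>Bhat D\<^esub> to_Bhat D (b k)) K \<one>\<^bsub>Bhat D\<^esub>"
proof -
  have c: "countable (lists higher)" using countable_higher by (rule countable_lists)
  let ?h = "to_nat_on (lists higher)"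
  have inj: "inj_on ?h (lists higher)" by (rule inj_on_to_nat_on[OF c])
  let ?f = "from_nat_into (lists higher)"
  have fh: "?f (?h L) = L" if "L \<in> lists higher" for L by (rule from_nat_into_to_nat_on[OF c that])
  let ?t = "\<lambda>a b. to_Bhat D a \<otimes>\<^bsub>Bhat D\<^esub> BF.limit_point G \<otimes>\<^bsub>Bhat D\<^esub> to_Bhat D b"
  have am: "abelian_monoid (Bhat D)" unfolding Bhat_eq by (rule BF.CR.abelian_monoid_axioms)
  have "has_csum (Bhat D) ((\<lambda>k. ?t (alist (?f k)) (blist (?f k))) \<circ> ?h) (lists higher) \<one>\<^bsub>Bhat D\<^esub>"
    by (rule has_csum_cong[OF resolution _ am]) (simp add: fh)
  from has_csum_reindex[OF this inj am]
  have "has_csum (Bhat D) (\<lambda>k. ?t (alist (?f k)) (blist (?f k))) (?h ` lists higher) \<one>\<^bsub>Bhat D\<^esub>" .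
  moreover have "(\<lambda>k. alist (?f k)) ` ?h ` lists higher \<subseteq> Bminus D"
    "(\<lambda>k. blist (?f k)) ` ?h ` lists higher \<subseteq> Bplus D"
    using fh alist_Bminus blist_Bplus by (auto simp: image_subset_iff)
  ultimately show ?thesis by blast
qed

end

theorem theorem5p2:
  fixes D :: "('i, 't::ab_group_add) cartan_data"
    and \<Delta> :: "('i, 't) ncpoly set \<Rightarrow>
      (('i, 't) ncpoly set \<times> ('i, 't) ncpoly set \<Rightarrow>\<^sub>0 qfield) set"
    and S \<phi> \<iota> :: "('i, 't) ncpoly set \<Rightarrow> ('i, 't) ncpoly set"
    and \<rho> :: "rat \<Rightarrow> qfield alg_closure"
    and \<omega> :: "('i, 't) ncpoly set \<Rightarrow> ('i, 't) ncpoly set \<Rightarrow> qfield alg_closure"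
    and xs ys :: "('i \<Rightarrow> nat) \<Rightarrow> ('i, 't) ncpoly set list"
  assumes "cartan_datum D"
    and "is_coproduct D \<Delta>"
    and "is_antipode D S"
    and "is_phi D \<phi>"
    and "is_identification D \<iota>"
    and "rational_powers \<rho>"
    and "DK_form D \<Delta> \<rho> \<omega>"
    and "dual_bases D \<omega> xs ys"
  shows "let \<Gamma> = extremal_projector D S \<phi> \<iota> xs ys;
             \<theta> = proj_term D S \<phi> \<iota> xs ys;
             N = proj_index D xs
    in has_csum (Bhat D) (\<lambda>k. to_Bhat D (\<theta> k)) N \<Gamma> \<and>
      (\<forall>i\<in>inds D.
         to_Bhat D (Bgen D (Egen i)) \<otimes>\<^bsub>Bhat D\<^esub> \<Gamma> = \<zero>\<^bsub>Bhat D\<^esub> \<and>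
         \<Gamma> \<otimes>\<^bsub>Bhat D\<^esub> to_Bhat D (Bgen D (Fgen i)) = \<zero>\<^bsub>Bhat D\<^esub>) \<and>
      \<Gamma> \<otimes>\<^bsub>Bhat D\<^esub> \<Gamma> = \<Gamma> \<and>
      (\<exists>(K :: nat set) a b. a ` K \<subseteq> Bminus D \<and> b ` K \<subseteq> Bplus D \<and>
         has_csum (Bhat D)
           (\<lambda>k. to_Bhat D (a k) \<otimes>\<^bsub>Bhat D\<^esub> \<Gamma> \<otimes>\<^bsub>Bhat D\<^esub> to_Bhat D (b k)) K \<one>\<^bsub>Bhat D\<^esub>) \<and>
      (\<theta> ` N \<subseteq> Bvee D \<and>
       (\<exists>\<Gamma>'. has_csum (Bvee_hat D) (\<lambda>k. to_Bvee_hat D (\<theta> k)) N \<Gamma>' \<and>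
          Bvee_hat_to_Bhat D \<Gamma>' = \<Gamma>))"
proof -
  interpret projector_data D \<Delta> \<rho> \<omega> S \<phi> \<iota> xs ys
    using assms
    by (intro projector_data.intro killing_form.intro cartan.intro killing_form_axioms.intro
        projector_data_axioms.intro)
  show ?thesis
    unfolding Let_def projector_eq
    by (intro conjI ballI exI[of _ "VF.limit_point G"] has_csum_G eB_projector projector_fB
        projector_idem resolution_nat theta_Bvee has_csum_G_Bvee(2) Bvee_hat_to_Bhat_G)
qed

end
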